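(* Consider a (not necessarily smooth) variety $V\subset(\mathbb C^* )^n$. 1. If a generic torus-invariant 1-form has no zeros when restricted to the smooth part $\operatorname{sm}V$, then $V$ is the preimage of a variety under a homomorphism $(\mathbb C^* )^n\to(\mathbb C^* )^{n-1}$. 2. More generally, if $\operatorname{Trop}_k\operatorname{sm}V=0$ for all $k<r$, then $V$ is the preimage of a variety under a homomorphism $(\mathbb C^* )^n\to(\mathbb C^* )^{n-r}$.
   Context: Torus-invariant 1-forms on $(\mathbb C^* )^n$ are $c_1\frac{dx_1}{x_1}+\cdots+c_n\frac{dx_n}{x_n}$ with constants $c_i$. For such forms $w_0,\ldots,w_k$, let $Z(w_0\wedge\cdots\wedge w_k)$ be the set of points $x\in\operatorname{sm}V$ at which the restrictions of $w_0,\ldots,w_k$ to $T_xV$ are linearly dependent. $\operatorname{Trop}_k\operatorname{sm}V$ is the common value, for generic $w_0,\ldots,w_k$, of the tropical fan of $Z(w_0\wedge\cdots\wedge w_k)$, a $k$-dimensional weighted polyhedral fan; for $k>\dim V$ it is set to be $0$. *)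

theory Defs
  imports
    "HOL-Analysis.Analysis"
    "HOL-Algebra.Ideal"
    "HOL-Library.Poly_Mapping"
    "HOL-Library.Function_Algebras"
begin

text \<open>
  All objects attached to \<open>(\<complex>\<^sup>*)\<^sup>n\<close> are indexed by natural numbers below \<open>n\<close>, so that \<open>n\<close> is an
  ordinary term.  Points of the torus are padded by \<open>1\<close> (pointwise multiplication is then the
  group law), vectors are padded by \<open>0\<close>.
\<close>

definition torus :: "nat \<Rightarrow> (nat \<Rightarrow> complex) set" where
  "torus n = {x. (\<forall>i<n. x i \<noteq> 0) \<and> (\<forall>i\<ge>n. x i = 1)}"

definition coord_space :: "nat \<Rightarrow> (nat \<Rightarrow> 'a::zero) set" where
  "coord_space n = {v. \<forall>i\<ge>n. v i = 0}"

definition fscale :: "'a::field \<Rightarrow> ('i \<Rightarrow> 'a) \<Rightarrow> 'i \<Rightarrow> 'a" where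
  "fscale c v = (\<lambda>i. c * v i)"

global_interpretation fvec: vector_space "fscale :: 'a::field \<Rightarrow> ('i \<Rightarrow> 'a) \<Rightarrow> 'i \<Rightarrow> 'a"
  by standard (auto simp: fscale_def fun_eq_iff algebra_simps)


section \<open>Laurent polynomials\<close>

text \<open>The exponent of a monomial is a finitely supported function \<open>nat \<Rightarrow>\<^sub>0 int\<close>.\<close>

type_synonym laurent_poly = "(nat \<Rightarrow>\<^sub>0 int) \<Rightarrow>\<^sub>0 complex"

definition laurent :: "nat \<Rightarrow> laurent_poly set" where
  "laurent n = {f. \<forall>m \<in> Poly_Mapping.keys f. Poly_Mapping.keys m \<subseteq> {..<n}}"

definition laurent_ring :: "nat \<Rightarrow> laurent_poly ring" where
  "laurent_ring n = \<lparr>carrier = laurent n, mult = (*), one = 1, zero = 0, add = (+)\<rparr>"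

definition leval :: "laurent_poly \<Rightarrow> (nat \<Rightarrow> complex) \<Rightarrow> complex" where
  "leval f x = (\<Sum>m \<in> Poly_Mapping.keys f. Poly_Mapping.lookup f m *
                  (\<Prod>i \<in> Poly_Mapping.keys m. x i powi Poly_Mapping.lookup m i))"

definition torus_hom :: "nat \<Rightarrow> nat \<Rightarrow> ((nat \<Rightarrow> complex) \<Rightarrow> (nat \<Rightarrow> complex)) \<Rightarrow> bool" where
  "torus_hom n m h \<longleftrightarrow>
     h ` torus n \<subseteq> torus m \<and>
     (\<forall>x \<in> torus n. \<forall>y \<in> torus n. h (x * y) = h x * h y) \<and>
     (\<forall>j<m. \<exists>f \<in> laurent n. \<forall>x \<in> torus n. h x j = leval f x)"


section \<open>Subvarieties of the torus\<close>

definition zero_locus :: "nat \<Rightarrow> laurent_poly set \<Rightarrow> (nat \<Rightarrow> complex) set" where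
  "zero_locus n S = {x \<in> torus n. \<forall>f \<in> S. leval f x = 0}"

definition vanishing_ideal :: "nat \<Rightarrow> (nat \<Rightarrow> complex) set \<Rightarrow> laurent_poly set" where
  "vanishing_ideal n X = {f \<in> laurent n. \<forall>x \<in> X. leval f x = 0}"

definition zariski_closed :: "nat \<Rightarrow> (nat \<Rightarrow> complex) set \<Rightarrow> bool" where
  "zariski_closed n X \<longleftrightarrow> (\<exists>S \<subseteq> laurent n. X = zero_locus n S)"

definition zariski_closure :: "nat \<Rightarrow> (nat \<Rightarrow> complex) set \<Rightarrow> (nat \<Rightarrow> complex) set" where
  "zariski_closure n X = \<Inter>{Y. zariski_closed n Y \<and> X \<subseteq> Y}"

text \<open>Varieties are closed and irreducible (hence nonempty).\<close>

definition variety :: "nat \<Rightarrow> (nat \<Rightarrow> complex) set \<Rightarrow> bool" where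
  "variety n V \<longleftrightarrow> zariski_closed n V \<and> V \<noteq> {} \<and>
     (\<forall>A B. zariski_closed n A \<and> zariski_closed n B \<and> V = A \<union> B \<longrightarrow> V = A \<or> V = B)"

text \<open>The Krull dimension: lengths of chains of irreducible closed subsets are bounded by \<open>n\<close>, so
  the supremum in \<open>nat\<close> is a maximum for nonempty \<open>X\<close>.\<close>

definition krull_dim :: "nat \<Rightarrow> (nat \<Rightarrow> complex) set \<Rightarrow> nat" where
  "krull_dim n X = Sup {d. \<exists>C :: nat \<Rightarrow> (nat \<Rightarrow> complex) set.
     (\<forall>i\<le>d. variety n (C i) \<and> C i \<subseteq> X) \<and> (\<forall>i<d. C i \<subset> C (Suc i))}"

definition components :: "nat \<Rightarrow> (nat \<Rightarrow> complex) set \<Rightarrow> (nat \<Rightarrow> complex) set set" where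
  "components n X = {C. variety n C \<and> C \<subseteq> X \<and>
     (\<forall>C'. variety n C' \<and> C \<subseteq> C' \<and> C' \<subseteq> X \<longrightarrow> C' = C)}"

text \<open>Zariski tangent space, as a subspace of \<open>\<complex>\<^sup>n\<close>, the tangent space of the torus in the
  coordinates \<open>x\<^sub>1, \<dots>, x\<^sub>n\<close>.\<close>

definition tangent_space :: "nat \<Rightarrow> (nat \<Rightarrow> complex) set \<Rightarrow> (nat \<Rightarrow> complex) \<Rightarrow> (nat \<Rightarrow> complex) set" where
  "tangent_space n V x = {v \<in> coord_space n. \<forall>f \<in> vanishing_ideal n V.
     (\<Sum>i<n. deriv (\<lambda>t. leval f (x(i := t))) (x i) * v i) = 0}"

definition smooth_part :: "nat \<Rightarrow> (nat \<Rightarrow> complex) set \<Rightarrow> (nat \<Rightarrow> complex) set" where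
  "smooth_part n V = {x \<in> V. fvec.dim (tangent_space n V x) = krull_dim n V}"


section \<open>Invariant forms, degeneracy loci, genericity\<close>

text \<open>The value of \<open>\<Sum>i. c\<^sub>i dx\<^sub>i / x\<^sub>i\<close> at the tangent vector \<open>v\<close> at the point \<open>x\<close>.\<close>

definition inv_form :: "nat \<Rightarrow> (nat \<Rightarrow> complex) \<Rightarrow> (nat \<Rightarrow> complex) \<Rightarrow> (nat \<Rightarrow> complex) \<Rightarrow> complex" where
  "inv_form n c x v = (\<Sum>i<n. c i * v i / x i)"

text \<open>\<open>Z(w\<^sub>0 \<and> \<dots> \<and> w\<^sub>k)\<close>, where \<open>w j\<close> is the coefficient vector of the \<open>j\<close>-th form.\<close>

definition degeneracy_locus ::
    "nat \<Rightarrow> (nat \<Rightarrow> complex) set \<Rightarrow> nat \<Rightarrow> (nat \<Rightarrow> nat \<Rightarrow> complex) \<Rightarrow> (nat \<Rightarrow> complex) set" where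
  "degeneracy_locus n V k w = {x \<in> smooth_part n V.
     \<exists>a :: nat \<Rightarrow> complex. (\<exists>j\<le>k. a j \<noteq> 0) \<and>
       (\<forall>v \<in> tangent_space n V x. (\<Sum>j\<le>k. a j * inv_form n (w j) x v) = 0)}"

text \<open>Polynomials in variables indexed by \<open>'v\<close>.  A property of points of the affine space
  \<open>\<complex>\<^sup>A\<close> is generic if it holds on a nonempty Zariski open subset; such a subset contains
  the complement of the zero set of some nonzero polynomial.\<close>

definition peval :: "(('v \<Rightarrow>\<^sub>0 nat) \<Rightarrow>\<^sub>0 complex) \<Rightarrow> ('v \<Rightarrow> complex) \<Rightarrow> complex" where
  "peval p c = (\<Sum>m \<in> Poly_Mapping.keys p. Poly_Mapping.lookup p m *
                  (\<Prod>v \<in> Poly_Mapping.keys m. c v ^ Poly_Mapping.lookup m v))"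

definition generic :: "'v set \<Rightarrow> (('v \<Rightarrow> complex) \<Rightarrow> bool) \<Rightarrow> bool" where
  "generic A P \<longleftrightarrow> (\<exists>p :: ('v \<Rightarrow>\<^sub>0 nat) \<Rightarrow>\<^sub>0 complex.
     p \<noteq> 0 \<and> (\<forall>m \<in> Poly_Mapping.keys p. Poly_Mapping.keys m \<subseteq> A) \<and>
     (\<forall>c. peval p c \<noteq> 0 \<longrightarrow> P c))"


section \<open>Tropical fans\<close>

text \<open>Trivial valuation, minimum convention: \<open>init_form u f\<close> collects the terms of \<open>f\<close> on which
  the pairing of the exponent with \<open>u\<close> is minimal.\<close>

definition pairing :: "(nat \<Rightarrow> real) \<Rightarrow> (nat \<Rightarrow>\<^sub>0 int) \<Rightarrow> real" where
  "pairing u m = (\<Sum>i \<in> Poly_Mapping.keys m. u i * of_int (Poly_Mapping.lookup m i))"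

definition init_form :: "(nat \<Rightarrow> real) \<Rightarrow> laurent_poly \<Rightarrow> laurent_poly" where
  "init_form u f =
     (\<Sum>m \<in> {m \<in> Poly_Mapping.keys f. \<forall>m' \<in> Poly_Mapping.keys f. pairing u m \<le> pairing u m'}.
        Poly_Mapping.single m (Poly_Mapping.lookup f m))"

definition init_ideal :: "nat \<Rightarrow> (nat \<Rightarrow> real) \<Rightarrow> laurent_poly set \<Rightarrow> laurent_poly set" where
  "init_ideal n u I = genideal (laurent_ring n) (init_form u ` I)"

definition trop_set :: "nat \<Rightarrow> (nat \<Rightarrow> complex) set \<Rightarrow> (nat \<Rightarrow> real) set" where
  "trop_set n X = {u \<in> coord_space n. init_ideal n u (vanishing_ideal n X) \<noteq> laurent n}"

definition minimal_primes :: "nat \<Rightarrow> laurent_poly set \<Rightarrow> laurent_poly set set" where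
  "minimal_primes n Q = {P. primeideal P (laurent_ring n) \<and> Q \<subseteq> P \<and>
     (\<forall>P'. primeideal P' (laurent_ring n) \<and> Q \<subseteq> P' \<and> P' \<subseteq> P \<longrightarrow> P' = P)}"

definition primary_ideals :: "nat \<Rightarrow> laurent_poly set \<Rightarrow> laurent_poly set set" where
  "primary_ideals n P = {J. ideal J (laurent_ring n) \<and> J \<noteq> laurent n \<and>
     (\<forall>f \<in> laurent n. \<forall>g \<in> laurent n. f * g \<in> J \<longrightarrow> f \<in> J \<or> (\<exists>e. g ^ e \<in> J)) \<and>
     {f \<in> laurent n. \<exists>e. f ^ e \<in> J} = P}"

text \<open>For a minimal prime \<open>P\<close> of \<open>Q\<close> and \<open>R = laurent_ring n\<close>, the proper submodules of the local
  module \<open>(R/Q)\<^sub>P\<close> correspond to the \<open>P\<close>-primary ideals containing \<open>Q\<close>.  Hence the following is the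
  length of \<open>(R/Q)\<^sub>P\<close>.\<close>

definition length_at :: "nat \<Rightarrow> laurent_poly set \<Rightarrow> laurent_poly set \<Rightarrow> nat" where
  "length_at n Q P = Sup {card C | C. finite C \<and> subset.chain {J \<in> primary_ideals n P. Q \<subseteq> J} C}"

definition init_mult :: "nat \<Rightarrow> (nat \<Rightarrow> complex) set \<Rightarrow> (nat \<Rightarrow> real) \<Rightarrow> nat" where
  "init_mult n X u =
     (let Q = init_ideal n u (vanishing_ideal n X) in \<Sum>P \<in> minimal_primes n Q. length_at n Q P)"

text \<open>Points near which \<open>T\<close> is a \<open>k\<close>-dimensional linear space.  The topology on
  \<^typ>\<open>nat \<Rightarrow> real\<close> is the product topology, which is the Euclidean one on
  \<^term>\<open>coord_space n\<close>.\<close>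

definition regular_points :: "nat \<Rightarrow> nat \<Rightarrow> (nat \<Rightarrow> real) set \<Rightarrow> (nat \<Rightarrow> real) set" where
  "regular_points n k T = {u \<in> T. \<exists>U L. open U \<and> u \<in> U \<and>
     fvec.subspace L \<and> L \<subseteq> coord_space n \<and> fvec.dim L = k \<and> T \<inter> U = (\<lambda>v. u + v) ` L \<inter> U}"

text \<open>
  A \<open>k\<close>-dimensional weighted fan is a union of \<open>k\<close>-dimensional rational cones together with a
  locally constant weight on its regular points, up to cones of weight \<open>0\<close>.  It is encoded by its
  weight function, extended by \<open>0\<close> to the other points of \<open>\<real>\<^sup>n\<close>; so two weighted fans are
  equal iff they have the same weight function, and the zero fan is the function \<open>0\<close>.
\<close>

type_synonym weighted_fan = "(nat \<Rightarrow> real) \<Rightarrow> nat"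

text \<open>Components of \<open>Z\<close> of dimension other than \<open>k\<close> do not contribute to the \<open>k\<close>-dimensional
  tropical fan of \<open>Z\<close>, and \<open>Z\<close> need not be closed.\<close>

definition pure_part :: "nat \<Rightarrow> nat \<Rightarrow> (nat \<Rightarrow> complex) set \<Rightarrow> (nat \<Rightarrow> complex) set" where
  "pure_part n k Z = \<Union>{C \<in> components n (zariski_closure n Z). krull_dim n C = k}"

definition trop_fan :: "nat \<Rightarrow> nat \<Rightarrow> (nat \<Rightarrow> complex) set \<Rightarrow> weighted_fan" where
  "trop_fan n k Z = (\<lambda>u. let X = pure_part n k Z in
     if u \<in> regular_points n k (trop_set n X) then init_mult n X u else 0)"

text \<open>\<open>has_trop_sm n V k F\<close> says that \<open>Trop\<^sub>k sm V\<close> is \<open>F\<close>, i.e. that \<open>F\<close> is the tropical fan of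
  \<open>Z(w\<^sub>0 \<and> \<dots> \<and> w\<^sub>k)\<close> for generic forms, whose coefficients \<open>c (j, i)\<close> range over
  \<open>(\<complex>\<^sup>n)\<^sup>k\<^sup>+\<^sup>1\<close>.  It is a relation because a common value has to be shown to exist; two
  values are equal because nonempty Zariski open sets intersect.\<close>

definition has_trop_sm :: "nat \<Rightarrow> (nat \<Rightarrow> complex) set \<Rightarrow> nat \<Rightarrow> weighted_fan \<Rightarrow> bool" where
  "has_trop_sm n V k F \<longleftrightarrow>
     (if k > krull_dim n V then F = 0
      else generic ({..k} \<times> {..<n})
             (\<lambda>c. trop_fan n k (degeneracy_locus n V k (\<lambda>j i. c (j, i))) = F))"

definition pulled_back :: "nat \<Rightarrow> nat \<Rightarrow> (nat \<Rightarrow> complex) set \<Rightarrow> bool" where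
  "pulled_back n m V \<longleftrightarrow> (\<exists>h W. torus_hom n m h \<and> variety m W \<and> V = {x \<in> torus n. h x \<in> W})"

end

theory Submission
  imports Defs "HOL-Computational_Algebra.Fundamental_Theorem_Algebra"
begin

text \<open>
  Let \<open>k\<close> be the rank of the lattice of one-parameter subgroups preserving \<open>V\<close>.  Invariant forms
  which are conormal, that is, vanish on some tangent space of \<open>V\<close>, annihilate the stabilizer.
  Conversely they are Zariski dense in its annihilator: the conormal variety of \<open>V\<close> in
  the torus times \<open>\<complex>\<^sup>n\<close> is Lagrangian, so if \<open>P\<close> vanishes on all conormal vectors, then the flow
  \<open>x \<mapsto> x exp(t \<nabla>P(c))\<close> preserves \<open>V\<close>, and gradients lie in the span of the stabilizer.

  Hence \<open>k + 1\<close> generic forms have a combination \<open>w\<close>, unique up to scaling, that annihilates the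
  stabilizer, and \<open>w\<close> has zeros on the smooth part.  Since the conormal variety has dimension \<open>n\<close>,
  counting dimensions shows that the characters of the quotient by the stabilizer take finitely many
  values at the zeros of \<open>w\<close> in a dense chart.  So the \<open>k\<close>-dimensional part of the degeneracy locus is
  a nonempty finite union of orbits of the stabilizer torus, and its tropical fan is the real span of
  the stabilizer lattice with positive weight.  Thus the vanishing of the first \<open>r\<close> fans, or for
  \<open>r = 1\<close> the absence of zeros of a generic form, forces \<open>r \<le> k\<close>, while \<open>V\<close> is pulled back from the
  quotient by its stabilizer.
\<close>

section \<open>Laurent polynomials as functions\<close>

text \<open>A generic set is only known to contain the complement of a hypersurface
  \<open>peval p c = 0\<close>. So it suffices to exhibit, for each nonzero \<open>p\<close>, one
  tuple of forms with \<open>peval p c \<noteq> 0\<close> whose degeneracy locus has a nonzero fan;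
  of that fan only the weight at the origin is computed, the number of components of the pure part.
  The obstacle is to avoid the hypersurface and still control the zeros of the forms; the density of
  conormal vectors serves this purpose. The flow of a gradient has complex exponents and need not be
  an algebraic one-parameter subgroup. Its components over a rational basis of \<complex> are
  integral up to a denominator, and they preserve \<open>V\<close> because they respect all
  coincidences of weights among the terms of its equations. Dimension is transcendence degree, read
  off from a triangular system of relations between the coordinates; dependence comes from comparing
  D^(r+1) monomials with O(D^r) spanning functions. The same system describes the tangent spaces on
  a dense chart of the smooth part, so singular points are never analysed.\<close>

abbreviation lookup :: "('a \<Rightarrow>\<^sub>0 'b::zero) \<Rightarrow> 'a \<Rightarrow> 'b" where "lookup \<equiv> Poly_Mapping.lookup"
abbreviation keys :: "('a \<Rightarrow>\<^sub>0 'b::zero) \<Rightarrow> 'a set" where "keys \<equiv> Poly_Mapping.keys"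
abbreviation single :: "'a \<Rightarrow> 'b \<Rightarrow> ('a \<Rightarrow>\<^sub>0 'b::zero)" where "single \<equiv> Poly_Mapping.single"

text \<open>Evaluation is multiplicative at such points. The condition is put on all indices so that
  the evaluation lemmas carry no bound on the variables; padding by 1 places torus points in this
  set.\<close>

definition nonzero_points :: "(nat \<Rightarrow> complex) set" where
  "nonzero_points = {x. \<forall>i. x i \<noteq> 0}"

definition monomial_at :: "(nat \<Rightarrow> complex) \<Rightarrow> (nat \<Rightarrow>\<^sub>0 int) \<Rightarrow> complex" where
  "monomial_at x m = (\<Prod>i\<in>keys m. x i powi lookup m i)"

text \<open>The coefficient type is left open because the same pairing serves integer one-parameter
  subgroups, complex tangent vectors and real tropical directions.\<close>

definition ipair :: "(nat \<Rightarrow> 'a::comm_ring_1) \<Rightarrow> (nat \<Rightarrow>\<^sub>0 int) \<Rightarrow> 'a" where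
  "ipair u m = (\<Sum>i\<in>keys m. u i * of_int (lookup m i))"

lemma nonzero_pointsD: "x \<in> nonzero_points \<Longrightarrow> x i \<noteq> 0"
  by (simp add: nonzero_points_def)

lemma torus_nonzero: "x \<in> torus n \<Longrightarrow> x \<in> nonzero_points"
  unfolding torus_def nonzero_points_def by (auto simp: not_less) (metis not_less zero_neq_one)

lemma lookup_not_keys: "m \<notin> keys f \<Longrightarrow> lookup f m = 0"
  by (simp add: in_keys_iff)

lemma monomial_at_superset:
  assumes "finite S" "keys m \<subseteq> S"
  shows "monomial_at x m = (\<Prod>i\<in>S. x i powi lookup m i)"
  unfolding monomial_at_def
  by (rule prod.mono_neutral_left) (use assms in \<open>auto simp: lookup_not_keys\<close>)

lemma ipair_superset:
  assumes "finite S" "keys m \<subseteq> S"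
  shows "ipair u m = (\<Sum>i\<in>S. u i * of_int (lookup m i))"
  unfolding ipair_def
  by (rule sum.mono_neutral_left) (use assms in \<open>auto simp: lookup_not_keys\<close>)

lemma monomial_at_add:
  assumes "x \<in> nonzero_points"
  shows "monomial_at x (m + m') = monomial_at x m * monomial_at x m'"
proof -
  let ?S = "keys m \<union> keys m'"
  have "keys (m + m') \<subseteq> ?S" by (rule keys_add)
  then show ?thesis
    using assms by (simp add: monomial_at_superset[of ?S] lookup_add power_int_add nonzero_pointsD
        prod.distrib)
qed

lemma monomial_at_zero [simp]: "monomial_at x 0 = 1"
  by (simp add: monomial_at_def)

lemma monomial_at_nonzero: "x \<in> nonzero_points \<Longrightarrow> monomial_at x m \<noteq> 0"
  by (simp add: monomial_at_def nonzero_pointsD)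

lemma monomial_at_mult: "monomial_at (x * y) m = monomial_at x m * monomial_at y m"
  by (simp add: monomial_at_def power_int_mult_distrib prod.distrib)

lemma monomial_at_single: "monomial_at x (single i k) = x i powi k"
  by (cases "k = 0") (auto simp: monomial_at_def)

lemma monomial_at_cong:
  "(\<And>i. i \<in> keys m \<Longrightarrow> x i = y i) \<Longrightarrow> monomial_at x m = monomial_at y m"
  by (simp add: monomial_at_def)

lemma ipair_add: "ipair u (m + m') = ipair u m + ipair u m'"
proof -
  let ?S = "keys m \<union> keys m'"
  have "keys (m + m') \<subseteq> ?S" by (rule keys_add)
  then show ?thesis
    by (simp add: ipair_superset[of ?S] lookup_add algebra_simps sum.distrib)
qed

lemma ipair_zero [simp]: "ipair u 0 = 0"
  by (simp add: ipair_def)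

lemma ipair_zero_left [simp]: "ipair (\<lambda>i. 0) m = 0"
  by (simp add: ipair_def)

lemma ipair_diff: "ipair u (m - m') = ipair u m - ipair u m'"
  using ipair_add[of u "m - m'" m'] by simp

lemma ipair_add_left: "ipair (\<lambda>i. u i + v i) m = ipair u m + ipair v m"
  by (simp add: ipair_def algebra_simps sum.distrib)

lemma ipair_scale_left: "ipair (\<lambda>i. c * u i) m = c * ipair u m"
  by (simp add: ipair_def sum_distrib_left mult.assoc)

lemma ipair_sum_left: "ipair (\<lambda>i. \<Sum>s\<in>S. u s i) m = (\<Sum>s\<in>S. ipair (u s) m)"
  unfolding ipair_def by (subst sum.swap) (simp add: sum_distrib_right)

lemma ipair_of_int: "ipair (\<lambda>i. of_int (v i)) m = of_int (ipair v m)"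
  by (simp add: ipair_def)

lemma ipair_single: "ipair u (single i k) = u i * of_int k"
  by (cases "k = 0") (auto simp: ipair_def)

lemma leval_eq: "leval f x = (\<Sum>m\<in>keys f. lookup f m * monomial_at x m)"
  by (simp add: leval_def monomial_at_def)

lemma leval_superset:
  assumes "finite S" "keys f \<subseteq> S"
  shows "leval f x = (\<Sum>m\<in>S. lookup f m * monomial_at x m)"
  unfolding leval_eq
  by (rule sum.mono_neutral_left) (use assms in \<open>auto simp: lookup_not_keys\<close>)

lemma leval_zero [simp]: "leval 0 x = 0"
  by (simp add: leval_def)

lemma leval_single: "leval (single m c) x = c * monomial_at x m"
  by (cases "c = 0") (auto simp: leval_eq)

lemma leval_one [simp]: "leval 1 x = 1"
  using leval_single[of 0 1 x] by simp

lemma leval_add: "leval (f + g) x = leval f x + leval g x"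
proof -
  let ?S = "keys f \<union> keys g"
  have "keys (f + g) \<subseteq> ?S" by (rule keys_add)
  then show ?thesis
    by (simp add: leval_superset[of ?S] lookup_add algebra_simps sum.distrib)
qed

lemma leval_uminus: "leval (- f) x = - leval f x"
  using leval_add[of f "- f" x] by (simp add: eq_neg_iff_add_eq_0 add.commute)

lemma leval_diff: "leval (f - g) x = leval f x - leval g x"
  using leval_add[of "f - g" g x] by simp

lemma leval_sum: "leval (sum f S) x = (\<Sum>s\<in>S. leval (f s) x)"
  by (induction S rule: infinite_finite_induct) (auto simp: leval_add)

lemma sum_single_lookup: "(\<Sum>m\<in>keys f. single m (lookup f m)) = f"
proof (rule poly_mapping_eqI)
  fix k
  have "lookup (\<Sum>m\<in>keys f. single m (lookup f m)) k = (\<Sum>m\<in>keys f. if m = k then lookup f m else 0)"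
    unfolding lookup_sum by (rule sum.cong) (auto simp: lookup_single when_def)
  also have "\<dots> = lookup f k"
    by (simp add: sum.delta' in_keys_iff)
  finally show "lookup (\<Sum>m\<in>keys f. single m (lookup f m)) k = lookup f k" .
qed

lemma leval_mult:
  assumes "x \<in> nonzero_points"
  shows "leval (f * g) x = leval f x * leval g x"
proof -
  have "f * g = (\<Sum>m\<in>keys f. \<Sum>m'\<in>keys g. single (m + m') (lookup f m * lookup g m'))"
    by (subst (1) sum_single_lookup[of f, symmetric], subst (1) sum_single_lookup[of g, symmetric])
       (simp add: sum_product mult_single)
  then show ?thesis
    by (simp add: leval_sum leval_single monomial_at_add assms leval_eq[of f] leval_eq[of g] sum_product algebra_simps)
qed

lemma leval_power: "x \<in> nonzero_points \<Longrightarrow> leval (f ^ k) x = leval f x ^ k"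
  by (induction k) (auto simp: leval_mult)

lemma leval_prod: "x \<in> nonzero_points \<Longrightarrow> leval (prod f S) x = (\<Prod>s\<in>S. leval (f s) x)"
  by (induction S rule: infinite_finite_induct) (auto simp: leval_mult)

text \<open>The base case is asked only for the terms of \<open>f\<close> itself, which keeps
  information on its support available there.\<close>

lemma poly_mapping_additive_induct [case_names single add]:
  fixes f :: "'a \<Rightarrow>\<^sub>0 'b::comm_monoid_add"
  assumes "\<And>m. m \<in> keys f \<Longrightarrow> P (single m (lookup f m))" "P 0" "\<And>f g. P f \<Longrightarrow> P g \<Longrightarrow> P (f + g)"
  shows "P f"
proof -
  have "finite S \<Longrightarrow> S \<subseteq> keys f \<Longrightarrow> P (\<Sum>m\<in>S. single m (lookup f m))" for S
    by (induction S rule: finite_induct) (use assms in auto)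
  from this[of "keys f"] show ?thesis by (simp add: sum_single_lookup)
qed

lemma sum_fun_apply [simp]: "sum f S x = (\<Sum>s\<in>S. f s x)" for f :: "'a \<Rightarrow> 'b \<Rightarrow> 'c::comm_monoid_add"
  by (induction S rule: infinite_finite_induct) auto


subsection \<open>The ring of Laurent polynomials\<close>

lemma laurent_zero [simp]: "0 \<in> laurent n" by (simp add: laurent_def)
lemma laurent_one [simp]: "1 \<in> laurent n" by (simp add: laurent_def)
lemma laurent_single: "keys m \<subseteq> {..<n} \<Longrightarrow> single m c \<in> laurent n"
  by (cases "c = 0") (auto simp: laurent_def)
lemma laurent_const [simp]: "single 0 c \<in> laurent n" by (simp add: laurent_single)
lemma laurent_add: "f \<in> laurent n \<Longrightarrow> g \<in> laurent n \<Longrightarrow> f + g \<in> laurent n"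
  using keys_add[of f g] unfolding laurent_def by blast
lemma laurent_uminus: "f \<in> laurent n \<Longrightarrow> - f \<in> laurent n"
  by (auto simp: laurent_def in_keys_iff)
lemma laurent_diff: "f \<in> laurent n \<Longrightarrow> g \<in> laurent n \<Longrightarrow> f - g \<in> laurent n"
  using laurent_add[of f n "- g"] laurent_uminus[of g n] by simp
lemma laurent_sum: "(\<And>s. s \<in> S \<Longrightarrow> f s \<in> laurent n) \<Longrightarrow> sum f S \<in> laurent n"
  by (induction S rule: infinite_finite_induct) (auto intro: laurent_add)
lemma laurent_mult: "f \<in> laurent n \<Longrightarrow> g \<in> laurent n \<Longrightarrow> f * g \<in> laurent n"
proof -
  assume a: "f \<in> laurent n" "g \<in> laurent n"
  {fix m assume "m \<in> keys (f * g)"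
    then obtain p q where "m = p + q" "p \<in> keys f" "q \<in> keys g" using keys_mult[of f g] by blast
    then have "keys m \<subseteq> {..<n}" using a keys_add[of p q] unfolding laurent_def by blast}
  then show ?thesis by (auto simp: laurent_def)
qed
lemma laurent_power: "f \<in> laurent n \<Longrightarrow> f ^ k \<in> laurent n"
  by (induction k) (auto intro: laurent_mult)
lemma laurent_prod: "(\<And>s. s \<in> S \<Longrightarrow> f s \<in> laurent n) \<Longrightarrow> prod f S \<in> laurent n"
  by (induction S rule: infinite_finite_induct) (auto intro: laurent_mult)
lemma laurent_mono: "f \<in> laurent j \<Longrightarrow> j \<le> n \<Longrightarrow> f \<in> laurent n"
  unfolding laurent_def by force
lemma laurent_keys: "f \<in> laurent n \<Longrightarrow> m \<in> keys f \<Longrightarrow> keys m \<subseteq> {..<n}"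
  by (auto simp: laurent_def)

lemma leval_cong:
  assumes "f \<in> laurent j" "\<And>i. i < j \<Longrightarrow> x i = y i"
  shows "leval f x = leval f y"
  unfolding leval_eq
  by (intro sum.cong refl arg_cong2[where f="(*)"] monomial_at_cong)
     (use assms in \<open>auto simp: laurent_def\<close>)

definition lvar :: "nat \<Rightarrow> int \<Rightarrow> laurent_poly" where "lvar i k = single (single i k) 1"

lemma lvar_laurent: "i < n \<Longrightarrow> lvar i k \<in> laurent n"
  unfolding lvar_def by (intro laurent_single) (cases "k = 0"; auto)
lemma lvar_mult: "lvar i k * lvar i l = lvar i (k + l)"
  by (simp add: lvar_def mult_single single_add)
lemma lvar_0 [simp]: "lvar i 0 = 1" by (simp add: lvar_def)
lemma leval_lvar: "leval (lvar i k) x = x i powi k"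
  by (simp add: lvar_def leval_single monomial_at_single)

lemma laurent_zero_index: "f \<in> laurent 0 \<Longrightarrow> f = single 0 (lookup f 0)"
proof (rule poly_mapping_eqI)
  fix k assume f: "f \<in> laurent 0"
  show "lookup f k = lookup (single 0 (lookup f 0)) k"
    using f by (cases "k = 0") (auto simp: lookup_single laurent_def in_keys_iff)
qed

text \<open>A power of the last variable is a unit and clears its negative exponents. Arguments by
  degree in one variable thereby apply to Laurent polynomials.\<close>

lemma laurent_Suc_expand:
  assumes "f \<in> laurent (Suc j)"
  shows "\<exists>K N a. (\<forall>e. a e \<in> laurent j) \<and> f * lvar j (int K) = (\<Sum>e\<le>N. a e * lvar j (int e))"
proof (rule poly_mapping_additive_induct[of f])
  fix m assume "m \<in> keys f"
  then have km: "keys m \<subseteq> {..<Suc j}" using assms by (auto simp: laurent_def)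
  define e where "e = lookup m j"
  define m' where "m' = m - single j e"
  have "lookup m' i = (if i = j then 0 else lookup m i)" for i
    by (simp add: m'_def e_def lookup_minus lookup_single when_def)
  then have km': "keys m' \<subseteq> {..<j}" using km by (auto simp: in_keys_iff split: if_splits)
  have mm: "m = m' + single j e" by (simp add: m'_def)
  define N where "N = nat (e + int (nat \<bar>e\<bar>))"
  have N: "int N = e + int (nat \<bar>e\<bar>)" by (simp add: N_def)
  have "single m (lookup f m) * lvar j (int (nat \<bar>e\<bar>)) = single m' (lookup f m) * lvar j (int N)"
    unfolding N by (subst mm) (simp add: lvar_def mult_single single_add add.assoc)
  also have "\<dots> = (\<Sum>d\<le>N. (if d = N then single m' (lookup f m) else 0) * lvar j (int d))"
    by (simp add: if_distrib[of "\<lambda>a. a * _"] sum.delta cong: if_cong)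
  finally show "\<exists>K N a. (\<forall>e. a e \<in> laurent j) \<and>
      single m (lookup f m) * lvar j (int K) = (\<Sum>e\<le>N. a e * lvar j (int e))"
    by - (rule exI[of _ "nat \<bar>e\<bar>"], rule exI[of _ N],
        rule exI[of _ "\<lambda>d. if d = N then single m' (lookup f m) else 0"], auto intro: laurent_single[OF km'])
next
  show "\<exists>K N a. (\<forall>e. a e \<in> laurent j) \<and> 0 * lvar j (int K) = (\<Sum>e\<le>N. a e * lvar j (int e))"
    by (intro exI[of _ 0] exI[of _ "\<lambda>_. 0"]) auto
next
  fix f g
  assume "\<exists>K N a. (\<forall>e. a e \<in> laurent j) \<and> f * lvar j (int K) = (\<Sum>e\<le>N. a e * lvar j (int e))"
    "\<exists>K N a. (\<forall>e. a e \<in> laurent j) \<and> g * lvar j (int K) = (\<Sum>e\<le>N. a e * lvar j (int e))"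
  then obtain K N a K' N' a' where a: "\<And>e. a e \<in> laurent j" "f * lvar j (int K) = (\<Sum>e\<le>N. a e * lvar j (int e))"
    and a': "\<And>e. a' e \<in> laurent j" "g * lvar j (int K') = (\<Sum>e\<le>N'. a' e * lvar j (int e))" by blast
  \<comment> \<open>The two expansions carry different powers \<open>K\<close> and
    \<open>K'\<close>. Each is multiplied by the power of the other and padded by zero coefficients
    to a common length.\<close>
  have shift: "\<exists>b. (\<forall>e. b e \<in> laurent j) \<and> (\<Sum>e\<le>N. a e * lvar j (int e)) * lvar j (int L) = (\<Sum>e\<le>M. b e * lvar j (int e))"
    if "\<And>e. a e \<in> laurent j" "N + L \<le> M" for a :: "nat \<Rightarrow> laurent_poly" and N L M
  proof -
    define b where "b e = (if L \<le> e \<and> e \<le> N + L then a (e - L) else 0)" for e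
    have "(\<Sum>e\<le>M. b e * lvar j (int e)) = (\<Sum>e\<in>{L..N + L}. b e * lvar j (int e))"
      by (rule sum.mono_neutral_right) (use that in \<open>auto simp: b_def\<close>)
    also have "\<dots> = (\<Sum>e\<le>N. b (e + L) * lvar j (int (e + L)))"
      by (rule sum.reindex_bij_witness[of _ "\<lambda>e. e + L" "\<lambda>e. e - L"]) auto
    also have "\<dots> = (\<Sum>e\<le>N. a e * lvar j (int e)) * lvar j (int L)"
      by (simp add: b_def sum_distrib_right mult.assoc lvar_mult)
    finally show ?thesis by (intro exI[of _ b]) (use that in \<open>auto simp: b_def\<close>)
  qed
  obtain b where b: "\<And>e. b e \<in> laurent j"
      "(\<Sum>e\<le>N. a e * lvar j (int e)) * lvar j (int K') = (\<Sum>e\<le>N + K' + N' + K. b e * lvar j (int e))"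
    using shift[of a N K' "N + K' + N' + K"] a by auto
  obtain b' where b': "\<And>e. b' e \<in> laurent j"
      "(\<Sum>e\<le>N'. a' e * lvar j (int e)) * lvar j (int K) = (\<Sum>e\<le>N + K' + N' + K. b' e * lvar j (int e))"
    using shift[of a' N' K "N + K' + N' + K"] a' by auto
  have "(f + g) * lvar j (int (K + K')) = f * lvar j (int K) * lvar j (int K') + g * lvar j (int K') * lvar j (int K)"
    by (simp add: distrib_right mult.assoc lvar_mult add.commute)
  also have "\<dots> = (\<Sum>e\<le>N + K' + N' + K. (b e + b' e) * lvar j (int e))"
    by (simp only: a(2) a'(2) b(2) b'(2) distrib_right sum.distrib)
  finally show "\<exists>K N a. (\<forall>e. a e \<in> laurent j) \<and> (f + g) * lvar j (int K) = (\<Sum>e\<le>N. a e * lvar j (int e))"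
    using b(1) b'(1)
    by - (rule exI[of _ "K + K'"], rule exI[of _ "N + K' + N' + K"], rule exI[of _ "\<lambda>e. b e + b' e"],
        auto intro: laurent_add)
qed


subsection \<open>Euler derivations, rescaling and selection of terms\<close>

text \<open>This is the derivation x_i d/dx_i, dual to the forms dx_i / x_i. Monomials are
  eigenvectors, hence these operators commute with each other and with the translations
  \<open>rescale\<close>.\<close>

definition euler :: "nat \<Rightarrow> laurent_poly \<Rightarrow> laurent_poly" where
  "euler i = Poly_Mapping.mapp (\<lambda>m c. of_int (lookup m i) * c)"

definition rescale :: "(nat \<Rightarrow> complex) \<Rightarrow> laurent_poly \<Rightarrow> laurent_poly" where
  "rescale s = Poly_Mapping.mapp (\<lambda>m c. monomial_at s m * c)"

definition lfilter :: "((nat \<Rightarrow>\<^sub>0 int) \<Rightarrow> bool) \<Rightarrow> laurent_poly \<Rightarrow> laurent_poly" where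
  "lfilter Q = Poly_Mapping.mapp (\<lambda>m c. if Q m then c else 0)"

lemma lookup_euler: "lookup (euler i f) m = of_int (lookup m i) * lookup f m"
  by (simp add: euler_def lookup_mapp when_def in_keys_iff)
lemma lookup_rescale: "lookup (rescale s f) m = monomial_at s m * lookup f m"
  by (simp add: rescale_def lookup_mapp when_def in_keys_iff)
lemma lookup_lfilter: "lookup (lfilter Q f) m = (if Q m then lookup f m else 0)"
  by (simp add: lfilter_def lookup_mapp when_def in_keys_iff)

lemma keys_euler: "keys (euler i f) \<subseteq> keys f" by (auto simp: lookup_euler in_keys_iff)
lemma keys_rescale: "keys (rescale i f) \<subseteq> keys f" by (auto simp: lookup_rescale in_keys_iff)
lemma keys_lfilter: "keys (lfilter Q f) = {m \<in> keys f. Q m}" by (auto simp: lookup_lfilter in_keys_iff split: if_splits)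

lemma laurent_euler: "f \<in> laurent n \<Longrightarrow> euler i f \<in> laurent n"
  using keys_euler by (fastforce simp: laurent_def)
lemma laurent_rescale: "f \<in> laurent n \<Longrightarrow> rescale i f \<in> laurent n"
  using keys_rescale by (fastforce simp: laurent_def)
lemma laurent_lfilter: "f \<in> laurent n \<Longrightarrow> lfilter Q f \<in> laurent n"
  by (auto simp: laurent_def keys_lfilter)

lemma euler_commute: "euler i (euler j f) = euler j (euler i f)"
  by (rule poly_mapping_eqI) (simp add: lookup_euler)
lemma euler_add: "euler i (f + g) = euler i f + euler i g"
  by (rule poly_mapping_eqI) (simp add: lookup_euler lookup_add distrib_left)
lemma euler_zero [simp]: "euler i 0 = 0"
  by (rule poly_mapping_eqI) (simp add: lookup_euler)
lemma euler_single: "euler i (single m c) = single m (of_int (lookup m i) * c)"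
  by (rule poly_mapping_eqI) (simp add: lookup_euler lookup_single when_def)
lemma euler_sum: "euler i (sum f S) = (\<Sum>s\<in>S. euler i (f s))"
  by (induction S rule: infinite_finite_induct) (auto simp: euler_add)
lemma euler_mult: "euler i (f * g) = euler i f * g + f * euler i g"
proof -
  have 1: "f = (\<Sum>m\<in>keys f. single m (lookup f m))" for f :: laurent_poly by (simp add: sum_single_lookup)
  have single: "euler i (single m c * single m' c') = euler i (single m c) * single m' c' + single m c * euler i (single m' c')"
    for m m' c c'
    by (simp add: mult_single euler_single lookup_add single_add[symmetric] algebra_simps)
  have "euler i ((\<Sum>m\<in>S. single m (c m)) * (\<Sum>m\<in>S'. single m (c' m))) =
      euler i (\<Sum>m\<in>S. single m (c m)) * (\<Sum>m\<in>S'. single m (c' m)) +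
      (\<Sum>m\<in>S. single m (c m)) * euler i (\<Sum>m\<in>S'. single m (c' m))" for S S' c c'
    by (simp only: sum_product euler_sum single sum.distrib)
  from this[where S="keys f" and S'="keys g" and c="lookup f" and c'="lookup g"]
  show ?thesis by (simp only: sum_single_lookup)
qed

lemma leval_rescale: "leval (rescale s f) x = leval f (x * s)"
  by (subst leval_superset[OF _ keys_rescale])
     (auto simp: leval_eq lookup_rescale monomial_at_mult algebra_simps intro!: sum.cong)

lemma euler_rescale: "euler i (rescale s f) = rescale s (euler i f)"
  by (rule poly_mapping_eqI) (simp add: lookup_euler lookup_rescale)

lemma leval_lfilter: "leval (lfilter Q f) x = (\<Sum>m\<in>{m\<in>keys f. Q m}. lookup f m * monomial_at x m)"
  by (simp add: leval_eq keys_lfilter lookup_lfilter)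

text \<open>In logarithmic coordinates: the derivative at \<open>x\<close> in the direction \<open>\<Sum>i<n. \<eta> i x i d/dx i\<close>.\<close>

definition log_deriv :: "nat \<Rightarrow> (nat \<Rightarrow> complex) \<Rightarrow> (nat \<Rightarrow> complex) \<Rightarrow> laurent_poly \<Rightarrow> complex" where
  "log_deriv n x \<eta> f = (\<Sum>i<n. \<eta> i * leval (euler i f) x)"

lemma log_deriv_zero [simp]: "log_deriv n x \<eta> 0 = 0" by (simp add: log_deriv_def)
lemma log_deriv_add: "log_deriv n x \<eta> (f + g) = log_deriv n x \<eta> f + log_deriv n x \<eta> g"
  by (simp add: log_deriv_def euler_add leval_add algebra_simps sum.distrib)
lemma log_deriv_sum: "log_deriv n x \<eta> (sum f S) = (\<Sum>s\<in>S. log_deriv n x \<eta> (f s))"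
  by (induction S rule: infinite_finite_induct) (auto simp: log_deriv_add)
lemma log_deriv_mult:
  assumes "x \<in> nonzero_points"
  shows "log_deriv n x \<eta> (f * g) = log_deriv n x \<eta> f * leval g x + leval f x * log_deriv n x \<eta> g"
  by (simp add: log_deriv_def euler_mult leval_add leval_mult[OF assms] algebra_simps sum.distrib
      sum_distrib_left)
lemma log_deriv_single:
  assumes "keys m \<subseteq> {..<n}"
  shows "log_deriv n x \<eta> (single m c) = c * ipair \<eta> m * monomial_at x m"
  unfolding ipair_superset[OF finite_lessThan assms]
  by (simp add: log_deriv_def euler_single leval_single sum_distrib_left sum_distrib_right algebra_simps)
lemma log_deriv_const [simp]: "log_deriv n x \<eta> (single 0 c) = 0"
  by (simp add: log_deriv_single)

text \<open>The link between the analytic derivatives in \<open>tangent_space\<close> and the formal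
  operators \<open>euler\<close>.\<close>

lemma has_derivative_coordinate:
  assumes "x \<in> nonzero_points"
  shows "((\<lambda>t. leval f (x(i := t))) has_field_derivative leval (euler i f) x / x i) (at (x i))"
proof -
  have mon: "((\<lambda>t. monomial_at (x(i := t)) m) has_field_derivative of_int (lookup m i) * monomial_at x m / x i) (at (x i))" for m
  proof (cases "i \<in> keys m")
    case True
    define C where "C = (\<Prod>j\<in>keys m - {i}. x j powi lookup m j)"
    have eq: "monomial_at (x(i := t)) m = t powi lookup m i * C" for t
      unfolding monomial_at_def C_def
      by (subst prod.remove[OF _ True]) (auto intro!: prod.cong)
    have x: "monomial_at x m = x i powi lookup m i * C" using eq[of "x i"] by simp
    have "((\<lambda>t. t powi lookup m i * C) has_field_derivative of_int (lookup m i) * x i powi (lookup m i - 1) * C) (at (x i))"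
      using nonzero_pointsD[OF assms, of i] by (auto intro!: derivative_eq_intros)
    then show ?thesis using nonzero_pointsD[OF assms, of i]
      by (simp add: eq x power_int_diff field_simps)
  next
    case False
    then have "monomial_at (x(i := t)) m = monomial_at x m" for t by (intro monomial_at_cong) auto
    then show ?thesis using False by (simp add: lookup_not_keys)
  qed
  have "leval (euler i f) x / x i = (\<Sum>m\<in>keys f. lookup f m * (of_int (lookup m i) * monomial_at x m / x i))"
    by (subst leval_superset[OF _ keys_euler])
       (auto simp: lookup_euler sum_divide_distrib algebra_simps intro!: sum.cong)
  then show ?thesis unfolding leval_eq[of f] by (auto intro!: derivative_eq_intros mon sum.cong)
qed

section \<open>Zariski topology and Noetherianity\<close>

lemma zariski_closed_iff: "zariski_closed n X \<longleftrightarrow> X = zero_locus n (vanishing_ideal n X)"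
proof
  assume "zariski_closed n X"
  then obtain S where "S \<subseteq> laurent n" "X = zero_locus n S" by (auto simp: zariski_closed_def)
  then show "X = zero_locus n (vanishing_ideal n X)"
    unfolding zero_locus_def vanishing_ideal_def by auto
next
  assume "X = zero_locus n (vanishing_ideal n X)"
  then show "zariski_closed n X"
    unfolding zariski_closed_def by (intro exI[of _ "vanishing_ideal n X"]) (auto simp: vanishing_ideal_def)
qed

lemma zariski_closed_torus: "zariski_closed n X \<Longrightarrow> X \<subseteq> torus n"
  by (auto simp: zariski_closed_def zero_locus_def)

lemma vanishing_idealD: "f \<in> vanishing_ideal n X \<Longrightarrow> x \<in> X \<Longrightarrow> leval f x = 0"
  by (simp add: vanishing_ideal_def)

lemma vanishing_ideal_laurent: "f \<in> vanishing_ideal n X \<Longrightarrow> f \<in> laurent n"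
  by (simp add: vanishing_ideal_def)

lemma zariski_closed_memI:
  assumes "zariski_closed n X" "x \<in> torus n" "\<And>f. f \<in> vanishing_ideal n X \<Longrightarrow> leval f x = 0"
  shows "x \<in> X"
  by (subst assms(1)[unfolded zariski_closed_iff]) (use assms in \<open>auto simp: zero_locus_def\<close>)

lemma zariski_closed_zero_locus: "S \<subseteq> laurent n \<Longrightarrow> zariski_closed n (zero_locus n S)"
  by (auto simp: zariski_closed_def)

lemma zariski_closed_Inter:
  assumes "\<A> \<noteq> {}" "\<And>A. A \<in> \<A> \<Longrightarrow> zariski_closed n A"
  shows "zariski_closed n (\<Inter>\<A>)"
proof -
  have "\<Inter>\<A> = zero_locus n (\<Union>A\<in>\<A>. vanishing_ideal n A)"
  proof
    show "\<Inter>\<A> \<subseteq> zero_locus n (\<Union>A\<in>\<A>. vanishing_ideal n A)"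
    proof
      fix x assume x: "x \<in> \<Inter>\<A>"
      obtain A where "A \<in> \<A>" using assms(1) by blast
      then have "x \<in> torus n" using x assms(2) zariski_closed_torus by blast
      then show "x \<in> zero_locus n (\<Union>A\<in>\<A>. vanishing_ideal n A)"
        using x by (auto simp: zero_locus_def dest: vanishing_idealD)
    qed
    show "zero_locus n (\<Union>A\<in>\<A>. vanishing_ideal n A) \<subseteq> \<Inter>\<A>"
    proof
      fix x assume "x \<in> zero_locus n (\<Union>A\<in>\<A>. vanishing_ideal n A)"
      then show "x \<in> \<Inter>\<A>" using assms(2) by (auto simp: zero_locus_def intro: zariski_closed_memI)
    qed
  qed
  then show ?thesis using vanishing_ideal_laurent by (metis (no_types, lifting) UN_least subsetI zariski_closed_def)
qed

lemma zariski_closed_torus_self: "zariski_closed n (torus n)"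
  unfolding zariski_closed_def zero_locus_def by (rule exI[of _ "{}"]) auto

lemma zariski_closed_Int:
  "zariski_closed n A \<Longrightarrow> zariski_closed n B \<Longrightarrow> zariski_closed n (A \<inter> B)"
  using zariski_closed_Inter[of "{A, B}" n] by auto

lemma zariski_closed_empty: "zariski_closed n {}"
  unfolding zariski_closed_def zero_locus_def by (rule exI[of _ "{1}"]) auto

lemma zariski_closed_Un:
  assumes "zariski_closed n A" "zariski_closed n B"
  shows "zariski_closed n (A \<union> B)"
proof -
  let ?S = "{f * g | f g. f \<in> vanishing_ideal n A \<and> g \<in> vanishing_ideal n B}"
  have "A \<union> B = zero_locus n ?S"
  proof (intro equalityI subsetI)
    fix x assume x: "x \<in> A \<union> B"
    then have xt: "x \<in> torus n" using assms zariski_closed_torus by blast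
    then show "x \<in> zero_locus n ?S"
      using x by (auto simp: zero_locus_def leval_mult[OF torus_nonzero] dest: vanishing_idealD)
  next
    fix x assume x: "x \<in> zero_locus n ?S"
    then have xt: "x \<in> torus n" by (simp add: zero_locus_def)
    show "x \<in> A \<union> B"
    proof (rule ccontr)
      assume "x \<notin> A \<union> B"
      then obtain f g where "f \<in> vanishing_ideal n A" "leval f x \<noteq> 0" "g \<in> vanishing_ideal n B" "leval g x \<noteq> 0"
        using zariski_closed_memI[OF assms(1) xt] zariski_closed_memI[OF assms(2) xt] by blast
      moreover from this have "leval (f * g) x = 0" using x unfolding zero_locus_def by blast
      ultimately show False by (simp add: leval_mult[OF torus_nonzero[OF xt]])
    qed
  qed
  then show ?thesis
    unfolding zariski_closed_def by (intro exI[of _ ?S]) (auto intro: laurent_mult vanishing_ideal_laurent)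
qed

lemma zariski_closed_UNION:
  "finite S \<Longrightarrow> (\<And>s. s \<in> S \<Longrightarrow> zariski_closed n (A s)) \<Longrightarrow> zariski_closed n (\<Union>s\<in>S. A s)"
  by (induction S rule: finite_induct) (auto intro: zariski_closed_empty zariski_closed_Un)

lemma zariski_closed_zero_set:
  "zariski_closed n X \<Longrightarrow> f \<in> laurent n \<Longrightarrow> zariski_closed n {x \<in> X. leval f x = 0}"
proof -
  assume X: "zariski_closed n X" "f \<in> laurent n"
  have "{x \<in> X. leval f x = 0} = X \<inter> zero_locus n {f}" using X zariski_closed_torus by (auto simp: zero_locus_def)
  then show ?thesis using X by (auto intro: zariski_closed_Int zariski_closed_zero_locus)
qed

lemma closure_closed: "X \<subseteq> torus n \<Longrightarrow> zariski_closed n (zariski_closure n X)"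
  unfolding zariski_closure_def by (rule zariski_closed_Inter) (use zariski_closed_torus_self in auto)

lemma closure_subset: "X \<subseteq> zariski_closure n X"
  by (auto simp: zariski_closure_def)

lemma closure_minimal: "zariski_closed n Y \<Longrightarrow> X \<subseteq> Y \<Longrightarrow> zariski_closure n X \<subseteq> Y"
  by (auto simp: zariski_closure_def)

lemma closure_vanish:
  assumes "f \<in> laurent n" "X \<subseteq> torus n" "\<And>x. x \<in> X \<Longrightarrow> leval f x = 0" "x \<in> zariski_closure n X"
  shows "leval f x = 0"
proof -
  have "zariski_closure n X \<subseteq> zero_locus n {f}"
    by (rule closure_minimal[OF zariski_closed_zero_locus]) (use assms in \<open>auto simp: zero_locus_def\<close>)
  then show ?thesis using assms(4) by (auto simp: zero_locus_def)
qed

lemma variety_closed: "variety n V \<Longrightarrow> zariski_closed n V" by (simp add: variety_def)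
lemma variety_nonempty: "variety n V \<Longrightarrow> V \<noteq> {}" by (simp add: variety_def)
lemma variety_torus: "variety n V \<Longrightarrow> V \<subseteq> torus n" by (simp add: variety_def zariski_closed_torus)

lemma variety_subset_Un:
  assumes V: "variety n V" and "zariski_closed n A" "zariski_closed n B" "V \<subseteq> A \<union> B"
  shows "V \<subseteq> A \<or> V \<subseteq> B"
proof -
  have "V = (V \<inter> A) \<union> (V \<inter> B)" using assms(4) by auto
  moreover have "zariski_closed n (V \<inter> A)" "zariski_closed n (V \<inter> B)"
    using assms by (auto intro: zariski_closed_Int variety_closed)
  ultimately have "V = V \<inter> A \<or> V = V \<inter> B" using V unfolding variety_def by blast
  then show ?thesis by blast
qed

lemma variety_subset_UNION:
  assumes V: "variety n V" and "finite S" "\<And>s. s \<in> S \<Longrightarrow> zariski_closed n (A s)" "V \<subseteq> (\<Union>s\<in>S. A s)"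
  shows "\<exists>s\<in>S. V \<subseteq> A s"
  using assms(2-)
proof (induction S rule: finite_induct)
  case empty
  then show ?case using variety_nonempty[OF V] by auto
next
  case (insert s S)
  have "V \<subseteq> A s \<or> V \<subseteq> (\<Union>s\<in>S. A s)"
    by (rule variety_subset_Un[OF V]) (use insert in \<open>auto intro: zariski_closed_UNION\<close>)
  then show ?case using insert by auto
qed

lemma variety_prime:
  assumes V: "variety n V" and fg: "f \<in> laurent n" "g \<in> laurent n" "\<And>x. x \<in> V \<Longrightarrow> leval f x * leval g x = 0"
  shows "(\<forall>x\<in>V. leval f x = 0) \<or> (\<forall>x\<in>V. leval g x = 0)"
proof -
  have "V \<subseteq> {x\<in>V. leval f x = 0} \<or> V \<subseteq> {x\<in>V. leval g x = 0}"
    by (rule variety_subset_Un[OF V]) (use fg V in \<open>auto intro!: zariski_closed_zero_set intro: variety_closed\<close>)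
  then show ?thesis by blast
qed

text \<open>Irreducibility: finitely many nonempty open subsets of \<open>V\<close> have a common
  point. General points of \<open>V\<close> are chosen in this way.\<close>

lemma variety_prod_nonvanishing:
  assumes V: "variety n V" and "finite S" "\<And>s. s \<in> S \<Longrightarrow> f s \<in> laurent n"
    "\<And>s. s \<in> S \<Longrightarrow> \<exists>x\<in>V. leval (f s) x \<noteq> 0"
  shows "\<exists>x\<in>V. \<forall>s\<in>S. leval (f s) x \<noteq> 0"
proof (rule ccontr)
  assume "\<not> ?thesis"
  then have "V \<subseteq> (\<Union>s\<in>S. {x\<in>V. leval (f s) x = 0})" by blast
  then have "\<exists>s\<in>S. V \<subseteq> {x\<in>V. leval (f s) x = 0}"
    by (intro variety_subset_UNION[OF V]) (use assms in \<open>auto intro: zariski_closed_zero_set variety_closed\<close>)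
  then show False using assms(4) by blast
qed

text \<open>A decomposition into two proper closed parts would give two functions, each vanishing on
  one part but not on the whole, whose product vanishes on \<open>V\<close>. Irreducibility can thus
  be tested on functions.\<close>

lemma varietyI:
  assumes "zariski_closed n V" "V \<noteq> {}"
    "\<And>f g. f \<in> laurent n \<Longrightarrow> g \<in> laurent n \<Longrightarrow> (\<And>x. x \<in> V \<Longrightarrow> leval f x * leval g x = 0) \<Longrightarrow>
      (\<forall>x\<in>V. leval f x = 0) \<or> (\<forall>x\<in>V. leval g x = 0)"
  shows "variety n V"
  unfolding variety_def
proof (intro conjI allI impI)
  fix A B assume AB: "zariski_closed n A \<and> zariski_closed n B \<and> V = A \<union> B"
  show "V = A \<or> V = B"
  proof (rule ccontr)
    assume *: "\<not> (V = A \<or> V = B)"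
    then obtain a b where ab: "a \<in> V" "a \<notin> A" "b \<in> V" "b \<notin> B" using AB by blast
    have t: "V \<subseteq> torus n" using assms(1) zariski_closed_torus by blast
    obtain f g where fg: "f \<in> vanishing_ideal n A" "leval f a \<noteq> 0" "g \<in> vanishing_ideal n B" "leval g b \<noteq> 0"
      using zariski_closed_memI[of n A a] zariski_closed_memI[of n B b] ab AB t by blast
    have "leval f x * leval g x = 0" if "x \<in> V" for x
      using that AB fg by (auto dest: vanishing_idealD)
    then show False using assms(3)[of f g] fg ab by (auto dest: vanishing_ideal_laurent)
  qed
qed (use assms in auto)


section \<open>The ascending chain condition for Laurent polynomials\<close>

inductive_set ideal_gen :: "nat \<Rightarrow> laurent_poly set \<Rightarrow> laurent_poly set" for n F where
  zero: "0 \<in> ideal_gen n F"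
| step: "f \<in> F \<Longrightarrow> g \<in> laurent n \<Longrightarrow> h \<in> ideal_gen n F \<Longrightarrow> g * f + h \<in> ideal_gen n F"

lemma ideal_gen_add: "a \<in> ideal_gen n F \<Longrightarrow> b \<in> ideal_gen n F \<Longrightarrow> a + b \<in> ideal_gen n F"
  by (induction a rule: ideal_gen.induct) (auto simp: add.assoc intro: ideal_gen.step)

lemma ideal_gen_mult: "a \<in> ideal_gen n F \<Longrightarrow> c \<in> laurent n \<Longrightarrow> c * a \<in> ideal_gen n F"
proof (induction a rule: ideal_gen.induct)
  case (step f g h)
  then have "(c * g) * f + c * h \<in> ideal_gen n F" by (intro ideal_gen.step) (auto intro: laurent_mult)
  then show ?case by (simp add: algebra_simps)
qed (auto intro: ideal_gen.zero)

lemma ideal_gen_base: "f \<in> F \<Longrightarrow> f \<in> ideal_gen n F"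
  using ideal_gen.step[of f F 1 n 0] ideal_gen.zero by simp

lemma ideal_gen_sum: "(\<And>s. s \<in> S \<Longrightarrow> a s \<in> ideal_gen n F) \<Longrightarrow> sum a S \<in> ideal_gen n F"
  by (induction S rule: infinite_finite_induct) (auto intro: ideal_gen_add ideal_gen.zero)

lemma ideal_gen_uminus: "a \<in> ideal_gen n F \<Longrightarrow> - a \<in> ideal_gen n F"
  using ideal_gen_mult[of a n F "-1"] by (simp add: laurent_uminus)

lemma ideal_gen_trans: "a \<in> ideal_gen n F \<Longrightarrow> F \<subseteq> ideal_gen n G \<Longrightarrow> a \<in> ideal_gen n G"
  by (induction a rule: ideal_gen.induct) (auto intro: ideal_gen_add ideal_gen_mult ideal_gen.zero)

lemma ideal_gen_mono: "F \<subseteq> G \<Longrightarrow> ideal_gen n F \<subseteq> ideal_gen n G"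
  using ideal_gen_trans ideal_gen_base by (meson subset_iff)

lemma ideal_gen_laurent: "a \<in> ideal_gen n F \<Longrightarrow> F \<subseteq> laurent n \<Longrightarrow> a \<in> laurent n"
  by (induction a rule: ideal_gen.induct) (auto intro: laurent_add laurent_mult)

lemma ideal_gen_image_sum:
  assumes "a \<in> ideal_gen n (f ` {..<k::nat})"
  shows "\<exists>h. (\<forall>i. h i \<in> laurent n) \<and> a = (\<Sum>i<k. h i * f i)"
  using assms
proof (induction a rule: ideal_gen.induct)
  case zero
  then show ?case by (intro exI[of _ "\<lambda>_. 0"]) auto
next
  case (step f' g h)
  then obtain h' i where h': "\<And>i. h' i \<in> laurent n" "h = (\<Sum>i<k. h' i * f i)" and i: "i < k" "f' = f i" by auto
  have "g * f' + h = (\<Sum>j<k. (h' j + (if j = i then g else 0)) * f j)"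
    using i by (simp add: h' distrib_right sum.distrib if_distrib[of "\<lambda>a. a * _"] sum.delta cong: if_cong)
  then show ?case using h' step by (intro exI[of _ "\<lambda>j. h' j + (if j = i then g else 0)"]) (auto intro: laurent_add)
qed

text \<open>In the induction step, the members of a strictly ascending sequence are
  replaced by members of minimal degree in the last variable.\<close>

theorem laurent_noetherian:
  "(\<And>i. f i \<in> laurent n) \<Longrightarrow> \<exists>k. f k \<in> ideal_gen n (f ` {..<k::nat})"
proof (induction n arbitrary: f)
  case 0
  show ?case
  proof (cases "f 0 = 0")
    case True
    then show ?thesis by (intro exI[of _ 0]) (auto intro: ideal_gen.zero)
  next
    case False
    obtain c d where c: "f 0 = single 0 c" and d: "f 1 = single 0 d" using laurent_zero_index 0 by metis
    have "f 1 = single 0 (d / c) * f 0" using False by (auto simp: c d[simplified] mult_single)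
    moreover have "single 0 (d / c) * f 0 \<in> ideal_gen 0 (f ` {..<1})"
      by (rule ideal_gen_mult[OF ideal_gen_base]) auto
    ultimately show ?thesis by metis
  qed
next
  case (Suc n)
  show ?case
  proof (rule ccontr)
    assume "\<not> ?case"
    then have bad: "f k \<notin> ideal_gen (Suc n) (f ` {..<k})" for k by blast
    define I where "I = ideal_gen (Suc n) (range f)"
    have I_lau: "I \<subseteq> laurent (Suc n)" unfolding I_def using ideal_gen_laurent Suc.prems by blast
    have I_fin: "\<exists>k. a \<in> ideal_gen (Suc n) (f ` {..<k})" if "a \<in> I" for a
      using that unfolding I_def
    proof (induction a rule: ideal_gen.induct)
      case (step f' g h)
      then obtain k i where "h \<in> ideal_gen (Suc n) (f ` {..<k})" "f' = f i" by auto
      then have "h \<in> ideal_gen (Suc n) (f ` {..<k + Suc i})" "f' \<in> f ` {..<k + Suc i}"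
        using ideal_gen_mono[OF image_mono[of "{..<k}" "{..<k + Suc i}" f], of "Suc n"] by auto
      then show ?case using step by (meson ideal_gen.step)
    qed (auto intro: ideal_gen.zero)
    \<comment> \<open>Finitely many elements of \<open>I\<close> lie in the ideal of finitely many
      \<open>f i\<close>, which misses some later \<open>f k\<close>. So \<open>I\<close> is not
      finitely generated.\<close>
    have notfin: "\<exists>a\<in>I. a \<notin> ideal_gen (Suc n) F" if F: "finite F" "F \<subseteq> I" for F
    proof -
      have "\<exists>k. F \<subseteq> ideal_gen (Suc n) (f ` {..<k})" using F
      proof (induction F rule: finite_induct)
        case (insert a F)
        then have aI: "a \<in> I" and "\<exists>k. F \<subseteq> ideal_gen (Suc n) (f ` {..<k})" by auto
        then obtain k k' where "F \<subseteq> ideal_gen (Suc n) (f ` {..<k})" "a \<in> ideal_gen (Suc n) (f ` {..<k'})"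
          using I_fin[OF aI] by blast
        then have "insert a F \<subseteq> ideal_gen (Suc n) (f ` {..<k + k'})"
          using ideal_gen_mono[OF image_mono[of "{..<k}" "{..<k + k'}" f], of "Suc n"]
            ideal_gen_mono[OF image_mono[of "{..<k'}" "{..<k + k'}" f], of "Suc n"] by auto
        then show ?case by blast
      qed auto
      then obtain k where "F \<subseteq> ideal_gen (Suc n) (f ` {..<k})" by blast
      then have "f k \<notin> ideal_gen (Suc n) F" using bad ideal_gen_trans by blast
      then show ?thesis unfolding I_def using ideal_gen_base by blast
    qed
    define rep where "rep N a = (\<Sum>e\<le>N. a e * lvar n (int e))" for N :: nat and a :: "nat \<Rightarrow> laurent_poly"
    define good where "good F N a \<longleftrightarrow> (\<forall>e. a e \<in> laurent n) \<and> rep N a \<in> I \<and> rep N a \<notin> ideal_gen (Suc n) F" for F N a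
    have lv: "lvar n k \<in> laurent (Suc n)" for k by (rule lvar_laurent) simp
    have ex_good: "\<exists>N a. good F N a" if F: "finite F" "F \<subseteq> I" for F
    proof -
      obtain b where b: "b \<in> I" "b \<notin> ideal_gen (Suc n) F" using notfin[OF F] by blast
      then obtain K N a where a: "\<And>e. a e \<in> laurent n" "b * lvar n (int K) = rep N a"
        using laurent_Suc_expand I_lau unfolding rep_def by (metis subsetD)
      have "rep N a \<in> I" using ideal_gen_mult[OF b(1)[unfolded I_def] lv[of "int K"]] a by (simp add: I_def mult.commute)
      moreover have "rep N a \<notin> ideal_gen (Suc n) F"
      proof
        assume "rep N a \<in> ideal_gen (Suc n) F"
        then have "lvar n (- int K) * rep N a \<in> ideal_gen (Suc n) F" by (rule ideal_gen_mult[OF _ lv])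
        also have "lvar n (- int K) * rep N a = b * (lvar n (int K) * lvar n (- int K))"
          unfolding a(2)[symmetric] by (simp only: ac_simps)
        finally show False using b by (simp add: lvar_mult)
      qed
      ultimately show ?thesis unfolding good_def using a by blast
    qed
    \<comment> \<open>The next element is taken outside the ideal of its predecessors
      \<open>F\<close>, written as a polynomial in the last variable with the least possible
      \<open>N\<close>.\<close>
    define nxt where "nxt F = (SOME (N, a). good F N a \<and> (\<forall>N' a'. good F N' a' \<longrightarrow> N \<le> N'))" for F
    have nxt: "good F (fst (nxt F)) (snd (nxt F)) \<and> (\<forall>N' a'. good F N' a' \<longrightarrow> fst (nxt F) \<le> N')"
      if F: "finite F" "F \<subseteq> I" for F
    proof -
      define N where "N = (LEAST N. \<exists>a. good F N a)"
      have "\<exists>a. good F N a" unfolding N_def by (rule LeastI_ex) (use ex_good[OF F] in blast)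
      then obtain a where "good F N a" by blast
      moreover have "\<forall>N' a'. good F N' a' \<longrightarrow> N \<le> N'" by (auto simp: N_def intro!: Least_le)
      ultimately have "\<exists>p. case p of (N, a) \<Rightarrow> good F N a \<and> (\<forall>N' a'. good F N' a' \<longrightarrow> N \<le> N')" by blast
      from someI_ex[OF this] show ?thesis unfolding nxt_def by (auto simp: case_prod_unfold)
    qed
    define el where "el F = rep (fst (nxt F)) (snd (nxt F))" for F
    define Fs where "Fs = rec_nat {} (\<lambda>_ F. insert (el F) F)"
    have Fs: "Fs 0 = {}" "Fs (Suc k) = insert (el (Fs k)) (Fs k)" for k by (simp_all add: Fs_def)
    have FsI: "finite (Fs k) \<and> Fs k \<subseteq> I" for k
    proof (induction k)
      case (Suc k)
      then show ?case using nxt[of "Fs k"] by (auto simp: Fs el_def good_def)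
    qed (auto simp: Fs)
    define N where "N k = fst (nxt (Fs k))" for k
    define a where "a k = snd (nxt (Fs k))" for k
    define g where "g k = rep (N k) (a k)" for k
    have gd: "good (Fs k) (N k) (a k)" and mini: "good (Fs k) N' a' \<Longrightarrow> N k \<le> N'" for k N' a'
      using nxt[of "Fs k"] FsI[of k] by (auto simp: N_def a_def)
    have Fs_eq: "Fs k = g ` {..<k}" for k
      by (induction k) (auto simp: Fs g_def N_def a_def el_def lessThan_Suc)
    have Nmono: "N i \<le> N k" if "i \<le> k" for i k
    proof (rule mini)
      have "Fs i \<subseteq> Fs k" using that by (auto simp: Fs_eq)
      then show "good (Fs i) (N k) (a k)" using gd[of k] ideal_gen_mono unfolding good_def by blast
    qed
    \<comment> \<open>The top coefficients involve one variable fewer, so the induction hypothesis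
      expresses one of them by its predecessors.\<close>
    define l where "l k = a k (N k)" for k
    have "l k \<in> laurent n" for k using gd by (auto simp: good_def l_def)
    then obtain k where "l k \<in> ideal_gen n (l ` {..<k})" using Suc.IH by blast
    then obtain h where h: "\<And>i. h i \<in> laurent n" "l k = (\<Sum>i<k. h i * l i)" using ideal_gen_image_sum by blast
    \<comment> \<open>The predecessors, shifted up to degree \<open>N k\<close>, are subtracted from
      \<open>g k\<close>. The top coefficient cancels, while the result stays in \<open>I\<close>
      and outside the ideal of \<open>Fs k\<close>; this contradicts the minimality of
      \<open>N k\<close>, or makes the result 0 if \<open>N k = 0\<close>.\<close>
    define b where "b e = a k e - (\<Sum>i<k. if N k - N i \<le> e then h i * a i (e - (N k - N i)) else 0)" for e
    have b_lau: "b e \<in> laurent n" for e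
      using h gd unfolding b_def good_def by (auto intro!: laurent_diff laurent_sum laurent_mult)
    have shift: "rep (N k) (\<lambda>e. if N k - N i \<le> e then h i * a i (e - (N k - N i)) else 0) = h i * lvar n (int (N k - N i)) * g i"
      if "i < k" for i
    proof -
      have le: "N i \<le> N k" using Nmono that by simp
      let ?L = "N k - N i"
      have "rep (N k) (\<lambda>e. if ?L \<le> e then h i * a i (e - ?L) else 0) = (\<Sum>e\<in>{?L..N k}. (if ?L \<le> e then h i * a i (e - ?L) else 0) * lvar n (int e))"
        unfolding rep_def by (rule sum.mono_neutral_right) auto
      also have "\<dots> = (\<Sum>e\<le>N i. h i * a i e * lvar n (int (e + ?L)))"
        by (rule sum.reindex_bij_witness[of _ "\<lambda>e. e + ?L" "\<lambda>e. e - ?L"]) (use le in auto)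
      also have "\<dots> = h i * lvar n (int ?L) * g i"
        unfolding g_def rep_def sum_distrib_left
        by (rule sum.cong[OF refl]) (simp add: lvar_mult[symmetric] algebra_simps)
      finally show ?thesis .
    qed
    have rep_sum: "rep M (\<lambda>e. a e - (\<Sum>i<k. c i e)) = rep M a - (\<Sum>i<k. rep M (c i))" for M a and c :: "nat \<Rightarrow> nat \<Rightarrow> laurent_poly"
    proof -
      have "(\<Sum>e\<le>M. (\<Sum>i<k. c i e) * lvar n (int e)) = (\<Sum>i<k. \<Sum>e\<le>M. c i e * lvar n (int e))"
        by (subst sum.swap) (simp add: sum_distrib_right)
      then show ?thesis by (simp add: rep_def left_diff_distrib sum_subtractf)
    qed
    have rb: "rep (N k) b = g k - (\<Sum>i<k. h i * lvar n (int (N k - N i)) * g i)"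
      unfolding b_def rep_sum g_def[of k] by (auto intro!: sum.cong simp: shift)
    have b_top: "b (N k) = 0"
    proof -
      have "(\<Sum>i<k. if N k - N i \<le> N k then h i * a i (N k - (N k - N i)) else 0) = (\<Sum>i<k. h i * l i)"
        by (rule sum.cong) (use Nmono in \<open>auto simp: l_def\<close>)
      then show ?thesis by (simp add: b_def h(2)[symmetric]) (simp add: l_def)
    qed
    have S: "(\<Sum>i<k. h i * lvar n (int (N k - N i)) * g i) \<in> ideal_gen (Suc n) (Fs k)"
      unfolding Fs_eq by (intro ideal_gen_sum ideal_gen_mult ideal_gen_base laurent_mult lv)
        (auto intro: laurent_mono[OF h(1)])
    then have SI: "(\<Sum>i<k. h i * lvar n (int (N k - N i)) * g i) \<in> I"
      using FsI[of k] unfolding I_def using ideal_gen_trans by blast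
    have rbI: "rep (N k) b \<in> I" unfolding rb using gd[of k] SI
      ideal_gen_add[of "g k" "Suc n" "range f" "- (\<Sum>i<k. h i * lvar n (int (N k - N i)) * g i)"]
      by (simp add: good_def g_def I_def ideal_gen_uminus)
    have rbn: "rep (N k) b \<notin> ideal_gen (Suc n) (Fs k)"
    proof
      assume "rep (N k) b \<in> ideal_gen (Suc n) (Fs k)"
      from ideal_gen_add[OF this S] have "g k \<in> ideal_gen (Suc n) (Fs k)" by (simp add: rb)
      then show False using gd[of k] by (simp add: good_def g_def)
    qed
    show False
    proof (cases "N k")
      case 0
      then have "rep (N k) b = 0" using b_top by (simp add: rep_def)
      then show False using rbn by (simp add: ideal_gen.zero)
    next
      case (Suc M)
      then have "rep M b = rep (N k) b" using b_top by (simp add: rep_def)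
      then have "good (Fs k) M b" using rbI rbn b_lau by (simp add: good_def)
      then show False using mini[of k M b] Suc by simp
    qed
  qed
qed

section \<open>Noetherian induction on closed sets, and irreducible components\<close>

lemma ideal_gen_vanish:
  assumes "a \<in> ideal_gen n F" "x \<in> nonzero_points" "\<And>f. f \<in> F \<Longrightarrow> leval f x = 0"
  shows "leval a x = 0"
  using assms(1) by (induction a rule: ideal_gen.induct) (auto simp: leval_add leval_mult assms(2,3))

text \<open>Otherwise there is a strictly decreasing sequence \<open>A k\<close>. Functions
  \<open>f k\<close> vanishing on \<open>A (Suc k)\<close> but not on \<open>A k\<close> contradict
  \<open>laurent_noetherian\<close>, since all earlier ones vanish on \<open>A k\<close>.\<close>

lemma minimal_closed_set:
  assumes "\<A> \<noteq> {}" "\<And>A. A \<in> \<A> \<Longrightarrow> zariski_closed n A"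
  shows "\<exists>A\<in>\<A>. \<forall>B\<in>\<A>. B \<subseteq> A \<longrightarrow> B = A"
proof (rule ccontr)
  assume "\<not> ?thesis"
  then have "\<forall>A\<in>\<A>. \<exists>B\<in>\<A>. B \<subset> A" by blast
  then obtain s where s: "\<And>A. A \<in> \<A> \<Longrightarrow> s A \<in> \<A> \<and> s A \<subset> A" by metis
  obtain A0 where A0: "A0 \<in> \<A>" using assms by blast
  define A where "A k = (s ^^ k) A0" for k
  have A: "A k \<in> \<A>" for k by (induction k) (use A0 s in \<open>auto simp: A_def\<close>)
  have dec: "A (Suc k) \<subset> A k" for k using s[OF A[of k]] by (simp add: A_def)
  have anti: "A l \<subseteq> A k" if "k \<le> l" for k l using that by (induction l rule: dec_induct) (use dec in auto)
  have "\<exists>f. f \<in> vanishing_ideal n (A (Suc k)) \<and> (\<exists>x\<in>A k. leval f x \<noteq> 0)" for k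
  proof (rule ccontr)
    assume c: "\<not> ?thesis"
    obtain x where x: "x \<in> A k" "x \<notin> A (Suc k)" using dec by blast
    then have "x \<in> torus n" using A assms(2) zariski_closed_torus by blast
    then have "x \<in> A (Suc k)" by (intro zariski_closed_memI[OF assms(2)[OF A]]) (use c x in auto)
    then show False using x by simp
  qed
  then obtain f where f: "\<And>k. f k \<in> vanishing_ideal n (A (Suc k))" "\<And>k. \<exists>x\<in>A k. leval (f k) x \<noteq> 0" by metis
  obtain k where k: "f k \<in> ideal_gen n (f ` {..<k})"
    using laurent_noetherian[of f n] f vanishing_ideal_laurent by blast
  obtain x where x: "x \<in> A k" "leval (f k) x \<noteq> 0" using f by blast
  have "leval (f i) x = 0" if "i < k" for i
    using f(1)[of i] x anti[of "Suc i" k] that by (auto dest: vanishing_idealD)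
  moreover have "x \<in> nonzero_points" using x A assms(2) zariski_closed_torus torus_nonzero by blast
  ultimately show False using ideal_gen_vanish[OF k] x by auto
qed

text \<open>A minimal zero locus of finitely many elements of the vanishing ideal does not shrink
  when one more element is added, so all of them vanish on it.\<close>

lemma closed_finite_equations:
  assumes "zariski_closed n X"
  shows "\<exists>F. finite F \<and> F \<subseteq> vanishing_ideal n X \<and> X = zero_locus n F"
proof -
  let ?\<A> = "{zero_locus n F | F. finite F \<and> F \<subseteq> vanishing_ideal n X}"
  have "\<exists>A\<in>?\<A>. \<forall>B\<in>?\<A>. B \<subseteq> A \<longrightarrow> B = A"
  proof (rule minimal_closed_set)
    fix A assume "A \<in> ?\<A>"
    then obtain F where "A = zero_locus n F" "F \<subseteq> laurent n" by (auto dest: vanishing_ideal_laurent)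
    then show "zariski_closed n A" by (simp add: zariski_closed_zero_locus)
  qed blast
  then obtain A where A: "A \<in> ?\<A>" and min_A: "\<forall>B\<in>?\<A>. B \<subseteq> A \<longrightarrow> B = A" ..
  from A obtain F where F: "finite F" "F \<subseteq> vanishing_ideal n X" and AF: "A = zero_locus n F" by auto
  have mini: "zero_locus n G = zero_locus n F"
    if "finite G" "G \<subseteq> vanishing_ideal n X" "zero_locus n G \<subseteq> zero_locus n F" for G
    using min_A[rule_format, of "zero_locus n G"] that AF by auto
  have "x \<in> X" if x: "x \<in> zero_locus n F" for x
  proof (rule zariski_closed_memI[OF assms])
    show "x \<in> torus n" using x by (simp add: zero_locus_def)
    fix f assume f: "f \<in> vanishing_ideal n X"
    have "zero_locus n (insert f F) = zero_locus n F"
      by (rule mini) (use F f in \<open>auto simp: zero_locus_def\<close>)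
    then show "leval f x = 0" using x by (auto simp: zero_locus_def)
  qed
  moreover have "X \<subseteq> zero_locus n F" using F zariski_closed_torus[OF assms] by (auto simp: zero_locus_def dest: vanishing_idealD)
  ultimately show ?thesis using F by blast
qed

text \<open>A minimal closed set without a decomposition would be nonempty and reducible, and both
  of its parts would decompose.\<close>

lemma closed_finite_union:
  assumes "zariski_closed n X"
  shows "\<exists>\<V>. finite \<V> \<and> (\<forall>V\<in>\<V>. variety n V) \<and> X = \<Union>\<V>"
proof (rule ccontr)
  let ?P = "\<lambda>X. \<exists>\<V>. finite \<V> \<and> (\<forall>V\<in>\<V>. variety n V) \<and> X = \<Union>\<V>"
  assume "\<not> ?P X"
  then have ne: "{X. zariski_closed n X \<and> \<not> ?P X} \<noteq> {}" using assms by blast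
  have "\<exists>A\<in>{X. zariski_closed n X \<and> \<not> ?P X}. \<forall>B\<in>{X. zariski_closed n X \<and> \<not> ?P X}. B \<subseteq> A \<longrightarrow> B = A"
    by (rule minimal_closed_set[OF ne, of n]) blast
  then obtain A where A': "A \<in> {X. zariski_closed n X \<and> \<not> ?P X}"
    and min_A: "\<forall>B\<in>{X. zariski_closed n X \<and> \<not> ?P X}. B \<subseteq> A \<longrightarrow> B = A" ..
  from A' have A: "zariski_closed n A" "\<not> ?P A" by simp_all
  have mini: "B = A" if "zariski_closed n B" "\<not> ?P B" "B \<subseteq> A" for B
    using min_A[rule_format, of B] that by simp
  have "A \<noteq> {}" using A(2) by (metis (no_types, lifting) Union_empty empty_iff finite.emptyI)
  moreover have "\<not> variety n A"
  proof
    assume "variety n A"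
    then have "?P A" by (intro exI[of _ "{A}"]) auto
    then show False using A by blast
  qed
  ultimately obtain B C where BC: "zariski_closed n B" "zariski_closed n C" "A = B \<union> C" "A \<noteq> B" "A \<noteq> C"
    using A unfolding variety_def by blast
  then have "?P B" "?P C" using mini[of B] mini[of C] by blast+
  then obtain \<V> \<W> where "finite \<V>" "\<forall>V\<in>\<V>. variety n V" "B = \<Union>\<V>" "finite \<W>" "\<forall>V\<in>\<W>. variety n V" "C = \<Union>\<W>"
    by blast
  then have "finite (\<V> \<union> \<W>) \<and> (\<forall>V\<in>\<V> \<union> \<W>. variety n V) \<and> A = \<Union>(\<V> \<union> \<W>)" using BC by auto
  then show False using A by blast
qed

text \<open>Every irreducible subset of \<open>X\<close> lies in one member of a finite
  decomposition, so the components are the maximal members.\<close>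

lemma finite_components:
  assumes "zariski_closed n X"
  shows "finite (components n X)" "X = \<Union>(components n X)"
proof -
  obtain \<V> where \<V>: "finite \<V>" "\<And>V. V \<in> \<V> \<Longrightarrow> variety n V" "X = \<Union>\<V>"
    using closed_finite_union[OF assms] by blast
  have sub: "\<exists>V\<in>\<V>. C \<subseteq> V" if "variety n C" "C \<subseteq> X" for C
    using variety_subset_UNION[OF that(1) \<V>(1), of "\<lambda>V. V"] \<V> that(2) variety_closed by auto
  have "components n X \<subseteq> \<V>"
  proof
    fix C assume C: "C \<in> components n X"
    then have "variety n C" "C \<subseteq> X" by (auto simp: components_def)
    then obtain V where "V \<in> \<V>" "C \<subseteq> V" using sub[of C] by blast
    moreover from this have "V = C" using C \<V> unfolding components_def by blast
    ultimately show "C \<in> \<V>" by simp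
  qed
  then show "finite (components n X)" using \<V>(1) finite_subset by blast
  have "V \<subseteq> \<Union>(components n X)" if V: "V \<in> \<V>" for V
  proof -
    have "finite {W\<in>\<V>. V \<subseteq> W}" "{W\<in>\<V>. V \<subseteq> W} \<noteq> {}" using \<V>(1) V by auto
    from finite_has_maximal[OF this] obtain M where M0: "M \<in> {W\<in>\<V>. V \<subseteq> W}"
      "\<forall>W\<in>{W\<in>\<V>. V \<subseteq> W}. M \<subseteq> W \<longrightarrow> M = W" ..
    have M: "M \<in> \<V>" "V \<subseteq> M" using M0(1) by simp_all
    have maxM: "W = M" if "W \<in> \<V>" "M \<subseteq> W" for W
    proof -
      have "W \<in> {W\<in>\<V>. V \<subseteq> W}" using that M by blast
      from M0(2)[rule_format, OF this that(2)] show ?thesis by simp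
    qed
    have "M \<in> components n X" unfolding components_def
    proof (intro CollectI conjI allI impI)
      show "variety n M" using M \<V>(2) by simp
      show "M \<subseteq> X" unfolding \<V>(3) using M by (rule_tac Union_upper)
      fix C' assume C': "variety n C' \<and> M \<subseteq> C' \<and> C' \<subseteq> X"
      then obtain W where "W \<in> \<V>" "C' \<subseteq> W" using sub[of C'] by blast
      moreover from this have "W = M" using maxM[of W] C' by blast
      ultimately show "C' = M" using C' by blast
    qed
    then show ?thesis using M by blast
  qed
  then show "X = \<Union>(components n X)" using \<V>(3) by (auto simp: components_def)
qed

section \<open>Polynomial functions\<close>

text \<open>A Vandermonde argument: the hypothesis passes from powers to all polynomials in
  \<open>l m\<close>, and the polynomial \<open>q\<close> with roots at the values of
  \<open>l\<close> other than \<mu> isolates one value. It splits a function along a one-parameter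
  curve into its weight classes.\<close>

lemma power_sums_separate:
  fixes d l :: "'a \<Rightarrow> complex"
  assumes "finite F" "\<And>N. (\<Sum>m\<in>F. d m * l m ^ N) = 0"
  shows "(\<Sum>m\<in>{m\<in>F. l m = \<mu>}. d m) = 0"
proof -
  have poly0: "(\<Sum>m\<in>F. d m * poly q (l m)) = 0" for q
  proof -
    have "(\<Sum>m\<in>F. d m * poly q (l m)) = (\<Sum>m\<in>F. \<Sum>i\<le>degree q. coeff q i * (d m * l m ^ i))"
      by (simp add: poly_altdef sum_distrib_left algebra_simps)
    also have "\<dots> = (\<Sum>i\<le>degree q. coeff q i * (\<Sum>m\<in>F. d m * l m ^ i))"
      by (subst sum.swap) (simp add: sum_distrib_left)
    finally show ?thesis by (simp add: assms(2))
  qed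
  define q where "q = (\<Prod>\<nu>\<in>l ` F - {\<mu>}. [:- \<nu>, 1:])"
  have q: "poly q (l m) = (if l m = \<mu> then poly q \<mu> else 0)" if "m \<in> F" for m
    using that assms(1) by (auto simp: q_def poly_prod prod_zero_iff)
  have "poly q \<mu> \<noteq> 0" using assms(1) by (auto simp: q_def poly_prod prod_zero_iff)
  moreover have "(\<Sum>m\<in>{m\<in>F. l m = \<mu>}. d m) * poly q \<mu> = (\<Sum>m\<in>F. d m * poly q (l m))"
    using assms(1) by (auto simp: q sum_distrib_right sum.inter_filter intro!: sum.cong)
  ultimately show ?thesis by (simp add: poly0)
qed

text \<open>Polynomials are treated as functions, so that substitution is composition and
  restriction to a line is immediate; \<open>A\<close> lists the variables that may occur. The
  formal polynomials in \<open>generic\<close> are translated by \<open>peval\<close>.\<close>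

inductive_set pfun :: "'v set \<Rightarrow> (('v \<Rightarrow> complex) \<Rightarrow> complex) set" for A where
  const: "(\<lambda>_. k) \<in> pfun A"
| proj: "v \<in> A \<Longrightarrow> (\<lambda>c. c v) \<in> pfun A"
| add: "P \<in> pfun A \<Longrightarrow> Q \<in> pfun A \<Longrightarrow> (\<lambda>c. P c + Q c) \<in> pfun A"
| mult: "P \<in> pfun A \<Longrightarrow> Q \<in> pfun A \<Longrightarrow> (\<lambda>c. P c * Q c) \<in> pfun A"

lemma pfun_sum: "(\<And>s. s \<in> S \<Longrightarrow> P s \<in> pfun A) \<Longrightarrow> (\<lambda>c. \<Sum>s\<in>S. P s c) \<in> pfun A"
  by (induction S rule: infinite_finite_induct) (auto intro: pfun.intros)

lemma pfun_prod: "(\<And>s. s \<in> S \<Longrightarrow> P s \<in> pfun A) \<Longrightarrow> (\<lambda>c. \<Prod>s\<in>S. P s c) \<in> pfun A"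
  by (induction S rule: infinite_finite_induct) (auto intro: pfun.intros)

lemma pfun_power: "P \<in> pfun A \<Longrightarrow> (\<lambda>c. P c ^ k) \<in> pfun A"
  by (induction k) (auto intro: pfun.intros)

lemma pfun_subst:
  assumes "P \<in> pfun A" "\<And>v. v \<in> A \<Longrightarrow> h v \<in> pfun B"
  shows "(\<lambda>c. P (\<lambda>v. h v c)) \<in> pfun B"
  using assms(1) by (induction P rule: pfun.induct) (auto intro: pfun.intros assms(2))

lemma pfun_mono: "P \<in> pfun A \<Longrightarrow> A \<subseteq> B \<Longrightarrow> P \<in> pfun B"
  by (induction P rule: pfun.induct) (auto intro: pfun.intros)

lemma pfun_cong:
  assumes "P \<in> pfun A" "\<And>v. v \<in> A \<Longrightarrow> c v = c' v"
  shows "P c = P c'"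
  using assms(1) by (induction P rule: pfun.induct) (auto simp: assms(2))

lemma pfun_line:
  assumes "P \<in> pfun A"
  shows "\<exists>q. \<forall>t. P (\<lambda>v. a v + t * b v) = poly q t"
  using assms
proof (induction P rule: pfun.induct)
  case (const k)
  show ?case by (rule exI[of _ "[:k:]"]) simp
next
  case (proj v)
  show ?case by (rule exI[of _ "[:a v, b v:]"]) simp
next
  case (add P Q)
  then obtain p q where "\<forall>t. P (\<lambda>v. a v + t * b v) = poly p t" "\<forall>t. Q (\<lambda>v. a v + t * b v) = poly q t" by blast
  then show ?case by (intro exI[of _ "p + q"]) simp
next
  case (mult P Q)
  then obtain p q where "\<forall>t. P (\<lambda>v. a v + t * b v) = poly p t" "\<forall>t. Q (\<lambda>v. a v + t * b v) = poly q t" by blast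
  then show ?case by (intro exI[of _ "p * q"]) simp
qed

lemma pfun_line_finite_zeros:
  assumes "P \<in> pfun A" "P (\<lambda>v. a v + t0 * b v) \<noteq> 0"
  shows "finite {t. P (\<lambda>v. a v + t * b v) = 0}"
proof -
  obtain q where q: "\<And>t. P (\<lambda>v. a v + t * b v) = poly q t" using pfun_line[OF assms(1)] by blast
  then have "q \<noteq> 0" using assms(2) by auto
  then show ?thesis unfolding q by (rule poly_roots_finite)
qed

text \<open>A point that is good for \<open>s\<close> and one that is good for \<open>S\<close> are
  joined by a line, on which each polynomial has finitely many zeros. \<open>L\<close> stands for an
  affine subspace: everything, a coordinate hyperplane, or the annihilator of the
  stabilizer.\<close>

lemma pfun_nonzero_prod:
  assumes "finite S" "\<And>s. s \<in> S \<Longrightarrow> P s \<in> pfun A"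
    "\<And>s. s \<in> S \<Longrightarrow> \<exists>c\<in>L. P s c \<noteq> 0" "L \<noteq> {}"
    "\<And>c d t. c \<in> L \<Longrightarrow> d \<in> L \<Longrightarrow> (\<lambda>v. c v + t * (d v - c v)) \<in> L"
  shows "\<exists>c\<in>L. \<forall>s\<in>S. P s c \<noteq> 0"
  using assms(1-3)
proof (induction S rule: finite_induct)
  case empty
  then show ?case using assms(4) by auto
next
  case (insert s S)
  then obtain c d where cd: "c \<in> L" "P s c \<noteq> 0" "d \<in> L" "\<forall>s\<in>S. P s d \<noteq> 0" by (metis insert_iff)
  let ?l = "\<lambda>t v. c v + t * (d v - c v)"
  have "finite (\<Union>r\<in>insert s S. {t. P r (?l t) = 0})"
  proof (intro finite_UN_I)
    fix r assume "r \<in> insert s S"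
    then show "finite {t. P r (?l t) = 0}"
      using pfun_line_finite_zeros[of "P s" A c 0 "\<lambda>v. d v - c v"] pfun_line_finite_zeros[of "P r" A c 1 "\<lambda>v. d v - c v"]
        cd insert.prems by auto
  qed (use insert in simp)
  then obtain t where "t \<notin> (\<Union>r\<in>insert s S. {t. P r (?l t) = 0})"
    using infinite_UNIV_char_0 ex_new_if_finite by blast
  then show ?case using assms(5)[OF cd(1,3), of t] by blast
qed

lemma pfun_expand:
  assumes "P \<in> pfun (insert v A)"
  shows "\<exists>N a. (\<forall>e. a e \<in> pfun A) \<and> (\<forall>c. P c = (\<Sum>e\<le>N. a e c * c v ^ e))"
proof -
  \<comment> \<open>Vanishing beyond \<open>N\<close> is carried along so that expansions can be
    summed up to larger bounds when they are added or multiplied.\<close>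
  have "\<exists>N a. (\<forall>e. a e \<in> pfun A) \<and> (\<forall>e>N. a e = (\<lambda>_. 0)) \<and> (\<forall>c. P c = (\<Sum>e\<le>N. a e c * c v ^ e))"
    using assms
  proof (induction P rule: pfun.induct)
    case (const k)
    show ?case
      by (rule exI[of _ 0], rule exI[of _ "\<lambda>e. if e = 0 then (\<lambda>_. k) else (\<lambda>_. 0)"]) (auto intro: pfun.intros)
  next
    case (proj w)
    show ?case
    proof (cases "w = v")
      case True
      then show ?thesis
        by - (rule exI[of _ 1], rule exI[of _ "\<lambda>e. if e = 1 then (\<lambda>_. 1) else (\<lambda>_. 0)"], auto intro: pfun.intros)
    next
      case False
      then show ?thesis using proj
        by - (rule exI[of _ 0], rule exI[of _ "\<lambda>e. if e = 0 then (\<lambda>c. c w) else (\<lambda>_. 0)"], auto intro: pfun.intros)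
    qed
  next
    case (add P Q)
    from add.IH(1) obtain N a where "\<forall>e. a e \<in> pfun A" "\<forall>e>N. a e = (\<lambda>_. 0)" "\<forall>c. P c = (\<Sum>e\<le>N. a e c * c v ^ e)"
      by (elim exE conjE)
    then have a: "a e \<in> pfun A" "e > N \<Longrightarrow> a e = (\<lambda>_. 0)" "P c = (\<Sum>e\<le>N. a e c * c v ^ e)" for e c
      by simp_all
    from add.IH(2) obtain M b where "\<forall>e. b e \<in> pfun A" "\<forall>e>M. b e = (\<lambda>_. 0)" "\<forall>c. Q c = (\<Sum>e\<le>M. b e c * c v ^ e)"
      by (elim exE conjE)
    then have b: "b e \<in> pfun A" "e > M \<Longrightarrow> b e = (\<lambda>_. 0)" "Q c = (\<Sum>e\<le>M. b e c * c v ^ e)" for e c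
      by simp_all
    have "P c + Q c = (\<Sum>e\<le>N + M. (a e c + b e c) * c v ^ e)" for c
    proof -
      have "P c = (\<Sum>e\<le>N + M. a e c * c v ^ e)" "Q c = (\<Sum>e\<le>N + M. b e c * c v ^ e)"
        unfolding a(3) b(3) by (intro sum.mono_neutral_left; auto simp: a(2) b(2))+
      then show ?thesis by (simp add: distrib_right sum.distrib)
    qed
    then show ?case using a b
      by - (rule exI[of _ "N + M"], rule exI[of _ "\<lambda>e c. a e c + b e c"], auto intro: pfun.intros)
  next
    case (mult P Q)
    from mult.IH(1) obtain N a where "\<forall>e. a e \<in> pfun A" "\<forall>e>N. a e = (\<lambda>_. 0)" "\<forall>c. P c = (\<Sum>e\<le>N. a e c * c v ^ e)"
      by (elim exE conjE)
    then have a: "a e \<in> pfun A" "e > N \<Longrightarrow> a e = (\<lambda>_. 0)" "P c = (\<Sum>e\<le>N. a e c * c v ^ e)" for e c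
      by simp_all
    from mult.IH(2) obtain M b where "\<forall>e. b e \<in> pfun A" "\<forall>e>M. b e = (\<lambda>_. 0)" "\<forall>c. Q c = (\<Sum>e\<le>M. b e c * c v ^ e)"
      by (elim exE conjE)
    then have b: "b e \<in> pfun A" "e > M \<Longrightarrow> b e = (\<lambda>_. 0)" "Q c = (\<Sum>e\<le>M. b e c * c v ^ e)" for e c
      by simp_all
    define d where "d e c = (\<Sum>i\<le>e. a i c * b (e - i) c)" for e c
    have d: "d e \<in> pfun A" for e
      unfolding d_def using a b by (intro pfun_sum pfun.mult) auto
    have d0: "d e = (\<lambda>_. 0)" if "e > N + M" for e
    proof
      fix c
      have "a i c * b (e - i) c = 0" if "i \<le> e" for i
      proof (cases "i > N")
        case False
        then have "e - i > M" using \<open>e > N + M\<close> that by linarith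
        then show ?thesis by (simp add: b(2))
      qed (simp add: a(2))
      then show "d e c = 0" unfolding d_def by (intro sum.neutral) auto
    qed
    have PQ: "P c * Q c = (\<Sum>e\<le>N + M. d e c * c v ^ e)" for c
    proof -
      have "P c * Q c = (\<Sum>k\<le>N + M. \<Sum>i\<le>k. (a i c * c v ^ i) * (b (k - i) c * c v ^ (k - i)))"
        unfolding a(3) b(3) sum_product
      proof -
        have "(\<Sum>i\<le>N. \<Sum>j\<le>M. (a i c * c v ^ i) * (b j c * c v ^ j)) =
          (\<Sum>(i, j)\<in>{(i, j). i + j \<le> N + M}. (a i c * c v ^ i) * (b j c * c v ^ j))"
          unfolding sum.cartesian_product
        proof (rule sum.mono_neutral_left)
          have "{(i, j). i + j \<le> N + M} \<subseteq> {..N + M} \<times> {..N + M}" by auto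
          then show "finite {(i, j). i + j \<le> N + M}" by (rule finite_subset) auto
          show "\<forall>i\<in>{(i, j). i + j \<le> N + M} - {..N} \<times> {..M}. (case i of (i, j) \<Rightarrow> a i c * c v ^ i * (b j c * c v ^ j)) = 0"
          proof
            fix ij assume ij: "ij \<in> {(i, j). i + j \<le> N + M} - {..N} \<times> {..M}"
            then have "fst ij > N \<or> snd ij > M" by (auto simp: not_le)
            then show "(case ij of (i, j) \<Rightarrow> a i c * c v ^ i * (b j c * c v ^ j)) = 0"
              using a(2)[of "fst ij"] b(2)[of "snd ij"] by (auto simp: case_prod_unfold)
          qed
        qed auto
        also have "\<dots> = (\<Sum>k\<le>N + M. \<Sum>i\<le>k. (a i c * c v ^ i) * (b (k - i) c * c v ^ (k - i)))"
          by (rule sum.triangle_reindex_eq)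
        finally show "(\<Sum>i\<le>N. \<Sum>j\<le>M. (a i c * c v ^ i) * (b j c * c v ^ j)) = \<dots>" .
      qed
      also have "\<dots> = (\<Sum>e\<le>N + M. d e c * c v ^ e)"
      proof (rule sum.cong[OF refl])
        fix k
        have "(a i c * c v ^ i) * (b (k - i) c * c v ^ (k - i)) = a i c * b (k - i) c * c v ^ k" if "i \<le> k" for i
          using that power_add[of "c v" i "k - i"] by (simp add: mult_ac)
        then show "(\<Sum>i\<le>k. (a i c * c v ^ i) * (b (k - i) c * c v ^ (k - i))) = d k c * c v ^ k"
          unfolding d_def sum_distrib_right by (intro sum.cong refl) simp
      qed
      finally show ?thesis .
    qed
    show ?case by (rule exI[of _ "N + M"], rule exI[of _ d]) (intro conjI allI impI d d0 PQ)
  qed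
  then show ?thesis by blast
qed

text \<open>Setting one variable to 2^N for all \<open>N\<close> gives power sums in 2^(\<beta> v),
  whose separation fixes the exponent of that variable; the induction treats the others. Exponents
  are functions on the whole type, so members of \<open>E\<close> are required to differ already on
  \<open>A\<close>.\<close>

lemma monomials_independent:
  fixes \<gamma> :: "('v \<Rightarrow> nat) \<Rightarrow> complex"
  assumes "finite A" "finite E" "\<And>\<alpha> \<beta>. \<alpha> \<in> E \<Longrightarrow> \<beta> \<in> E \<Longrightarrow> (\<And>v. v \<in> A \<Longrightarrow> \<alpha> v = \<beta> v) \<Longrightarrow> \<alpha> = \<beta>"
    "\<And>y. (\<Sum>\<alpha>\<in>E. \<gamma> \<alpha> * (\<Prod>v\<in>A. y v ^ \<alpha> v)) = 0" "\<alpha> \<in> E"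
  shows "\<gamma> \<alpha> = 0"
  using assms
proof (induction A arbitrary: E rule: finite_induct)
  case empty
  have "\<beta> = \<alpha>" if "\<beta> \<in> E" for \<beta> using empty.prems(2)[OF that empty.prems(4)] by simp
  then have "E = {\<alpha>}" using empty.prems(4) by blast
  then show ?case using empty.prems(3) by simp
next
  case (insert v A)
  let ?E = "{\<beta>\<in>E. (2::complex) ^ \<beta> v = 2 ^ \<alpha> v}"
  have inj: "(2::complex) ^ i = 2 ^ j \<Longrightarrow> i = j" for i j :: nat
    by (metis norm_numeral norm_power one_less_numeral_iff power_inject_exp semiring_norm(76))
  show ?case
  proof (rule insert.IH[of ?E])
    fix y :: "'v \<Rightarrow> complex"
    have "(\<Sum>\<beta>\<in>E. (\<gamma> \<beta> * (\<Prod>w\<in>A. y w ^ \<beta> w)) * (2 ^ \<beta> v) ^ N) = 0" for N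
    proof -
      have "(\<Sum>\<beta>\<in>E. (\<gamma> \<beta> * (\<Prod>w\<in>A. y w ^ \<beta> w)) * (2 ^ \<beta> v) ^ N) =
        (\<Sum>\<beta>\<in>E. \<gamma> \<beta> * (\<Prod>w\<in>insert v A. (y(v := 2 ^ N)) w ^ \<beta> w))"
      proof (rule sum.cong[OF refl])
        fix \<beta>
        have "(\<Prod>w\<in>A. (y(v := 2 ^ N)) w ^ \<beta> w) = (\<Prod>w\<in>A. y w ^ \<beta> w)"
          using insert.hyps by (intro prod.cong) auto
        moreover have "(2 ^ \<beta> v) ^ N = ((2::complex) ^ N) ^ \<beta> v" by (simp add: power_mult[symmetric] mult.commute)
        ultimately show "(\<gamma> \<beta> * (\<Prod>w\<in>A. y w ^ \<beta> w)) * (2 ^ \<beta> v) ^ N = \<gamma> \<beta> * (\<Prod>w\<in>insert v A. (y(v := 2 ^ N)) w ^ \<beta> w)"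
          using insert.hyps by (simp add: mult_ac)
      qed
      then show ?thesis using insert.prems(3) by simp
    qed
    from power_sums_separate[OF insert.prems(1) this]
    show "(\<Sum>\<beta>\<in>?E. \<gamma> \<beta> * (\<Prod>w\<in>A. y w ^ \<beta> w)) = 0" .
  next
    fix \<beta> \<beta>' assume *: "\<beta> \<in> ?E" "\<beta>' \<in> ?E" "\<And>w. w \<in> A \<Longrightarrow> \<beta> w = \<beta>' w"
    have "\<beta> v = \<beta>' v" using * inj by auto
    then show "\<beta> = \<beta>'" using * insert.prems(2)[of \<beta> \<beta>'] by auto
  qed (use insert.prems in auto)
qed

lemma peval_pfun:
  assumes "\<And>m. m \<in> keys p \<Longrightarrow> keys m \<subseteq> A"
  shows "peval p \<in> pfun A"
  unfolding peval_def[abs_def] using assms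
  by (intro pfun_sum pfun.mult pfun_prod pfun_power pfun.const pfun.proj) auto

text \<open>It supplies a first tuple outside the hypersurface that defines a generic set. Distinct
  keys differ as exponent functions on the finite set \<open>A\<close> of variables that
  occur.\<close>

lemma peval_nonzero:
  assumes "p \<noteq> 0"
  shows "\<exists>c. peval p c \<noteq> 0"
proof (rule ccontr)
  assume "\<not> ?thesis"
  then have z: "peval p c = 0" for c by blast
  define A where "A = (\<Union>m\<in>keys p. keys m)"
  have A: "finite A" by (simp add: A_def)
  have pe: "(\<Sum>\<alpha>\<in>lookup ` keys p. lookup p (Poly_Mapping.Abs_poly_mapping \<alpha>) * (\<Prod>v\<in>A. c v ^ \<alpha> v)) = peval p c" for c
  proof -
    have "(\<Sum>\<alpha>\<in>lookup ` keys p. lookup p (Poly_Mapping.Abs_poly_mapping \<alpha>) * (\<Prod>v\<in>A. c v ^ \<alpha> v)) =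
      (\<Sum>m\<in>keys p. lookup p m * (\<Prod>v\<in>A. c v ^ lookup m v))"
      by (subst sum.reindex) (simp_all add: inj_on_def Poly_Mapping.lookup_inverse)
    also have "\<dots> = peval p c" unfolding peval_def
    proof (intro sum.cong refl arg_cong2[where f="(*)"])
      fix m assume "m \<in> keys p"
      then show "(\<Prod>v\<in>A. c v ^ lookup m v) = (\<Prod>v\<in>keys m. c v ^ lookup m v)"
        by (intro prod.mono_neutral_right A) (auto simp: A_def lookup_not_keys)
    qed
    finally show ?thesis .
  qed
  obtain m where m: "m \<in> keys p" using assms by (metis all_not_in_conv keys_eq_empty)
  have "lookup p (Poly_Mapping.Abs_poly_mapping (lookup m)) = 0"
  proof (rule monomials_independent[OF A, of "lookup ` keys p"])
    fix \<alpha> \<beta> assume "\<alpha> \<in> lookup ` keys p" "\<beta> \<in> lookup ` keys p" "\<And>v. v \<in> A \<Longrightarrow> \<alpha> v = \<beta> v"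
    then obtain m m' where m: "\<alpha> = lookup m" "m \<in> keys p" "\<beta> = lookup m'" "m' \<in> keys p" by blast
    show "\<alpha> = \<beta>"
    proof
      fix v show "\<alpha> v = \<beta> v"
        using \<open>\<And>v. v \<in> A \<Longrightarrow> \<alpha> v = \<beta> v\<close>[of v] m by (cases "v \<in> A") (auto simp: A_def lookup_not_keys)
    qed
  qed (use m z pe in auto)
  then show False using m by (simp add: Poly_Mapping.lookup_inverse in_keys_iff)
qed

text \<open>One induction over \<open>P\<close> yields a single gradient with both of its uses: as
  the derivative along a line, and in the formal chain rule after Laurent polynomials are
  substituted.\<close>

lemma pfun_gradient:
  fixes P :: "(nat \<Rightarrow> complex) \<Rightarrow> complex"
  assumes "P \<in> pfun {..<n}"
  shows "\<exists>P'. (\<forall>l. P' l \<in> pfun {..<n}) \<and>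
     (\<forall>c b. ((\<lambda>s. P (\<lambda>l. c l + s * b l)) has_field_derivative (\<Sum>l<n. P' l c * b l)) (at 0)) \<and>
     (\<forall>N h. (\<forall>l<n. h l \<in> laurent N) \<longrightarrow>
       (\<exists>q\<in>laurent N. \<forall>x\<in>nonzero_points. leval q x = P (\<lambda>l. leval (h l) x) \<and>
         (\<forall>\<eta>. log_deriv N x \<eta> q = (\<Sum>l<n. P' l (\<lambda>l. leval (h l) x) * log_deriv N x \<eta> (h l)))))"
  using assms
proof (induction P rule: pfun.induct)
  case (const k)
  show ?case
    by (rule exI[of _ "\<lambda>_ _. 0"]) (auto intro!: pfun.intros bexI[of _ "single 0 k"] simp: leval_single)
next
  case (proj v)
  have *: "(\<Sum>l<n. (if l = v then 1 else 0) * b l) = b v" for b :: "nat \<Rightarrow> complex"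
    using proj by (simp add: if_distrib[of "\<lambda>a. a * _"] sum.delta cong: if_cong)
  show ?case
  proof (rule exI[of _ "\<lambda>l _. if l = v then 1 else 0"], intro conjI allI impI)
    fix l show "(\<lambda>_. if l = v then 1 else 0) \<in> pfun {..<n}" by (rule pfun.const)
  next
    fix c b :: "nat \<Rightarrow> complex"
    show "((\<lambda>s. c v + s * b v) has_field_derivative (\<Sum>l<n. (if l = v then 1 else 0) * b l)) (at 0)"
      unfolding * by (auto intro!: derivative_eq_intros)
  next
    fix N and h :: "nat \<Rightarrow> laurent_poly" assume "\<forall>l<n. h l \<in> laurent N"
    then show "\<exists>q\<in>laurent N. \<forall>x\<in>nonzero_points. leval q x = leval (h v) x \<and>
         (\<forall>\<eta>. log_deriv N x \<eta> q = (\<Sum>l<n. (if l = v then 1 else 0) * log_deriv N x \<eta> (h l)))"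
      using proj by (intro bexI[of _ "h v"]) (auto simp: *)
  qed
next
  case (add P Q)
  from add.IH(1) obtain P' where "\<forall>l. P' l \<in> pfun {..<n}"
    "\<forall>c b. ((\<lambda>s. P (\<lambda>l. c l + s * b l)) has_field_derivative (\<Sum>l<n. P' l c * b l)) (at 0)"
    "\<forall>N h. (\<forall>l<n. h l \<in> laurent N) \<longrightarrow>
       (\<exists>q\<in>laurent N. \<forall>x\<in>nonzero_points. leval q x = P (\<lambda>l. leval (h l) x) \<and>
         (\<forall>\<eta>. log_deriv N x \<eta> q = (\<Sum>l<n. P' l (\<lambda>l. leval (h l) x) * log_deriv N x \<eta> (h l))))"
    by (elim exE conjE)
  note P' = this(1)[rule_format] this(2)[rule_format] this(3)[THEN spec, THEN spec, THEN mp]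
  from add.IH(2) obtain Q' where "\<forall>l. Q' l \<in> pfun {..<n}"
    "\<forall>c b. ((\<lambda>s. Q (\<lambda>l. c l + s * b l)) has_field_derivative (\<Sum>l<n. Q' l c * b l)) (at 0)"
    "\<forall>N h. (\<forall>l<n. h l \<in> laurent N) \<longrightarrow>
       (\<exists>q\<in>laurent N. \<forall>x\<in>nonzero_points. leval q x = Q (\<lambda>l. leval (h l) x) \<and>
         (\<forall>\<eta>. log_deriv N x \<eta> q = (\<Sum>l<n. Q' l (\<lambda>l. leval (h l) x) * log_deriv N x \<eta> (h l))))"
    by (elim exE conjE)
  note Q' = this(1)[rule_format] this(2)[rule_format] this(3)[THEN spec, THEN spec, THEN mp]
  show ?case
  proof (rule exI[of _ "\<lambda>l c. P' l c + Q' l c"], intro conjI allI impI)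
    fix l show "(\<lambda>c. P' l c + Q' l c) \<in> pfun {..<n}" using P'(1) Q'(1) by (intro pfun.add)
  next
    fix c b :: "nat \<Rightarrow> complex"
    show "((\<lambda>s. P (\<lambda>l. c l + s * b l) + Q (\<lambda>l. c l + s * b l)) has_field_derivative (\<Sum>l<n. (P' l c + Q' l c) * b l)) (at 0)"
      using DERIV_add[OF P'(2)[of c b] Q'(2)[of c b]] by (simp add: distrib_right sum.distrib)
  next
    fix N and h :: "nat \<Rightarrow> laurent_poly" assume h: "\<forall>l<n. h l \<in> laurent N"
    obtain p q where "p \<in> laurent N" "\<forall>x\<in>nonzero_points. leval p x = P (\<lambda>l. leval (h l) x) \<and>
         (\<forall>\<eta>. log_deriv N x \<eta> p = (\<Sum>l<n. P' l (\<lambda>l. leval (h l) x) * log_deriv N x \<eta> (h l)))"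
      "q \<in> laurent N" "\<forall>x\<in>nonzero_points. leval q x = Q (\<lambda>l. leval (h l) x) \<and>
         (\<forall>\<eta>. log_deriv N x \<eta> q = (\<Sum>l<n. Q' l (\<lambda>l. leval (h l) x) * log_deriv N x \<eta> (h l)))"
      using P'(3)[OF h] Q'(3)[OF h] by blast
    then show "\<exists>q\<in>laurent N. \<forall>x\<in>nonzero_points. leval q x = P (\<lambda>l. leval (h l) x) + Q (\<lambda>l. leval (h l) x) \<and>
         (\<forall>\<eta>. log_deriv N x \<eta> q = (\<Sum>l<n. (P' l (\<lambda>l. leval (h l) x) + Q' l (\<lambda>l. leval (h l) x)) * log_deriv N x \<eta> (h l)))"
      by (intro bexI[of _ "p + q"]) (auto simp: leval_add log_deriv_add distrib_right sum.distrib laurent_add)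
  qed
next
  case (mult P Q)
  from mult.IH(1) obtain P' where "\<forall>l. P' l \<in> pfun {..<n}"
    "\<forall>c b. ((\<lambda>s. P (\<lambda>l. c l + s * b l)) has_field_derivative (\<Sum>l<n. P' l c * b l)) (at 0)"
    "\<forall>N h. (\<forall>l<n. h l \<in> laurent N) \<longrightarrow>
       (\<exists>q\<in>laurent N. \<forall>x\<in>nonzero_points. leval q x = P (\<lambda>l. leval (h l) x) \<and>
         (\<forall>\<eta>. log_deriv N x \<eta> q = (\<Sum>l<n. P' l (\<lambda>l. leval (h l) x) * log_deriv N x \<eta> (h l))))"
    by (elim exE conjE)
  note P' = this(1)[rule_format] this(2)[rule_format] this(3)[THEN spec, THEN spec, THEN mp]
  from mult.IH(2) obtain Q' where "\<forall>l. Q' l \<in> pfun {..<n}"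
    "\<forall>c b. ((\<lambda>s. Q (\<lambda>l. c l + s * b l)) has_field_derivative (\<Sum>l<n. Q' l c * b l)) (at 0)"
    "\<forall>N h. (\<forall>l<n. h l \<in> laurent N) \<longrightarrow>
       (\<exists>q\<in>laurent N. \<forall>x\<in>nonzero_points. leval q x = Q (\<lambda>l. leval (h l) x) \<and>
         (\<forall>\<eta>. log_deriv N x \<eta> q = (\<Sum>l<n. Q' l (\<lambda>l. leval (h l) x) * log_deriv N x \<eta> (h l))))"
    by (elim exE conjE)
  note Q' = this(1)[rule_format] this(2)[rule_format] this(3)[THEN spec, THEN spec, THEN mp]
  show ?case
  proof (rule exI[of _ "\<lambda>l c. P' l c * Q c + P c * Q' l c"], intro conjI allI impI)
    fix l show "(\<lambda>c. P' l c * Q c + P c * Q' l c) \<in> pfun {..<n}" using P'(1) Q'(1) mult.hyps by (intro pfun.add pfun.mult)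
  next
    fix c b :: "nat \<Rightarrow> complex"
    show "((\<lambda>s. P (\<lambda>l. c l + s * b l) * Q (\<lambda>l. c l + s * b l)) has_field_derivative (\<Sum>l<n. (P' l c * Q c + P c * Q' l c) * b l)) (at 0)"
      by (rule DERIV_cong[OF DERIV_mult[OF P'(2)[of c b] Q'(2)[of c b]]])
         (simp add: distrib_left distrib_right sum.distrib sum_distrib_left sum_distrib_right mult_ac)
  next
    fix N and h :: "nat \<Rightarrow> laurent_poly" assume h: "\<forall>l<n. h l \<in> laurent N"
    obtain p q where "p \<in> laurent N" "\<forall>x\<in>nonzero_points. leval p x = P (\<lambda>l. leval (h l) x) \<and>
         (\<forall>\<eta>. log_deriv N x \<eta> p = (\<Sum>l<n. P' l (\<lambda>l. leval (h l) x) * log_deriv N x \<eta> (h l)))"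
      "q \<in> laurent N" "\<forall>x\<in>nonzero_points. leval q x = Q (\<lambda>l. leval (h l) x) \<and>
         (\<forall>\<eta>. log_deriv N x \<eta> q = (\<Sum>l<n. Q' l (\<lambda>l. leval (h l) x) * log_deriv N x \<eta> (h l)))"
      using P'(3)[OF h] Q'(3)[OF h] by blast
    then show "\<exists>q\<in>laurent N. \<forall>x\<in>nonzero_points. leval q x = P (\<lambda>l. leval (h l) x) * Q (\<lambda>l. leval (h l) x) \<and>
         (\<forall>\<eta>. log_deriv N x \<eta> q = (\<Sum>l<n. (P' l (\<lambda>l. leval (h l) x) * Q (\<lambda>l. leval (h l) x) + P (\<lambda>l. leval (h l) x) * Q' l (\<lambda>l. leval (h l) x)) * log_deriv N x \<eta> (h l)))"
      by (intro bexI[of _ "p * q"])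
         (auto simp: leval_mult log_deriv_mult distrib_left distrib_right sum.distrib laurent_mult sum_distrib_left sum_distrib_right mult_ac)
  qed
qed

lemma pfun_laurent:
  assumes "P \<in> pfun A" "\<And>v. v \<in> A \<Longrightarrow> h v \<in> laurent n"
  shows "\<exists>q\<in>laurent n. \<forall>x\<in>nonzero_points. leval q x = P (\<lambda>v. leval (h v) x)"
  using assms(1)
proof (induction P rule: pfun.induct)
  case (const k)
  show ?case by (rule bexI[of _ "single 0 k"]) (auto simp: leval_single)
next
  case (proj v)
  then show ?case using assms(2) by blast
next
  case (add P Q)
  then show ?case by (metis laurent_add leval_add)
next
  case (mult P Q)
  then show ?case by (metis laurent_mult leval_mult)
qed


subsection \<open>Algebraic dependence by counting\<close>

text \<open>The relation is indexed by \<open>E\<close> rather than by the set of vectors; if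
  \<open>u\<close> is not injective, two equal vectors already give one.\<close>

lemma span_dependency:
  fixes u :: "'a \<Rightarrow> 'i \<Rightarrow> complex"
  assumes "finite E" "finite T" "card T < card E" "\<And>\<alpha>. \<alpha> \<in> E \<Longrightarrow> u \<alpha> \<in> fvec.span T"
  shows "\<exists>\<gamma>. (\<exists>\<alpha>\<in>E. \<gamma> \<alpha> \<noteq> 0) \<and> (\<forall>x. (\<Sum>\<alpha>\<in>E. \<gamma> \<alpha> * u \<alpha> x) = 0)"
proof (cases "inj_on u E")
  case False
  then obtain \<alpha> \<beta> where ab: "\<alpha> \<in> E" "\<beta> \<in> E" "\<alpha> \<noteq> \<beta>" "u \<alpha> = u \<beta>" by (auto simp: inj_on_def)
  define \<gamma> where "\<gamma> a = (if a = \<alpha> then 1 else if a = \<beta> then - 1 else (0::complex))" for a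
  have "(\<Sum>a\<in>E. \<gamma> a * u a x) = 0" for x
  proof -
    have "(\<Sum>a\<in>E. \<gamma> a * u a x) = (\<Sum>a\<in>{\<alpha>, \<beta>}. \<gamma> a * u a x)"
      by (rule sum.mono_neutral_right) (use assms ab in \<open>auto simp: \<gamma>_def\<close>)
    then show ?thesis using ab by (simp add: \<gamma>_def)
  qed
  moreover have "\<gamma> \<alpha> \<noteq> 0" by (simp add: \<gamma>_def)
  ultimately show ?thesis using ab by blast
next
  case True
  have "fvec.dependent (u ` E)"
  proof (rule ccontr)
    assume "\<not> ?thesis"
    then have "card (u ` E) \<le> card T" using fvec.independent_span_bound[OF assms(2), of "u ` E"] assms(4) by auto
    then show False using assms(3) card_image[OF True] by simp
  qed
  then obtain g where g: "\<exists>v\<in>u ` E. g v \<noteq> 0" "(\<Sum>v\<in>u ` E. fscale (g v) v) = 0"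
    using fvec.dependent_finite[of "u ` E"] assms(1) by auto
  have "(\<Sum>\<alpha>\<in>E. g (u \<alpha>) * u \<alpha> x) = 0" for x
    using fun_cong[OF g(2), of x] by (simp add: sum.reindex[OF True] fscale_def)
  then show ?thesis using g(1) by (intro exI[of _ "\<lambda>\<alpha>. g (u \<alpha>)"]) auto
qed

text \<open>There are D^(r+1) monomials with exponents below \<open>D\<close> in
  \<open>r + 1\<close> functions, but after multiplication by \<open>H\<close> they lie in a space
  of dimension O(D^r). A linear relation between them is the polynomial sought; \<open>H\<close> has
  no zeros on \<Gamma> and can be cancelled.\<close>

lemma growth_dependency:
  fixes u :: "nat \<Rightarrow> 'i \<Rightarrow> complex"
  assumes "\<And>D. \<exists>T H. finite T \<and> card T \<le> K * (C * D + 1) ^ r \<and> (\<forall>x\<in>\<Gamma>. H x \<noteq> 0) \<and>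
     (\<forall>\<alpha>. (\<forall>i\<le>r. \<alpha> i < D) \<longrightarrow> (\<lambda>x. if x \<in> \<Gamma> then H x * (\<Prod>i\<le>r. u i x ^ \<alpha> i) else 0) \<in> fvec.span T)"
  shows "\<exists>G\<in>pfun {..r}. (\<exists>y. G y \<noteq> 0) \<and> (\<forall>x\<in>\<Gamma>. G (\<lambda>i. u i x) = 0)"
proof -
  \<comment> \<open>With this value K (C + 1)^r < D, hence K (C D + 1)^r \<le> K ((C + 1) D)^r <
    D^(r + 1).\<close>
  define D where "D = K * (C + 1) ^ r + 1"
  have D1: "D \<ge> 1" by (simp add: D_def)
  then have "C * D + 1 \<le> (C + 1) * D" by simp
  then have "K * (C * D + 1) ^ r \<le> K * ((C + 1) * D) ^ r" by (intro mult_left_mono power_mono) auto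
  also have "\<dots> = K * (C + 1) ^ r * D ^ r" by (simp only: power_mult_distrib mult.assoc)
  also have "\<dots> < D * D ^ r" using D1 by (intro mult_strict_right_mono) (auto simp: D_def)
  finally have bound: "K * (C * D + 1) ^ r < D ^ Suc r" by simp
  obtain T H where TH: "finite T" "card T \<le> K * (C * D + 1) ^ r" "\<forall>x\<in>\<Gamma>. H x \<noteq> 0"
     "\<And>\<alpha>. (\<forall>i\<le>r. \<alpha> i < D) \<Longrightarrow> (\<lambda>x. if x \<in> \<Gamma> then H x * (\<Prod>i\<le>r. u i x ^ \<alpha> i) else 0) \<in> fvec.span T"
    using assms[of D] by blast
  define E where "E = {..r} \<rightarrow>\<^sub>E {..<D}"
  have E: "finite E" "card E = D ^ Suc r" by (auto simp: E_def card_PiE finite_PiE)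
  obtain \<gamma> \<alpha> where \<gamma>: "\<alpha> \<in> E" "\<gamma> \<alpha> \<noteq> 0"
    "\<And>x. (\<Sum>\<alpha>\<in>E. \<gamma> \<alpha> * (if x \<in> \<Gamma> then H x * (\<Prod>i\<le>r. u i x ^ \<alpha> i) else 0)) = 0"
  proof -
    have "card T < card E" using TH(2) E(2) bound by simp
    moreover have "(\<lambda>x. if x \<in> \<Gamma> then H x * (\<Prod>i\<le>r. u i x ^ \<alpha> i) else 0) \<in> fvec.span T" if "\<alpha> \<in> E" for \<alpha>
      using TH(4)[of \<alpha>] that by (simp add: E_def PiE_iff)
    ultimately show thesis using span_dependency[OF E(1) TH(1),
      of "\<lambda>\<alpha> x. if x \<in> \<Gamma> then H x * (\<Prod>i\<le>r. u i x ^ \<alpha> i) else 0"] that by blast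
  qed
  define G where "G y = (\<Sum>\<alpha>\<in>E. \<gamma> \<alpha> * (\<Prod>i\<le>r. y i ^ \<alpha> i))" for y
  have "G \<in> pfun {..r}" unfolding G_def[abs_def]
    by (intro pfun_sum pfun.mult pfun_prod pfun_power pfun.const pfun.proj) auto
  moreover have "\<exists>y. G y \<noteq> 0"
  proof (rule ccontr)
    assume "\<not> ?thesis"
    then have z: "\<And>y. (\<Sum>\<alpha>\<in>E. \<gamma> \<alpha> * (\<Prod>v\<in>{..r}. y v ^ \<alpha> v)) = 0" by (simp add: G_def)
 have inj_E: "\<alpha> = \<beta>" if "\<alpha> \<in> E" "\<beta> \<in> E" "\<And>v. v \<in> {..r} \<Longrightarrow> \<alpha> v = \<beta> v" for \<alpha> \<beta>
      using that(1,2) unfolding E_def by (rule PiE_ext) (rule that(3))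
    have "\<gamma> \<alpha> = 0" by (rule monomials_independent[OF finite_atMost E(1) _ z \<gamma>(1)]) (rule inj_E)
    then show False using \<gamma>(2) by contradiction
  qed
  moreover have "G (\<lambda>i. u i x) = 0" if "x \<in> \<Gamma>" for x
  proof -
    have "H x * G (\<lambda>i. u i x) = 0" using \<gamma>(3)[of x] that by (simp add: G_def sum_distrib_left mult_ac)
    then show ?thesis using TH(3) that by simp
  qed
  ultimately show ?thesis by blast
qed

section \<open>The conormal variety is Lagrangian\<close>

definition has_gradient :: "nat \<Rightarrow> ((nat \<Rightarrow> complex) \<Rightarrow> complex) \<Rightarrow> (nat \<Rightarrow> (nat \<Rightarrow> complex) \<Rightarrow> complex) \<Rightarrow> bool" where
  "has_gradient n P P' \<longleftrightarrow> (\<forall>l. P' l \<in> pfun {..<n}) \<and>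
     (\<forall>c b. ((\<lambda>s. P (\<lambda>l. c l + s * b l)) has_field_derivative (\<Sum>l<n. P' l c * b l)) (at 0)) \<and>
     (\<forall>N h. (\<forall>l<n. h l \<in> laurent N) \<longrightarrow>
       (\<exists>q\<in>laurent N. \<forall>x\<in>nonzero_points. leval q x = P (\<lambda>l. leval (h l) x) \<and>
         (\<forall>\<eta>. log_deriv N x \<eta> q = (\<Sum>l<n. P' l (\<lambda>l. leval (h l) x) * log_deriv N x \<eta> (h l)))))"

lemma gradient_exists: "P \<in> pfun {..<n} \<Longrightarrow> \<exists>P'. has_gradient n P P'"
  unfolding has_gradient_def by (rule pfun_gradient)

lemma has_gradient_pfun: "has_gradient n P P' \<Longrightarrow> P' l \<in> pfun {..<n}"
  by (simp add: has_gradient_def)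

lemma has_gradient_deriv:
  "has_gradient n P P' \<Longrightarrow> ((\<lambda>s. P (\<lambda>l. c l + s * b l)) has_field_derivative (\<Sum>l<n. P' l c * b l)) (at 0)"
  by (simp add: has_gradient_def)

lemma has_gradient_subst:
  assumes "has_gradient n P P'" "\<And>l. h l \<in> laurent N"
  obtains q where "q \<in> laurent N" "\<And>x. x \<in> nonzero_points \<Longrightarrow> leval q x = P (\<lambda>l. leval (h l) x)"
    "\<And>x \<eta>. x \<in> nonzero_points \<Longrightarrow> log_deriv N x \<eta> q = (\<Sum>l<n. P' l (\<lambda>l. leval (h l) x) * log_deriv N x \<eta> (h l))"
proof -
  have "\<forall>l<n. h l \<in> laurent N" using assms(2) by simp
  then have "\<exists>q\<in>laurent N. \<forall>x\<in>nonzero_points. leval q x = P (\<lambda>l. leval (h l) x) \<and>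
         (\<forall>\<eta>. log_deriv N x \<eta> q = (\<Sum>l<n. P' l (\<lambda>l. leval (h l) x) * log_deriv N x \<eta> (h l)))"
    using assms(1)[unfolded has_gradient_def] by blast
  then show ?thesis using that by blast
qed

text \<open>The differential of \<open>f\<close> in the basis dx_l / x_l. For \<open>f\<close> in
  the vanishing ideal of \<open>V\<close> and \<open>x\<close> in \<open>V\<close> it is a conormal
  vector of \<open>V\<close> at \<open>x\<close>.\<close>

definition covector :: "laurent_poly \<Rightarrow> (nat \<Rightarrow> complex) \<Rightarrow> nat \<Rightarrow> complex" where
  "covector f x = (\<lambda>l. leval (euler l f) x)"

lemma log_deriv_covector: "log_deriv n x \<eta> f = (\<Sum>l<n. \<eta> l * covector f x l)"
  by (simp add: log_deriv_def covector_def)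

text \<open>Linearity in \<open>f\<close> at a fixed point: identities on conormal vectors can be
  differentiated along a line in the vanishing ideal.\<close>

lemma covector_line:
  assumes "x \<in> nonzero_points"
  shows "covector (f + single 0 s * g) x = (\<lambda>l. covector f x l + s * covector g x l)"
  using euler_single[of _ 0 s]
  by (auto simp: covector_def euler_add euler_mult leval_add leval_mult[OF assms] leval_single)

lemma vanishing_ideal_add:
  "f \<in> vanishing_ideal n X \<Longrightarrow> g \<in> vanishing_ideal n X \<Longrightarrow> f + g \<in> vanishing_ideal n X"
  by (auto simp: vanishing_ideal_def leval_add intro: laurent_add)

lemma vanishing_ideal_mult:
  "X \<subseteq> torus n \<Longrightarrow> f \<in> vanishing_ideal n X \<Longrightarrow> g \<in> laurent n \<Longrightarrow> g * f \<in> vanishing_ideal n X"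
  using torus_nonzero by (fastforce simp: vanishing_ideal_def leval_mult intro: laurent_mult)

lemma vanishing_ideal_zero [simp]: "0 \<in> vanishing_ideal n X"
  by (simp add: vanishing_ideal_def)

lemma vanishing_ideal_line:
  "X \<subseteq> torus n \<Longrightarrow> f \<in> vanishing_ideal n X \<Longrightarrow> g \<in> vanishing_ideal n X \<Longrightarrow> f + single 0 s * g \<in> vanishing_ideal n X"
  by (intro vanishing_ideal_add vanishing_ideal_mult) auto

text \<open>Let \<open>\<xi>\<close> be the gradient of \<open>P\<close> at the conormal vector \<open>c\<close> of \<open>V\<close> at \<open>x\<close>.  The claim says that
  all derivatives of \<open>g\<close> along the curve \<open>x exp(t \<xi>)\<close> vanish at \<open>t = 0\<close>.  The vector \<open>(\<xi>, 0)\<close> is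
  tangent to the conormal variety since it is orthogonal to it for the symplectic form; below this
  is the symmetry of \<open>euler i (euler l f)\<close> in \<open>i\<close> and \<open>l\<close>.\<close>

lemma gradient_flow:
  assumes V: "V \<subseteq> torus n" and P: "has_gradient n P P'"
    and van: "\<And>x f. x \<in> V \<Longrightarrow> f \<in> vanishing_ideal n V \<Longrightarrow> P (covector f x) = 0"
    and g: "g \<in> vanishing_ideal n V"
  shows "x \<in> V \<Longrightarrow> f \<in> vanishing_ideal n V \<Longrightarrow>
    (\<Sum>m\<in>keys g. lookup g m * monomial_at x m * ipair (\<lambda>l. P' l (covector f x)) m ^ N) = 0"
proof (induction N arbitrary: x f)
  case 0
  then show ?case using vanishing_idealD[OF g] by (simp add: leval_eq)
next
  case (Suc N)
  let ?I = "vanishing_ideal n V"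
  have x: "x \<in> nonzero_points" using Suc.prems V torus_nonzero by blast
  \<comment> \<open>\<open>Q m\<close> is the \<open>N\<close>-th power of the weight of
    \<open>m\<close> under the gradient, as a polynomial in the covector; \<open>q m\<close> below
    is its pullback by y \<mapsto> \<open>covector f y\<close>.\<close>
  define Q where "Q m c = ipair (\<lambda>l. P' l c) m ^ N" for m c
  have "\<exists>Q'. has_gradient n (Q m) Q'" for m
    unfolding Q_def[abs_def] ipair_def
    by (intro gradient_exists pfun_power pfun_sum pfun.mult pfun.const has_gradient_pfun[OF P])
  then obtain Q' where Q': "\<And>m. has_gradient n (Q m) (Q' m)" by metis
  have h: "euler l f \<in> laurent n" for l using Suc.prems laurent_euler vanishing_ideal_laurent by blast
  define R where "R m q \<longleftrightarrow> q \<in> laurent n \<and> (\<forall>y\<in>nonzero_points. leval q y = Q m (covector f y) \<and>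
      (\<forall>\<eta>. log_deriv n y \<eta> q = (\<Sum>l<n. Q' m l (covector f y) * log_deriv n y \<eta> (euler l f))))" for m q
  have "\<exists>q. R m q" for m
    by (rule has_gradient_subst[OF Q'[of m], where h="\<lambda>l. euler l f", OF h]) (auto simp: R_def covector_def)
  then obtain q where "\<And>m. R m (q m)" by metis
  then have q: "q m \<in> laurent n" "y \<in> nonzero_points \<Longrightarrow> leval (q m) y = Q m (covector f y)"
    "y \<in> nonzero_points \<Longrightarrow> log_deriv n y \<eta> (q m) = (\<Sum>l<n. Q' m l (covector f y) * log_deriv n y \<eta> (euler l f))"
    for m y \<eta> by (simp_all add: R_def)
  have gk: "keys m \<subseteq> {..<n}" if "m \<in> keys g" for m using laurent_keys[OF vanishing_ideal_laurent[OF g] that] .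
  \<comment> \<open>The induction hypothesis at all points of \<open>V\<close>, with
    \<open>f\<close> fixed, says that \<open>tot\<close> lies in the vanishing ideal. Its derivative
    along \<xi> will produce the sum for \<open>Suc N\<close>.\<close>
  define tot where "tot = (\<Sum>m\<in>keys g. q m * single m (lookup g m))"
  have "leval tot y = 0" if "y \<in> V" for y
  proof -
    have y: "y \<in> nonzero_points" using that V torus_nonzero by blast
    show ?thesis using Suc.IH[OF that Suc.prems(2)]
      by (simp add: tot_def leval_sum leval_mult[OF y] leval_single q(2)[OF y] Q_def mult_ac)
  qed
  then have tot: "tot \<in> ?I"
    unfolding vanishing_ideal_def tot_def by (auto intro!: laurent_sum laurent_mult q laurent_single gk)
  define \<xi> where "\<xi> = (\<lambda>l. P' l (covector f x))"
  \<comment> \<open>Replacing \<open>f\<close> by \<open>f + s g'\<close> in the hypothesis on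
    \<open>P\<close> and differentiating at s = 0 shows that \<xi> is tangent to
    \<open>V\<close>.\<close>
  have tang_xi: "log_deriv n x \<xi> g' = 0" if g': "g' \<in> ?I" for g'
  proof -
    have "(\<lambda>s. P (\<lambda>l. covector f x l + s * covector g' x l)) = (\<lambda>s. 0)"
      using van[OF Suc.prems(1) vanishing_ideal_line[OF V Suc.prems(2) g']] by (simp add: covector_line[OF x])
    then have "((\<lambda>s. 0) has_field_derivative (\<Sum>l<n. P' l (covector f x) * covector g' x l)) (at (0::complex))"
      using has_gradient_deriv[OF P, of "covector f x" "covector g' x"] by simp
    then have "(\<Sum>l<n. P' l (covector f x) * covector g' x l) = 0"
      using DERIV_unique DERIV_const by blast
    then show ?thesis by (simp add: log_deriv_covector \<xi>_def)
  qed
  \<comment> \<open>The same variation of \<open>f\<close> in the induction hypothesis shows that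
    this combination of the gradients of the \<open>Q m\<close> is tangent as well.\<close>
  define \<eta> where "\<eta> l = (\<Sum>m\<in>keys g. lookup g m * monomial_at x m * Q' m l (covector f x))" for l
  have tang_eta: "log_deriv n x \<eta> g' = 0" if g': "g' \<in> ?I" for g'
  proof -
    let ?S = "\<lambda>s. \<Sum>m\<in>keys g. lookup g m * monomial_at x m * Q m (\<lambda>l. covector f x l + s * covector g' x l)"
    have S0: "?S = (\<lambda>s. 0)"
      using Suc.IH[OF Suc.prems(1) vanishing_ideal_line[OF V Suc.prems(2) g']] by (simp add: covector_line[OF x] Q_def)
    have S1: "(?S has_field_derivative (\<Sum>m\<in>keys g. lookup g m * monomial_at x m * (\<Sum>l<n. Q' m l (covector f x) * covector g' x l))) (at 0)"
      by (intro DERIV_sum DERIV_cmult has_gradient_deriv Q')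
    have "(\<Sum>m\<in>keys g. lookup g m * monomial_at x m * (\<Sum>l<n. Q' m l (covector f x) * covector g' x l)) = 0"
      using DERIV_unique[OF S1[unfolded S0] DERIV_const] .
    also have "(\<Sum>m\<in>keys g. lookup g m * monomial_at x m * (\<Sum>l<n. Q' m l (covector f x) * covector g' x l)) = log_deriv n x \<eta> g'"
      unfolding log_deriv_covector \<eta>_def sum_distrib_left sum_distrib_right
      by (subst sum.swap) (simp add: mult_ac)
    finally show ?thesis .
  qed
  obtain p where p: "p \<in> laurent n" "\<And>y. y \<in> nonzero_points \<Longrightarrow> leval p y = P (covector f y)"
    "\<And>y \<eta>. y \<in> nonzero_points \<Longrightarrow> log_deriv n y \<eta> p = (\<Sum>l<n. P' l (covector f y) * log_deriv n y \<eta> (euler l f))"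
    by (rule has_gradient_subst[OF P, where h="\<lambda>l. euler l f", OF h], rule that) (simp_all add: covector_def)
  \<comment> \<open>\<open>p\<close> is y \<mapsto> \<open>P (covector f y)\<close>. Its derivative
    along \<eta> pairs \<xi> with \<eta> through the second derivatives of \<open>f\<close>; by
    their symmetry, the extra term in the derivative of \<open>tot\<close> along \<xi> is
    zero.\<close>
  have "p \<in> ?I" using p V torus_nonzero van[OF _ Suc.prems(2)] by (auto simp: vanishing_ideal_def subset_iff)
  then have lp: "log_deriv n x \<eta> p = 0" by (rule tang_eta)
  have 0: "(\<Sum>i<n. \<xi> i * (\<Sum>l<n. \<eta> l * leval (euler l (euler i f)) x)) = 0"
    using lp unfolding p(3)[OF x] by (simp add: \<xi>_def log_deriv_def)
  have "(\<Sum>l<n. \<eta> l * log_deriv n x \<xi> (euler l f)) = (\<Sum>l<n. \<Sum>i<n. \<xi> i * (\<eta> l * leval (euler l (euler i f)) x))"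
    by (simp add: log_deriv_def sum_distrib_left mult_ac euler_commute[of _ "_::nat" f])
  also have "\<dots> = 0" using 0 by (subst sum.swap) (simp add: sum_distrib_left)
  finally have first: "(\<Sum>l<n. \<eta> l * log_deriv n x \<xi> (euler l f)) = 0" .
  have "0 = log_deriv n x \<xi> tot" using tang_xi[OF tot] by simp
  also have "\<dots> = (\<Sum>m\<in>keys g. (\<Sum>l<n. Q' m l (covector f x) * log_deriv n x \<xi> (euler l f)) * (lookup g m * monomial_at x m)
      + Q m (covector f x) * (lookup g m * ipair \<xi> m * monomial_at x m))"
    unfolding tot_def log_deriv_sum
    by (intro sum.cong refl) (simp add: log_deriv_mult[OF x] q(2,3)[OF x] leval_single log_deriv_single gk)
  also have "\<dots> = (\<Sum>l<n. \<eta> l * log_deriv n x \<xi> (euler l f))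
      + (\<Sum>m\<in>keys g. Q m (covector f x) * (lookup g m * ipair \<xi> m * monomial_at x m))"
    unfolding sum.distrib \<eta>_def sum_distrib_left sum_distrib_right
    by (subst sum.swap) (simp add: mult_ac)
  also have "\<dots> = (\<Sum>m\<in>keys g. lookup g m * monomial_at x m * ipair \<xi> m ^ Suc N)"
    unfolding first by (simp add: Q_def \<xi>_def mult_ac)
  finally show ?case by (simp add: \<xi>_def)
qed


section \<open>The stabilizer of a variety\<close>

definition one_param :: "(nat \<Rightarrow> int) \<Rightarrow> complex \<Rightarrow> nat \<Rightarrow> complex" where
  "one_param v t = (\<lambda>i. t powi v i)"

definition stab_lattice :: "nat \<Rightarrow> (nat \<Rightarrow> complex) set \<Rightarrow> (nat \<Rightarrow> int) set" where
  "stab_lattice n V = {v \<in> coord_space n. \<forall>x\<in>V. \<forall>t. t \<noteq> 0 \<longrightarrow> x * one_param v t \<in> V}"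

lemma one_param_torus: "v \<in> coord_space n \<Longrightarrow> t \<noteq> 0 \<Longrightarrow> one_param v t \<in> torus n"
  by (auto simp: one_param_def torus_def coord_space_def)

lemma torus_mult: "x \<in> torus n \<Longrightarrow> y \<in> torus n \<Longrightarrow> x * y \<in> torus n"
  by (auto simp: torus_def)

lemma monomial_at_one_param: "t \<noteq> 0 \<Longrightarrow> monomial_at (one_param v t) m = t powi ipair v m"
proof -
  assume t: "t \<noteq> 0"
  have "(\<Prod>i\<in>S. (t powi v i) powi lookup m i) = t powi (\<Sum>i\<in>S. v i * lookup m i)" if "finite S" for S
    using that by (induction S rule: finite_induct) (auto simp: power_int_add t power_int_mult)
  then show ?thesis by (simp add: monomial_at_def one_param_def ipair_def)
qed

text \<open>Coordinates with respect to a Hamel basis of \<open>\<complex>\<close> over \<open>\<rat>\<close>.\<close>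

lemma rational_coordinates:
  fixes \<xi> :: "nat \<Rightarrow> complex"
  shows "\<exists>B \<rho>. finite B \<and> (\<forall>l<n. \<xi> l = (\<Sum>b\<in>B. of_rat (\<rho> l b) * b)) \<and>
    (\<forall>b\<in>B. \<forall>m. (\<Sum>l<n. \<xi> l * of_int (m l)) = 0 \<longrightarrow> (\<Sum>l<n. \<rho> l b * of_int (m l)) = 0)"
proof -
  interpret qv: vector_space "\<lambda>q z. of_rat q * z :: complex"
    by standard (auto simp: algebra_simps of_rat_add of_rat_mult)
  obtain H where H: "qv.independent H" "UNIV \<subseteq> qv.span H"
    by (rule qv.maximal_independent_subset[of UNIV])
  let ?r = "qv.representation H"
  define B where "B = (\<Union>l<n. {b. ?r (\<xi> l) b \<noteq> 0})"
  have fin: "finite B" by (auto simp: B_def qv.finite_representation)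
  have "\<xi> l = (\<Sum>b\<in>B. of_rat (?r (\<xi> l) b) * b)" if "l < n" for l
  proof -
    have "(\<Sum>b | ?r (\<xi> l) b \<noteq> 0. of_rat (?r (\<xi> l) b) * b) = \<xi> l"
      by (rule qv.sum_nonzero_representation_eq[OF H(1)]) (use H(2) in blast)
    moreover have "(\<Sum>b | ?r (\<xi> l) b \<noteq> 0. of_rat (?r (\<xi> l) b) * b) = (\<Sum>b\<in>B. of_rat (?r (\<xi> l) b) * b)"
      by (rule sum.mono_neutral_left[OF fin]) (use that in \<open>auto simp: B_def\<close>)
    ultimately show ?thesis by simp
  qed
  moreover have "(\<Sum>l<n. ?r (\<xi> l) b * of_int (m l)) = 0" if "(\<Sum>l<n. \<xi> l * of_int (m l)) = 0" for b m
  proof -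
    have sp: "z \<in> qv.span H" for z using H(2) by auto
    have "(\<Sum>l<n. ?r (\<xi> l) b * of_int (m l)) = (\<Sum>l<n. ?r (of_rat (of_int (m l)) * \<xi> l) b)"
      by (intro sum.cong refl) (subst qv.representation_scale[OF H(1) sp], simp add: mult.commute)
    also have "\<dots> = ?r (\<Sum>l<n. of_rat (of_int (m l)) * \<xi> l) b"
      by (subst qv.representation_sum[OF H(1)]) (auto intro: sp)
    also have "(\<Sum>l<n. of_rat (of_int (m l)) * \<xi> l) = 0" using that by (simp add: mult.commute)
    finally show ?thesis by (simp add: qv.representation_zero)
  qed
  ultimately show ?thesis using fin by - (rule exI[of _ B], rule exI[of _ "\<lambda>l. ?r (\<xi> l)"], blast)
qed

lemma common_denominator:
  fixes \<rho> :: "nat \<Rightarrow> rat"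
  shows "\<exists>(d::int) v. d > 0 \<and> (\<forall>l<n. of_int (v l) = of_int d * \<rho> l)"
proof (induction n)
  case (Suc n)
  then obtain d v where d: "d > 0" "\<forall>l<n. of_int (v l) = of_int d * \<rho> l" by blast
  obtain a b where ab: "\<rho> n = of_int a / of_int b" "b > 0" by (metis Fract_of_int_quotient Rat_cases)
  have "\<forall>l<Suc n. of_int (if l = n then a * d else b * v l) = of_int (d * b) * \<rho> l"
    using d ab by (auto simp: less_Suc_eq)
  then show ?case using d ab by (intro exI[of _ "d * b"] exI[of _ "\<lambda>l. if l = n then a * d else b * v l"]) auto
qed (auto intro: exI[of _ 1])

text \<open>At a general point the gradient \<xi> is a combination of rational vectors, one for each
  basis element of \<complex> over \<rat>. Cleared of denominators, they are integer vectors
  satisfying all integral relations satisfied by \<xi>. In an equation of \<open>V\<close> the terms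
  of equal weight under \<xi> sum to zero by \<open>gradient_flow\<close>, and these vectors are
  constant on such groups of terms. So they lie in \<open>stab_lattice\<close>, and \<open>w\<close>
  annihilates them and thus \<xi>.\<close>

lemma gradient_in_stab:
  assumes V: "variety n V" and P: "has_gradient n P P'"
    and van: "\<And>x f. x \<in> V \<Longrightarrow> f \<in> vanishing_ideal n V \<Longrightarrow> P (covector f x) = 0"
    and w: "\<And>v. v \<in> stab_lattice n V \<Longrightarrow> (\<Sum>l<n. w l * of_int (v l)) = 0"
    and f: "f \<in> vanishing_ideal n V" and x0: "x0 \<in> V"
  shows "(\<Sum>l<n. w l * P' l (covector f x0)) = 0"
proof (rule ccontr)
  assume nz: "(\<Sum>l<n. w l * P' l (covector f x0)) \<noteq> 0"
  let ?\<xi> = "\<lambda>y l. P' l (covector f y)"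
  have Vt: "V \<subseteq> torus n" by (rule variety_torus[OF V])
  have Vnz: "y \<in> nonzero_points" if "y \<in> V" for y using that Vt torus_nonzero by blast
  have hl: "euler l f \<in> laurent n" for l using f laurent_euler vanishing_ideal_laurent by blast
  obtain F where F: "finite F" "F \<subseteq> vanishing_ideal n V" "V = zero_locus n F"
    using closed_finite_equations[OF variety_closed[OF V]] by blast
  \<comment> \<open>Only differences of exponents within finitely many equations of \<open>V\<close>
    have to be compared, so a general point has to satisfy only finitely many conditions.\<close>
  define E where "E = (\<Union>g\<in>F. (\<lambda>(m, m'). m - m') ` (keys g \<times> keys g))"
  have E: "finite E" using F(1) by (auto simp: E_def)
  have Ek: "keys m \<subseteq> {..<n}" if m: "m \<in> E" for m
  proof -
    obtain g a b where g: "g \<in> F" "a \<in> keys g" "b \<in> keys g" "m = a - b" using m by (auto simp: E_def)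
    then have "g \<in> laurent n" using F(2) vanishing_ideal_laurent by blast
    then have "keys a \<subseteq> {..<n}" "keys b \<subseteq> {..<n}" using g laurent_keys by auto
    then show ?thesis using keys_diff[of a b] g by blast
  qed
  have "\<exists>q\<in>laurent n. \<forall>y\<in>nonzero_points. leval q y = ipair (?\<xi> y) m" for m
  proof -
    have "(\<lambda>c. ipair (\<lambda>l. P' l c) m) \<in> pfun {..<n}"
      unfolding ipair_def by (intro pfun_sum pfun.mult pfun.const has_gradient_pfun[OF P])
    from pfun_laurent[OF this, of "\<lambda>l. euler l f" n] hl show ?thesis by (simp add: covector_def)
  qed
  then obtain e where e: "\<And>m. e m \<in> laurent n" "\<And>m y. y \<in> nonzero_points \<Longrightarrow> leval (e m) y = ipair (?\<xi> y) m" by metis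
  obtain h where h: "h \<in> laurent n" "\<And>y. y \<in> nonzero_points \<Longrightarrow> leval h y = (\<Sum>l<n. w l * ?\<xi> y l)"
  proof -
    have "(\<lambda>c. \<Sum>l<n. w l * P' l c) \<in> pfun {..<n}"
      by (intro pfun_sum pfun.mult pfun.const has_gradient_pfun[OF P])
    from pfun_laurent[OF this, of "\<lambda>l. euler l f" n] hl show ?thesis by (auto simp: covector_def intro: that)
  qed
  \<comment> \<open>The differences whose weight under the gradient is zero at every point of
    \<open>V\<close>; the others have nonzero weight at general points.\<close>
  define M0 where "M0 = {m\<in>E. \<forall>y\<in>V. leval (e m) y = 0}"
  define E1 where "E1 = E - M0"
  have E1: "finite E1" "\<And>m. m \<in> E1 \<Longrightarrow> \<exists>y\<in>V. leval (e m) y \<noteq> 0" using E by (auto simp: E1_def M0_def)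
  have "\<exists>y\<in>V. \<forall>s\<in>insert h (e ` E1). leval s y \<noteq> 0"
    by (rule variety_prod_nonvanishing[OF V, of _ "\<lambda>s. s"]) (use E1 h e x0 nz Vnz in auto)
  then obtain x where x: "x \<in> V" "leval h x \<noteq> 0" "\<And>m. m \<in> E1 \<Longrightarrow> leval (e m) x \<noteq> 0" by auto
  obtain B \<rho> where B: "finite B" "\<And>l. l < n \<Longrightarrow> ?\<xi> x l = (\<Sum>b\<in>B. of_rat (\<rho> l b) * b)"
    "\<And>b m. b \<in> B \<Longrightarrow> (\<Sum>l<n. ?\<xi> x l * of_int (m l)) = 0 \<Longrightarrow> (\<Sum>l<n. \<rho> l b * of_int (m l)) = 0"
    using rational_coordinates[of n "?\<xi> x"] by blast
  have wb: "(\<Sum>l<n. w l * of_rat (\<rho> l b)) = 0" if b: "b \<in> B" for b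
  proof -
    obtain d v' where d: "d > (0::int)" "\<And>l. l < n \<Longrightarrow> of_int (v' l) = of_int d * \<rho> l b"
      using common_denominator[of n "\<lambda>l. \<rho> l b"] by blast
    define v where "v l = (if l < n then v' l else 0)" for l
    have vM: "ipair v m = 0" if m: "m \<in> M0" for m
    proof -
      have mk: "keys m \<subseteq> {..<n}" using m Ek by (auto simp: M0_def)
      have "ipair (?\<xi> x) m = 0" using m x(1) e(2)[OF Vnz[OF x(1)]] by (auto simp: M0_def)
      then have "(\<Sum>l<n. \<rho> l b * of_int (lookup m l)) = 0"
        using B(3)[OF b, of "lookup m"] by (simp add: ipair_superset[OF _ mk])
      moreover have "of_int (ipair v m) = of_int d * (\<Sum>l<n. \<rho> l b * of_int (lookup m l))"
        by (simp add: ipair_superset[OF _ mk] v_def d(2) sum_distrib_left mult.assoc)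
      ultimately have "(of_int (ipair v m) :: rat) = 0" by simp
      then show ?thesis by simp
    qed
    have "v \<in> stab_lattice n V"
    proof -
      have vc: "v \<in> coord_space n" by (simp add: v_def coord_space_def)
      have van_t: "leval g (y * one_param v t) = 0" if g: "g \<in> F" and y: "y \<in> V" and t: "t \<noteq> 0" for g y t
      proof (rule ccontr)
        assume "leval g (y * one_param v t) \<noteq> 0"
        \<comment> \<open>A failure at \<open>y\<close> persists at a general point
          \<open>z\<close>, where two terms of \<open>g\<close> have equal weight only if their
          difference lies in \<open>M0\<close>.\<close>
        then have "\<exists>z\<in>V. \<forall>s\<in>insert (rescale (one_param v t) g) (e ` E1). leval s z \<noteq> 0"
          by (intro variety_prod_nonvanishing[OF V, of _ "\<lambda>s. s"])
             (use E1 e y g F(2) vanishing_ideal_laurent in \<open>auto simp: leval_rescale intro!: laurent_rescale\<close>)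
        then obtain z where z: "z \<in> V" "leval (rescale (one_param v t) g) z \<noteq> 0" "\<And>m. m \<in> E1 \<Longrightarrow> leval (e m) z \<noteq> 0" by auto
        let ?\<mu> = "\<lambda>m. ipair (?\<xi> z) m"
        have g': "g \<in> vanishing_ideal n V" using g F by blast
        have grp: "(\<Sum>m\<in>{m\<in>keys g. ?\<mu> m = \<mu>}. lookup g m * monomial_at z m) = 0" for \<mu>
          by (rule power_sums_separate) (use gradient_flow[OF Vt P van g' z(1) f] in auto)
        have "leval (rescale (one_param v t) g) z = (\<Sum>m\<in>keys g. lookup g m * monomial_at z m * t powi ipair v m)"
          unfolding leval_rescale leval_eq[of g] by (simp add: monomial_at_mult monomial_at_one_param[OF t] mult.assoc)
        also have "\<dots> = (\<Sum>\<mu>\<in>?\<mu> ` keys g. \<Sum>m\<in>{m\<in>keys g. ?\<mu> m = \<mu>}. lookup g m * monomial_at z m * t powi ipair v m)"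
          by (rule sum.image_gen) simp
        also have "\<dots> = 0"
        proof (rule sum.neutral, rule ballI)
          fix \<mu> assume "\<mu> \<in> ?\<mu> ` keys g"
          then obtain m0 where m0: "m0 \<in> keys g" "\<mu> = ?\<mu> m0" by blast
          have "ipair v m = ipair v m0" if m: "m \<in> keys g" "?\<mu> m = \<mu>" for m
          proof -
            have mE: "m - m0 \<in> E" using m m0 g by (auto simp: E_def)
            have "leval (e (m - m0)) z = 0" using m m0 e(2)[OF Vnz[OF z(1)]] by (simp add: ipair_diff)
            then have "m - m0 \<in> M0" using z(3) mE by (auto simp: E1_def)
            then show ?thesis using vM[of "m - m0"] by (simp add: ipair_diff)
          qed
          then have "(\<Sum>m\<in>{m\<in>keys g. ?\<mu> m = \<mu>}. lookup g m * monomial_at z m * t powi ipair v m) =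
            (\<Sum>m\<in>{m\<in>keys g. ?\<mu> m = \<mu>}. lookup g m * monomial_at z m) * t powi ipair v m0"
            unfolding sum_distrib_right by (intro sum.cong) auto
          then show "(\<Sum>m\<in>{m\<in>keys g. ?\<mu> m = \<mu>}. lookup g m * monomial_at z m * t powi ipair v m) = 0"
            by (simp add: grp)
        qed
        finally show False using z by simp
      qed
      then have "y * one_param v t \<in> V" if "y \<in> V" "t \<noteq> 0" for y t
      proof -
        have "y * one_param v t \<in> torus n" using that Vt one_param_torus[OF vc] torus_mult by blast
        then have "y * one_param v t \<in> zero_locus n F" using that van_t
          by (simp add: zero_locus_def)
        then show ?thesis using F(3) by simp
      qed
      then show ?thesis using vc by (simp add: stab_lattice_def)
    qed
    from w[OF this] have "(\<Sum>l<n. w l * of_int (v l)) = 0" .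
    moreover have "of_int (v l) = (of_int d * of_rat (\<rho> l b) :: complex)" if "l < n" for l
    proof -
      have "(of_int (v l) :: complex) = of_rat (of_int (v' l))" using that by (simp add: v_def)
      also have "\<dots> = of_rat (of_int d * \<rho> l b)" by (simp only: d(2)[OF that])
      finally show ?thesis by (simp add: of_rat_mult)
    qed
    ultimately have "of_int d * (\<Sum>l<n. w l * of_rat (\<rho> l b)) = 0"
      by (simp add: sum_distrib_left mult_ac)
    then show ?thesis using d(1) by simp
  qed
  have "(\<Sum>l<n. w l * ?\<xi> x l) = (\<Sum>l<n. \<Sum>b\<in>B. b * (w l * of_rat (\<rho> l b)))"
    by (intro sum.cong refl) (simp add: B(2) sum_distrib_left mult_ac)
  also have "\<dots> = (\<Sum>b\<in>B. b * (\<Sum>l<n. w l * of_rat (\<rho> l b)))"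
    by (subst sum.swap) (simp add: sum_distrib_left)
  also have "\<dots> = 0" by (simp add: wb)
  finally show False using x(2) h(2)[OF Vnz[OF x(1)]] by simp
qed

text \<open>By \<open>gradient_in_stab\<close> the derivative of \<open>P\<close> in the direction
  \<open>w\<close> again vanishes on all covectors. On the line through 0 and \<open>w\<close> it is
  \<open>pderiv q\<close>, so induction on the degree makes \<open>q\<close> constant; the covector
  of the zero function gives q(0) = 0.\<close>

lemma covectors_dense:
  assumes V: "variety n V" and P: "P \<in> pfun {..<n}"
    and van: "\<And>x f. x \<in> V \<Longrightarrow> f \<in> vanishing_ideal n V \<Longrightarrow> P (covector f x) = 0"
    and w: "\<And>v. v \<in> stab_lattice n V \<Longrightarrow> (\<Sum>l<n. w l * of_int (v l)) = 0"
  shows "P w = 0"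
proof -
  have "q = 0" if "P \<in> pfun {..<n}" "\<And>x f. x \<in> V \<Longrightarrow> f \<in> vanishing_ideal n V \<Longrightarrow> P (covector f x) = 0"
     "\<And>t. P (\<lambda>l. t * w l) = poly q t" for P q
    using that
  proof (induction "degree q" arbitrary: q P rule: less_induct)
    case less
    obtain P' where P': "has_gradient n P P'" using gradient_exists less.prems(1) by blast
    define DP where "DP c = (\<Sum>l<n. w l * P' l c)" for c
    have DP: "DP \<in> pfun {..<n}" unfolding DP_def[abs_def]
      by (intro pfun_sum pfun.mult pfun.const has_gradient_pfun[OF P'])
    have DPv: "DP (covector f x) = 0" if "x \<in> V" "f \<in> vanishing_ideal n V" for x f
      unfolding DP_def by (rule gradient_in_stab[OF V P' less.prems(2) w that(2,1)])
    have DPt: "DP (\<lambda>l. t * w l) = poly (pderiv q) t" for t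
    proof -
      have "((\<lambda>s. P (\<lambda>l. t * w l + s * w l)) has_field_derivative DP (\<lambda>l. t * w l)) (at 0)"
        using has_gradient_deriv[OF P', of "\<lambda>l. t * w l" w] by (simp add: DP_def mult.commute)
      moreover have "(\<lambda>s. P (\<lambda>l. t * w l + s * w l)) = (\<lambda>s. poly q (t + s))"
        by (simp add: distrib_right[symmetric] less.prems(3))
      moreover have "((\<lambda>s. poly q (t + s)) has_field_derivative poly (pderiv q) (t + 0) * 1) (at 0)"
        by (rule DERIV_chain2[OF poly_DERIV]) (auto intro!: derivative_eq_intros)
      ultimately show ?thesis using DERIV_unique by fastforce
    qed
    obtain x where x: "x \<in> V" using variety_nonempty[OF V] by blast
    have "poly q 0 = 0" using less.prems(2)[OF x, of 0] less.prems(3)[of 0] by (simp add: covector_def)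
    moreover have "degree q = 0"
    proof (rule ccontr)
      assume d: "degree q \<noteq> 0"
      then have "pderiv q = 0"
        by (intro less.hyps[OF _ DP DPv DPt]) (simp_all add: degree_pderiv)
      then show False using d by (simp add: pderiv_eq_0_iff)
    qed
    ultimately show "q = 0" by (metis degree_eq_zeroE poly_pCons mult_zero_left add.right_neutral pCons_0_0)
  qed
  moreover obtain q where q: "\<And>t. P (\<lambda>l. 0 + t * w l) = poly q t" using pfun_line[OF P, of "\<lambda>_. 0" w] by blast
  ultimately have "q = 0" using P van by simp
  then show ?thesis using q[of 1] by simp
qed

section \<open>Triangular form of a variety\<close>

definition psum :: "(nat \<Rightarrow> laurent_poly) \<Rightarrow> nat \<Rightarrow> nat \<Rightarrow> laurent_poly" where
  "psum a N j = (\<Sum>e\<le>N. a e * lvar j (int e))"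

definition vanishes :: "(nat \<Rightarrow> complex) set \<Rightarrow> laurent_poly \<Rightarrow> bool" where
  "vanishes V f \<longleftrightarrow> (\<forall>x\<in>V. leval f x = 0)"

text \<open>The coordinate \<open>x\<^sub>j\<close> is transcendental over the preceding ones on \<open>V\<close>.\<close>

definition transc :: "(nat \<Rightarrow> complex) set \<Rightarrow> nat \<Rightarrow> bool" where
  "transc V j \<longleftrightarrow> (\<forall>N a. (\<forall>e. a e \<in> laurent j) \<longrightarrow> vanishes V (psum a N j) \<longrightarrow> (\<forall>e\<le>N. vanishes V (a e)))"

text \<open>A relation for \<open>x\<^sub>j\<close> of minimal degree over the preceding coordinates; its constant term is made
  nonzero by dividing by a power of \<open>x\<^sub>j\<close>.\<close>

definition min_rel :: "(nat \<Rightarrow> complex) set \<Rightarrow> nat \<Rightarrow> nat \<Rightarrow> (nat \<Rightarrow> laurent_poly) \<Rightarrow> bool" where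
  "min_rel V j N a \<longleftrightarrow> N \<ge> 1 \<and> (\<forall>e. a e \<in> laurent j) \<and> vanishes V (psum a N j) \<and>
     \<not> vanishes V (a N) \<and> \<not> vanishes V (a 0) \<and>
     (\<forall>M b. M < N \<longrightarrow> (\<forall>e. b e \<in> laurent j) \<longrightarrow> vanishes V (psum b M j) \<longrightarrow> (\<forall>e\<le>M. vanishes V (b e)))"

lemma psum_laurent: "(\<And>e. a e \<in> laurent j) \<Longrightarrow> psum a N j \<in> laurent (Suc j)"
  unfolding psum_def
  by (intro laurent_sum laurent_mult lvar_laurent) (auto intro: laurent_mono[OF _ le_SucI[OF order_refl]])

lemma min_relD:
  "min_rel V j N a \<Longrightarrow> M < N \<Longrightarrow> (\<And>e. b e \<in> laurent j) \<Longrightarrow> vanishes V (psum b M j) \<Longrightarrow> e \<le> M \<Longrightarrow> vanishes V (b e)"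
  by (simp add: min_rel_def)

lemma leval_psum:
  "x \<in> nonzero_points \<Longrightarrow> leval (psum a N j) x = (\<Sum>e\<le>N. leval (a e) x * x j ^ e)"
  by (simp add: psum_def leval_sum leval_mult leval_lvar)

text \<open>Minimality of the degree forces both end coefficients to be nonzero on \<open>V\<close>:
  otherwise the relation could be shortened at the top, or divided by \<open>x_j\<close> at the
  bottom.\<close>

lemma min_rel_exists:
  assumes V: "V \<subseteq> nonzero_points" and nt: "\<not> transc V j"
  shows "\<exists>N a. min_rel V j N a"
proof -
  define R where "R N \<longleftrightarrow> (\<exists>a. (\<forall>e. a e \<in> laurent j) \<and> vanishes V (psum a N j) \<and> (\<exists>e\<le>N. \<not> vanishes V (a e)))" for N
  define N where "N = (LEAST N. R N)"
  have "\<exists>N. R N" using nt by (auto simp: R_def transc_def)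
  then have "R N" unfolding N_def by (rule LeastI_ex)
  then obtain a e0 where a: "\<And>e. a e \<in> laurent j" "vanishes V (psum a N j)" "e0 \<le> N" "\<not> vanishes V (a e0)"
    by (auto simp: R_def)
  have mini: "vanishes V (b e)" if "M < N" "\<And>e. b e \<in> laurent j" "vanishes V (psum b M j)" "e \<le> M" for M b e
  proof -
    have "\<not> R M" using not_less_Least[of M R] that(1) unfolding N_def by blast
    then show ?thesis using that(2-) unfolding R_def by blast
  qed
  have top: "\<not> vanishes V (a N)"
  proof
    assume v: "vanishes V (a N)"
    show False
    proof (cases N)
      case 0
      then show False using v a by simp
    next
      case (Suc M)
      have "vanishes V (psum a M j)"
        using a(2) v V unfolding vanishes_def by (auto simp: leval_psum subset_iff Suc)
      then have "vanishes V (a e)" if "e \<le> N" for e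
        using mini[of M a e] a(1) v that Suc by (cases "e = N") auto
      then show False using a by blast
    qed
  qed
  have N1: "N \<ge> 1"
  proof (rule ccontr)
    assume "\<not> ?thesis"
    then have "N = 0" by simp
    then show False using a(2) top by (simp add: psum_def)
  qed
  have bot: "\<not> vanishes V (a 0)"
  proof
    assume v: "vanishes V (a 0)"
    obtain M where M: "N = Suc M" using N1 by (cases N) auto
    have "vanishes V (psum (\<lambda>e. a (Suc e)) M j)" unfolding vanishes_def
    proof
      fix x assume x: "x \<in> V"
      then have xn: "x \<in> nonzero_points" using V by blast
      have "leval (psum a (Suc M) j) x = 0" using a(2) x by (simp add: vanishes_def M)
      then have "(\<Sum>e\<le>Suc M. leval (a e) x * x j ^ e) = 0" unfolding leval_psum[OF xn] .
      then have "x j * (\<Sum>e\<le>M. leval (a (Suc e)) x * x j ^ e) = 0"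
        using v x unfolding sum.atMost_Suc_shift by (simp add: vanishes_def sum_distrib_left mult_ac)
      then show "leval (psum (\<lambda>e. a (Suc e)) M j) x = 0"
        using nonzero_pointsD[OF xn] by (simp add: leval_psum[OF xn])
    qed
    then have "vanishes V (a (Suc M))" using mini[of M "\<lambda>e. a (Suc e)" M] a(1) M by auto
    then show False using top M by simp
  qed
  show ?thesis unfolding min_rel_def using N1 a(1,2) top bot mini by blast
qed

definition tdeg :: "(nat \<Rightarrow> complex) set \<Rightarrow> nat \<Rightarrow> nat" where
  "tdeg V j = (SOME N. \<exists>a. min_rel V j N a)"
definition tcoef :: "(nat \<Rightarrow> complex) set \<Rightarrow> nat \<Rightarrow> nat \<Rightarrow> laurent_poly" where
  "tcoef V j = (SOME a. min_rel V j (tdeg V j) a)"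
definition tpoly :: "(nat \<Rightarrow> complex) set \<Rightarrow> nat \<Rightarrow> laurent_poly" where
  "tpoly V j = psum (tcoef V j) (tdeg V j) j"
definition tlead :: "(nat \<Rightarrow> complex) set \<Rightarrow> nat \<Rightarrow> laurent_poly" where
  "tlead V j = tcoef V j (tdeg V j)"

lemma min_rel_tdeg:
  assumes "V \<subseteq> nonzero_points" "\<not> transc V j"
  shows "min_rel V j (tdeg V j) (tcoef V j)"
proof -
  have "\<exists>a. min_rel V j (tdeg V j) a" unfolding tdeg_def by (rule someI_ex) (rule min_rel_exists[OF assms])
  then show ?thesis unfolding tcoef_def by (rule someI_ex)
qed

lemma leval_of_nat: "leval (of_nat e) x = of_nat e"
  by (induction e) (auto simp: leval_add)

text \<open>Pseudo-division by the relations \<open>tpoly\<close>, one variable at a time, until the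
  degree is so small that all coefficients vanish on \<open>V\<close>. Since \<delta> is a
  derivation at \<open>y\<close>, both conclusions pass through every step. With \<delta> =
  \<open>log_deriv\<close> this describes tangent spaces; with \<delta> = 0 it extends identities on
  \<open>V\<close> to points that satisfy the relations.\<close>

lemma triangular_reduction:
  fixes \<delta> :: "laurent_poly \<Rightarrow> complex"
  assumes V: "V \<subseteq> nonzero_points" "V \<noteq> {}" and y: "y \<in> nonzero_points"
    and add: "\<And>f g. \<delta> (f + g) = \<delta> f + \<delta> g"
    and mult: "\<And>f g. \<delta> (f * g) = \<delta> f * leval g y + leval f y * \<delta> g"
    and rel: "\<And>j. j < k \<Longrightarrow> \<not> transc V j \<Longrightarrow> leval (tlead V j) y \<noteq> 0 \<and> leval (tpoly V j) y = 0 \<and> \<delta> (tpoly V j) = 0"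
    and f: "f \<in> laurent k" "vanishes V f"
  shows "leval f y = 0 \<and> \<delta> f = 0"
  using rel f
proof (induction k arbitrary: f)
  case 0
  have d0: "\<delta> 0 = 0" using add[of 0 0] by simp
  obtain x where "x \<in> V" using V by blast
  then have "leval f x = 0" using 0 by (simp add: vanishes_def)
  moreover have f: "f = single 0 (lookup f 0)" by (rule laurent_zero_index[OF 0(2)])
  ultimately have "lookup f 0 = 0" by (metis leval_single monomial_at_zero mult.right_neutral)
  then have "f = 0" using f by simp
  then show ?case using d0 by simp
next
  case (Suc k)
  have d0: "\<delta> 0 = 0" using add[of 0 0] by simp
  have dsum: "\<delta> (sum h S) = (\<Sum>s\<in>S. \<delta> (h s))" for h and S :: "nat set"
    by (induction S rule: infinite_finite_induct) (auto simp: add d0)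
  have dminus: "\<delta> (f - g) = \<delta> f - \<delta> g" for f g using add[of "f - g" g] by simp
  have IH: "leval f y = 0" "\<delta> f = 0" if "f \<in> laurent k" "vanishes V f" for f
    using Suc.IH[OF _ that] Suc.prems(1) by (auto simp: less_Suc_eq)
  have coefs: "leval (psum a M k) y = 0 \<and> \<delta> (psum a M k) = 0"
    if "\<And>e. a e \<in> laurent k" "\<And>e. e \<le> M \<Longrightarrow> vanishes V (a e)" for a M
    unfolding psum_def dsum leval_sum
    using IH[OF that] by (auto simp: leval_mult[OF y] mult intro!: sum.neutral)
  have main: "leval (psum a M k) y = 0 \<and> \<delta> (psum a M k) = 0"
    if "\<And>e. a e \<in> laurent k" "vanishes V (psum a M k)" for a M
  proof (cases "transc V k")
    case True
    then show ?thesis using that by (intro coefs) (auto simp: transc_def)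
  next
    case nt: False
    let ?N = "tdeg V k" and ?c = "tcoef V k"
    have mr: "min_rel V k ?N ?c" by (rule min_rel_tdeg[OF V(1) nt])
    have yk: "leval (tlead V k) y \<noteq> 0" "leval (tpoly V k) y = 0" "\<delta> (tpoly V k) = 0"
      using Suc.prems(1)[of k] nt by auto
    show ?thesis using that
    proof (induction M arbitrary: a rule: less_induct)
      case (less M)
      show ?case
      proof (cases "M < ?N")
        case True
        show ?thesis by (intro coefs less.prems(1) min_relD[OF mr True less.prems])
      next
        case False
        have "?N \<ge> 1" using mr by (simp add: min_rel_def)
        then obtain M' where M': "M = Suc M'" using False by (cases M) auto
        obtain L where L: "M = L + ?N" using False by (metis le_iff_add not_less add.commute)
        \<comment> \<open>One division step: multiply by \<open>tlead V k\<close> and subtract the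
          multiple of \<open>tpoly V k\<close> that cancels the top coefficient \<open>a M\<close>.
          The leading coefficient is nonzero at \<open>y\<close>, so the conclusion for
          \<open>a'\<close> gives the one for \<open>a\<close>.\<close>
        define c' where "c' e = (if L \<le> e \<and> e \<le> M then a M * ?c (e - L) else 0)" for e
        define a' where "a' e = tlead V k * a e - c' e" for e
        have sh: "psum c' M k = a M * lvar k (int L) * tpoly V k"
        proof -
          have "psum c' M k = (\<Sum>e\<in>{L..M}. c' e * lvar k (int e))"
            unfolding psum_def by (rule sum.mono_neutral_right) (auto simp: c'_def)
          also have "\<dots> = (\<Sum>e\<le>?N. c' (e + L) * lvar k (int (e + L)))"
            by (rule sum.reindex_bij_witness[of _ "\<lambda>e. e + L" "\<lambda>e. e - L"]) (use L in auto)
          also have "\<dots> = (\<Sum>e\<le>?N. a M * lvar k (int L) * (?c e * lvar k (int e)))"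
          proof (rule sum.cong[OF refl])
            fix e assume "e \<in> {..?N}"
            then have "c' (e + L) = a M * ?c e" using L by (simp add: c'_def)
            then show "c' (e + L) * lvar k (int (e + L)) = a M * lvar k (int L) * (?c e * lvar k (int e))"
              by (simp only: of_nat_add lvar_mult[symmetric] mult_ac)
          qed
          finally show ?thesis by (simp add: tpoly_def psum_def sum_distrib_left)
        qed
        have "a' M = 0" using L by (simp add: a'_def c'_def tlead_def mult.commute)
        then have "psum a' M' k = psum a' M k" by (simp add: M' psum_def)
        also have "\<dots> = tlead V k * psum a M k - psum c' M k"
          unfolding psum_def a'_def sum_distrib_left sum_subtractf[symmetric]
          by (intro sum.cong refl) (simp add: algebra_simps)
        finally have eq: "psum a' M' k = tlead V k * psum a M k - a M * lvar k (int L) * tpoly V k" by (simp add: sh)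
        have "vanishes V (psum a' M' k)"
          using less.prems(2) mr V(1) by (auto simp: eq vanishes_def leval_diff leval_mult subset_iff min_rel_def tpoly_def)
        moreover have "a' e \<in> laurent k" for e
          using less.prems mr unfolding a'_def c'_def tlead_def min_rel_def by (auto intro!: laurent_diff laurent_mult)
        ultimately have "leval (psum a' M' k) y = 0 \<and> \<delta> (psum a' M' k) = 0" using less.IH[of M' a'] M' by simp
        then show ?thesis unfolding eq using yk by (auto simp: leval_diff leval_mult[OF y] dminus mult)
      qed
    qed
  qed
  obtain K N a where a: "\<And>e. a e \<in> laurent k" "f * lvar k (int K) = psum a N k"
    using laurent_Suc_expand[OF Suc.prems(2)] unfolding psum_def by blast
  have "vanishes V (psum a N k)" using Suc.prems(3) V(1)
    unfolding a(2)[symmetric] vanishes_def by (auto simp: leval_mult subset_iff)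
  then have *: "leval (f * lvar k (int K)) y = 0" "\<delta> (f * lvar k (int K)) = 0" using main[of a N] a by auto
  have "leval f y = 0" using *(1) nonzero_pointsD[OF y] by (simp add: leval_mult[OF y] leval_lvar)
  moreover from this have "\<delta> f = 0" using *(2) nonzero_pointsD[OF y] by (simp add: mult leval_lvar)
  ultimately show ?case by simp
qed

definition free_vars :: "nat \<Rightarrow> (nat \<Rightarrow> complex) set \<Rightarrow> nat set" where
  "free_vars n V = {j. j < n \<and> transc V j}"
definition alg_vars :: "nat \<Rightarrow> (nat \<Rightarrow> complex) set \<Rightarrow> nat set" where
  "alg_vars n V = {j. j < n \<and> \<not> transc V j}"
text \<open>On this dense open part of \<open>V\<close> the relations \<open>tpoly\<close> have
  their full degree, and their differentials form a triangular matrix with nonzero diagonal.\<close>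

definition chart :: "nat \<Rightarrow> (nat \<Rightarrow> complex) set \<Rightarrow> (nat \<Rightarrow> complex) set" where
  "chart n V = {x\<in>V. \<forall>j\<in>alg_vars n V. leval (tlead V j) x \<noteq> 0 \<and> leval (euler j (tpoly V j)) x \<noteq> 0}"

lemma finite_vars [simp]: "finite (free_vars n V)" "finite (alg_vars n V)"
  by (auto simp: free_vars_def alg_vars_def)

lemma card_vars: "card (free_vars n V) + card (alg_vars n V) = n"
proof -
  have "card (free_vars n V \<union> alg_vars n V) = card (free_vars n V) + card (alg_vars n V)"
    by (intro card_Un_disjoint) (auto simp: free_vars_def alg_vars_def)
  moreover have "free_vars n V \<union> alg_vars n V = {..<n}" by (auto simp: free_vars_def alg_vars_def)
  ultimately show ?thesis by simp
qed

lemma euler_laurent_zero: "f \<in> laurent j \<Longrightarrow> j \<le> i \<Longrightarrow> euler i f = 0"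
  by (rule poly_mapping_eqI) (force simp: lookup_euler laurent_def in_keys_iff)

lemma euler_lvar: "euler i (lvar j k) = (if i = j then of_int k * lvar j k else 0)"
proof -
  have "(of_int k :: laurent_poly) * single (single j k) 1 = single (single j k) (of_int k)"
    by (metis add_0 mult.right_neutral mult_single single_of_int)
  then show ?thesis by (simp add: lvar_def euler_single lookup_single when_def)
qed

lemma variety_nonzero: "variety n V \<Longrightarrow> V \<subseteq> nonzero_points"
  using variety_torus torus_nonzero by blast

lemma tpoly_facts:
  assumes V: "variety n V" and j: "j \<in> alg_vars n V"
  shows "tpoly V j \<in> laurent (Suc j)" "tpoly V j \<in> laurent n" "tlead V j \<in> laurent j" "tlead V j \<in> laurent n"
    "vanishes V (tpoly V j)" "\<not> vanishes V (tlead V j)" "\<not> vanishes V (euler j (tpoly V j))"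
proof -
  have nt: "\<not> transc V j" and jn: "j < n" using j by (auto simp: alg_vars_def)
  let ?N = "tdeg V j" and ?c = "tcoef V j"
  have Vn: "V \<subseteq> nonzero_points" by (rule variety_nonzero[OF V])
  have mr: "min_rel V j ?N ?c" by (rule min_rel_tdeg[OF Vn nt])
  have c: "?c e \<in> laurent j" for e using mr by (simp add: min_rel_def)
  show 1: "tpoly V j \<in> laurent (Suc j)" unfolding tpoly_def by (rule psum_laurent[OF c])
  show "tpoly V j \<in> laurent n" by (rule laurent_mono[OF 1]) (use jn in simp)
  show 2: "tlead V j \<in> laurent j" unfolding tlead_def by (rule c)
  show "tlead V j \<in> laurent n" by (rule laurent_mono[OF 2]) (use jn in simp)
  show "vanishes V (tpoly V j)" "\<not> vanishes V (tlead V j)" using mr by (auto simp: min_rel_def tpoly_def tlead_def)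
  show "\<not> vanishes V (euler j (tpoly V j))"
  proof
    assume v: "vanishes V (euler j (tpoly V j))"
    obtain M where M: "?N = Suc M" using mr by (cases ?N) (auto simp: min_rel_def)
    \<comment> \<open>The coefficients of the derivative of the relation in \<open>x_j\<close>. If
      it vanished on \<open>V\<close>, minimality of the degree would make its top coefficient
      vanish on \<open>V\<close>, a positive integer times the leading coefficient of the
      relation.\<close>
    define b where "b e = single 0 (of_nat (Suc e)) * ?c (Suc e)" for e
    have "vanishes V (psum b M j)" unfolding vanishes_def
    proof
      fix x assume x: "x \<in> V"
      then have xn: "x \<in> nonzero_points" using Vn by blast
      have "leval (euler j (tpoly V j)) x = (\<Sum>e\<le>?N. leval (?c e) x * (of_nat e * x j ^ e))"
        unfolding tpoly_def psum_def euler_sum leval_sum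
        by (intro sum.cong refl)
           (simp add: euler_mult euler_laurent_zero[OF c] euler_lvar leval_mult[OF xn] leval_lvar leval_of_nat)
      also have "\<dots> = x j * leval (psum b M j) x"
        unfolding M sum.atMost_Suc_shift leval_psum[OF xn]
        by (simp add: b_def leval_mult[OF xn] leval_single sum_distrib_left mult_ac)
      finally show "leval (psum b M j) x = 0" using v x nonzero_pointsD[OF xn] by (simp add: vanishes_def)
    qed
    moreover have "b e \<in> laurent j" for e by (auto simp: b_def intro!: laurent_mult c)
    ultimately have "vanishes V (b M)" using min_relD[OF mr, of M b M] M by simp
    then have "vanishes V (?c ?N)"
      using Vn by (auto simp: vanishes_def b_def M leval_mult subset_iff leval_of_nat simp del: of_nat_Suc)
    then show False using mr by (simp add: min_rel_def)
  qed
qed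

lemma chart_nonvanishing:
  assumes V: "variety n V" and f: "finite S" "\<And>f. f \<in> S \<Longrightarrow> f \<in> laurent n" "\<And>f. f \<in> S \<Longrightarrow> \<not> vanishes V f"
  shows "\<exists>x\<in>chart n V. \<forall>f\<in>S. leval f x \<noteq> 0"
proof -
  have "\<exists>x\<in>V. \<forall>s\<in>S \<union> tlead V ` alg_vars n V \<union> (\<lambda>j. euler j (tpoly V j)) ` alg_vars n V. leval s x \<noteq> 0"
    by (rule variety_prod_nonvanishing[OF V, of _ "\<lambda>s. s"])
       (use f tpoly_facts[OF V] in \<open>auto simp: vanishes_def intro: laurent_euler\<close>)
  then show ?thesis by (auto simp: chart_def)
qed

lemma chart_vanishes:
  assumes "variety n V" "f \<in> laurent n" "\<And>x. x \<in> chart n V \<Longrightarrow> leval f x = 0"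
  shows "vanishes V f"
  using chart_nonvanishing[OF assms(1), of "{f}"] assms(2,3) by auto

lemma chart_subset: "chart n V \<subseteq> V" by (auto simp: chart_def)

subsection \<open>Growth of the coordinate ring\<close>

text \<open>The functions are cut off outside \<Gamma>, so that equality of functions means equality
  on \<Gamma>. The filtration by the size \<open>D\<close> of the exponents is the one whose growth
  measures dimension.\<close>

definition mons :: "(nat \<Rightarrow> complex) set \<Rightarrow> nat \<Rightarrow> nat \<Rightarrow> ((nat \<Rightarrow> complex) \<Rightarrow> complex) set" where
  "mons \<Gamma> k D = fvec.span {(\<lambda>x. if x \<in> \<Gamma> then monomial_at x m else 0) | m.
      keys m \<subseteq> {..<k} \<and> (\<forall>i. \<bar>lookup m i\<bar> \<le> int D)}"

definition restr :: "(nat \<Rightarrow> complex) set \<Rightarrow> laurent_poly \<Rightarrow> (nat \<Rightarrow> complex) \<Rightarrow> complex" where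
  "restr \<Gamma> f = (\<lambda>x. if x \<in> \<Gamma> then leval f x else 0)"

lemma span_mult_image:
  fixes \<phi> \<psi> :: "'i \<Rightarrow> complex"
  assumes "\<phi> \<in> fvec.span T"
  shows "\<psi> * \<phi> \<in> fvec.span ((\<lambda>\<tau>. \<psi> * \<tau>) ` T)"
  using assms
proof (induction \<phi> rule: fvec.span_induct_alt)
  case base
  have "\<psi> * 0 = 0" by (rule mult_zero_right)
  then show ?case using fvec.span_zero by metis
next
  case (step c x y)
  have eq: "\<psi> * (fscale c x + y) = fscale c (\<psi> * x) + \<psi> * y" by (auto simp: fscale_def fun_eq_iff algebra_simps)
  show ?case unfolding eq by (intro fvec.span_add fvec.span_scale fvec.span_base imageI step)
qed

lemma mons_mult:
  assumes \<Gamma>: "\<Gamma> \<subseteq> nonzero_points" and "\<phi> \<in> mons \<Gamma> k D" "\<psi> \<in> mons \<Gamma> k D'"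
  shows "\<phi> * \<psi> \<in> mons \<Gamma> k (D + D')"
proof -
  let ?S = "\<lambda>D. {(\<lambda>x. if x \<in> \<Gamma> then monomial_at x m else 0) | m. keys m \<subseteq> {..<k} \<and> (\<forall>i. \<bar>lookup m i\<bar> \<le> int D)}"
  have 1: "a * b \<in> mons \<Gamma> k (D + D')" if "a \<in> ?S D" "b \<in> ?S D'" for a b
  proof -
    from that(1) obtain m where m1: "a = (\<lambda>x. if x \<in> \<Gamma> then monomial_at x m else 0)" "keys m \<subseteq> {..<k}" "\<forall>i. \<bar>lookup m i\<bar> \<le> int D"
      by blast
    from that(2) obtain m' where m2: "b = (\<lambda>x. if x \<in> \<Gamma> then monomial_at x m' else 0)" "keys m' \<subseteq> {..<k}" "\<forall>i. \<bar>lookup m' i\<bar> \<le> int D'"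
      by blast
    note m = m1 m2
    have "a * b = (\<lambda>x. if x \<in> \<Gamma> then monomial_at x (m + m') else 0)"
      using \<Gamma> by (auto simp: m fun_eq_iff monomial_at_add subset_iff)
    moreover have "keys (m + m') \<subseteq> {..<k}" using keys_add[of m m'] m by blast
    moreover have "\<bar>lookup (m + m') i\<bar> \<le> int (D + D')" for i
      using m(3)[rule_format, of i] m(6)[rule_format, of i] by (simp add: lookup_add)
    ultimately show ?thesis unfolding mons_def by (intro fvec.span_base) blast
  qed
  have sub: "fvec.subspace (mons \<Gamma> k (D + D'))" by (simp add: mons_def)
  have 2: "a * \<psi> \<in> mons \<Gamma> k (D + D')" if a: "a \<in> ?S D" for a
  proof -
    have "a * \<psi> \<in> fvec.span ((\<lambda>\<tau>. a * \<tau>) ` ?S D')" using assms(3) unfolding mons_def by (rule span_mult_image)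
    also have "\<dots> \<subseteq> mons \<Gamma> k (D + D')" by (rule fvec.span_minimal[OF _ sub]) (use 1[OF a] in blast)
    finally show ?thesis .
  qed
  have "\<psi> * \<phi> \<in> fvec.span ((\<lambda>\<tau>. \<psi> * \<tau>) ` ?S D)" using assms(2) unfolding mons_def by (rule span_mult_image)
  also have "\<dots> \<subseteq> mons \<Gamma> k (D + D')" by (rule fvec.span_minimal[OF _ sub]) (use 2 in \<open>auto simp: mult.commute\<close>)
  finally show ?thesis by (simp add: mult.commute)
qed

lemma mons_mono: "D \<le> D' \<Longrightarrow> mons \<Gamma> k D \<subseteq> mons \<Gamma> k D'"
  unfolding mons_def
proof (rule fvec.span_mono, rule subsetI)
  fix \<phi> assume D: "D \<le> D'" and "\<phi> \<in> {(\<lambda>x. if x \<in> \<Gamma> then monomial_at x m else 0) | m. keys m \<subseteq> {..<k} \<and> (\<forall>i. \<bar>lookup m i\<bar> \<le> int D)}"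
  then obtain m where m: "\<phi> = (\<lambda>x. if x \<in> \<Gamma> then monomial_at x m else 0)" "keys m \<subseteq> {..<k}" "\<And>i. \<bar>lookup m i\<bar> \<le> int D" by blast
  have "\<bar>lookup m i\<bar> \<le> int D'" for i using m(3)[of i] D by linarith
  then show "\<phi> \<in> {(\<lambda>x. if x \<in> \<Gamma> then monomial_at x m else 0) | m. keys m \<subseteq> {..<k} \<and> (\<forall>i. \<bar>lookup m i\<bar> \<le> int D')}"
    using m by blast
qed

lemma mons_restr:
  assumes "f \<in> laurent k"
  shows "\<exists>D. restr \<Gamma> f \<in> mons \<Gamma> k D"
proof -
  define D where "D = nat (\<Sum>m\<in>keys f. \<Sum>i\<in>keys m. \<bar>lookup m i\<bar>)"
  have D: "\<bar>lookup m i\<bar> \<le> int D" if "m \<in> keys f" for m i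
  proof (cases "i \<in> keys m")
    case True
    then have "\<bar>lookup m i\<bar> \<le> (\<Sum>i\<in>keys m. \<bar>lookup m i\<bar>)" by (intro member_le_sum) auto
    also have "\<dots> \<le> (\<Sum>m\<in>keys f. \<Sum>i\<in>keys m. \<bar>lookup m i\<bar>)"
      by (rule member_le_sum[OF that, of "\<lambda>m. \<Sum>i\<in>keys m. \<bar>lookup m i\<bar>"]) (auto intro: sum_nonneg)
    finally show ?thesis unfolding D_def by linarith
  qed (simp add: lookup_not_keys)
  have "restr \<Gamma> f = (\<Sum>m\<in>keys f. fscale (lookup f m) (\<lambda>x. if x \<in> \<Gamma> then monomial_at x m else 0))"
    by (auto simp: restr_def fun_eq_iff leval_eq fscale_def)
  also have "\<dots> \<in> mons \<Gamma> k D"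
    unfolding mons_def using laurent_keys[OF assms] D
    by (intro fvec.span_sum fvec.span_scale fvec.span_base) blast
  finally show ?thesis by blast
qed

lemma mons_one: "(\<lambda>x. if x \<in> \<Gamma> then 1 else 0) \<in> mons \<Gamma> k 0"
  unfolding mons_def by (intro fvec.span_base CollectI exI[of _ 0]) auto

definition cutoff :: "(nat \<Rightarrow> complex) set \<Rightarrow> ((nat \<Rightarrow> complex) \<Rightarrow> complex) \<Rightarrow> (nat \<Rightarrow> complex) \<Rightarrow> complex" where
  "cutoff \<Gamma> \<phi> = (\<lambda>x. if x \<in> \<Gamma> then \<phi> x else 0)"

lemma cutoff_mult: "cutoff \<Gamma> (\<lambda>x. \<phi> x * \<psi> x) = cutoff \<Gamma> \<phi> * cutoff \<Gamma> \<psi>"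
  by (auto simp: cutoff_def fun_eq_iff)

lemma mons_power:
  assumes \<Gamma>: "\<Gamma> \<subseteq> nonzero_points" and "cutoff \<Gamma> \<phi> \<in> mons \<Gamma> k D"
  shows "cutoff \<Gamma> (\<lambda>x. \<phi> x ^ e) \<in> mons \<Gamma> k (D * e)"
proof (induction e)
  case 0
  then show ?case using mons_one by (simp add: cutoff_def)
next
  case (Suc e)
  have "cutoff \<Gamma> (\<lambda>x. \<phi> x ^ Suc e) = cutoff \<Gamma> \<phi> * cutoff \<Gamma> (\<lambda>x. \<phi> x ^ e)"
    by (auto simp: cutoff_def fun_eq_iff)
  moreover have "D * Suc e = D + D * e" by simp
  ultimately show ?case using mons_mult[OF \<Gamma> assms(2) Suc] by metis
qed

text \<open>A transcendental coordinate contributes about 2 D exponents. An algebraic one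
  contributes only the powers below the degree of its relation, at the cost of a factor
  \<open>H\<close> without zeros on the chart and of a linear increase of \<open>D\<close>.\<close>

lemma growth:
  assumes V: "variety n V" and k: "k \<le> n"
  shows "\<exists>K C. \<forall>D. \<exists>T H. finite T \<and> card T \<le> K * (C * D + 1) ^ card (free_vars k V) \<and>
    (\<forall>x\<in>chart n V. H x \<noteq> 0) \<and> (\<forall>\<phi>\<in>mons (chart n V) k D. H * \<phi> \<in> fvec.span T)"
  using k
proof (induction k)
  case 0
  let ?\<Gamma> = "chart n V"
  have "mons ?\<Gamma> 0 D = fvec.span {\<lambda>x. if x \<in> ?\<Gamma> then 1 else 0}" for D
  proof -
    have "{(\<lambda>x. if x \<in> ?\<Gamma> then monomial_at x m else 0) | m. keys m \<subseteq> {..<0} \<and> (\<forall>i. \<bar>lookup m i\<bar> \<le> int D)}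
      = {\<lambda>x. if x \<in> ?\<Gamma> then 1 else 0}" by (auto cong: if_cong intro!: exI[of _ 0])
    then show ?thesis by (simp add: mons_def)
  qed
  moreover have "free_vars 0 V = {}" by (simp add: free_vars_def)
  ultimately show ?case
    by (intro exI[of _ 1] exI[of _ 1] allI exI[of _ "{\<lambda>x. if x \<in> ?\<Gamma> then 1 else 0}"] exI[of _ "1::(nat \<Rightarrow> complex) \<Rightarrow> complex"]) auto
next
  case (Suc k)
  let ?\<Gamma> = "chart n V"
  let ?r = "card (free_vars k V)"
  have \<Gamma>: "?\<Gamma> \<subseteq> nonzero_points" using chart_subset variety_nonzero[OF V] by blast
  have kn: "k < n" using Suc.prems by simp
  from Suc.IH[OF Suc_leD[OF Suc.prems]] obtain K C where "\<forall>D. \<exists>T H. finite T \<and> card T \<le> K * (C * D + 1) ^ ?r \<and>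
    (\<forall>x\<in>?\<Gamma>. H x \<noteq> 0) \<and> (\<forall>\<phi>\<in>mons ?\<Gamma> k D. H * \<phi> \<in> fvec.span T)" by (elim exE)
  note KC = this[THEN spec]
  have split: "\<exists>m' e. (\<lambda>x. if x \<in> ?\<Gamma> then monomial_at x m else 0) = cutoff ?\<Gamma> (\<lambda>x. x k powi e) * cutoff ?\<Gamma> (\<lambda>x. monomial_at x m')
      \<and> \<bar>e\<bar> \<le> int D \<and> cutoff ?\<Gamma> (\<lambda>x. monomial_at x m') \<in> mons ?\<Gamma> k D"
    if m: "keys m \<subseteq> {..<Suc k}" "\<forall>i. \<bar>lookup m i\<bar> \<le> int D" for m D
  proof -
    define e where "e = lookup m k"
    define m' where "m' = m - single k e"
    have l: "lookup m' i = (if i = k then 0 else lookup m i)" for i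
      by (simp add: m'_def e_def lookup_minus lookup_single when_def)
    have "keys m' \<subseteq> {..<k}"
    proof
      fix i assume "i \<in> keys m'"
      then have "i \<noteq> k" "i \<in> keys m" using l[of i] by (auto simp: in_keys_iff split: if_splits)
      then show "i \<in> {..<k}" using m(1) by auto
    qed
    moreover have "\<forall>i. \<bar>lookup m' i\<bar> \<le> int D" using m(2) by (auto simp: l)
    ultimately have "cutoff ?\<Gamma> (\<lambda>x. monomial_at x m') \<in> mons ?\<Gamma> k D"
      unfolding mons_def cutoff_def by (intro fvec.span_base) blast
    moreover have "monomial_at x m = x k powi e * monomial_at x m'" if "x \<in> ?\<Gamma>" for x
      using monomial_at_add[of x "single k e" m'] that \<Gamma> by (auto simp: m'_def monomial_at_single)
    then have "(\<lambda>x. if x \<in> ?\<Gamma> then monomial_at x m else 0) = cutoff ?\<Gamma> (\<lambda>x. x k powi e) * cutoff ?\<Gamma> (\<lambda>x. monomial_at x m')"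
      by (auto simp: cutoff_def fun_eq_iff)
    moreover have "\<bar>e\<bar> \<le> int D" using m(2) by (simp add: e_def)
    ultimately show ?thesis by blast
  qed
  have gen: "\<forall>\<phi>\<in>mons ?\<Gamma> (Suc k) D. H * \<phi> \<in> fvec.span T"
    if "\<And>m. keys m \<subseteq> {..<Suc k} \<Longrightarrow> \<forall>i. \<bar>lookup m i\<bar> \<le> int D \<Longrightarrow> H * (\<lambda>x. if x \<in> ?\<Gamma> then monomial_at x m else 0) \<in> fvec.span T" for D H T
  proof
    fix \<phi> assume "\<phi> \<in> mons ?\<Gamma> (Suc k) D"
    then have "H * \<phi> \<in> fvec.span ((\<lambda>\<tau>. H * \<tau>) ` {(\<lambda>x. if x \<in> ?\<Gamma> then monomial_at x m else 0) | m.
      keys m \<subseteq> {..<Suc k} \<and> (\<forall>i. \<bar>lookup m i\<bar> \<le> int D)})" unfolding mons_def by (rule span_mult_image)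
    also have "\<dots> \<subseteq> fvec.span T" by (rule fvec.span_minimal) (use that in auto)
    finally show "H * \<phi> \<in> fvec.span T" .
  qed
  show ?case
  proof (cases "transc V k")
    case True
    then have "free_vars (Suc k) V = insert k (free_vars k V)" by (auto simp: free_vars_def less_Suc_eq)
    then have r: "card (free_vars (Suc k) V) = Suc ?r" by (simp add: free_vars_def)
    show ?thesis unfolding r
    proof (rule exI[of _ K], rule exI[of _ "C + 2"], rule allI)
      fix D
      obtain T H where TH: "finite T" "card T \<le> K * (C * D + 1) ^ ?r" "\<forall>x\<in>?\<Gamma>. H x \<noteq> 0"
        "\<And>\<phi>. \<phi> \<in> mons ?\<Gamma> k D \<Longrightarrow> H * \<phi> \<in> fvec.span T" using KC[of D] by blast
      \<comment> \<open>The exponent of the new coordinate runs freely from -D to D; the resulting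
        factor 2 D + 1 is absorbed by \<open>C + 2\<close>.\<close>
      define T' where "T' = (\<lambda>(e, \<tau>). cutoff ?\<Gamma> (\<lambda>x. x k powi e) * \<tau>) ` ({- int D..int D} \<times> T)"
      have "card T' \<le> card ({- int D..int D} \<times> T)" unfolding T'_def by (rule card_image_le) (use TH in auto)
      also have "\<dots> = (2 * D + 1) * card T"
      proof -
        have "card {- int D..int D} = 2 * D + 1" unfolding card_atLeastAtMost_int by linarith
        then show ?thesis by (simp only: card_cartesian_product)
      qed
      also have "\<dots> \<le> ((C + 2) * D + 1) * (K * ((C + 2) * D + 1) ^ ?r)"
      proof (intro mult_mono)
        have "card T \<le> K * (C * D + 1) ^ ?r" by (rule TH)
        also have "\<dots> \<le> K * ((C + 2) * D + 1) ^ ?r" by (intro mult_left_mono power_mono) auto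
        finally show "card T \<le> K * ((C + 2) * D + 1) ^ ?r" .
      qed auto
      also have "\<dots> = K * ((C + 2) * D + 1) ^ Suc ?r" by (simp add: mult_ac)
      finally have cT': "card T' \<le> K * ((C + 2) * D + 1) ^ Suc ?r" .
      have "\<forall>\<phi>\<in>mons ?\<Gamma> (Suc k) D. H * \<phi> \<in> fvec.span T'"
      proof (rule gen)
        fix m assume m: "keys m \<subseteq> {..<Suc k}" "\<forall>i. \<bar>lookup m i\<bar> \<le> int D"
        obtain m' e where e: "(\<lambda>x. if x \<in> ?\<Gamma> then monomial_at x m else 0) = cutoff ?\<Gamma> (\<lambda>x. x k powi e) * cutoff ?\<Gamma> (\<lambda>x. monomial_at x m')"
          "\<bar>e\<bar> \<le> int D" "cutoff ?\<Gamma> (\<lambda>x. monomial_at x m') \<in> mons ?\<Gamma> k D" using split[OF m] by blast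
        have "cutoff ?\<Gamma> (\<lambda>x. x k powi e) * (H * cutoff ?\<Gamma> (\<lambda>x. monomial_at x m')) \<in>
            fvec.span ((\<lambda>\<tau>. cutoff ?\<Gamma> (\<lambda>x. x k powi e) * \<tau>) ` T)"
          by (rule span_mult_image[OF TH(4)[OF e(3)]])
        also have "\<dots> \<subseteq> fvec.span T'" 
        proof (rule fvec.span_mono, rule subsetI)
          fix \<psi> assume "\<psi> \<in> (\<lambda>\<tau>. cutoff ?\<Gamma> (\<lambda>x. x k powi e) * \<tau>) ` T"
          then obtain \<tau> where \<tau>: "\<tau> \<in> T" "\<psi> = cutoff ?\<Gamma> (\<lambda>x. x k powi e) * \<tau>" by blast
          then have "(e, \<tau>) \<in> {- int D..int D} \<times> T" using e(2) by auto
          then show "\<psi> \<in> T'" unfolding T'_def by (rule rev_image_eqI) (simp only: \<tau>(2) prod.case)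
        qed
        finally show "H * (\<lambda>x. if x \<in> ?\<Gamma> then monomial_at x m else 0) \<in> fvec.span T'"
          unfolding e(1) by (simp add: mult_ac)
      qed
      moreover have "finite T'" using TH by (simp add: T'_def)
      ultimately show "\<exists>T H. finite T \<and> card T \<le> K * ((C + 2) * D + 1) ^ Suc ?r \<and>
        (\<forall>x\<in>?\<Gamma>. H x \<noteq> 0) \<and> (\<forall>\<phi>\<in>mons ?\<Gamma> (Suc k) D. H * \<phi> \<in> fvec.span T)"
        using cT' TH(3) by blast
    qed
  next
    case nt: False
    then have "free_vars (Suc k) V = free_vars k V" by (auto simp: free_vars_def less_Suc_eq)
    then have r: "card (free_vars (Suc k) V) = ?r" by simp
    have kB: "k \<in> alg_vars n V" using nt kn by (simp add: alg_vars_def)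
    let ?N = "tdeg V k" and ?a = "tcoef V k" and ?l = "tlead V k"
    have mr: "min_rel V k ?N ?a" by (rule min_rel_tdeg[OF variety_nonzero[OF V] nt])
    obtain M where M: "?N = Suc M" using mr by (cases ?N) (auto simp: min_rel_def)
    have "\<exists>D. restr ?\<Gamma> (?a e) \<in> mons ?\<Gamma> k D" for e using mr by (intro mons_restr) (auto simp: min_rel_def)
    then obtain De where De: "\<And>e. restr ?\<Gamma> (?a e) \<in> mons ?\<Gamma> k (De e)" by metis
    define c where "c = (\<Sum>e\<le>?N. De e)"
    have c: "cutoff ?\<Gamma> (leval (?a e)) \<in> mons ?\<Gamma> k c" if "e \<le> ?N" for e
    proof -
      have "De e \<le> c" unfolding c_def using that by (intro member_le_sum) auto
      then show ?thesis using De[of e] mons_mono unfolding restr_def cutoff_def by blast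
    qed
    have sub: "fvec.subspace (mons ?\<Gamma> k D)" for D by (simp add: mons_def)
    \<comment> \<open>Reduction of powers of \<open>x_k\<close> by its relation. Each new power
      needs one factor \<open>?l\<close> and increases the size of the coefficients by at most
      \<open>c\<close>, the bound for the coefficients of the relation.\<close>
    have red: "\<exists>w. (\<forall>i. cutoff ?\<Gamma> (w i) \<in> mons ?\<Gamma> k (c * L)) \<and>
        (\<forall>x\<in>?\<Gamma>. (leval ?l x * x k) ^ L = (\<Sum>i<?N. w i x * x k ^ i))" for L
    proof (induction L)
      case 0
      have "\<forall>i. cutoff ?\<Gamma> (if i = 0 then (\<lambda>_. 1) else (\<lambda>_. 0)) \<in> mons ?\<Gamma> k (c * 0)"
        using mons_one fvec.subspace_0[OF sub] by (auto simp: cutoff_def zero_fun_def)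
      moreover have "(\<Sum>i<?N. (if i = 0 then (\<lambda>_. 1) else (\<lambda>_. 0)) x * x k ^ i) = 1" for x :: "nat \<Rightarrow> complex"
        unfolding M sum.lessThan_Suc_shift by simp
      ultimately show ?case
        by (intro exI[of _ "\<lambda>i. if i = (0::nat) then (\<lambda>_. 1) else (\<lambda>_. 0)"] conjI ballI) simp_all
    next
      case (Suc L)
      then obtain w where w: "\<And>i. cutoff ?\<Gamma> (w i) \<in> mons ?\<Gamma> k (c * L)"
        "\<And>x. x \<in> ?\<Gamma> \<Longrightarrow> (leval ?l x * x k) ^ L = (\<Sum>i<?N. w i x * x k ^ i)" by blast
      define w' where "w' i x = (if i = 0 then 0 else leval ?l x * w (i - 1) x) - w M x * leval (?a i) x" for i x
      have w'1: "cutoff ?\<Gamma> (w' i) \<in> mons ?\<Gamma> k (c * Suc L)" if "i < ?N" for i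
      proof -
        have 1: "cutoff ?\<Gamma> (\<lambda>x. leval ?l x * w j x) \<in> mons ?\<Gamma> k (c * Suc L)" for j
          using mons_mult[OF \<Gamma> c[of ?N] w(1)[of j]] by (simp add: cutoff_mult tlead_def)
        have 2: "cutoff ?\<Gamma> (\<lambda>x. w M x * leval (?a i) x) \<in> mons ?\<Gamma> k (c * Suc L)"
          using mons_mult[OF \<Gamma> w(1)[of M] c[of i]] that by (simp add: cutoff_mult add.commute)
        have "cutoff ?\<Gamma> (w' i) = (if i = 0 then 0 else cutoff ?\<Gamma> (\<lambda>x. leval ?l x * w (i - 1) x)) - cutoff ?\<Gamma> (\<lambda>x. w M x * leval (?a i) x)"
          by (auto simp: cutoff_def w'_def fun_eq_iff)
        then show ?thesis using 1[of "i - 1"] 2 fvec.subspace_diff[OF sub] fvec.subspace_0[OF sub] by simp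
      qed
      have w'2: "(leval ?l x * x k) ^ Suc L = (\<Sum>i<?N. w' i x * x k ^ i)" if x: "x \<in> ?\<Gamma>" for x
      proof -
        have xV: "x \<in> V" "x \<in> nonzero_points" using x chart_subset \<Gamma> by auto
        have "vanishes V (psum ?a ?N k)" using mr by (simp add: min_rel_def)
        then have "leval (psum ?a ?N k) x = 0" using xV by (simp add: vanishes_def)
        then have "(\<Sum>e\<le>?N. leval (?a e) x * x k ^ e) = 0" unfolding leval_psum[OF xV(2)] .
        then have top: "leval ?l x * x k ^ ?N = - (\<Sum>e<?N. leval (?a e) x * x k ^ e)"
          by (simp add: lessThan_Suc_atMost[symmetric] tlead_def eq_neg_iff_add_eq_0 add.commute)
        have "(leval ?l x * x k) ^ Suc L = (\<Sum>i<?N. leval ?l x * w i x * x k ^ Suc i)"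
          unfolding power_Suc[of _ L] w(2)[OF x] by (simp add: sum_distrib_left mult_ac)
        also have "\<dots> = (\<Sum>i<M. leval ?l x * w i x * x k ^ Suc i) + w M x * (leval ?l x * x k ^ ?N)"
          by (simp add: M mult_ac)
        also have "(\<Sum>i<M. leval ?l x * w i x * x k ^ Suc i) = (\<Sum>i<?N. (if i = 0 then 0 else leval ?l x * w (i - 1) x) * x k ^ i)"
          unfolding M sum.lessThan_Suc_shift by simp
        also have "\<dots> + w M x * (leval ?l x * x k ^ ?N) = (\<Sum>i<?N. w' i x * x k ^ i)"
          unfolding top w'_def left_diff_distrib sum_subtractf by (simp add: sum_distrib_left mult_ac)
        finally show ?thesis .
      qed
      show ?case
      proof (intro exI[of _ "\<lambda>i. if i < ?N then w' i else (\<lambda>_. 0)"] conjI allI ballI)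
        fix i show "cutoff ?\<Gamma> (if i < ?N then w' i else (\<lambda>_. 0)) \<in> mons ?\<Gamma> k (c * Suc L)"
          using w'1[of i] fvec.subspace_0[OF sub] by (auto simp: cutoff_def zero_fun_def)
      next
        fix x assume "x \<in> ?\<Gamma>"
        then show "(leval ?l x * x k) ^ Suc L = (\<Sum>i<?N. (if i < ?N then w' i else (\<lambda>_. 0)) x * x k ^ i)"
          using w'2 by simp
      qed
    qed
    show ?thesis unfolding r
    proof (rule exI[of _ "?N * K"], rule exI[of _ "C * (1 + 2 * c)"], rule allI)
      fix D
      obtain T H where TH: "finite T" "card T \<le> K * (C * ((1 + 2 * c) * D) + 1) ^ ?r" "\<forall>x\<in>?\<Gamma>. H x \<noteq> 0"
        "\<And>\<phi>. \<phi> \<in> mons ?\<Gamma> k ((1 + 2 * c) * D) \<Longrightarrow> H * \<phi> \<in> fvec.span T" using KC[of "(1 + 2 * c) * D"] by blast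
      define T' where "T' = (\<lambda>(i, \<tau>). cutoff ?\<Gamma> (\<lambda>x. x k ^ i) * \<tau>) ` ({..<?N} \<times> T)"
      \<comment> \<open>This factor turns an exponent e with -D \<le> e \<le> D into L = D + e,
        between 0 and 2 D, and supplies the leading coefficients for the reduction. The coefficients
        then have size D + c (2 D - L) + c L = (1 + 2 c) D, where the induction hypothesis is
        applied.\<close>
      define H' where "H' = H * (\<lambda>x. leval ?l x ^ (2 * D) * x k ^ D)"
      have "card T' \<le> card ({..<?N} \<times> T)" unfolding T'_def by (rule card_image_le) (use TH in auto)
      also have "\<dots> = ?N * card T" by (simp add: card_cartesian_product)
      also have "\<dots> \<le> ?N * (K * (C * ((1 + 2 * c) * D) + 1) ^ ?r)" by (rule mult_left_mono[OF TH(2)]) simp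
      finally have cT': "card T' \<le> ?N * K * (C * (1 + 2 * c) * D + 1) ^ ?r" by (simp only: mult.assoc)
      have H': "\<forall>x\<in>?\<Gamma>. H' x \<noteq> 0"
        using TH(3) \<Gamma> kB by (auto simp: H'_def chart_def dest!: subsetD nonzero_pointsD[of _ k])
      have "\<forall>\<phi>\<in>mons ?\<Gamma> (Suc k) D. H' * \<phi> \<in> fvec.span T'"
      proof (rule gen)
        fix m assume m: "keys m \<subseteq> {..<Suc k}" "\<forall>i. \<bar>lookup m i\<bar> \<le> int D"
        obtain m' e where e: "(\<lambda>x. if x \<in> ?\<Gamma> then monomial_at x m else 0) = cutoff ?\<Gamma> (\<lambda>x. x k powi e) * cutoff ?\<Gamma> (\<lambda>x. monomial_at x m')"
          "\<bar>e\<bar> \<le> int D" "cutoff ?\<Gamma> (\<lambda>x. monomial_at x m') \<in> mons ?\<Gamma> k D" using split[OF m] by blast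
        define L where "L = nat (int D + e)"
        have L: "int L = int D + e" "L \<le> 2 * D" using e(2) by (auto simp: L_def)
        obtain w where w: "\<And>i. cutoff ?\<Gamma> (w i) \<in> mons ?\<Gamma> k (c * L)"
          "\<And>x. x \<in> ?\<Gamma> \<Longrightarrow> (leval ?l x * x k) ^ L = (\<Sum>i<?N. w i x * x k ^ i)" using red by blast
        define \<psi> where "\<psi> i = cutoff ?\<Gamma> (\<lambda>x. monomial_at x m') * cutoff ?\<Gamma> (\<lambda>x. leval ?l x ^ (2 * D - L)) * cutoff ?\<Gamma> (w i)" for i
        have "\<psi> i \<in> mons ?\<Gamma> k (D + c * (2 * D - L) + c * L)" for i
          unfolding \<psi>_def using c[of ?N]
          by (intro mons_mult[OF \<Gamma>] e(3) w mons_power[OF \<Gamma>]) (simp add: tlead_def)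
        moreover have "D + c * (2 * D - L) + c * L = (1 + 2 * c) * D"
        proof -
          have "c * (2 * D - L) + c * L = c * (2 * D)" using L(2) by (metis add_mult_distrib2 le_add_diff_inverse2)
          then show ?thesis by (simp add: algebra_simps)
        qed
        ultimately have psi: "\<psi> i \<in> mons ?\<Gamma> k ((1 + 2 * c) * D)" for i by simp
        have "H' * (\<lambda>x. if x \<in> ?\<Gamma> then monomial_at x m else 0) = (\<Sum>i<?N. cutoff ?\<Gamma> (\<lambda>x. x k ^ i) * (H * \<psi> i))"
        proof
          fix x
          show "(H' * (\<lambda>x. if x \<in> ?\<Gamma> then monomial_at x m else 0)) x = (\<Sum>i<?N. cutoff ?\<Gamma> (\<lambda>x. x k ^ i) * (H * \<psi> i)) x"
          proof (cases "x \<in> ?\<Gamma>")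
            case True
            then have xk: "x k \<noteq> 0" using \<Gamma> nonzero_pointsD by blast
            have "x k ^ D * x k powi e = x k ^ L"
              using power_int_add[of "x k" "int D" e] xk by (simp add: L(1)[symmetric])
            moreover have "leval ?l x ^ (2 * D) = leval ?l x ^ (2 * D - L) * leval ?l x ^ L"
              using L(2) by (simp add: power_add[symmetric])
            ultimately have "leval ?l x ^ (2 * D) * x k ^ D * x k powi e = leval ?l x ^ (2 * D - L) * (leval ?l x * x k) ^ L"
              by (simp add: power_mult_distrib mult_ac)
            then have "H x * (leval ?l x ^ (2 * D) * x k ^ D * x k powi e) * monomial_at x m' =
               H x * (leval ?l x ^ (2 * D - L) * (\<Sum>i<?N. w i x * x k ^ i)) * monomial_at x m'"
              by (simp only: w(2)[OF True])
            then show ?thesis using True unfolding e(1)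
              by (simp add: H'_def \<psi>_def cutoff_def sum_distrib_left sum_distrib_right mult_ac)
          qed (simp add: cutoff_def)
        qed
        also have "\<dots> \<in> fvec.span T'"
        proof (rule fvec.span_sum)
          fix i assume i: "i \<in> {..<?N}"
          have "cutoff ?\<Gamma> (\<lambda>x. x k ^ i) * (H * \<psi> i) \<in> fvec.span ((\<lambda>\<tau>. cutoff ?\<Gamma> (\<lambda>x. x k ^ i) * \<tau>) ` T)"
            by (rule span_mult_image[OF TH(4)[OF psi]])
          also have "\<dots> \<subseteq> fvec.span T'" 
          proof (rule fvec.span_mono, rule subsetI)
            fix \<phi> assume "\<phi> \<in> (\<lambda>\<tau>. cutoff ?\<Gamma> (\<lambda>x. x k ^ i) * \<tau>) ` T"
            then obtain \<tau> where \<tau>: "\<tau> \<in> T" "\<phi> = cutoff ?\<Gamma> (\<lambda>x. x k ^ i) * \<tau>" by blast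
            then have "(i, \<tau>) \<in> {..<?N} \<times> T" using i by auto
            then show "\<phi> \<in> T'" unfolding T'_def by (rule rev_image_eqI) (simp only: \<tau>(2) prod.case)
          qed
          finally show "cutoff ?\<Gamma> (\<lambda>x. x k ^ i) * (H * \<psi> i) \<in> fvec.span T'" .
        qed
        finally show "H' * (\<lambda>x. if x \<in> ?\<Gamma> then monomial_at x m else 0) \<in> fvec.span T'" .
      qed
      moreover have "finite T'" using TH by (simp add: T'_def)
      ultimately show "\<exists>T H. finite T \<and> card T \<le> ?N * K * (C * (1 + 2 * c) * D + 1) ^ ?r \<and>
        (\<forall>x\<in>?\<Gamma>. H x \<noteq> 0) \<and> (\<forall>\<phi>\<in>mons ?\<Gamma> (Suc k) D. H * \<phi> \<in> fvec.span T)"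
        using cT' H' by blast
    qed
  qed
qed

lemma mons_prod:
  assumes \<Gamma>: "\<Gamma> \<subseteq> nonzero_points" and u: "\<And>i. i \<le> r \<Longrightarrow> cutoff \<Gamma> (u i) \<in> mons \<Gamma> k c"
    and \<alpha>: "\<And>i. i \<le> r \<Longrightarrow> \<alpha> i < D"
  shows "cutoff \<Gamma> (\<lambda>x. \<Prod>i\<le>r. u i x ^ \<alpha> i) \<in> mons \<Gamma> k (c * Suc r * D)"
  using u \<alpha>
proof (induction r)
  case 0
  have "cutoff \<Gamma> (\<lambda>x. u 0 x ^ \<alpha> 0) \<in> mons \<Gamma> k (c * \<alpha> 0)" by (intro mons_power[OF \<Gamma>]) (use 0 in auto)
  moreover have "c * \<alpha> 0 \<le> c * D" using 0(2)[of 0] by (intro mult_left_mono) auto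
  ultimately show ?case using mons_mono[of "c * \<alpha> 0" "c * D" \<Gamma> k] by auto
next
  case (Suc r)
  have "cutoff \<Gamma> (\<lambda>x. \<Prod>i\<le>r. u i x ^ \<alpha> i) \<in> mons \<Gamma> k (c * Suc r * D)" using Suc by auto
  moreover have "cutoff \<Gamma> (\<lambda>x. u (Suc r) x ^ \<alpha> (Suc r)) \<in> mons \<Gamma> k (c * \<alpha> (Suc r))"
    by (intro mons_power[OF \<Gamma>]) (use Suc in auto)
  ultimately have "cutoff \<Gamma> (\<lambda>x. \<Prod>i\<le>Suc r. u i x ^ \<alpha> i) \<in> mons \<Gamma> k (c * Suc r * D + c * \<alpha> (Suc r))"
    using mons_mult[OF \<Gamma>] by (simp add: cutoff_mult)
  moreover have "c * \<alpha> (Suc r) \<le> c * D" using Suc.prems(2)[of "Suc r"] by (intro mult_left_mono) auto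
  then have "c * Suc r * D + c * \<alpha> (Suc r) \<le> c * Suc (Suc r) * D" by (simp add: algebra_simps)
  ultimately show ?case using mons_mono by blast
qed

text \<open>The free coordinates bound the transcendence degree: \<open>growth\<close> and
  \<open>growth_dependency\<close> give a relation on the chart, and the chart is dense in
  \<open>V\<close>.\<close>

lemma laurent_dependent:
  assumes V: "variety n V" and k: "k \<le> n" and u: "\<And>i. u i \<in> laurent k"
  shows "\<exists>G\<in>pfun {..card (free_vars k V)}. (\<exists>y. G y \<noteq> 0) \<and> (\<forall>x\<in>V. G (\<lambda>i. leval (u i) x) = 0)"
proof -
  let ?\<Gamma> = "chart n V" and ?r = "card (free_vars k V)"
  have \<Gamma>: "?\<Gamma> \<subseteq> nonzero_points" using chart_subset variety_nonzero[OF V] by blast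
  from growth[OF V k] obtain K C where "\<forall>D. \<exists>T H. finite T \<and> card T \<le> K * (C * D + 1) ^ ?r \<and>
    (\<forall>x\<in>?\<Gamma>. H x \<noteq> 0) \<and> (\<forall>\<phi>\<in>mons ?\<Gamma> k D. H * \<phi> \<in> fvec.span T)" by (elim exE)
  note KC = this[THEN spec]
  obtain De where De: "\<And>i. restr ?\<Gamma> (u i) \<in> mons ?\<Gamma> k (De i)" using mons_restr[OF u] by metis
  define c where "c = (\<Sum>i\<le>?r. De i)"
  have c: "cutoff ?\<Gamma> (leval (u i)) \<in> mons ?\<Gamma> k c" if "i \<le> ?r" for i
  proof -
    have "De i \<le> c" unfolding c_def using that by (intro member_le_sum) auto
    then show ?thesis using De[of i] mons_mono unfolding restr_def cutoff_def by blast
  qed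
  have "\<exists>G\<in>pfun {..?r}. (\<exists>y. G y \<noteq> 0) \<and> (\<forall>x\<in>?\<Gamma>. G (\<lambda>i. leval (u i) x) = 0)"
  proof (rule growth_dependency[of K "C * (c * Suc ?r)" ?r])
    fix D
    obtain T H where TH: "finite T" "card T \<le> K * (C * (c * Suc ?r * D) + 1) ^ ?r" "\<forall>x\<in>?\<Gamma>. H x \<noteq> 0"
        "\<And>\<phi>. \<phi> \<in> mons ?\<Gamma> k (c * Suc ?r * D) \<Longrightarrow> H * \<phi> \<in> fvec.span T" using KC[of "c * Suc ?r * D"] by blast
    have "(\<lambda>x. if x \<in> ?\<Gamma> then H x * (\<Prod>i\<le>?r. leval (u i) x ^ \<alpha> i) else 0) \<in> fvec.span T"
      if "\<forall>i\<le>?r. \<alpha> i < D" for \<alpha>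
    proof -
      have "H * cutoff ?\<Gamma> (\<lambda>x. \<Prod>i\<le>?r. leval (u i) x ^ \<alpha> i) \<in> fvec.span T"
        by (intro TH(4) mons_prod[OF \<Gamma> c]) (use that in auto)
      moreover have "H * cutoff ?\<Gamma> (\<lambda>x. \<Prod>i\<le>?r. leval (u i) x ^ \<alpha> i) =
        (\<lambda>x. if x \<in> ?\<Gamma> then H x * (\<Prod>i\<le>?r. leval (u i) x ^ \<alpha> i) else 0)"
        by (auto simp: cutoff_def fun_eq_iff)
      ultimately show ?thesis by simp
    qed
    then show "\<exists>T H. finite T \<and> card T \<le> K * (C * (c * Suc ?r) * D + 1) ^ ?r \<and> (\<forall>x\<in>?\<Gamma>. H x \<noteq> 0) \<and>
      (\<forall>\<alpha>. (\<forall>i\<le>?r. \<alpha> i < D) \<longrightarrow> (\<lambda>x. if x \<in> ?\<Gamma> then H x * (\<Prod>i\<le>?r. leval (u i) x ^ \<alpha> i) else 0) \<in> fvec.span T)"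
      using TH by (intro exI[of _ T] exI[of _ H]) (auto simp: mult.assoc)
  qed
  then obtain G where G: "G \<in> pfun {..?r}" "\<exists>y. G y \<noteq> 0" "\<And>x. x \<in> ?\<Gamma> \<Longrightarrow> G (\<lambda>i. leval (u i) x) = 0" by blast
  obtain q where q: "q \<in> laurent n" "\<And>x. x \<in> nonzero_points \<Longrightarrow> leval q x = G (\<lambda>i. leval (u i) x)"
    using pfun_laurent[OF G(1), of u n] u laurent_mono[OF _ k] by metis
  have "vanishes V q" by (rule chart_vanishes[OF V q(1)]) (use G(3) q(2) \<Gamma> in auto)
  then have "\<forall>x\<in>V. G (\<lambda>i. leval (u i) x) = 0" using q(2) variety_nonzero[OF V] by (auto simp: vanishes_def subset_iff)
  then show ?thesis using G by blast
qed

section \<open>Dimension\<close>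

subsection \<open>Tangent spaces on the chart\<close>

text \<open>Tangent vectors in the coordinates v_i / x_i. An invariant form becomes the pairing with
  its constant coefficient vector, and translations in the torus act trivially on these
  coordinates.\<close>

definition log_tangent :: "nat \<Rightarrow> (nat \<Rightarrow> complex) set \<Rightarrow> (nat \<Rightarrow> complex) \<Rightarrow> (nat \<Rightarrow> complex) set" where
  "log_tangent n V x = {\<eta> \<in> coord_space n. \<forall>f \<in> vanishing_ideal n V. log_deriv n x \<eta> f = 0}"

lemma tangent_space_log:
  assumes "x \<in> nonzero_points"
  shows "v \<in> tangent_space n V x \<longleftrightarrow> (\<lambda>i. v i / x i) \<in> log_tangent n V x"
proof -
  have "(\<Sum>i<n. deriv (\<lambda>t. leval f (x(i := t))) (x i) * v i) = log_deriv n x (\<lambda>i. v i / x i) f" for f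
    unfolding log_deriv_def
    by (intro sum.cong refl) (simp add: DERIV_imp_deriv[OF has_derivative_coordinate[OF assms]])
  then show ?thesis
    using nonzero_pointsD[OF assms] by (auto simp: tangent_space_def log_tangent_def coord_space_def)
qed

lemma inv_form_log: "inv_form n c x v = (\<Sum>l<n. c l * (v l / x l))"
  by (simp add: inv_form_def)

lemma tangent_space_image:
  assumes "x \<in> nonzero_points"
  shows "tangent_space n V x = (\<lambda>\<eta>. x * \<eta>) ` log_tangent n V x"
proof (intro equalityI subsetI)
  fix v assume "v \<in> tangent_space n V x"
  then have "(\<lambda>i. v i / x i) \<in> log_tangent n V x" by (simp add: tangent_space_log[OF assms])
  moreover have "v = x * (\<lambda>i. v i / x i)" using nonzero_pointsD[OF assms] by (auto simp: fun_eq_iff)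
  ultimately show "v \<in> (\<lambda>\<eta>. x * \<eta>) ` log_tangent n V x" by blast
next
  fix v assume "v \<in> (\<lambda>\<eta>. x * \<eta>) ` log_tangent n V x"
  then obtain \<eta> where \<eta>: "\<eta> \<in> log_tangent n V x" "v = x * \<eta>" by blast
  then have "(\<lambda>i. v i / x i) = \<eta>" using nonzero_pointsD[OF assms] by (auto simp: fun_eq_iff)
  then show "v \<in> tangent_space n V x" using \<eta> by (simp add: tangent_space_log[OF assms])
qed

lemma log_tangent_subspace: "fvec.subspace (log_tangent n V x)"
  unfolding fvec.subspace_def log_tangent_def coord_space_def fscale_def log_deriv_def
  by (auto simp: distrib_right sum.distrib mult.assoc sum_distrib_left[symmetric])

text \<open>A family dual to the coordinates in \<open>A\<close> is a basis: evaluation at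
  \<open>A\<close> shows independence, and a vector minus its expansion vanishes on
  \<open>A\<close>.\<close>

lemma dim_coordinates:
  fixes U :: "('i \<Rightarrow> 'a::field) set"
  assumes U: "fvec.subspace U" and A: "finite A"
    and u: "\<And>a. a \<in> A \<Longrightarrow> u a \<in> U" "\<And>a b. a \<in> A \<Longrightarrow> b \<in> A \<Longrightarrow> u a b = (if a = b then 1 else 0)"
    and det: "\<And>v. v \<in> U \<Longrightarrow> (\<And>a. a \<in> A \<Longrightarrow> v a = 0) \<Longrightarrow> v = 0"
  shows "fvec.dim U = card A"
proof -
  have inj: "inj_on u A"
  proof
    fix a b assume ab: "a \<in> A" "b \<in> A" "u a = u b"
    show "a = b" using u(2)[OF ab(1,2)] u(2)[OF ab(2,2)] ab(3) by (auto split: if_splits)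
  qed
  have at: "(\<Sum>a\<in>A. fscale (g a) (u a)) b = g b" if "b \<in> A" for g b
  proof -
    have "(\<Sum>a\<in>A. fscale (g a) (u a)) b = (\<Sum>a\<in>A. g a * u a b)" by (simp add: fscale_def)
    also have "\<dots> = (\<Sum>a\<in>A. if a = b then g a else 0)" by (intro sum.cong refl) (use u(2) that in auto)
    also have "\<dots> = g b" using A that by simp
    finally show ?thesis .
  qed
  have ind: "fvec.independent (u ` A)"
  proof (rule fvec.independent_if_scalars_zero)
    fix f w assume s: "(\<Sum>x\<in>u ` A. fscale (f x) x) = 0" and w: "w \<in> u ` A"
    then obtain b where b: "b \<in> A" "w = u b" by blast
    have "(\<Sum>a\<in>A. fscale (f (u a)) (u a)) = 0" using s by (simp add: sum.reindex[OF inj])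
    then have "f (u b) = 0" using at[OF b(1), of "\<lambda>a. f (u a)"] by simp
    then show "f w = 0" using b by simp
  qed (use A in simp)
  have "U \<subseteq> fvec.span (u ` A)"
  proof
    fix v assume v: "v \<in> U"
    let ?s = "\<Sum>a\<in>A. fscale (v a) (u a)"
    have "?s \<in> U" by (intro fvec.subspace_sum[OF U] fvec.subspace_scale[OF U] u)
    then have "v - ?s \<in> U" by (rule fvec.subspace_diff[OF U v])
    then have "v - ?s = 0" by (rule det) (simp only: minus_apply at diff_self)
    then have "v = ?s" by simp
    also have "?s \<in> fvec.span (u ` A)" by (intro fvec.span_sum fvec.span_scale fvec.span_base) auto
    finally show "v \<in> fvec.span (u ` A)" .
  qed
  moreover have "u ` A \<subseteq> U" using u by auto
  ultimately have "fvec.dim U = card (u ` A)" using fvec.basis_card_eq_dim[OF _ _ ind] by metis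
  then show ?thesis using card_image[OF inj] by simp
qed

lemma dim_mult_image:
  fixes s :: "'i \<Rightarrow> 'a::field"
  assumes "\<And>i. s i \<noteq> 0"
  shows "fvec.dim ((\<lambda>v. s * v) ` U) = fvec.dim U"
proof -
  interpret vp: vector_space_pair "fscale :: 'a \<Rightarrow> ('i \<Rightarrow> 'a) \<Rightarrow> _" "fscale :: 'a \<Rightarrow> ('i \<Rightarrow> 'a) \<Rightarrow> _"
    by unfold_locales
  have lin: "Vector_Spaces.linear fscale fscale (\<lambda>v. s * v)"
    by unfold_locales (auto simp: fscale_def fun_eq_iff algebra_simps)
  have inj: "inj_on (\<lambda>v. s * v) X" for X :: "('i \<Rightarrow> 'a) set"
    using assms by (auto simp: inj_on_def fun_eq_iff)
  obtain B where B: "B \<subseteq> U" "fvec.independent B" "U \<subseteq> fvec.span B" "card B = fvec.dim U"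
    using fvec.basis_exists by blast
  have "fvec.independent ((\<lambda>v. s * v) ` B)"
    by (rule vp.linear_independent_injective_image[OF lin B(2) inj])
  moreover have "(\<lambda>v. s * v) ` U \<subseteq> fvec.span ((\<lambda>v. s * v) ` B)"
    using B(3) vp.linear_span_image[OF lin, of B] by blast
  ultimately have "card ((\<lambda>v. s * v) ` B) = fvec.dim ((\<lambda>v. s * v) ` U)"
    using B(1) by (intro fvec.basis_card_eq_dim) auto
  then show ?thesis using card_image[OF inj, of B] B(4) by simp
qed

lemma log_deriv_tpoly:
  assumes "variety n V" "j \<in> alg_vars n V"
  shows "log_deriv n x \<eta> (tpoly V j) = (\<Sum>i<j. \<eta> i * leval (euler i (tpoly V j)) x) + \<eta> j * leval (euler j (tpoly V j)) x"
proof -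
  have jn: "j < n" using assms(2) by (simp add: alg_vars_def)
  have "log_deriv n x \<eta> (tpoly V j) = (\<Sum>i<Suc j. \<eta> i * leval (euler i (tpoly V j)) x)"
    unfolding log_deriv_def
  proof (rule sum.mono_neutral_right)
    show "\<forall>i\<in>{..<n} - {..<Suc j}. \<eta> i * leval (euler i (tpoly V j)) x = 0"
      using euler_laurent_zero[OF tpoly_facts(1)[OF assms]] by (auto simp: not_less)
  qed (use jn in auto)
  then show ?thesis by simp
qed

lemma vanishing_ideal_iff: "f \<in> vanishing_ideal n V \<longleftrightarrow> f \<in> laurent n \<and> vanishes V f"
  by (simp add: vanishing_ideal_def vanishes_def)

text \<open>\<open>triangular_reduction\<close>, with the derivative along \<eta> as derivation,
  reduces the whole vanishing ideal to the relations \<open>tpoly\<close>.\<close>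

lemma chart_tangent_iff:
  assumes V: "variety n V" and x: "x \<in> chart n V" and \<eta>: "\<eta> \<in> coord_space n"
  shows "\<eta> \<in> log_tangent n V x \<longleftrightarrow> (\<forall>j\<in>alg_vars n V. log_deriv n x \<eta> (tpoly V j) = 0)"
proof
  assume "\<eta> \<in> log_tangent n V x"
  then show "\<forall>j\<in>alg_vars n V. log_deriv n x \<eta> (tpoly V j) = 0"
    using tpoly_facts[OF V] by (auto simp: log_tangent_def vanishing_ideal_iff)
next
  assume a: "\<forall>j\<in>alg_vars n V. log_deriv n x \<eta> (tpoly V j) = 0"
  have xV: "x \<in> V" "x \<in> nonzero_points" using x chart_subset variety_nonzero[OF V] by auto
  have "log_deriv n x \<eta> f = 0" if f: "f \<in> vanishing_ideal n V" for f
  proof -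
    have "leval f x = 0 \<and> log_deriv n x \<eta> f = 0"
    proof (rule triangular_reduction[OF variety_nonzero[OF V] variety_nonempty[OF V] xV(2), of _ n])
      fix j assume "j < n" "\<not> transc V j"
      then have j: "j \<in> alg_vars n V" by (simp add: alg_vars_def)
      then show "leval (tlead V j) x \<noteq> 0 \<and> leval (tpoly V j) x = 0 \<and> log_deriv n x \<eta> (tpoly V j) = 0"
        using a x xV(1) tpoly_facts(5)[OF V j] by (auto simp: chart_def vanishes_def)
    qed (use f in \<open>auto simp: log_deriv_add log_deriv_mult[OF xV(2)] vanishing_ideal_iff\<close>)
    then show ?thesis by simp
  qed
  then show "\<eta> \<in> log_tangent n V x" using \<eta> by (simp add: log_tangent_def)
qed

text \<open>The relation for \<open>x_j\<close> involves only coordinates up to \<open>j\<close>,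
  and its derivative in \<open>x_j\<close> is nonzero on the chart. So the algebraic entries of
  \<eta> are solved for in increasing order without disturbing earlier relations.\<close>

lemma chart_tangent_solve:
  assumes V: "variety n V" and x: "x \<in> chart n V" and val: "val \<in> coord_space n"
  shows "\<exists>\<eta>\<in>log_tangent n V x. \<forall>a\<in>free_vars n V. \<eta> a = val a"
proof -
  have "\<exists>\<eta>\<in>coord_space n. (\<forall>a\<in>free_vars n V. \<eta> a = val a) \<and> (\<forall>j\<in>alg_vars n V. j < k \<longrightarrow> log_deriv n x \<eta> (tpoly V j) = 0)" for k
  proof (induction k)
    case 0
    then show ?case using val by auto
  next
    case (Suc k)
    then obtain \<eta> where \<eta>: "\<eta> \<in> coord_space n" "\<forall>a\<in>free_vars n V. \<eta> a = val a"
      "\<forall>j\<in>alg_vars n V. j < k \<longrightarrow> log_deriv n x \<eta> (tpoly V j) = 0" by blast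
    show ?case
    proof (cases "k \<in> alg_vars n V")
      case False
      then show ?thesis using \<eta> by (metis less_Suc_eq)
    next
      case True
      let ?P = "\<lambda>i. leval (euler i (tpoly V k)) x"
      define t where "t = - (\<Sum>i<k. \<eta> i * ?P i) / ?P k"
      have nz: "?P k \<noteq> 0" using x True by (simp add: chart_def)
      have "(\<Sum>i<k. (\<eta>(k := t)) i * ?P i) = (\<Sum>i<k. \<eta> i * ?P i)" by (rule sum.cong) auto
      then have k: "log_deriv n x (\<eta>(k := t)) (tpoly V k) = 0"
        using nz by (simp add: log_deriv_tpoly[OF V True] t_def)
      have "log_deriv n x (\<eta>(k := t)) (tpoly V j) = log_deriv n x \<eta> (tpoly V j)" if "j \<in> alg_vars n V" "j < k" for j
        unfolding log_deriv_tpoly[OF V that(1)] using that(2) by simp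
      then have "\<forall>j\<in>alg_vars n V. j < Suc k \<longrightarrow> log_deriv n x (\<eta>(k := t)) (tpoly V j) = 0"
        using k \<eta>(3) by (auto simp: less_Suc_eq)
      moreover have "k < n" "k \<notin> free_vars n V" using True by (auto simp: alg_vars_def free_vars_def)
      then have "\<eta>(k := t) \<in> coord_space n" "\<forall>a\<in>free_vars n V. (\<eta>(k := t)) a = val a"
        using \<eta> by (auto simp: coord_space_def)
      ultimately show ?thesis by blast
    qed
  qed
  from this[of n] obtain \<eta> where "\<eta> \<in> coord_space n" "\<forall>a\<in>free_vars n V. \<eta> a = val a"
      "\<forall>j\<in>alg_vars n V. j < n \<longrightarrow> log_deriv n x \<eta> (tpoly V j) = 0" by blast
  then show ?thesis using chart_tangent_iff[OF V x] by (auto simp: alg_vars_def)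
qed

lemma chart_tangent_unique:
  assumes V: "variety n V" and x: "x \<in> chart n V" and \<eta>: "\<eta> \<in> log_tangent n V x"
    and z: "\<And>a. a \<in> free_vars n V \<Longrightarrow> \<eta> a = 0"
  shows "\<eta> = 0"
proof
  have \<eta>c: "\<eta> \<in> coord_space n" using \<eta> by (simp add: log_tangent_def)
  fix i show "\<eta> i = 0 i"
  proof (induction i rule: less_induct)
    case (less i)
    consider "i \<in> free_vars n V" | "i \<in> alg_vars n V" | "i \<ge> n" by (force simp: free_vars_def alg_vars_def)
    then show ?case
    proof cases
      case 2
      have "log_deriv n x \<eta> (tpoly V i) = 0" using \<eta> chart_tangent_iff[OF V x \<eta>c] 2 by simp
      then show ?thesis using less 2 x by (auto simp: log_deriv_tpoly[OF V 2] chart_def)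
    qed (use z \<eta>c in \<open>auto simp: coord_space_def\<close>)
  qed
qed

lemma free_vars_less: "a \<in> free_vars n V \<Longrightarrow> a < n" by (simp add: free_vars_def)

lemma dim_chart_tangent:
  assumes V: "variety n V" and x: "x \<in> chart n V"
  shows "fvec.dim (tangent_space n V x) = card (free_vars n V)"
proof -
  have xn: "x \<in> nonzero_points" using x chart_subset variety_nonzero[OF V] by blast
  have "\<exists>\<eta>\<in>log_tangent n V x. \<forall>b\<in>free_vars n V. \<eta> b = (if a = b then 1 else 0)" if a: "a \<in> free_vars n V" for a
  proof -
    have "(\<lambda>b. if a = b then 1 else 0) \<in> coord_space n" using free_vars_less[OF a] by (auto simp: coord_space_def)
    from chart_tangent_solve[OF V x this] show ?thesis .
  qed
  then obtain u where u: "\<And>a. a \<in> free_vars n V \<Longrightarrow> u a \<in> log_tangent n V x"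
    "\<And>a b. a \<in> free_vars n V \<Longrightarrow> b \<in> free_vars n V \<Longrightarrow> u a b = (if a = b then 1 else 0)" by metis
  have "fvec.dim (log_tangent n V x) = card (free_vars n V)"
    using dim_coordinates[OF log_tangent_subspace finite_vars(1) u] chart_tangent_unique[OF V x] by blast
  then show ?thesis
    unfolding tangent_space_image[OF xn] using dim_mult_image[of x] nonzero_pointsD[OF xn] by simp
qed

text \<open>In the algebraic coordinates the differentials of the relations are triangular with
  nonzero diagonal, so multipliers that match \<open>c\<close> there exist. In the free coordinates
  the match is forced by testing against tangent vectors.\<close>

lemma chart_conormal:
  assumes V: "variety n V" and x: "x \<in> chart n V"
    and c: "\<And>\<eta>. \<eta> \<in> log_tangent n V x \<Longrightarrow> (\<Sum>l<n. c l * \<eta> l) = 0"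
  shows "\<exists>\<mu>. \<forall>l<n. c l = (\<Sum>j\<in>alg_vars n V. \<mu> j * covector (tpoly V j) x l)"
proof -
  let ?B = "alg_vars n V"
  let ?M = "\<lambda>i l. covector (tpoly V i) x l"
  have M0: "?M i l = 0" if "i \<in> ?B" "i < l" for i l
    using euler_laurent_zero[OF tpoly_facts(1)[OF V that(1)], of l] that by (simp add: covector_def)
  \<comment> \<open>The multipliers are found from the largest index downwards. The differential of
    the relation for \<open>x_k\<close> has no entries beyond \<open>k\<close>, so a new multiplier
    leaves the equations at larger indices intact.\<close>
  define S where "S k = {i\<in>?B. k \<le> i}" for k
  have "\<exists>\<mu>. \<forall>j\<in>S 0. c j = (\<Sum>i\<in>S 0. \<mu> i * ?M i j)"
  proof (rule inc_induct[of 0 n])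
    show "\<exists>\<mu>. \<forall>j\<in>S n. c j = (\<Sum>i\<in>S n. \<mu> i * ?M i j)" by (rule exI) (auto simp: S_def alg_vars_def)
  next
    fix k assume "\<exists>\<mu>. \<forall>j\<in>S (Suc k). c j = (\<Sum>i\<in>S (Suc k). \<mu> i * ?M i j)"
    then obtain \<mu> where \<mu>: "\<forall>j\<in>S (Suc k). c j = (\<Sum>i\<in>S (Suc k). \<mu> i * ?M i j)" by blast
    show "\<exists>\<mu>. \<forall>j\<in>S k. c j = (\<Sum>i\<in>S k. \<mu> i * ?M i j)"
    proof (cases "k \<in> ?B")
      case False
      then have "S k = S (Suc k)" by (auto simp: S_def Suc_le_eq order_le_less)
      then show ?thesis using \<mu> by auto
    next
      case True
      then have Sk: "S k = insert k (S (Suc k))" "k \<notin> S (Suc k)" by (auto simp: S_def Suc_le_eq order_le_less)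
      have fin: "finite (S (Suc k))" by (simp add: S_def)
      have nz: "?M k k \<noteq> 0" using x True by (simp add: chart_def covector_def)
      define t where "t = (c k - (\<Sum>i\<in>S (Suc k). \<mu> i * ?M i k)) / ?M k k"
      have "c j = (\<Sum>i\<in>S k. (\<mu>(k := t)) i * ?M i j)" if j: "j \<in> S k" for j
      proof -
        have "(\<Sum>i\<in>S k. (\<mu>(k := t)) i * ?M i j) = t * ?M k j + (\<Sum>i\<in>S (Suc k). (\<mu>(k := t)) i * ?M i j)"
          using Sk fin by simp
        also have "(\<Sum>i\<in>S (Suc k). (\<mu>(k := t)) i * ?M i j) = (\<Sum>i\<in>S (Suc k). \<mu> i * ?M i j)"
          using Sk(2) by (intro sum.cong) auto
        also have "t * ?M k j + \<dots> = c j"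
        proof (cases "j = k")
          case True
          then show ?thesis using nz by (simp add: t_def)
        next
          case False
          then have "j \<in> S (Suc k)" "k < j" using j Sk by (auto simp: S_def)
          then show ?thesis using \<mu> M0[OF True] by simp
        qed
        finally show ?thesis by simp
      qed
      then show ?thesis by blast
    qed
  qed simp
  moreover have "S 0 = ?B" by (simp add: S_def)
  ultimately obtain \<mu> where \<mu>: "\<And>j. j \<in> ?B \<Longrightarrow> c j = (\<Sum>i\<in>?B. \<mu> i * ?M i j)" by auto
  have "c l = (\<Sum>i\<in>?B. \<mu> i * ?M i l)" if l: "l < n" for l
  proof (cases "l \<in> ?B")
    case False
    then have lf: "l \<in> free_vars n V" using l by (simp add: free_vars_def alg_vars_def)
    have "(\<lambda>b. if l = b then 1 else 0) \<in> coord_space n" using l by (auto simp: coord_space_def)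
    then obtain \<eta> where \<eta>: "\<eta> \<in> log_tangent n V x" "\<forall>b\<in>free_vars n V. \<eta> b = (if l = b then 1 else 0)"
      using chart_tangent_solve[OF V x] by blast
    \<comment> \<open>The difference vanishes at the algebraic coordinates, and among the free ones
      \<eta> has its only nonzero entry, 1, at \<open>l\<close>. Their pairing is therefore
      \<open>d l\<close>.\<close>
    define d where "d i = c i - (\<Sum>j\<in>?B. \<mu> j * ?M j i)" for i
    have "(\<Sum>i<n. \<eta> i * (\<Sum>j\<in>?B. \<mu> j * ?M j i)) = (\<Sum>j\<in>?B. \<mu> j * log_deriv n x \<eta> (tpoly V j))"
      unfolding log_deriv_covector sum_distrib_left by (subst sum.swap) (simp add: mult_ac)
    also have "\<dots> = 0" using \<eta>(1) tpoly_facts(2,5)[OF V] by (auto simp: log_tangent_def vanishing_ideal_iff intro!: sum.neutral)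
    finally have "(\<Sum>i<n. d i * \<eta> i) = 0"
      using c[OF \<eta>(1)] by (simp add: d_def left_diff_distrib right_diff_distrib sum_subtractf mult.commute)
    moreover have "d i * \<eta> i = (if i = l then d l else 0)" if "i < n" for i
    proof (cases "i \<in> ?B")
      case True
      then show ?thesis using \<mu> False by (auto simp: d_def)
    next
      case False
      then have "i \<in> free_vars n V" using that by (simp add: free_vars_def alg_vars_def)
      then show ?thesis using \<eta>(2) by auto
    qed
    then have "(\<Sum>i<n. d i * \<eta> i) = d l" using l by simp
    ultimately show ?thesis by (simp add: d_def)
  qed (use \<mu> in simp)
  then show ?thesis by blast
qed

subsection \<open>Krull dimension\<close>

definition indep_on :: "(nat \<Rightarrow> complex) set \<Rightarrow> nat \<Rightarrow> (nat \<Rightarrow> laurent_poly) \<Rightarrow> bool" where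
  "indep_on X r u \<longleftrightarrow> (\<forall>G\<in>pfun {..<r}. (\<forall>x\<in>X. G (\<lambda>i. leval (u i) x) = 0) \<longrightarrow> (\<forall>y. G y = 0))"

lemma indep_on_bound:
  assumes V: "variety n V" and u: "indep_on V r u" "\<And>i. i < r \<Longrightarrow> u i \<in> laurent n"
  shows "r \<le> card (free_vars n V)"
proof (rule ccontr)
  assume r: "\<not> ?thesis"
  let ?d = "card (free_vars n V)"
  have "(if i < r then u i else 0) \<in> laurent n" for i using u(2) by simp
  from laurent_dependent[OF V order_refl, of "\<lambda>i. if i < r then u i else 0", OF this]
  obtain G where G: "G \<in> pfun {..?d}" "\<exists>y. G y \<noteq> 0" "\<And>x. x \<in> V \<Longrightarrow> G (\<lambda>i. leval (if i < r then u i else 0) x) = 0"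
    by blast
  have "G \<in> pfun {..<r}" by (rule pfun_mono[OF G(1)]) (use r in auto)
  moreover have "G (\<lambda>i. leval (u i) x) = 0" if "x \<in> V" for x
    using G(3)[OF that] pfun_cong[OF G(1), of "\<lambda>i. leval (u i) x" "\<lambda>i. leval (if i < r then u i else 0) x"] r by auto
  ultimately show False using u(1) G(2) unfolding indep_on_def by blast
qed

text \<open>Write a relation as a polynomial in \<open>f\<close>. On \<open>C\<close> only its
  constant coefficient survives, so this is zero by independence on \<open>C\<close>; irreducibility
  of \<open>V\<close> allows dividing by \<open>f\<close> and repeating.\<close>

lemma indep_on_extend:
  assumes V: "variety n V" and u: "indep_on C r u" "\<And>i. u i \<in> laurent n" "C \<subseteq> V"
    and f: "f \<in> laurent n" "vanishes C f" "\<not> vanishes V f"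
  shows "indep_on V (Suc r) (u(r := f))"
  unfolding indep_on_def
proof (intro ballI impI)
  fix G assume G: "G \<in> pfun {..<Suc r}" and van: "\<forall>x\<in>V. G (\<lambda>i. leval ((u(r := f)) i) x) = 0"
  have Vn: "V \<subseteq> nonzero_points" by (rule variety_nonzero[OF V])
  have "\<exists>N a. (\<forall>e. a e \<in> pfun {..<r}) \<and> (\<forall>y. G y = (\<Sum>e\<le>N. a e y * y r ^ e))"
    using pfun_expand[of G r "{..<r}"] G by (simp add: lessThan_Suc)
  then obtain N a where a: "\<And>e. a e \<in> pfun {..<r}" "\<And>y. G y = (\<Sum>e\<le>N. a e y * y r ^ e)" by blast
  have au: "a e (\<lambda>i. leval ((u(r := f)) i) x) = a e (\<lambda>i. leval (u i) x)" for e x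
    by (rule pfun_cong[OF a(1)]) auto
  have "\<forall>e\<le>N. \<forall>y. a e y = 0"
    if "\<And>e. a e \<in> pfun {..<r}" "\<And>x. x \<in> V \<Longrightarrow> (\<Sum>e\<le>N. a e (\<lambda>i. leval (u i) x) * leval f x ^ e) = 0" for N a
    using that
  proof (induction N arbitrary: a)
    case 0
    then have "\<forall>y. a 0 y = 0" using u unfolding indep_on_def by (auto simp: subset_iff)
    then show ?case by simp
  next
    case (Suc N)
    have "a 0 (\<lambda>i. leval (u i) x) = 0" if "x \<in> C" for x
    proof -
      have "x \<in> V" "leval f x = 0" using that f(2) u(3) by (auto simp: vanishes_def)
      then show ?thesis using Suc.prems(2)[of x] unfolding sum.atMost_Suc_shift by simp
    qed
    then have a0: "a 0 y = 0" for y using u(1) Suc.prems(1)[of 0] unfolding indep_on_def by blast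
    have sh: "leval f x * (\<Sum>e\<le>N. a (Suc e) (\<lambda>i. leval (u i) x) * leval f x ^ e) = 0" if "x \<in> V" for x
      using Suc.prems(2)[OF that] unfolding sum.atMost_Suc_shift by (simp add: a0 sum_distrib_left mult_ac)
    define Q where "Q y = (\<Sum>e\<le>N. a (Suc e) y * y r ^ e)" for y
    have "Q \<in> pfun {..<Suc r}" unfolding Q_def[abs_def]
      by (intro pfun_sum pfun.mult pfun_power pfun.proj pfun_mono[OF Suc.prems(1)]) auto
    then obtain q where q: "q \<in> laurent n" "\<And>x. x \<in> nonzero_points \<Longrightarrow> leval q x = Q (\<lambda>i. leval ((u(r := f)) i) x)"
      using pfun_laurent[of Q "{..<Suc r}" "u(r := f)" n] u(2) f(1) by fastforce
    have Qu: "Q (\<lambda>i. leval ((u(r := f)) i) x) = (\<Sum>e\<le>N. a (Suc e) (\<lambda>i. leval (u i) x) * leval f x ^ e)" for x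
      unfolding Q_def using pfun_cong[OF Suc.prems(1), of "\<lambda>i. leval ((u(r := f)) i) x" "\<lambda>i. leval (u i) x"] by simp
    have "leval f x * leval q x = 0" if "x \<in> V" for x using sh[OF that] q(2) Vn that Qu by (auto simp: subset_iff)
    then have "\<forall>x\<in>V. leval q x = 0" using variety_prime[OF V f(1) q(1)] f(3) by (auto simp: vanishes_def)
    then have "(\<Sum>e\<le>N. a (Suc e) (\<lambda>i. leval (u i) x) * leval f x ^ e) = 0" if "x \<in> V" for x
      using q(2) Qu Vn that by (metis subsetD)
    from Suc.IH[of "\<lambda>e. a (Suc e)", OF Suc.prems(1) this] have "\<forall>e\<le>N. \<forall>y. a (Suc e) y = 0" .
    then show ?case using a0 by (metis Suc_le_mono not0_implies_Suc)
  qed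
  from this[of a N] have "\<forall>e\<le>N. \<forall>y. a e y = 0" using a van au by simp
  then show "\<forall>y. G y = 0" by (simp add: a(2))
qed

lemma closed_separate:
  assumes "zariski_closed n C" "C \<subset> C'" "C' \<subseteq> torus n"
  shows "\<exists>f\<in>vanishing_ideal n C. \<not> vanishes C' f"
proof -
  obtain x where "x \<in> C'" "x \<notin> C" using assms(2) by blast
  then show ?thesis using zariski_closed_memI[OF assms(1), of x] assms(3) by (auto simp: vanishes_def)
qed

text \<open>Each strict inclusion supplies a function that vanishes on the smaller variety but not
  on the larger, and \<open>indep_on_extend\<close> adds it to the independent family.\<close>

lemma chain_bound:
  assumes C: "\<And>i. i \<le> d \<Longrightarrow> variety n (C i)" "\<And>i. i < d \<Longrightarrow> C i \<subset> C (Suc i)"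
  shows "d \<le> card (free_vars n (C d))"
proof -
  have "k \<le> d \<Longrightarrow> \<exists>u. (\<forall>i. u i \<in> laurent n) \<and> indep_on (C k) k u" for k
  proof (induction k)
    case 0
    obtain x where x: "x \<in> C 0" using variety_nonempty[OF C(1)] 0 by blast
    have "indep_on (C 0) 0 (\<lambda>_. 0)" unfolding indep_on_def
    proof (intro ballI impI allI)
      fix G :: "(nat \<Rightarrow> complex) \<Rightarrow> complex" and y
      assume G: "G \<in> pfun {..<0}" "\<forall>x\<in>C 0. G (\<lambda>i. leval ((\<lambda>_. 0) i) x) = 0"
      have "G y = G (\<lambda>i. leval 0 x)" by (rule pfun_cong[OF G(1)]) simp
      then show "G y = 0" using bspec[OF G(2) x] by simp
    qed
    then show ?case by (intro exI[of _ "\<lambda>_. 0"]) auto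
  next
    case (Suc k)
    then obtain u where u: "\<And>i. u i \<in> laurent n" "indep_on (C k) k u" by auto
    obtain f where f: "f \<in> vanishing_ideal n (C k)" "\<not> vanishes (C (Suc k)) f"
      using closed_separate[OF variety_closed[OF C(1)] C(2) variety_torus[OF C(1)]] Suc.prems by (metis Suc_leD Suc_le_lessD)
    have "indep_on (C (Suc k)) (Suc k) (u(k := f))"
      using indep_on_extend[OF C(1)[OF Suc.prems] u(2,1)] C(2)[of k] f Suc.prems by (auto simp: vanishing_ideal_iff)
    moreover have "(u(k := f)) i \<in> laurent n" for i using u(1) f(1) by (simp add: vanishing_ideal_iff)
    ultimately show ?case by blast
  qed
  then obtain u where "\<And>i. u i \<in> laurent n" "indep_on (C d) d u" by blast
  then show ?thesis using indep_on_bound[OF C(1)[OF order_refl]] by blast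
qed

section \<open>Dense coordinate projections, lifting of points and hyperplane sections\<close>

definition indep_coords :: "(nat \<Rightarrow> complex) set \<Rightarrow> nat set \<Rightarrow> bool" where
  "indep_coords X A \<longleftrightarrow> (\<forall>G\<in>pfun A. (\<forall>x\<in>X. G x = 0) \<longrightarrow> (\<forall>y. G y = 0))"

lemma indep_coords_bound:
  assumes V: "variety n V" and A: "indep_coords V A" "A \<subseteq> {..<n}"
  shows "card A \<le> card (free_vars n V)"
proof -
  have fin: "finite A" using A(2) finite_subset by blast
  from ex_bij_betw_nat_finite[OF this] obtain e where e: "bij_betw e {..<card A} A" unfolding atLeast0LessThan ..
  have "indep_on V (card A) (\<lambda>i. lvar (e i) 1)" unfolding indep_on_def
  proof (intro ballI impI allI)
    fix G :: "(nat \<Rightarrow> complex) \<Rightarrow> complex" and y :: "nat \<Rightarrow> complex"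
    assume G: "G \<in> pfun {..<card A}" "\<forall>x\<in>V. G (\<lambda>i. leval (lvar (e i) 1) x) = 0"
    have 1: "(\<lambda>c. G (\<lambda>i. c (e i))) \<in> pfun A"
      by (rule pfun_subst[OF G(1)]) (use e in \<open>auto intro!: pfun.proj simp: bij_betw_def\<close>)
    have 2: "\<forall>x\<in>V. G (\<lambda>i. x (e i)) = 0" using G(2) by (simp add: leval_lvar)
    have *: "G (\<lambda>i. c (e i)) = 0" for c
      using A(1)[unfolded indep_coords_def, THEN bspec, OF 1, THEN mp, OF 2] by blast
    let ?c = "\<lambda>a. y (the_inv_into {..<card A} e a)"
    have "G y = G (\<lambda>i. ?c (e i))"
      by (rule pfun_cong[OF G(1)]) (use e in \<open>simp add: bij_betw_def the_inv_into_f_f\<close>)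
    then show "G y = 0" using *[of ?c] by simp
  qed
  then show ?thesis
    by (rule indep_on_bound[OF V]) (use e A(2) in \<open>auto simp: bij_betw_def intro!: lvar_laurent\<close>)
qed

lemma coord_laurent:
  assumes "G \<in> pfun A" "A \<subseteq> {..<k}"
  shows "\<exists>q\<in>laurent k. \<forall>x\<in>nonzero_points. leval q x = G x"
  using pfun_laurent[OF assms(1), of "\<lambda>i. lvar i 1" k] assms(2) by (auto simp: leval_lvar intro: lvar_laurent)

text \<open>A relation is expanded in the last free coordinate, whose transcendence makes every
  coefficient vanish on \<open>V\<close>.\<close>

lemma free_vars_indep:
  assumes V: "variety n V"
  shows "indep_coords V (free_vars n V)"
proof -
  have Vn: "V \<subseteq> nonzero_points" by (rule variety_nonzero[OF V])
  have "\<forall>y. G y = 0" if "G \<in> pfun (free_vars k V)" "\<forall>x\<in>V. G x = 0" for G k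
    using that
  proof (induction k arbitrary: G)
    case 0
    obtain x where x: "x \<in> V" using variety_nonempty[OF V] by blast
    have "G y = G x" for y by (rule pfun_cong[OF 0(1)]) (simp add: free_vars_def)
    then show ?case using 0(2) x by simp
  next
    case (Suc k)
    show ?case
    proof (cases "transc V k")
      case False
      then have "free_vars (Suc k) V = free_vars k V" by (auto simp: free_vars_def less_Suc_eq)
      then show ?thesis using Suc by simp
    next
      case True
      then have "free_vars (Suc k) V = insert k (free_vars k V)" by (auto simp: free_vars_def less_Suc_eq)
      then obtain N a where a: "\<And>e. a e \<in> pfun (free_vars k V)" "\<And>y. G y = (\<Sum>e\<le>N. a e y * y k ^ e)"
        using pfun_expand[of G k "free_vars k V"] Suc.prems(1) by auto
      have "\<exists>q\<in>laurent k. \<forall>x\<in>nonzero_points. leval q x = a e x" for e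
        by (rule coord_laurent[OF a(1)]) (auto simp: free_vars_def)
      then obtain q where q: "\<And>e. q e \<in> laurent k" "\<And>e x. x \<in> nonzero_points \<Longrightarrow> leval (q e) x = a e x" by metis
      have "vanishes V (psum q N k)"
        using Suc.prems(2) Vn by (auto simp: vanishes_def leval_psum q(2) a(2) subset_iff)
      then have "\<forall>e\<le>N. vanishes V (q e)" using True q(1) by (simp add: transc_def)
      then have "\<forall>e\<le>N. \<forall>x\<in>V. a e x = 0" using q(2) Vn by (auto simp: vanishes_def subset_iff)
      then have "\<forall>e\<le>N. \<forall>y. a e y = 0" using Suc.IH[OF a(1)] by blast
      then show ?thesis by (simp add: a(2))
    qed
  qed
  then show ?thesis unfolding indep_coords_def by blast
qed

text \<open>Density of the complement of finitely many hypersurfaces. It removes side conditions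
  such as nonzero parameters or membership in the chart.\<close>

lemma pfun_vanish_open:
  assumes "finite S" "G \<in> pfun A" "\<And>s. s \<in> S \<Longrightarrow> P s \<in> pfun A" "\<And>s. s \<in> S \<Longrightarrow> \<exists>c. P s c \<noteq> 0"
    "\<And>c. (\<And>s. s \<in> S \<Longrightarrow> P s c \<noteq> 0) \<Longrightarrow> G c = 0"
  shows "G y = 0"
proof (rule ccontr)
  assume y: "G y \<noteq> 0"
  define Q where "Q s = (case s of None \<Rightarrow> G | Some s \<Rightarrow> P s)" for s
  have "\<exists>c\<in>UNIV. \<forall>s\<in>insert None (Some ` S). Q s c \<noteq> 0"
    by (rule pfun_nonzero_prod[where A=A]) (use assms y in \<open>auto simp: Q_def\<close>)
  then obtain c where c: "\<forall>s\<in>insert None (Some ` S). Q s c \<noteq> 0" by blast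
  then have "P s c \<noteq> 0" if "s \<in> S" for s using that by (auto simp: Q_def)
  from assms(5)[OF this] have "G c = 0" .
  moreover have "G c \<noteq> 0" using c by (auto simp: Q_def)
  ultimately show False by simp
qed

text \<open>A substitute for the norm: \<open>u\<close> is algebraic over the free coordinates, and
  the lowest nonzero coefficient of a relation for \<open>u\<close> is a multiple of
  \<open>u\<close> on \<open>V\<close>.\<close>

lemma laurent_norm:
  assumes V: "variety n V" and k: "k \<le> n" and u: "u \<in> laurent k" "\<not> vanishes V u"
  shows "\<exists>B\<in>pfun (free_vars k V). \<exists>a\<in>laurent k. (\<exists>y. B y \<noteq> 0) \<and> (\<forall>x\<in>V. B x = leval a x * leval u x)"
proof -
  have Vn: "V \<subseteq> nonzero_points" by (rule variety_nonzero[OF V])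
  let ?A = "free_vars k V"
  let ?r = "card ?A"
  from ex_bij_betw_nat_finite[of ?A] obtain e where e: "bij_betw e {..<?r} ?A" unfolding atLeast0LessThan by auto
  have ek: "e i < k" if "i < ?r" for i using e that by (auto simp: bij_betw_def free_vars_def)
  define z where "z i = (if i < ?r then lvar (e i) 1 else u)" for i
  have z: "z i \<in> laurent k" for i using u(1) ek by (auto simp: z_def intro: lvar_laurent)
  obtain G where G: "G \<in> pfun {..?r}" "\<exists>y. G y \<noteq> 0" "\<And>x. x \<in> V \<Longrightarrow> G (\<lambda>i. leval (z i) x) = 0"
    using laurent_dependent[OF V k, of z, OF z] by blast
  have "{..?r} = insert ?r {..<?r}" by auto
  then obtain N a where a: "\<And>i. a i \<in> pfun {..<?r}" "\<And>y. G y = (\<Sum>i\<le>N. a i y * y ?r ^ i)"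
    using pfun_expand[of G ?r "{..<?r}"] G(1) by auto
  define b where "b i y = a i (\<lambda>l. y (e l))" for i and y :: "nat \<Rightarrow> complex"
  have b: "b i \<in> pfun ?A" for i
    unfolding b_def[abs_def] by (rule pfun_subst[OF a(1)]) (use e in \<open>auto intro!: pfun.proj simp: bij_betw_def\<close>)
  have az: "a i (\<lambda>l. leval (z l) x) = b i x" for i x
    unfolding b_def by (rule pfun_cong[OF a(1)]) (simp add: z_def leval_lvar)
  have ab: "(\<exists>y. b i y \<noteq> 0)" if "a i y \<noteq> 0" for i y
  proof -
    have "a i y = b i (\<lambda>l. y (the_inv_into {..<?r} e l))" unfolding b_def
      by (rule pfun_cong[OF a(1)]) (use e in \<open>simp add: bij_betw_def the_inv_into_f_f\<close>)
    then show ?thesis using that by metis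
  qed
  have rep: "\<exists>q\<in>laurent k. \<forall>x\<in>nonzero_points. leval q x = b i x" for i
    by (rule coord_laurent[OF b]) (auto simp: free_vars_def)
  then obtain q where q: "\<And>i. q i \<in> laurent k" "\<And>i x. x \<in> nonzero_points \<Longrightarrow> leval (q i) x = b i x" by metis
  obtain y where y: "G y \<noteq> 0" using G by blast
  then have "\<exists>i\<le>N. a i y \<noteq> 0" unfolding a(2) by (metis (no_types, lifting) atMost_iff mult_zero_left sum.neutral)
  then obtain i0 where "i0 \<le> N" "\<exists>y. b i0 y \<noteq> 0" using ab by blast
  then have "\<exists>i. \<exists>y. b i y \<noteq> 0" by blast
  \<comment> \<open>The relation starts with the power \<open>i1\<close> of \<open>u\<close>.
    Irreducibility of \<open>V\<close> allows cancelling this power; the constant term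
    \<open>b i1\<close> then equals minus the rest, a multiple of \<open>u\<close>.\<close>
  define i1 where "i1 = (LEAST i. \<exists>y. b i y \<noteq> 0)"
  have i1: "\<exists>y. b i1 y \<noteq> 0" unfolding i1_def by (rule LeastI_ex) fact
  have below: "b i y = 0" if "i < i1" for i y using not_less_Least[of i "\<lambda>i. \<exists>y. b i y \<noteq> 0"] that by (auto simp: i1_def)
  have i1N: "i1 \<le> N" using \<open>i0 \<le> N\<close> \<open>\<exists>y. b i0 y \<noteq> 0\<close> Least_le[of "\<lambda>i. \<exists>y. b i y \<noteq> 0" i0] by (simp add: i1_def)
  define s where "s = (\<Sum>i\<le>N - i1. q (i + i1) * u ^ i)"
  have s: "s \<in> laurent k" unfolding s_def by (intro laurent_sum laurent_mult laurent_power q u)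
  have "leval (u ^ i1) x * leval s x = 0" if x: "x \<in> V" for x
  proof -
    have xn: "x \<in> nonzero_points" using x Vn by blast
    have "0 = (\<Sum>i\<le>N. b i x * leval u x ^ i)" using G(3)[OF x] unfolding a(2) az by (simp add: z_def)
    also have "\<dots> = (\<Sum>i\<in>{i1..N}. b i x * leval u x ^ i)"
      by (rule sum.mono_neutral_right) (use below in \<open>auto simp: not_le\<close>)
    also have "\<dots> = (\<Sum>i\<le>N - i1. b (i + i1) x * leval u x ^ (i + i1))"
      by (rule sum.reindex_bij_witness[of _ "\<lambda>i. i + i1" "\<lambda>i. i - i1"]) (use i1N in auto)
    also have "\<dots> = leval (u ^ i1) x * leval s x"
      by (simp add: s_def leval_sum leval_mult[OF xn] leval_power[OF xn] q(2)[OF xn] sum_distrib_left power_add mult_ac)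
    finally show ?thesis by simp
  qed
  then have "(\<forall>x\<in>V. leval (u ^ i1) x = 0) \<or> (\<forall>x\<in>V. leval s x = 0)"
    by (intro variety_prime[OF V]) (auto intro!: laurent_power laurent_mono[OF u(1) k] laurent_mono[OF s k])
  moreover have "\<not> (\<forall>x\<in>V. leval (u ^ i1) x = 0)"
    using u(2) Vn by (auto simp: vanishes_def leval_power subset_iff)
  ultimately have sv: "\<And>x. x \<in> V \<Longrightarrow> leval s x = 0" by blast
  define t where "t = - (\<Sum>i<N - i1. q (Suc i + i1) * u ^ i)"
  have t: "t \<in> laurent k" unfolding t_def by (intro laurent_uminus laurent_sum laurent_mult laurent_power q u)
  have "b i1 x = leval t x * leval u x" if x: "x \<in> V" for x
  proof -
    have xn: "x \<in> nonzero_points" using x Vn by blast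
    have e1: "leval s x = b i1 x + (\<Sum>i<N - i1. b (Suc i + i1) x * leval u x ^ Suc i)"
      unfolding s_def leval_sum
      by (subst lessThan_Suc_atMost[symmetric], subst sum.lessThan_Suc_shift)
         (simp add: leval_mult[OF xn] leval_power[OF xn] q(2)[OF xn])
    have e2: "leval t x * leval u x = - (\<Sum>i<N - i1. b (Suc i + i1) x * leval u x ^ Suc i)"
      by (simp add: t_def leval_uminus leval_sum leval_mult[OF xn] leval_power[OF xn] q(2)[OF xn] sum_distrib_right sum_distrib_left mult_ac)
    show ?thesis unfolding e2 using e1[unfolded sv[OF x], symmetric] by (simp only: eq_neg_iff_add_eq_0)
  qed
  then show ?thesis using b i1 t by blast
qed

lemma leval_upd: "f \<in> laurent j \<Longrightarrow> j \<le> k \<Longrightarrow> leval f (y(k := t)) = leval f y"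
  by (rule leval_cong) auto

text \<open>The algebraic coordinates are found one after another as roots of their relations.
  \<open>N\<close> is the product of the norms of the end coefficients, so its nonvanishing
  guarantees suitable roots at every stage.\<close>

lemma lift_point:
  assumes V: "variety n V"
  shows "\<exists>N\<in>pfun (free_vars n V). (\<exists>a. N a \<noteq> 0) \<and>
    (\<forall>a. (\<forall>i\<in>free_vars n V. a i \<noteq> 0) \<longrightarrow> N a \<noteq> 0 \<longrightarrow> (\<exists>x\<in>V. \<forall>i\<in>free_vars n V. x i = a i))"
proof -
  have Vn: "V \<subseteq> nonzero_points" by (rule variety_nonzero[OF V])
  let ?A = "free_vars n V" and ?B = "alg_vars n V"
  \<comment> \<open>Nonzero end coefficients ensure that the relation for \<open>x_j\<close> is a
    nonconstant polynomial in \<open>x_j\<close> and that its roots are nonzero.\<close>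
  define u where "u j = tlead V j * tcoef V j 0" for j
  have nt: "\<not> transc V j" "j < n" if "j \<in> ?B" for j using that by (auto simp: alg_vars_def)
  have mr: "min_rel V j (tdeg V j) (tcoef V j)" if "j \<in> ?B" for j by (rule min_rel_tdeg[OF Vn nt(1)[OF that]])
  have tc: "tcoef V j e \<in> laurent j" if "j \<in> ?B" for j e using mr[OF that] by (simp add: min_rel_def)
  have u: "u j \<in> laurent j" "\<not> vanishes V (u j)" if j: "j \<in> ?B" for j
  proof -
    have l: "tlead V j \<in> laurent j" by (rule tpoly_facts[OF V j])
    show "u j \<in> laurent j" unfolding u_def by (intro laurent_mult l tc[OF j])
    show "\<not> vanishes V (u j)"
    proof
      assume "vanishes V (u j)"
      then have "leval (tlead V j) x * leval (tcoef V j 0) x = 0" if "x \<in> V" for x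
        using Vn that leval_mult unfolding vanishes_def u_def by (metis subsetD)
      then have "vanishes V (tlead V j) \<or> vanishes V (tcoef V j 0)"
        unfolding vanishes_def using nt(2)[OF j]
        by (intro variety_prime[OF V]) (auto intro: laurent_mono[OF l] laurent_mono[OF tc[OF j]])
      then show False using mr[OF j] by (simp add: min_rel_def tlead_def)
    qed
  qed
  have "\<exists>B a. B \<in> pfun (free_vars j V) \<and> a \<in> laurent j \<and> (\<exists>y. B y \<noteq> 0) \<and> (\<forall>x\<in>V. B x = leval a x * leval (u j) x)"
    if j: "j \<in> ?B" for j using laurent_norm[OF V _ u[OF j]] nt(2)[OF j] by (metis less_imp_le)
  then obtain B a where B: "\<And>j. j \<in> ?B \<Longrightarrow> B j \<in> pfun (free_vars j V)" "\<And>j. j \<in> ?B \<Longrightarrow> a j \<in> laurent j"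
    "\<And>j. j \<in> ?B \<Longrightarrow> \<exists>y. B j y \<noteq> 0" "\<And>j x. j \<in> ?B \<Longrightarrow> x \<in> V \<Longrightarrow> B j x = leval (a j) x * leval (u j) x" by metis
  have fsub: "free_vars j V \<subseteq> ?A" if "j \<in> ?B" for j using nt(2)[OF that] by (auto simp: free_vars_def)
  have "\<exists>q\<in>laurent j. \<forall>x\<in>nonzero_points. leval q x = B j x" if "j \<in> ?B" for j
    by (rule coord_laurent[OF B(1)[OF that]]) (auto simp: free_vars_def)
  then obtain q where q: "\<And>j. j \<in> ?B \<Longrightarrow> q j \<in> laurent j" "\<And>j x. j \<in> ?B \<Longrightarrow> x \<in> nonzero_points \<Longrightarrow> leval (q j) x = B j x" by metis
  define N where "N c = (\<Prod>j\<in>?B. B j c)" for c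
  have N: "N \<in> pfun ?A" unfolding N_def[abs_def] by (intro pfun_prod pfun_mono[OF B(1)] fsub)
  have "\<exists>c\<in>UNIV. \<forall>j\<in>?B. B j c \<noteq> 0"
    by (rule pfun_nonzero_prod[where A="?A"]) (use B(3) in \<open>auto intro: pfun_mono[OF B(1)] subsetD[OF fsub]\<close>)
  then have N0: "\<exists>c. N c \<noteq> 0" by (auto simp: N_def)
  have "\<exists>x\<in>V. \<forall>i\<in>?A. x i = c i" if c: "\<forall>i\<in>?A. c i \<noteq> 0" "N c \<noteq> 0" for c
  proof -
    have Bc: "B j c \<noteq> 0" if "j \<in> ?B" for j using c(2) that by (auto simp: N_def)
    have "k \<le> n \<Longrightarrow> \<exists>y\<in>nonzero_points. (\<forall>i\<in>?A. i < k \<longrightarrow> y i = c i) \<and> (\<forall>i\<ge>k. y i = 1) \<and>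
      (\<forall>j\<in>?B. j < k \<longrightarrow> leval (tlead V j) y \<noteq> 0 \<and> leval (tpoly V j) y = 0)" for k
    proof (induction k)
      case 0
      show ?case by (rule bexI[of _ "\<lambda>_. 1"]) (auto simp: nonzero_points_def)
    next
      case (Suc k)
      then obtain y where y: "y \<in> nonzero_points" "\<forall>i\<in>?A. i < k \<longrightarrow> y i = c i" "\<forall>i\<ge>k. y i = 1"
        "\<forall>j\<in>?B. j < k \<longrightarrow> leval (tlead V j) y \<noteq> 0 \<and> leval (tpoly V j) y = 0" by auto
      have keep: "\<forall>j\<in>?B. j < k \<longrightarrow> leval (tlead V j) (y(k := t)) \<noteq> 0 \<and> leval (tpoly V j) (y(k := t)) = 0" for t
      proof (intro ballI impI)
        fix j assume j: "j \<in> ?B" "j < k"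
        have "leval (tlead V j) (y(k := t)) = leval (tlead V j) y" "leval (tpoly V j) (y(k := t)) = leval (tpoly V j) y"
          using j tpoly_facts(1,3)[OF V j(1)] by (auto intro: leval_upd)
        then show "leval (tlead V j) (y(k := t)) \<noteq> 0 \<and> leval (tpoly V j) (y(k := t)) = 0" using y(4) j by simp
      qed
      show ?case
      proof (cases "k \<in> ?B")
        case False
        then have kA: "k \<in> ?A" using Suc.prems by (simp add: free_vars_def alg_vars_def)
        show ?thesis
        proof (rule bexI[of _ "y(k := c k)"], intro conjI)
          show "y(k := c k) \<in> nonzero_points" using y(1) c(1) kA by (auto simp: nonzero_points_def)
          show "\<forall>j\<in>?B. j < Suc k \<longrightarrow> leval (tlead V j) (y(k := c k)) \<noteq> 0 \<and> leval (tpoly V j) (y(k := c k)) = 0"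
            using keep[of "c k"] False by (auto simp: less_Suc_eq)
        qed (use y in \<open>auto simp: less_Suc_eq\<close>)
      next
        case True
        \<comment> \<open>\<open>B k = a k * u k\<close> is an identity on \<open>V\<close> in the
          coordinates below \<open>k\<close>. It holds at the partial point \<open>y\<close> too,
          because \<open>y\<close> satisfies the relations found so far.\<close>
        have "leval (q k - a k * u k) y = 0 \<and> (\<lambda>_. 0::complex) (q k - a k * u k) = 0"
        proof (rule triangular_reduction[OF Vn variety_nonempty[OF V] y(1), where k=k])
          fix j assume j: "j < k" "\<not> transc V j"
          then have "j \<in> ?B" using Suc.prems by (simp add: alg_vars_def)
          then show "leval (tlead V j) y \<noteq> 0 \<and> leval (tpoly V j) y = 0 \<and> (0::complex) = 0" using y(4) j by simp
        next
          show "q k - a k * u k \<in> laurent k" by (intro laurent_diff laurent_mult q B u True)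
          show "vanishes V (q k - a k * u k)"
            using Vn by (auto simp: vanishes_def leval_diff leval_mult q(2)[OF True] B(4)[OF True] subset_iff)
        qed auto
        then have "B k y = leval (a k) y * leval (u k) y" by (simp add: leval_diff leval_mult[OF y(1)] q(2)[OF True y(1)])
        moreover have "B k y = B k c" by (rule pfun_cong[OF B(1)[OF True]]) (use y(2) Suc.prems in \<open>auto simp: free_vars_def\<close>)
        ultimately have uy: "leval (u k) y \<noteq> 0" using Bc[OF True] by auto
        then have ly: "leval (tlead V k) y \<noteq> 0" "leval (tcoef V k 0) y \<noteq> 0" by (auto simp: u_def leval_mult[OF y(1)])
        let ?N = "tdeg V k"
        define p where "p = (\<Sum>e\<le>?N. monom (leval (tcoef V k e) y) e)"
        have cp: "coeff p i = (if i \<le> ?N then leval (tcoef V k i) y else 0)" for i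
          by (simp add: p_def coeff_sum)
        have "coeff p ?N \<noteq> 0" using ly(1) by (simp add: cp tlead_def)
        moreover have "?N \<ge> 1" using mr[OF True] by (simp add: min_rel_def)
        ultimately have "degree p \<noteq> 0" using le_degree[of p ?N] by auto
        then obtain t where t: "poly p t = 0"
          using fundamental_theorem_of_algebra[of p] constant_degree[of p] by auto
        have t0: "t \<noteq> 0"
        proof
          assume "t = 0"
          then have "coeff p 0 = 0" using t by (simp add: poly_0_coeff_0)
          then show False using ly(2) by (simp add: cp)
        qed
        have yt: "y(k := t) \<in> nonzero_points" using y(1) t0 by (auto simp: nonzero_points_def)
        have "leval (tpoly V k) (y(k := t)) = (\<Sum>e\<le>?N. leval (tcoef V k e) y * t ^ e)"
          unfolding tpoly_def leval_psum[OF yt] using leval_upd[OF tc[OF True] order_refl] by simp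
        also have "\<dots> = poly p t" by (simp add: p_def poly_sum poly_monom)
        finally have Pk: "leval (tpoly V k) (y(k := t)) = 0" using t by simp
        have lk: "leval (tlead V k) (y(k := t)) \<noteq> 0"
          using leval_upd[OF tpoly_facts(3)[OF V True] order_refl] ly(1) by simp
        have kA: "k \<notin> ?A" using nt(1)[OF True] by (simp add: free_vars_def)
        show ?thesis
        proof (rule bexI[OF _ yt], intro conjI)
          show "\<forall>j\<in>?B. j < Suc k \<longrightarrow> leval (tlead V j) (y(k := t)) \<noteq> 0 \<and> leval (tpoly V j) (y(k := t)) = 0"
            using keep[of t] Pk lk by (auto simp: less_Suc_eq)
        qed (use y kA in \<open>auto simp: less_Suc_eq\<close>)
      qed
    qed
    from this[of n] obtain y where y: "y \<in> nonzero_points" "\<forall>i\<in>?A. i < n \<longrightarrow> y i = c i" "\<forall>i\<ge>n. y i = 1"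
        "\<forall>j\<in>?B. j < n \<longrightarrow> leval (tlead V j) y \<noteq> 0 \<and> leval (tpoly V j) y = 0" by auto
    have "y \<in> V"
    proof (rule zariski_closed_memI[OF variety_closed[OF V]])
      show "y \<in> torus n" using y(1,3) by (simp add: torus_def nonzero_points_def)
      fix f assume f: "f \<in> vanishing_ideal n V"
      have "leval f y = 0 \<and> (\<lambda>_. 0::complex) f = 0"
      proof (rule triangular_reduction[OF Vn variety_nonempty[OF V] y(1), where k=n])
        fix j assume j: "j < n" "\<not> transc V j"
        then have "j \<in> ?B" by (simp add: alg_vars_def)
        then show "leval (tlead V j) y \<noteq> 0 \<and> leval (tpoly V j) y = 0 \<and> (0::complex) = 0" using y(4) j by simp
      qed (use f in \<open>auto simp: vanishing_ideal_iff\<close>)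
      then show "leval f y = 0" by simp
    qed
    then show ?thesis using y(2) free_vars_less by blast
  qed
  then show ?thesis using N N0 by blast
qed

text \<open>A minimal closed subset on which the coordinates stay independent is irreducible: if it
  were a union of two smaller ones, the product of a relation on each would be a relation on the
  whole.\<close>

lemma indep_coords_irreducible:
  assumes X: "zariski_closed n X" "indep_coords X A" "A \<subseteq> {..<n}"
  shows "\<exists>Y\<subseteq>X. variety n Y \<and> indep_coords Y A"
proof -
  let ?\<A> = "{Y. Y \<subseteq> X \<and> zariski_closed n Y \<and> indep_coords Y A}"
  have "\<exists>Y\<in>?\<A>. \<forall>Z\<in>?\<A>. Z \<subseteq> Y \<longrightarrow> Z = Y" by (rule minimal_closed_set[of _ n]) (use X in auto)
  then obtain Y where Y0: "Y \<in> ?\<A>" and min0: "\<forall>Z\<in>?\<A>. Z \<subseteq> Y \<longrightarrow> Z = Y" ..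
  from Y0 have Y: "Y \<subseteq> X" "zariski_closed n Y" "indep_coords Y A" by auto
  have mini: "Z = Y" if "zariski_closed n Z" "indep_coords Z A" "Z \<subseteq> Y" for Z
    using min0[rule_format, of Z] that Y by auto
  have "variety n Y" unfolding variety_def
  proof (intro conjI allI impI)
    show "zariski_closed n Y" by fact
    show "Y \<noteq> {}"
    proof
      assume "Y = {}"
      then have "\<forall>y::nat \<Rightarrow> complex. (1::complex) = 0"
        using Y(3)[unfolded indep_coords_def, THEN bspec, OF pfun.const[of 1 A]] by simp
      then show False by simp
    qed
    fix P Q assume PQ: "zariski_closed n P \<and> zariski_closed n Q \<and> Y = P \<union> Q"
    show "Y = P \<or> Y = Q"
    proof (rule ccontr)
      assume "\<not> ?thesis"
      then have "\<not> indep_coords P A" "\<not> indep_coords Q A" using mini PQ by blast+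
      then obtain G G' y y' where G: "G \<in> pfun A" "\<forall>x\<in>P. G x = 0" "G y \<noteq> 0" "G' \<in> pfun A" "\<forall>x\<in>Q. G' x = 0" "G' y' \<noteq> 0"
        unfolding indep_coords_def by blast
      have "\<forall>x\<in>Y. G x * G' x = 0" using PQ G by auto
      then have GG: "\<forall>y. G y * G' y = 0"
        using Y(3)[unfolded indep_coords_def, THEN bspec, OF pfun.mult[OF G(1,4)]] by blast
      have "G y = 0"
        by (rule pfun_vanish_open[of "{()}" G A "\<lambda>_. G'"]) (use G GG in auto)
      then show False using G by simp
    qed
  qed
  then show ?thesis using Y by blast
qed

text \<open>On the section by a general value of one free coordinate, the other free coordinates
  remain independent, since general values of them lift by \<open>lift_point\<close>. An irreducible
  part of the section with this property is proper, because the cut coordinate is constant on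
  it.\<close>

lemma cut_variety:
  assumes V: "variety n V" and d: "card (free_vars n V) = Suc d"
  shows "\<exists>Y. variety n Y \<and> Y \<subset> V \<and> d \<le> card (free_vars n Y)"
proof -
  have Vn: "V \<subseteq> nonzero_points" by (rule variety_nonzero[OF V])
  let ?A = "free_vars n V"
  obtain a0 where a0: "a0 \<in> ?A" using d by fastforce
  obtain N where N: "N \<in> pfun ?A" "\<exists>a. N a \<noteq> 0"
    "\<And>a. (\<forall>i\<in>?A. a i \<noteq> 0) \<Longrightarrow> N a \<noteq> 0 \<Longrightarrow> \<exists>x\<in>V. \<forall>i\<in>?A. x i = a i" using lift_point[OF V] by blast
  define P where "P s = (case s of None \<Rightarrow> N | Some i \<Rightarrow> (\<lambda>c. c i))" for s :: "nat option"
  have PA: "P s \<in> pfun ?A" if "s \<in> insert None (Some ` ?A)" for s using that N(1) by (auto simp: P_def intro: pfun.proj)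
  have "\<exists>c\<in>UNIV. \<forall>s\<in>insert None (Some ` ?A). P s c \<noteq> 0"
    by (rule pfun_nonzero_prod[where A="?A"]) (use PA N(2) in \<open>auto simp: P_def intro: exI[of _ "\<lambda>_. 1"]\<close>)
  then obtain a where a: "\<forall>s\<in>insert None (Some ` ?A). P s a \<noteq> 0" by blast
  define X where "X = {x\<in>V. leval (lvar a0 1 - single 0 (a a0)) x = 0}"
  have a0n: "a0 < n" using a0 free_vars_less by blast
  have X: "zariski_closed n X" unfolding X_def
    by (intro zariski_closed_zero_set variety_closed V laurent_diff lvar_laurent a0n laurent_const)
  have Xeq: "x \<in> X \<longleftrightarrow> x \<in> V \<and> x a0 = a a0" for x
    by (auto simp: X_def leval_diff leval_lvar leval_single)
  have "indep_coords X (?A - {a0})" unfolding indep_coords_def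
  proof (intro ballI impI allI)
    fix G y assume G: "G \<in> pfun (?A - {a0})" "\<forall>x\<in>X. G x = 0"
    show "G y = 0"
    proof (rule ccontr)
      assume y: "G y \<noteq> 0"
      \<comment> \<open>The lifting conditions and \<open>G \<noteq> 0\<close> must hold together on
        this hyperplane. Each holds somewhere on it: the former at \<open>a\<close>, the latter
        because \<open>G\<close> ignores the coordinate \<open>a0\<close>.\<close>
      define L where "L = {c :: nat \<Rightarrow> complex. c a0 = a a0}"
      define Q where "Q s = (case s of None \<Rightarrow> G | Some s \<Rightarrow> P s)" for s
      have "G (y(a0 := a a0)) \<noteq> 0" using y pfun_cong[OF G(1), of "y(a0 := a a0)" y] by auto
      then have "\<exists>c\<in>L. \<forall>s\<in>insert None (Some ` insert None (Some ` ?A)). Q s c \<noteq> 0"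
      proof (intro pfun_nonzero_prod[where A="?A"])
        fix s assume "s \<in> insert None (Some ` insert None (Some ` ?A))"
        then consider "s = None" | t where "s = Some t" "t \<in> insert None (Some ` ?A)" by blast
        note s = this
        show "Q s \<in> pfun ?A" using s by cases (use PA pfun_mono[OF G(1), of ?A] in \<open>auto simp: Q_def\<close>)
        have L: "y(a0 := a a0) \<in> L" "a \<in> L" by (simp_all add: L_def)
        show "\<exists>c\<in>L. Q s c \<noteq> 0" using s
        proof cases
          case 1
          then show ?thesis using \<open>G (y(a0 := a a0)) \<noteq> 0\<close> L by (auto simp: Q_def)
        next
          case 2
          have "P t a \<noteq> 0" using a 2(2) by blast
          then have "Q s a \<noteq> 0" by (simp add: Q_def 2(1))
          then show ?thesis using L by blast
        qed
      qed (auto simp: L_def)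
      then obtain c where c: "c a0 = a a0" "G c \<noteq> 0" "\<forall>s\<in>insert None (Some ` ?A). P s c \<noteq> 0"
        by (auto simp: Q_def L_def)
      then obtain x where x: "x \<in> V" "\<forall>i\<in>?A. x i = c i" using N(3)[of c] by (auto simp: P_def)
      then have "x \<in> X" using c(1) a0 by (simp add: Xeq)
      moreover have "G x = G c" by (rule pfun_cong[OF G(1)]) (use x in auto)
      ultimately show False using G(2) c(2) by simp
    qed
  qed
  moreover have "?A - {a0} \<subseteq> {..<n}" using free_vars_less by auto
  ultimately obtain Y where Y: "Y \<subseteq> X" "variety n Y" "indep_coords Y (?A - {a0})"
    using indep_coords_irreducible[OF X] by blast
  have "card (?A - {a0}) \<le> card (free_vars n Y)" by (rule indep_coords_bound[OF Y(2,3)]) (use free_vars_less in auto)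
  then have c: "d \<le> card (free_vars n Y)" using d a0 by simp
  have "Y \<noteq> V"
  proof
    assume "Y = V"
    then have z: "\<forall>x\<in>V. x a0 + - a a0 = 0" using Y(1) Xeq by auto
    have m: "(\<lambda>c. c a0 + - a a0) \<in> pfun ?A" using a0 by (intro pfun.add pfun.proj pfun.const)
    from free_vars_indep[OF V, unfolded indep_coords_def, THEN bspec, OF m, THEN mp, OF z, THEN spec, of "\<lambda>_. a a0 + 1"]
    show False by simp
  qed
  moreover have "Y \<subseteq> V" using Y(1) Xeq by auto
  ultimately have "Y \<subset> V" by blast
  then show ?thesis using Y(2) c by blast
qed

lemma chain_exists:
  "variety n V \<Longrightarrow> d \<le> card (free_vars n V) \<Longrightarrow>
   \<exists>C. (\<forall>i\<le>d. variety n (C i) \<and> C i \<subseteq> V) \<and> (\<forall>i<d. C i \<subset> C (Suc i)) \<and> C d = V"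
proof (induction d arbitrary: V)
  case 0
  then show ?case by (intro exI[of _ "\<lambda>_. V"]) auto
next
  case (Suc d)
  obtain e where e: "card (free_vars n V) = Suc e" "d \<le> e" using Suc.prems(2) by (cases "card (free_vars n V)") auto
  obtain Y where Y: "variety n Y" "Y \<subset> V" "e \<le> card (free_vars n Y)" using cut_variety[OF Suc.prems(1) e(1)] by blast
  have "d \<le> card (free_vars n Y)" using Y e by simp
  then obtain C where C: "\<forall>i\<le>d. variety n (C i) \<and> C i \<subseteq> Y" "\<forall>i<d. C i \<subset> C (Suc i)" "C d = Y"
    using Suc.IH[OF Y(1)] by blast
  let ?C = "\<lambda>i. if i \<le> d then C i else V"
  have c1: "variety n (?C i) \<and> ?C i \<subseteq> V" for i
  proof (cases "i \<le> d")
    case True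
    then have "variety n (C i)" "C i \<subseteq> Y" using C(1) by blast+
    then show ?thesis using True Y(2) by auto
  qed (use Suc.prems in auto)
  have c2: "?C i \<subset> ?C (Suc i)" if "i < Suc d" for i
    using that C Y(2) by (cases "i = d") auto
  show ?case
  proof (rule exI[of _ ?C], intro conjI allI impI)
    fix i show "variety n (?C i)" "?C i \<subseteq> V" using c1[of i] by blast+
  next
    fix i assume "i < Suc d" then show "?C i \<subset> ?C (Suc i)" by (rule c2)
  qed simp
qed

text \<open>Independent functions bound the length of chains, and repeated hyperplane sections build
  a chain of that length: Krull dimension is transcendence degree.\<close>

theorem krull_dim_free_vars:
  assumes V: "variety n V"
  shows "krull_dim n V = card (free_vars n V)"
  unfolding krull_dim_def
proof (rule cSup_eq_maximum)
  show "card (free_vars n V) \<in> {d. \<exists>C. (\<forall>i\<le>d. variety n (C i) \<and> C i \<subseteq> V) \<and> (\<forall>i<d. C i \<subset> C (Suc i))}"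
    using chain_exists[OF V order_refl] by blast
next
  fix d assume "d \<in> {d. \<exists>C. (\<forall>i\<le>d. variety n (C i) \<and> C i \<subseteq> V) \<and> (\<forall>i<d. C i \<subset> C (Suc i))}"
  then obtain C where C0: "\<forall>i\<le>d. variety n (C i) \<and> C i \<subseteq> V" "\<forall>i<d. C i \<subset> C (Suc i)"
    by (elim CollectE exE conjE)
  have C: "i \<le> d \<Longrightarrow> variety n (C i)" "i \<le> d \<Longrightarrow> C i \<subseteq> V" "i < d \<Longrightarrow> C i \<subset> C (Suc i)" for i
    using C0 by simp_all
  have "d \<le> card (free_vars n (C d))" by (rule chain_bound) (use C in auto)
  also have "\<dots> \<le> card (free_vars n V)"
  proof (rule indep_coords_bound[OF V])
    show "indep_coords V (free_vars n (C d))"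
      using free_vars_indep[OF C(1)[OF order_refl]] C(2)[OF order_refl] unfolding indep_coords_def by blast
  qed (use free_vars_less in auto)
  finally show "d \<le> card (free_vars n V)" .
qed

lemma chart_smooth: "variety n V \<Longrightarrow> x \<in> chart n V \<Longrightarrow> x \<in> smooth_part n V"
  using chart_subset by (auto simp: smooth_part_def dim_chart_tangent krull_dim_free_vars)

section \<open>Algebraic relations on the conormal variety\<close>

lemma laurent_pfun:
  assumes f: "f \<in> laurent N"
  shows "\<exists>P\<in>pfun {..<N}. \<exists>K. \<forall>z\<in>nonzero_points. P z = leval f z * (\<Prod>i<N. z i ^ K)"
proof -
  define K where "K = nat (\<Sum>m\<in>keys f. \<Sum>i\<in>keys m. \<bar>lookup m i\<bar>)"
  have K: "- lookup m i \<le> int K" if "m \<in> keys f" for m i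
  proof (cases "i \<in> keys m")
    case True
    then have "\<bar>lookup m i\<bar> \<le> (\<Sum>i\<in>keys m. \<bar>lookup m i\<bar>)" by (intro member_le_sum) auto
    also have "\<dots> \<le> (\<Sum>m\<in>keys f. \<Sum>i\<in>keys m. \<bar>lookup m i\<bar>)"
      by (rule member_le_sum[OF that, of "\<lambda>m. \<Sum>i\<in>keys m. \<bar>lookup m i\<bar>"]) (auto intro: sum_nonneg)
    finally show ?thesis unfolding K_def by linarith
  qed (simp add: lookup_not_keys)
  define P where "P z = (\<Sum>m\<in>keys f. lookup f m * (\<Prod>i<N. z i ^ nat (int K + lookup m i)))" for z
  have "P \<in> pfun {..<N}" unfolding P_def[abs_def]
    by (intro pfun_sum pfun.mult pfun_prod pfun_power pfun.const pfun.proj) auto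
  moreover have "P z = leval f z * (\<Prod>i<N. z i ^ K)" if z: "z \<in> nonzero_points" for z
  proof -
    have "(\<Prod>i<N. z i ^ nat (int K + lookup m i)) = monomial_at z m * (\<Prod>i<N. z i ^ K)" if m: "m \<in> keys f" for m
    proof -
      have "z i ^ nat (int K + lookup m i) = z i powi lookup m i * z i ^ K" for i
      proof -
        have "z i ^ nat (int K + lookup m i) = z i powi (int K + lookup m i)"
          using K[OF m, of i] by (simp add: power_int_def)
        also have "\<dots> = z i powi lookup m i * z i ^ K" using nonzero_pointsD[OF z] by (simp add: power_int_add)
        finally show ?thesis .
      qed
      then show ?thesis unfolding monomial_at_superset[OF finite_lessThan laurent_keys[OF f m]]
        by (simp add: prod.distrib)
    qed
    then show ?thesis by (simp add: P_def leval_eq sum_distrib_right mult.assoc)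
  qed
  ultimately show ?thesis by blast
qed

definition join_points :: "nat \<Rightarrow> (nat \<Rightarrow> complex) \<Rightarrow> (nat \<Rightarrow> complex) \<Rightarrow> nat \<Rightarrow> complex" where
  "join_points n x w = (\<lambda>i. if i < n then x i else w i)"

lemma laurent_specialize:
  assumes w: "w \<in> nonzero_points"
  shows "\<exists>q\<in>laurent n. \<forall>x\<in>nonzero_points. leval q x = leval f (join_points n x w)"
proof (rule poly_mapping_additive_induct[of f])
  fix m assume "m \<in> keys f"
  define m1 where "m1 = Poly_Mapping.mapp (\<lambda>i k. if i < n then k else 0) m"
  have l1: "lookup m1 i = (if i < n then lookup m i else 0)" for i
    by (simp add: m1_def lookup_mapp when_def in_keys_iff)
  have k1: "keys m1 = {i\<in>keys m. i < n}" by (auto simp: in_keys_iff l1 split: if_splits)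
  define C where "C = (\<Prod>i\<in>{i\<in>keys m. \<not> i < n}. w i powi lookup m i)"
  have "monomial_at (join_points n x w) m = monomial_at x m1 * C" for x
  proof -
    have "monomial_at (join_points n x w) m = (\<Prod>i\<in>keys m. if i < n then x i powi lookup m i else w i powi lookup m i)"
      unfolding monomial_at_def join_points_def by (intro prod.cong) auto
    also have "\<dots> = (\<Prod>i\<in>{i\<in>keys m. i < n}. x i powi lookup m i) * C"
      unfolding C_def by (subst prod.If_cases) (auto simp: Int_def)
    also have "(\<Prod>i\<in>{i\<in>keys m. i < n}. x i powi lookup m i) = monomial_at x m1"
      unfolding monomial_at_def k1 by (intro prod.cong) (auto simp: l1)
    finally show ?thesis .
  qed
  then show "\<exists>q\<in>laurent n. \<forall>x\<in>nonzero_points. leval q x = leval (single m (lookup f m)) (join_points n x w)"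
    by (intro bexI[of _ "single m1 (lookup f m * C)"]) (auto simp: leval_single k1 intro!: laurent_single)
next
  show "\<exists>q\<in>laurent n. \<forall>x\<in>nonzero_points. leval q x = leval 0 (join_points n x w)" by (rule bexI[of _ 0]) auto
next
  fix f g
  assume "\<exists>q\<in>laurent n. \<forall>x\<in>nonzero_points. leval q x = leval f (join_points n x w)"
    "\<exists>q\<in>laurent n. \<forall>x\<in>nonzero_points. leval q x = leval g (join_points n x w)"
  then show "\<exists>q\<in>laurent n. \<forall>x\<in>nonzero_points. leval q x = leval (f + g) (join_points n x w)"
    by (metis laurent_add leval_add)
qed

definition torus_product :: "nat \<Rightarrow> nat \<Rightarrow> (nat \<Rightarrow> complex) set \<Rightarrow> (nat \<Rightarrow> complex) set" where
  "torus_product n N V = {z \<in> torus N. join_points n z (\<lambda>_. 1) \<in> V}"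

lemma leval_join: "f \<in> laurent n \<Longrightarrow> leval f (join_points n x w) = leval f x"
  by (rule leval_cong) (auto simp: join_points_def)

lemma join_nonzero: "x \<in> nonzero_points \<Longrightarrow> w \<in> nonzero_points \<Longrightarrow> join_points n x w \<in> nonzero_points"
  by (auto simp: nonzero_points_def join_points_def)

lemma join_torus: "x \<in> nonzero_points \<Longrightarrow> join_points n x (\<lambda>_. 1) \<in> torus n"
  by (auto simp: nonzero_points_def join_points_def torus_def)

lemma torus_mono:
  assumes "x \<in> torus n" "n \<le> N"
  shows "x \<in> torus N"
  unfolding torus_def
proof (intro CollectI conjI allI impI)
  fix i
  show "x i \<noteq> 0" using torus_nonzero[OF assms(1)] by (rule nonzero_pointsD)
  show "x i = 1" if "i \<ge> N" using assms that by (simp add: torus_def)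
qed

lemma join_torus_id: "x \<in> torus n \<Longrightarrow> join_points n x (\<lambda>_. 1) = x"
  by (auto simp: join_points_def torus_def)

text \<open>If \<open>f\<close> and \<open>g\<close> are nonzero at two points, a common second
  factor \<open>w'\<close> can be chosen for which both remain nonzero above the respective first
  factors. Irreducibility of \<open>V\<close> then applies to the slice over
  \<open>w'\<close>.\<close>

lemma variety_product:
  assumes V: "variety n V" and N: "n \<le> N"
  shows "variety N (torus_product n N V)"
proof (rule varietyI)
  let ?V = "torus_product n N V"
  have "?V = zero_locus N (vanishing_ideal n V)"
  proof (intro equalityI subsetI)
    fix z assume "z \<in> ?V"
    then have z: "z \<in> torus N" "join_points n z (\<lambda>_. 1) \<in> V" by (auto simp: torus_product_def)
    have "leval f z = 0" if "f \<in> vanishing_ideal n V" for f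
      using vanishing_idealD[OF that z(2)] leval_join[OF vanishing_ideal_laurent[OF that]] by simp
    then show "z \<in> zero_locus N (vanishing_ideal n V)" using z by (simp add: zero_locus_def)
  next
    fix z assume "z \<in> zero_locus N (vanishing_ideal n V)"
    then have z: "z \<in> torus N" "\<And>f. f \<in> vanishing_ideal n V \<Longrightarrow> leval f z = 0" by (auto simp: zero_locus_def)
    have "join_points n z (\<lambda>_. 1) \<in> V"
      by (rule zariski_closed_memI[OF variety_closed[OF V] join_torus[OF torus_nonzero[OF z(1)]]])
         (use z(2) leval_join vanishing_ideal_laurent in metis)
    then show "z \<in> ?V" using z by (simp add: torus_product_def)
  qed
  moreover have "vanishing_ideal n V \<subseteq> laurent N"
    using vanishing_ideal_laurent laurent_mono[OF _ N] by blast
  ultimately show "zariski_closed N ?V" using zariski_closed_zero_locus[of "vanishing_ideal n V" N] by simp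
  obtain x where x: "x \<in> V" using variety_nonempty[OF V] by blast
  then have "x \<in> torus n" using variety_torus[OF V] by blast
  then have "x \<in> ?V" using x N join_torus_id torus_mono by (auto simp: torus_product_def)
  then show "?V \<noteq> {}" by blast
  fix f g assume f: "f \<in> laurent N" and g: "g \<in> laurent N" and fg: "\<And>x. x \<in> ?V \<Longrightarrow> leval f x * leval g x = 0"
  show "(\<forall>x\<in>?V. leval f x = 0) \<or> (\<forall>x\<in>?V. leval g x = 0)"
  proof (rule ccontr)
    assume "\<not> ?thesis"
    then obtain z1 z2 where z: "z1 \<in> ?V" "leval f z1 \<noteq> 0" "z2 \<in> ?V" "leval g z2 \<noteq> 0" by blast
    have zn: "z1 \<in> nonzero_points" "z2 \<in> nonzero_points" using z by (auto simp: torus_product_def torus_nonzero)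
    obtain P K where P: "P \<in> pfun {..<N}" "\<And>z. z \<in> nonzero_points \<Longrightarrow> P z = leval f z * (\<Prod>i<N. z i ^ K)"
      using laurent_pfun[OF f] by blast
    obtain Q L where Q: "Q \<in> pfun {..<N}" "\<And>z. z \<in> nonzero_points \<Longrightarrow> Q z = leval g z * (\<Prod>i<N. z i ^ L)"
      using laurent_pfun[OF g] by blast
    have sub: "(\<lambda>w. R (join_points n x w)) \<in> pfun {..<N}" if "R \<in> pfun {..<N}" for R x
    proof (rule pfun_subst[OF that])
      fix i assume "i \<in> {..<N}"
      then show "(\<lambda>w. join_points n x w i) \<in> pfun {..<N}"
        by (cases "i < n") (auto simp: join_points_def intro: pfun.intros)
    qed
    have "P (join_points n z1 z1) \<noteq> 0" "Q (join_points n z2 z2) \<noteq> 0"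
      using z zn P(2) Q(2) nonzero_pointsD by (auto simp: join_points_def)
    define F where "F s = (case s of Some i \<Rightarrow> (\<lambda>w. w i) | None \<Rightarrow> (\<lambda>w. P (join_points n z1 w) * Q (join_points n z2 w)))" for s :: "nat option"
    have "(\<lambda>w. P (join_points n z1 w)) \<in> pfun {..<N}" "(\<lambda>w. Q (join_points n z2 w)) \<in> pfun {..<N}"
      using sub P(1) Q(1) by blast+
    then have "\<exists>w\<in>UNIV. \<forall>b\<in>{False, True}. (if b then P (join_points n z1 w) else Q (join_points n z2 w)) \<noteq> 0"
    proof (intro pfun_nonzero_prod[where A="{..<N}"])
      fix b
      show "(\<lambda>w. if b then P (join_points n z1 w) else Q (join_points n z2 w)) \<in> pfun {..<N}"
        using sub P(1) Q(1) by (cases b) auto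
      show "\<exists>w\<in>UNIV. (if b then P (join_points n z1 w) else Q (join_points n z2 w)) \<noteq> 0"
        using \<open>P (join_points n z1 z1) \<noteq> 0\<close> \<open>Q (join_points n z2 z2) \<noteq> 0\<close> by (cases b) auto
    qed auto
    then obtain w0 where w0: "P (join_points n z1 w0) \<noteq> 0" "Q (join_points n z2 w0) \<noteq> 0" by auto
    have FA: "F s \<in> pfun {..<N}" if "s \<in> insert None (Some ` {..<N})" for s
      using that sub P(1) Q(1) by (auto simp: F_def intro!: pfun.mult pfun.proj)
    have "\<exists>w\<in>UNIV. \<forall>s\<in>insert None (Some ` {..<N}). F s w \<noteq> 0"
      by (rule pfun_nonzero_prod[where A="{..<N}"])
         (use FA w0 in \<open>auto simp: F_def intro: exI[of _ w0] exI[of _ "\<lambda>_. 1"]\<close>)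
    then obtain w where w: "\<forall>s\<in>insert None (Some ` {..<N}). F s w \<noteq> 0" by blast
    define w' where "w' i = (if i < N then w i else 1)" for i
    have w'n: "w' \<in> nonzero_points" using w by (auto simp: w'_def nonzero_points_def F_def)
    have cong: "R (join_points n x w) = R (join_points n x w')" if "R \<in> pfun {..<N}" for R x
      by (rule pfun_cong[OF that]) (auto simp: join_points_def w'_def)
    have fg': "leval f (join_points n z1 w') \<noteq> 0" "leval g (join_points n z2 w') \<noteq> 0"
      using w cong[OF P(1), of z1] cong[OF Q(1), of z2] P(2)[OF join_nonzero[OF zn(1) w'n]] Q(2)[OF join_nonzero[OF zn(2) w'n]]
      by (auto simp: F_def)
    obtain p where p: "p \<in> laurent n" "\<And>x. x \<in> nonzero_points \<Longrightarrow> leval p x = leval f (join_points n x w')"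
      using laurent_specialize[OF w'n] by blast
    obtain q where q: "q \<in> laurent n" "\<And>x. x \<in> nonzero_points \<Longrightarrow> leval q x = leval g (join_points n x w')"
      using laurent_specialize[OF w'n] by blast
    have "leval p x * leval q x = 0" if x: "x \<in> V" for x
    proof -
      have xt: "x \<in> torus n" using x variety_torus[OF V] by blast
      have "join_points n x w' \<in> torus N"
      proof -
        have "join_points n x w' i = 1" if "i \<ge> N" for i using N that by (simp add: join_points_def w'_def)
        then show ?thesis using nonzero_pointsD[OF join_nonzero[OF torus_nonzero[OF xt] w'n]] by (simp add: torus_def)
      qed
      moreover have "join_points n (join_points n x w') (\<lambda>_. 1) = x" using join_torus_id[OF xt] by (simp add: join_points_def cong: if_cong)
      ultimately have "join_points n x w' \<in> ?V" using x by (simp add: torus_product_def)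
      then show ?thesis using fg p(2) q(2) torus_nonzero[OF xt] by simp
    qed
    then have "(\<forall>x\<in>V. leval p x = 0) \<or> (\<forall>x\<in>V. leval q x = 0)" by (intro variety_prime[OF V p(1) q(1)])
    moreover have "leval p (join_points n z1 (\<lambda>_. 1)) \<noteq> 0"
      using fg'(1) p(2)[OF zn(1)] leval_join[OF p(1)] by simp
    moreover have "leval q (join_points n z2 (\<lambda>_. 1)) \<noteq> 0"
      using fg'(2) q(2)[OF zn(2)] leval_join[OF q(1)] by simp
    ultimately show False using z by (auto simp: torus_product_def)
  qed
qed

text \<open>It bounds the number of free coordinates of the product: among the first
  \<open>n\<close> there are no more than those of \<open>V\<close>.\<close>

lemma transc_product:
  assumes V: "variety n V" and N: "n \<le> N" and j: "j < n" and t: "transc (torus_product n N V) j"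
  shows "transc V j"
proof -
  have van: "vanishes (torus_product n N V) f \<longleftrightarrow> vanishes V f" if f: "f \<in> laurent n" for f
  proof
    assume v: "vanishes (torus_product n N V) f"
    show "vanishes V f" unfolding vanishes_def
    proof
      fix x assume x: "x \<in> V"
      then have xt: "x \<in> torus n" using variety_torus[OF V] by blast
      then have "x \<in> torus_product n N V" using x N join_torus_id torus_mono by (auto simp: torus_product_def)
      then show "leval f x = 0" using v by (simp add: vanishes_def)
    qed
  next
    assume "vanishes V f"
    then show "vanishes (torus_product n N V) f"
      using leval_join[OF f] by (auto simp: vanishes_def torus_product_def)
  qed
  show ?thesis unfolding transc_def
  proof (intro allI impI)
    fix M a e assume a: "\<forall>e. a e \<in> laurent j" and v: "vanishes V (psum a M j)" and e: "e \<le> M"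
    have an: "a e \<in> laurent n" for e using a j laurent_mono[of "a e" j n] by simp
    have "psum a M j \<in> laurent n" using laurent_mono[OF psum_laurent, of a j n M] a j by simp
    then have "vanishes (torus_product n N V) (a e)" using t a v e van unfolding transc_def by blast
    then show "vanishes V (a e)" using van[OF an] by simp
  qed
qed

text \<open>The conormal variety over the chart has dimension \<open>n\<close>.\<close>

lemma conormal_dependent:
  assumes V: "variety n V" and C: "C \<subseteq> {..<n}" and f: "\<And>i. f i \<in> laurent n"
  shows "\<exists>G\<in>pfun {..n}. (\<exists>y. G y \<noteq> 0) \<and> (\<forall>x\<in>chart n V. \<forall>c. (\<forall>\<eta>\<in>log_tangent n V x. (\<Sum>l<n. c l * \<eta> l) = 0) \<longrightarrow>
     G (\<lambda>i. if i \<in> C then c i else leval (f i) x) = 0)"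
proof -
  let ?B = "alg_vars n V"
  let ?b = "card ?B"
  let ?N = "n + ?b"
  let ?V = "torus_product n ?N V"
  from ex_bij_betw_nat_finite[of ?B] obtain e where e: "bij_betw e {..<?b} ?B" unfolding atLeast0LessThan by auto
  have eB: "e k \<in> ?B" if "k < ?b" for k using e that by (auto simp: bij_betw_def)
  have V': "variety ?N ?V" by (rule variety_product[OF V]) simp
  \<comment> \<open>Besides the free coordinates of \<open>V\<close> there is at most one for each
    multiplier, hence at most \<open>n\<close> altogether.\<close>
  have "free_vars ?N ?V \<subseteq> free_vars n V \<union> {n..<?N}"
    using transc_product[OF V, of ?N] by (auto simp: free_vars_def not_less)
  then have "card (free_vars ?N ?V) \<le> card (free_vars n V \<union> {n..<?N})" by (intro card_mono) auto
  also have "\<dots> \<le> card (free_vars n V) + ?b" using card_Un_le[of "free_vars n V" "{n..<?N}"] by simp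
  also have "\<dots> = n" by (rule card_vars)
  finally have r: "card (free_vars ?N ?V) \<le> n" .
  \<comment> \<open>The coordinates \<open>n + k\<close> of the product are multipliers. By
    \<open>chart_conormal\<close>, conormal entries become functions on the product of
    \<open>V\<close> with a torus.\<close>
  define u where "u i = (if i \<in> C then \<Sum>k<?b. lvar (n + k) 1 * euler i (tpoly V (e k)) else f i)" for i
  have "u i \<in> laurent ?N" for i
    using f tpoly_facts(2)[OF V eB]
    by (auto simp: u_def intro!: laurent_sum laurent_mult lvar_laurent laurent_euler intro: laurent_mono[where j=n])
  from laurent_dependent[OF V' order_refl, of u, OF this]
  obtain G where G: "G \<in> pfun {..card (free_vars ?N ?V)}" "\<exists>y. G y \<noteq> 0" "\<And>z. z \<in> ?V \<Longrightarrow> G (\<lambda>i. leval (u i) z) = 0"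
    by blast
  have Gn: "G \<in> pfun {..n}" by (rule pfun_mono[OF G(1)]) (use r in auto)
  have "G (\<lambda>i. if i \<in> C then c i else leval (f i) x) = 0"
    if x: "x \<in> chart n V" and c: "\<And>\<eta>. \<eta> \<in> log_tangent n V x \<Longrightarrow> (\<Sum>l<n. c l * \<eta> l) = 0" for x c
  proof -
    have xV: "x \<in> V" using x chart_subset by blast
    then have xt: "x \<in> torus n" using variety_torus[OF V] by blast
    have xn: "x \<in> nonzero_points" by (rule torus_nonzero[OF xt])
    obtain \<mu> where \<mu>: "\<And>l. l < n \<Longrightarrow> c l = (\<Sum>j\<in>?B. \<mu> j * covector (tpoly V j) x l)"
      using chart_conormal[OF V x c] by blast
    define H where "H w = G (\<lambda>i. if i \<in> C then \<Sum>k<?b. w k * covector (tpoly V (e k)) x i else leval (f i) x)" for w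
    have H: "H \<in> pfun {..<?b}" unfolding H_def[abs_def]
    proof (rule pfun_subst[OF Gn])
      fix i show "(\<lambda>w. if i \<in> C then \<Sum>k<?b. w k * covector (tpoly V (e k)) x i else leval (f i) x) \<in> pfun {..<?b}"
        by (cases "i \<in> C") (auto intro!: pfun_sum pfun.mult pfun.proj pfun.const)
    qed
    \<comment> \<open>The product contains only nonzero multipliers; the relation extends to
      arbitrary ones by density.\<close>
    have "H w = 0" for w
    proof (rule pfun_vanish_open[of "{..<?b}" H "{..<?b}" "\<lambda>k w. w k"])
      fix w :: "nat \<Rightarrow> complex" assume w: "\<And>k. k \<in> {..<?b} \<Longrightarrow> w k \<noteq> 0"
      define z where "z i = (if i < n then x i else if i < ?N then w (i - n) else 1)" for i
      have zt: "z \<in> torus ?N" using xn w by (auto simp: z_def torus_def nonzero_points_def)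
      have zj: "join_points n z (\<lambda>_. 1) = x" using xt by (auto simp: join_points_def z_def torus_def)
      have zV: "z \<in> ?V" using zt zj xV by (simp add: torus_product_def)
      have lz: "leval g z = leval g x" if "g \<in> laurent n" for g using leval_join[OF that, of z "\<lambda>_. 1"] zj by simp
      have "leval (u i) z = (if i \<in> C then \<Sum>k<?b. w k * covector (tpoly V (e k)) x i else leval (f i) x)" for i
        using f tpoly_facts(2)[OF V eB]
        by (auto simp: u_def leval_sum leval_mult[OF torus_nonzero[OF zt]] leval_lvar lz laurent_euler covector_def z_def
            intro!: sum.cong)
      then show "H w = 0" using G(3)[OF zV] by (simp add: H_def)
    qed (use H in \<open>auto intro: pfun.proj exI[of _ "\<lambda>_. 1"]\<close>)
    from this[of "\<lambda>k. \<mu> (e k)"] have "G (\<lambda>i. if i \<in> C then \<Sum>k<?b. \<mu> (e k) * covector (tpoly V (e k)) x i else leval (f i) x) = 0"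
      by (simp add: H_def)
    moreover have "(\<Sum>k<?b. \<mu> (e k) * covector (tpoly V (e k)) x i) = c i" if "i \<in> C" for i
      using \<mu>[of i] that C sum.reindex_bij_betw[OF e, of "\<lambda>j. \<mu> j * covector (tpoly V j) x i"] by auto
    ultimately show ?thesis by (simp cong: if_cong)
  qed
  then show ?thesis using Gn G(2) by blast
qed


section \<open>Echelon form of the stabilizer lattice\<close>

text \<open>A rational echelon basis with denominators cleared: over the integers the pivots cannot
  in general be normalised to 1, so they share one positive value \<open>N\<close>.\<close>

definition echelon :: "(nat \<Rightarrow> int) set \<Rightarrow> nat set \<Rightarrow> int \<Rightarrow> (nat \<Rightarrow> nat \<Rightarrow> int) \<Rightarrow> bool" where
  "echelon L J N v \<longleftrightarrow> N > 0 \<and> (\<forall>s\<in>J. v s \<in> L \<and> (\<forall>s'\<in>J. v s s' = (if s = s' then N else 0)))"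

text \<open>\<open>J\<close> is a maximal set of pivots; a nonzero vector of \<open>L\<close> that
  vanishes on \<open>J\<close> would supply another one.\<close>

lemma echelon_exists:
  assumes L: "L \<subseteq> coord_space n" and lin: "\<And>u w a b. u \<in> L \<Longrightarrow> w \<in> L \<Longrightarrow> (\<lambda>i. a * u i + b * w i) \<in> L"
  shows "\<exists>J N v. J \<subseteq> {..<n} \<and> echelon L J N v \<and> (\<forall>u\<in>L. (\<forall>s\<in>J. u s = 0) \<longrightarrow> u = (\<lambda>_. 0))"
proof -
  let ?\<J> = "{J. J \<subseteq> {..<n} \<and> (\<exists>N v. echelon L J N v)}"
  have fin: "finite ?\<J>" by (rule finite_subset[of _ "Pow {..<n}"]) auto
  have "{} \<in> ?\<J>" by (auto simp: echelon_def intro: exI[of _ 1])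
  then have "?\<J> \<noteq> {}" by blast
  from finite_has_maximal[OF fin this] obtain J where J0: "J \<in> ?\<J>" "\<forall>J'\<in>?\<J>. J \<subseteq> J' \<longrightarrow> J = J'" ..
  then obtain N v where J: "J \<subseteq> {..<n}" and e: "echelon L J N v" by blast
  have "u = (\<lambda>_. 0)" if u: "u \<in> L" "\<forall>s\<in>J. u s = 0" for u
  proof (rule ccontr)
    assume "u \<noteq> (\<lambda>_. 0)"
    then obtain i where i: "u i \<noteq> 0" by blast
    then have iJ: "i \<notin> J" "i < n" using u L by (auto simp: coord_space_def not_le[symmetric])
    \<comment> \<open>The sign makes the new pivot positive. The zero summand brings the vector into
      the form required by \<open>lin\<close>.\<close>
    define w where "w l = sgn (u i) * u l + 0 * u l" for l
    have w: "w \<in> L" "\<And>s. s \<in> J \<Longrightarrow> w s = 0" "w i > 0"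
      using lin[OF u(1) u(1), of "sgn (u i)" 0] u(2) i by (auto simp: w_def[abs_def] sgn_if)
    \<comment> \<open>The old vectors are scaled by \<open>w i\<close> and cleared in column
      \<open>i\<close>; all pivots become \<open>N * w i\<close>.\<close>
    define v' where "v' s l = (if s = i then N * w l + 0 * w l else w i * v s l + (- v s i) * w l)" for s l
    have "echelon L (insert i J) (N * w i) v'" unfolding echelon_def
    proof (intro conjI ballI)
      show "N * w i > 0" using e w(3) by (simp add: echelon_def)
      fix s assume s: "s \<in> insert i J"
      show "v' s \<in> L"
      proof (cases "s = i")
        case True
        then show ?thesis unfolding v'_def[abs_def] using lin[OF w(1) w(1), of N 0] by simp
      next
        case False
        then have "v s \<in> L" using s e by (simp add: echelon_def)
        then show ?thesis unfolding v'_def[abs_def] using lin[OF _ w(1), of "v s" "w i" "- v s i"] False by simp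
      qed
      fix s' assume s': "s' \<in> insert i J"
      show "v' s s' = (if s = s' then N * w i else 0)"
        using s s' iJ w(2) e by (auto simp: v'_def echelon_def)
    qed
    then have "insert i J \<in> ?\<J>" using J iJ by auto
    then show False using J0(2) iJ by blast
  qed
  then show ?thesis using J e by blast
qed

lemma stab_lattice_lin:
  assumes "u \<in> stab_lattice n V" "w \<in> stab_lattice n V"
  shows "(\<lambda>i. a * u i + b * w i) \<in> stab_lattice n V"
proof -
  have "x * one_param (\<lambda>i. a * u i + b * w i) t \<in> V" if "x \<in> V" "t \<noteq> 0" for x t
  proof -
    have "x * one_param u (t powi a) \<in> V" using assms(1) that by (simp add: stab_lattice_def)
    then have "x * one_param u (t powi a) * one_param w (t powi b) \<in> V" using assms(2) that by (simp add: stab_lattice_def)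
    moreover have "x * one_param u (t powi a) * one_param w (t powi b) = x * one_param (\<lambda>i. a * u i + b * w i) t"
      using that by (auto simp: one_param_def fun_eq_iff power_int_add power_int_mult)
    ultimately show ?thesis by simp
  qed
  then show ?thesis using assms by (simp add: stab_lattice_def coord_space_def)
qed

section \<open>The action of the stabilizer\<close>

lemma two_powi_inject: "(2::complex) powi i = 2 powi j \<Longrightarrow> i = j"
proof -
  have pos: "k = 0" if "(2::complex) powi int k = 1" for k
  proof -
    have "norm ((2::complex) ^ k) = 1" using that by simp
    then have "(2::real) ^ k = 2 ^ 0" by (simp add: norm_power)
    then show ?thesis using power_inject_exp[of "2::real" k 0] by simp
  qed
  assume "(2::complex) powi i = 2 powi j"
  then have e: "(2::complex) powi (i - j) = 1" by (simp add: power_int_diff)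
  show ?thesis
  proof (cases "i \<ge> j")
    case True
    then show ?thesis using pos[of "nat (i - j)"] e by simp
  next
    case False
    have "(2::complex) powi (j - i) = inverse (2 powi (i - j))" by (simp add: power_int_minus[symmetric])
    then show ?thesis using pos[of "nat (j - i)"] e False by simp
  qed
qed

lemma ipair_sum_right: "ipair u (sum m S) = (\<Sum>s\<in>S. ipair u (m s))"
  by (induction S rule: infinite_finite_induct) (auto simp: ipair_add)

lemma log_deriv_ipair:
  assumes "f \<in> laurent n"
  shows "log_deriv n x \<eta> f = (\<Sum>m\<in>keys f. lookup f m * monomial_at x m * ipair \<eta> m)"
proof -
  have "log_deriv n x \<eta> f = (\<Sum>m\<in>keys f. log_deriv n x \<eta> (single m (lookup f m)))"
    unfolding log_deriv_sum[symmetric] by (simp only: sum_single_lookup)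
  then show ?thesis using laurent_keys[OF assms] by (simp add: log_deriv_single mult_ac)
qed

text \<open>By \<open>determined\<close> the vectors \<open>v s\<close> span the stabilizer lattice
  up to finite index, so \<open>card J\<close> is its rank.\<close>

locale stabilizer_basis =
  fixes n :: nat and V :: "(nat \<Rightarrow> complex) set" and J :: "nat set" and N :: int and v :: "nat \<Rightarrow> nat \<Rightarrow> int"
  assumes V: "variety n V" and J: "J \<subseteq> {..<n}" and echelon: "echelon (stab_lattice n V) J N v"
    and determined: "\<And>u. u \<in> stab_lattice n V \<Longrightarrow> (\<forall>s\<in>J. u s = 0) \<Longrightarrow> u = (\<lambda>_. 0)"
begin

lemma N_pos: "N > 0" using echelon by (simp add: echelon_def)
lemma v_stab: "s \<in> J \<Longrightarrow> v s \<in> stab_lattice n V" using echelon by (simp add: echelon_def)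
lemma v_coord: "s \<in> J \<Longrightarrow> v s \<in> coord_space n" using v_stab by (simp add: stab_lattice_def)
lemma v_at: "s \<in> J \<Longrightarrow> s' \<in> J \<Longrightarrow> v s s' = (if s = s' then N else 0)" using echelon by (simp add: echelon_def)
lemma finite_J [simp]: "finite J" using J finite_subset by blast
lemma V_torus: "V \<subseteq> torus n" by (rule variety_torus[OF V])
lemma V_nonzero: "x \<in> V \<Longrightarrow> x \<in> nonzero_points" using V_torus torus_nonzero by blast

lemma stab_zero: "(\<lambda>_. 0) \<in> stab_lattice n V"
proof -
  have "one_param (\<lambda>_. 0) t = 1" for t by (auto simp: one_param_def fun_eq_iff)
  then show ?thesis by (simp add: stab_lattice_def coord_space_def)
qed

lemma stab_sum: "finite S \<Longrightarrow> S \<subseteq> J \<Longrightarrow> (\<lambda>l. \<Sum>s\<in>S. a s * v s l) \<in> stab_lattice n V"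
proof (induction S rule: finite_induct)
  case (insert s S)
  then show ?case using stab_lattice_lin[OF v_stab, of s "\<lambda>l. \<Sum>s\<in>S. a s * v s l" "a s" 1] by simp
qed (simp add: stab_zero)

lemma stab_expand:
  assumes u: "u \<in> stab_lattice n V"
  shows "N * u l = (\<Sum>s\<in>J. u s * v s l)"
proof -
  have "(\<lambda>l. N * u l + (-1) * (\<Sum>s\<in>J. u s * v s l)) = (\<lambda>_. 0)"
  proof (rule determined[OF stab_lattice_lin[OF u stab_sum[OF finite_J order_refl]]], rule ballI)
    fix s' assume s': "s' \<in> J"
    have "(\<Sum>s\<in>J. u s * v s s') = (\<Sum>s\<in>J. if s = s' then u s * N else 0)"
      by (intro sum.cong refl) (use v_at s' in auto)
    then show "N * u s' + (-1) * (\<Sum>s\<in>J. u s * v s s') = 0" using s' by simp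
  qed
  from fun_cong[OF this, of l] show ?thesis by simp
qed

section \<open>Characters trivial on the stabilizer, and forms annihilating it\<close>

definition I :: "nat set" where "I = {..<n} - J"

text \<open>The exponents \<open>inv_mon i\<close> span, up to finite index, the characters trivial on the stabilizer.\<close>

definition inv_mon :: "nat \<Rightarrow> (nat \<Rightarrow>\<^sub>0 int)" where
  "inv_mon i = single i N - (\<Sum>s\<in>J. single s (v s i))"

lemma keys_inv_mon: "i \<in> I \<Longrightarrow> keys (inv_mon i) \<subseteq> {..<n}"
proof -
  assume i: "i \<in> I"
  have 1: "keys (single i N) \<subseteq> {..<n}" using i by (auto simp: I_def)
  have "keys (single s (v s i)) \<subseteq> {..<n}" if "s \<in> J" for s using that J by (cases "v s i = 0") auto
  then have 2: "keys (\<Sum>s\<in>J. single s (v s i)) \<subseteq> {..<n}"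
    using keys_sum[of "\<lambda>s. single s (v s i)" J] by blast
  show ?thesis unfolding inv_mon_def using keys_diff[of "single i N" "\<Sum>s\<in>J. single s (v s i)"] 1 2 by blast
qed

lemma ipair_inv_mon: "ipair u (inv_mon i) = u i * of_int N - (\<Sum>s\<in>J. u s * of_int (v s i))"
  by (simp add: inv_mon_def ipair_diff ipair_sum_right ipair_single)

lemma ipair_v_inv_mon: "s \<in> J \<Longrightarrow> ipair (v s) (inv_mon i) = 0"
proof -
  assume s: "s \<in> J"
  have "(\<Sum>s'\<in>J. v s s' * v s' i) = (\<Sum>s'\<in>J. if s' = s then N * v s i else 0)"
    by (intro sum.cong refl) (use v_at[OF s] in auto)
  then show ?thesis using s by (simp add: ipair_inv_mon)
qed

definition perp :: "(nat \<Rightarrow> complex) \<Rightarrow> bool" where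
  "perp w \<longleftrightarrow> (\<forall>s\<in>J. (\<Sum>l<n. w l * of_int (v s l)) = 0)"

lemma perp_stab:
  assumes w: "perp w" and u: "u \<in> stab_lattice n V"
  shows "(\<Sum>l<n. w l * of_int (u l)) = 0"
proof -
  have "of_int N * (\<Sum>l<n. w l * of_int (u l)) = (\<Sum>l<n. w l * of_int (N * u l))"
    by (simp add: sum_distrib_left mult_ac)
  also have "\<dots> = (\<Sum>l<n. \<Sum>s\<in>J. of_int (u s) * (w l * of_int (v s l)))"
    unfolding stab_expand[OF u] by (simp add: sum_distrib_left mult_ac)
  also have "\<dots> = (\<Sum>s\<in>J. of_int (u s) * (\<Sum>l<n. w l * of_int (v s l)))"
    by (subst sum.swap) (simp add: sum_distrib_left)
  also have "\<dots> = 0" using w by (simp add: perp_def)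
  finally show ?thesis using N_pos by simp
qed

text \<open>The entries outside \<open>J\<close> parametrise the annihilator of the stabilizer;
  those in \<open>J\<close> are solved for with the pivots.\<close>

lemma perp_extend: "\<exists>w. perp w \<and> (\<forall>i\<in>I. w i = p i)"
proof -
  define w where "w l = (if l \<in> J then - (\<Sum>i\<in>I. p i * of_int (v l i)) / of_int N else p l)" for l
  have "(\<Sum>l<n. w l * of_int (v s l)) = 0" if s: "s \<in> J" for s
  proof -
    have "{..<n} = J \<union> I" "J \<inter> I = {}" "finite I" using J by (auto simp: I_def)
    then have "(\<Sum>l<n. w l * of_int (v s l)) = (\<Sum>l\<in>J. w l * of_int (v s l)) + (\<Sum>l\<in>I. w l * of_int (v s l))"
      by (simp add: sum.union_disjoint)
    also have "(\<Sum>l\<in>J. w l * of_int (v s l)) = (\<Sum>l\<in>J. if l = s then w s * of_int N else 0)"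
      by (intro sum.cong refl) (use v_at[OF s] in auto)
    also have "\<dots> = - (\<Sum>i\<in>I. p i * of_int (v s i))" using s N_pos by (simp add: w_def)
    also have "(\<Sum>l\<in>I. w l * of_int (v s l)) = (\<Sum>i\<in>I. p i * of_int (v s i))"
      by (intro sum.cong refl) (auto simp: w_def I_def)
    finally show ?thesis by simp
  qed
  then show ?thesis by (intro exI[of _ w]) (auto simp: perp_def w_def I_def)
qed

section \<open>The stabilizer torus and its weights\<close>

definition act :: "(nat \<Rightarrow> complex) \<Rightarrow> nat \<Rightarrow> complex" where
  "act t = (\<lambda>l. \<Prod>s\<in>J. t s powi v s l)"

definition stable :: "(nat \<Rightarrow> complex) set \<Rightarrow> bool" where
  "stable X \<longleftrightarrow> (\<forall>x\<in>X. \<forall>s\<in>J. \<forall>t. t \<noteq> 0 \<longrightarrow> x * one_param (v s) t \<in> X)"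

lemma stable_V: "stable V"
  using v_stab by (auto simp: stable_def stab_lattice_def)

lemma stable_act:
  assumes X: "stable X" and x: "x \<in> X" and t: "\<And>s. s \<in> J \<Longrightarrow> t s \<noteq> 0"
  shows "x * act t \<in> X"
proof -
  have "finite S \<Longrightarrow> S \<subseteq> J \<Longrightarrow> x * (\<lambda>l. \<Prod>s\<in>S. t s powi v s l) \<in> X" for S
  proof (induction S rule: finite_induct)
    case empty
    have "x * (\<lambda>l. 1) = x" by (auto simp: fun_eq_iff)
    then show ?case using x by simp
  next
    case (insert s S)
    have eq: "x * (\<lambda>l. \<Prod>s\<in>insert s S. t s powi v s l) = (x * (\<lambda>l. \<Prod>s\<in>S. t s powi v s l)) * one_param (v s) (t s)"
      using insert.hyps by (auto simp: fun_eq_iff one_param_def)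
    have "x * (\<lambda>l. \<Prod>s\<in>S. t s powi v s l) \<in> X" "s \<in> J" using insert.IH insert.prems by blast+
    moreover have "t s \<noteq> 0" using t insert.prems by blast
    ultimately have "(x * (\<lambda>l. \<Prod>s\<in>S. t s powi v s l)) * one_param (v s) (t s) \<in> X"
      using X[unfolded stable_def, THEN bspec, THEN bspec, THEN spec, THEN mp] by blast
    then show ?case unfolding eq .
  qed
  then show ?thesis by (simp add: act_def)
qed

lemma act_torus: "(\<And>s. s \<in> J \<Longrightarrow> t s \<noteq> 0) \<Longrightarrow> act t \<in> torus n"
  using v_coord by (auto simp: act_def torus_def coord_space_def)

lemma monomial_at_act:
  assumes t: "\<And>s. s \<in> J \<Longrightarrow> t s \<noteq> 0"
  shows "monomial_at (act t) m = (\<Prod>s\<in>J. t s powi ipair (v s) m)"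
proof -
  have "finite S \<Longrightarrow> S \<subseteq> J \<Longrightarrow> monomial_at (\<lambda>l. \<Prod>s\<in>S. t s powi v s l) m = (\<Prod>s\<in>S. t s powi ipair (v s) m)" for S
  proof (induction S rule: finite_induct)
    case empty
    then show ?case by (simp add: monomial_at_def)
  next
    case (insert s S)
    have "(\<lambda>l. \<Prod>s\<in>insert s S. t s powi v s l) = one_param (v s) (t s) * (\<lambda>l. \<Prod>s\<in>S. t s powi v s l)"
      using insert.hyps by (auto simp: fun_eq_iff one_param_def)
    then show ?case using insert t by (simp add: monomial_at_mult monomial_at_one_param)
  qed
  then show ?thesis by (simp add: act_def)
qed

lemma act_J: "s \<in> J \<Longrightarrow> act t s = t s ^ nat N"
proof -
  assume s: "s \<in> J"
  have "act t s = (\<Prod>s'\<in>J. if s' = s then t s powi N else 1)"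
    unfolding act_def by (intro prod.cong refl) (use v_at s in auto)
  then show ?thesis using s N_pos by (simp add: power_int_def)
qed

text \<open>Translating \<open>x\<close> along \<open>v s\<close> by the parameters 2^k gives power
  sums in \<open>2 powi ipair (v s) m\<close>. These numbers determine the weights, since 2 is not a
  root of unity.\<close>

lemma stable_group_sum:
  assumes X: "stable X" and f: "f \<in> vanishing_ideal n X" and s: "s \<in> J" and x: "x \<in> X"
  shows "(\<Sum>m\<in>{m\<in>keys f. ipair (v s) m = a}. lookup f m * monomial_at x m) = 0"
proof -
  have "(\<Sum>m\<in>keys f. (lookup f m * monomial_at x m) * (2 powi ipair (v s) m) ^ k) = 0" for k
  proof -
    have p: "(2::complex) ^ k \<noteq> 0" by simp
    have "x * one_param (v s) (2 ^ k) \<in> X" using X x s p unfolding stable_def by blast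
    then have "leval f (x * one_param (v s) (2 ^ k)) = 0" by (rule vanishing_idealD[OF f])
    moreover have "((2::complex) ^ k) powi a = (2 powi a) ^ k" for a
      by (simp add: power_int_power power_int_power' mult.commute)
    ultimately show ?thesis by (simp add: leval_eq monomial_at_mult monomial_at_one_param mult.assoc)
  qed
  from power_sums_separate[OF finite_keys this, of "2 powi a"]
  have "(\<Sum>m\<in>{m\<in>keys f. (2::complex) powi ipair (v s) m = 2 powi a}. lookup f m * monomial_at x m) = 0" .
  moreover have "{m\<in>keys f. (2::complex) powi ipair (v s) m = 2 powi a} = {m\<in>keys f. ipair (v s) m = a}"
    using two_powi_inject by auto
  ultimately show ?thesis by simp
qed

lemma stable_class:
  assumes X: "stable X" and f: "f \<in> vanishing_ideal n X" and S: "finite S" "S \<subseteq> J"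
  shows "lfilter (\<lambda>m. \<forall>s\<in>S. ipair (v s) m = a s) f \<in> vanishing_ideal n X"
  using S
proof (induction S rule: finite_induct)
  case empty
  have "lfilter (\<lambda>m. \<forall>s\<in>{}. ipair (v s) m = a s) f = f" by (rule poly_mapping_eqI) (simp add: lookup_lfilter)
  then show ?case using f by simp
next
  case (insert s S)
  let ?g = "lfilter (\<lambda>m. \<forall>s\<in>S. ipair (v s) m = a s) f"
  have g: "?g \<in> vanishing_ideal n X" using insert by simp
  have "leval (lfilter (\<lambda>m. \<forall>s\<in>insert s S. ipair (v s) m = a s) f) x = 0" if x: "x \<in> X" for x
  proof -
    have "leval (lfilter (\<lambda>m. \<forall>s\<in>insert s S. ipair (v s) m = a s) f) x =
      (\<Sum>m\<in>{m\<in>keys ?g. ipair (v s) m = a s}. lookup ?g m * monomial_at x m)"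
      unfolding leval_lfilter by (intro sum.cong) (auto simp: keys_lfilter lookup_lfilter)
    then show ?thesis using stable_group_sum[OF X g _ x, of s "a s"] insert.prems by simp
  qed
  then show ?case using f by (auto simp: vanishing_ideal_def intro: laurent_lfilter)
qed

text \<open>The selected terms form a union of full weight classes, and each class vanishes on
  \<open>X\<close> by \<open>stable_class\<close>. Initial forms in directions spanned by the
  stabilizer are of this kind.\<close>

lemma stable_filter:
  assumes X: "stable X" and f: "f \<in> vanishing_ideal n X"
    and Q: "\<And>m m'. (\<And>s. s \<in> J \<Longrightarrow> ipair (v s) m = ipair (v s) m') \<Longrightarrow> Q m = Q m'"
  shows "lfilter Q f \<in> vanishing_ideal n X"
proof -
  let ?k = "\<lambda>m s. if s \<in> J then ipair (v s) m else 0"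
  have "leval (lfilter Q f) x = 0" if x: "x \<in> X" for x
  proof -
    let ?S = "{m\<in>keys f. Q m}"
    have "leval (lfilter Q f) x = (\<Sum>\<kappa>\<in>?k ` ?S. \<Sum>m\<in>{m\<in>?S. ?k m = \<kappa>}. lookup f m * monomial_at x m)"
      unfolding leval_lfilter by (rule sum.image_gen) simp
    also have "\<dots> = 0"
    proof (rule sum.neutral, rule ballI)
      fix \<kappa> assume "\<kappa> \<in> ?k ` ?S"
      then obtain m0 where m0: "m0 \<in> keys f" "Q m0" "\<kappa> = ?k m0" by blast
      have "{m\<in>?S. ?k m = \<kappa>} = {m\<in>keys f. \<forall>s\<in>J. ipair (v s) m = ipair (v s) m0}"
      proof (intro equalityI subsetI)
        fix m assume "m \<in> {m\<in>?S. ?k m = \<kappa>}"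
        then show "m \<in> {m\<in>keys f. \<forall>s\<in>J. ipair (v s) m = ipair (v s) m0}"
          using m0(3) by (auto simp: fun_eq_iff) metis
      next
        fix m assume m: "m \<in> {m\<in>keys f. \<forall>s\<in>J. ipair (v s) m = ipair (v s) m0}"
        then have "Q m = Q m0" by (intro Q) auto
        then show "m \<in> {m\<in>?S. ?k m = \<kappa>}" using m m0 by (auto simp: fun_eq_iff)
      qed
      then show "(\<Sum>m\<in>{m\<in>?S. ?k m = \<kappa>}. lookup f m * monomial_at x m) = 0"
        using vanishing_idealD[OF stable_class[OF X f finite_J order_refl, of "\<lambda>s. ipair (v s) m0"] x]
        by (simp add: leval_lfilter)
    qed
    finally show ?thesis .
  qed
  then show ?thesis using f by (auto simp: vanishing_ideal_def intro: laurent_lfilter)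
qed

text \<open>The derivative along \<open>v s\<close> multiplies every weight class of
  \<open>f\<close> by its weight, and each class vanishes at \<open>x\<close>.\<close>

lemma v_tangent:
  assumes x: "x \<in> V" and s: "s \<in> J"
  shows "(\<lambda>l. of_int (v s l)) \<in> log_tangent n V x"
proof -
  have "log_deriv n x (\<lambda>l. of_int (v s l)) f = 0" if f: "f \<in> vanishing_ideal n V" for f
  proof -
    have "log_deriv n x (\<lambda>l. of_int (v s l)) f = (\<Sum>m\<in>keys f. lookup f m * monomial_at x m * of_int (ipair (v s) m))"
      using log_deriv_ipair[OF vanishing_ideal_laurent[OF f]] by (simp add: ipair_of_int)
    also have "\<dots> = (\<Sum>a\<in>ipair (v s) ` keys f. \<Sum>m\<in>{m\<in>keys f. ipair (v s) m = a}. lookup f m * monomial_at x m * of_int (ipair (v s) m))"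
      by (rule sum.image_gen) simp
    also have "\<dots> = (\<Sum>a\<in>ipair (v s) ` keys f. (\<Sum>m\<in>{m\<in>keys f. ipair (v s) m = a}. lookup f m * monomial_at x m) * of_int a)"
      unfolding sum_distrib_right by (intro sum.cong refl) auto
    also have "\<dots> = 0" using stable_group_sum[OF stable_V f s x] by simp
    finally show ?thesis .
  qed
  then show ?thesis using v_coord[OF s] by (simp add: log_tangent_def coord_space_def)
qed

definition conormal :: "(nat \<Rightarrow> complex) \<Rightarrow> (nat \<Rightarrow> complex) \<Rightarrow> bool" where
  "conormal x c \<longleftrightarrow> (\<forall>\<eta>\<in>log_tangent n V x. (\<Sum>l<n. c l * \<eta> l) = 0)"

lemma conormal_perp: "x \<in> V \<Longrightarrow> conormal x c \<Longrightarrow> perp c"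
  unfolding conormal_def perp_def by (intro ballI) (rule bspec[OF _ v_tangent])

lemma covector_conormal: "f \<in> vanishing_ideal n V \<Longrightarrow> conormal x (covector f x)"
  by (auto simp: conormal_def log_tangent_def log_deriv_covector mult.commute)

lemma log_tangent_act:
  assumes x: "x \<in> V" and t: "\<And>s. s \<in> J \<Longrightarrow> t s \<noteq> 0"
  shows "log_tangent n V (x * act t) = log_tangent n V x"
proof -
  have le: "log_tangent n V x \<subseteq> log_tangent n V (x * act t)" if t: "\<And>s. s \<in> J \<Longrightarrow> t s \<noteq> 0" for x t
  proof
    fix \<eta> assume \<eta>: "\<eta> \<in> log_tangent n V x"
    have "log_deriv n (x * act t) \<eta> f = 0" if f: "f \<in> vanishing_ideal n V" for f
    proof -
      have "rescale (act t) f \<in> vanishing_ideal n V"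
        using f stable_act[OF stable_V _ t] by (auto simp: vanishing_ideal_def leval_rescale intro: laurent_rescale)
      then have "log_deriv n x \<eta> (rescale (act t) f) = 0" using \<eta> by (simp add: log_tangent_def)
      then show ?thesis by (simp add: log_deriv_def euler_rescale leval_rescale)
    qed
    then show "\<eta> \<in> log_tangent n V (x * act t)" using \<eta> by (simp add: log_tangent_def)
  qed
  have "act t * act (\<lambda>s. inverse (t s)) = 1"
    using t by (auto simp: act_def fun_eq_iff prod.distrib[symmetric] power_int_inverse intro!: prod.neutral)
  then have "x * act t * act (\<lambda>s. inverse (t s)) = x" by (simp add: mult.assoc)
  then show ?thesis using le[where t=t and x=x] le[where t="\<lambda>s. inverse (t s)" and x="x * act t"] t by auto
qed

subsection \<open>A conormal vector with few zeros\<close>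

text \<open>Along an orbit \<open>f\<close> is a Laurent polynomial in the parameters
  \<open>t\<close>; \<open>K\<close> bounds its negative exponents.\<close>

lemma pfun_act:
  assumes "f \<in> laurent n"
  shows "\<exists>P\<in>pfun J. \<exists>K. \<forall>t. (\<forall>s\<in>J. t s \<noteq> 0) \<longrightarrow> P t = leval f (x * act t) * (\<Prod>s\<in>J. t s ^ K)"
proof -
  define K where "K = nat (\<Sum>m\<in>keys f. \<Sum>s\<in>J. \<bar>ipair (v s) m\<bar>)"
  have K: "- ipair (v s) m \<le> int K" if "m \<in> keys f" "s \<in> J" for m s
  proof -
    have "\<bar>ipair (v s) m\<bar> \<le> (\<Sum>s\<in>J. \<bar>ipair (v s) m\<bar>)" using that by (intro member_le_sum) auto
    also have "\<dots> \<le> (\<Sum>m\<in>keys f. \<Sum>s\<in>J. \<bar>ipair (v s) m\<bar>)"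
      by (rule member_le_sum[OF that(1), of "\<lambda>m. \<Sum>s\<in>J. \<bar>ipair (v s) m\<bar>"]) (auto intro: sum_nonneg)
    finally show ?thesis unfolding K_def by linarith
  qed
  define P where "P t = (\<Sum>m\<in>keys f. lookup f m * monomial_at x m * (\<Prod>s\<in>J. t s ^ nat (int K + ipair (v s) m)))" for t
  have "P \<in> pfun J" unfolding P_def[abs_def]
    by (intro pfun_sum pfun.mult pfun_prod pfun_power pfun.const pfun.proj)
  moreover have "P t = leval f (x * act t) * (\<Prod>s\<in>J. t s ^ K)" if t: "\<forall>s\<in>J. t s \<noteq> 0" for t
  proof -
    have "(\<Prod>s\<in>J. t s ^ nat (int K + ipair (v s) m)) = monomial_at (act t) m * (\<Prod>s\<in>J. t s ^ K)" if m: "m \<in> keys f" for m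
    proof -
      have "t s ^ nat (int K + ipair (v s) m) = t s powi ipair (v s) m * t s ^ K" if s: "s \<in> J" for s
      proof -
        have "t s ^ nat (int K + ipair (v s) m) = t s powi (int K + ipair (v s) m)"
          using K[OF m s] by (simp add: power_int_def)
        also have "\<dots> = t s powi ipair (v s) m * t s ^ K" using t s by (simp add: power_int_add)
        finally show ?thesis .
      qed
      then show ?thesis using t by (simp add: monomial_at_act prod.distrib[symmetric] cong: prod.cong)
    qed
    then show ?thesis by (simp add: P_def leval_eq monomial_at_mult sum_distrib_right mult.assoc)
  qed
  ultimately show ?thesis by blast
qed

lemma perp_line: "perp c \<Longrightarrow> perp d \<Longrightarrow> perp (\<lambda>l. c l + t * (d l - c l))"
proof -
  assume a: "perp c" "perp d"
  have "(\<Sum>l<n. (c l + t * (d l - c l)) * of_int (v s l)) =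
    (1 - t) * (\<Sum>l<n. c l * of_int (v s l)) + t * (\<Sum>l<n. d l * of_int (v s l))" for s
    by (simp add: sum_distrib_left sum.distrib[symmetric] algebra_simps)
  then show ?thesis using a by (simp add: perp_def)
qed

text \<open>On the conormal variety, of dimension \<open>n\<close>, the entries c_l with l in
  \<open>I\<close>, the coordinates x_l with l in \<open>J\<close> and one character
  \<open>inv_mon i\<close> are n + 1 functions, hence satisfy a relation \<open>G i\<close>. The
  zeros of a fixed \<open>w\<close> are stable under the stabilizer, which moves the coordinates in
  \<open>J\<close> arbitrarily but fixes the character. So these coordinates can be specialised, and
  an equation in one variable for the character remains, nontrivial for general
  \<open>w\<close>.\<close>

lemma good_conormal:
  assumes q: "q \<in> pfun {..<n}" and w0: "perp w0" "q w0 \<noteq> 0"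
  shows "\<exists>w x. x \<in> chart n V \<and> conormal x w \<and> perp w \<and> q w \<noteq> 0 \<and>
    (\<forall>i\<in>I. finite {monomial_at y (inv_mon i) | y. y \<in> chart n V \<and> conormal y w})"
proof -
  have chV: "chart n V \<subseteq> V" by (rule chart_subset)
  have IJ: "l < n \<Longrightarrow> l \<notin> I \<Longrightarrow> l \<in> J" "l \<in> I \<Longrightarrow> l < n" "n \<notin> I" "n \<notin> J" for l using J by (auto simp: I_def)
  \<comment> \<open>The index \<open>n\<close> is the slot of the character; the slots below
    \<open>n\<close> are shared between \<open>I\<close> and \<open>J\<close>.\<close>
  define f where "f i l = (if l \<in> J then lvar l 1 else if l = n then single (inv_mon i) 1 else 0)" for i l
  have fl: "f i l \<in> laurent n" if "i \<in> I" for i l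
    using J keys_inv_mon[OF that] by (auto simp: f_def intro!: lvar_laurent laurent_single)
  define R0 where "R0 i G \<longleftrightarrow> G \<in> pfun {..n} \<and> (\<exists>y. G y \<noteq> 0) \<and>
    (\<forall>x\<in>chart n V. \<forall>c. conormal x c \<longrightarrow> G (\<lambda>l. if l \<in> I then c l else leval (f i l) x) = 0)" for i G
  have "\<exists>G. R0 i G" if i: "i \<in> I" for i
    using conormal_dependent[OF V, of I "f i", OF _ fl[OF i]] unfolding R0_def conormal_def I_def by blast
  then obtain G where "\<And>i. i \<in> I \<Longrightarrow> R0 i (G i)" by metis
  then have G: "i \<in> I \<Longrightarrow> G i \<in> pfun {..n}" "i \<in> I \<Longrightarrow> \<exists>y. G i y \<noteq> 0"
    "i \<in> I \<Longrightarrow> x \<in> chart n V \<Longrightarrow> conormal x c \<Longrightarrow> G i (\<lambda>l. if l \<in> I then c l else leval (f i l) x) = 0"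
    for i x c unfolding R0_def by blast+
  from G(2) obtain p where p: "\<And>i. i \<in> I \<Longrightarrow> G i (p i) \<noteq> 0" by metis
  \<comment> \<open>The conditions on \<open>w\<close>: the given \<open>q\<close> is nonzero, and
    so is each relation \<open>G i\<close> after its other arguments are specialised to
    \<open>p i\<close>.\<close>
  define Q where "Q s = (case s of None \<Rightarrow> q | Some i \<Rightarrow> (\<lambda>w. G i (\<lambda>l. if l \<in> I then w l else p i l)))" for s
  let ?S = "insert None (Some ` I)"
  have Sf: "finite ?S" by (simp add: I_def)
  have Qp: "Q s \<in> pfun {..<n}" if s: "s \<in> ?S" for s
  proof (cases s)
    case (Some i)
    then have i: "i \<in> I" using s by auto
    have "(\<lambda>w. G i (\<lambda>l. if l \<in> I then w l else p i l)) \<in> pfun {..<n}"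
    proof (rule pfun_subst[OF G(1)[OF i]])
      fix l show "(\<lambda>w. if l \<in> I then w l else p i l) \<in> pfun {..<n}"
        using IJ(2) by (cases "l \<in> I") (auto intro: pfun.intros)
    qed
    then show ?thesis by (simp add: Q_def Some)
  qed (use q in \<open>simp add: Q_def\<close>)
  have "\<exists>c\<in>{c. perp c}. \<forall>s\<in>?S. Q s c \<noteq> 0"
  proof (rule pfun_nonzero_prod[OF Sf Qp])
    fix s assume s: "s \<in> ?S"
    show "\<exists>c\<in>{c. perp c}. Q s c \<noteq> 0"
    proof (cases s)
      case (Some i)
      then have i: "i \<in> I" using s by auto
      obtain w where w: "perp w" "\<forall>l\<in>I. w l = p i l" using perp_extend by blast
      have "(\<lambda>l. if l \<in> I then w l else p i l) = p i" using w(2) by auto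
      then show ?thesis using w(1) p[OF i] by (auto simp: Q_def Some)
    qed (use w0 in \<open>auto simp: Q_def\<close>)
  qed (use w0 perp_line in auto)
  then obtain w1 where w1: "perp w1" "\<forall>s\<in>?S. Q s w1 \<noteq> 0" by blast
  \<comment> \<open>All conditions in one polynomial that is nonzero somewhere on the annihilator of
    the stabilizer. By \<open>covectors_dense\<close> it is also nonzero at an actual conormal
    vector.\<close>
  define R where "R c = (\<Prod>s\<in>?S. Q s c)" for c
  have R: "R \<in> pfun {..<n}" unfolding R_def[abs_def] by (intro pfun_prod Qp)
  have "R w1 \<noteq> 0" using w1(2) Sf by (simp add: R_def prod_zero_iff)
  then have "\<exists>x\<in>V. \<exists>g\<in>vanishing_ideal n V. R (covector g x) \<noteq> 0"
    using covectors_dense[OF V R, of w1] perp_stab[OF w1(1)] by blast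
  then obtain x0 g where x0: "x0 \<in> V" "g \<in> vanishing_ideal n V" "R (covector g x0) \<noteq> 0" by blast
  obtain h where h: "h \<in> laurent n" "\<And>x. x \<in> nonzero_points \<Longrightarrow> leval h x = R (covector g x)"
    using pfun_laurent[OF R, of "\<lambda>l. euler l g" n] laurent_euler[OF vanishing_ideal_laurent[OF x0(2)]]
    unfolding covector_def by blast
  have "\<not> vanishes V h" using x0 h(2)[OF V_nonzero[OF x0(1)]] unfolding vanishes_def by metis
  then obtain x where x: "x \<in> chart n V" "leval h x \<noteq> 0" using chart_nonvanishing[OF V, of "{h}"] h(1) by auto
  define w where "w = covector g x"
  have xV: "x \<in> V" using x chV by blast
  have "R w \<noteq> 0" using x h(2)[OF V_nonzero[OF xV]] by (simp add: w_def)
  then have Qw: "\<And>s. s \<in> ?S \<Longrightarrow> Q s w \<noteq> 0" using Sf by (auto simp: R_def)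
  have cw: "conormal x w" unfolding w_def by (rule covector_conormal[OF x0(2)])
  have "finite {monomial_at y (inv_mon i) | y. y \<in> chart n V \<and> conormal y w}" if i: "i \<in> I" for i
  proof -
    define F where "F T = G i (\<lambda>l. if l \<in> I then w l else if l = n then T else p i l)" for T
    have "G i (\<lambda>l. if l \<in> I then w l else p i l) \<noteq> 0" using Qw[of "Some i"] i by (simp add: Q_def)
    moreover have "(\<lambda>l. if l \<in> I then w l else p i l) = (\<lambda>l. if l \<in> I then w l else if l = n then p i n else p i l)" by auto
    ultimately have F0: "F (p i n) \<noteq> 0" by (simp add: F_def)
    define a where "a l = (if l \<in> I then w l else if l = n then 0 else p i l)" for l
    define b where "b l = (if l = n then 1 else 0 :: complex)" for l
    have Fl: "F T = G i (\<lambda>l. a l + T * b l)" for T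
      unfolding F_def a_def b_def using IJ(3) by (intro arg_cong[of _ _ "G i"]) auto
    have fin: "finite {T. F T = 0}"
      using pfun_line_finite_zeros[OF G(1)[OF i], of a "p i n" b] F0 unfolding Fl by simp
    have "F (monomial_at y (inv_mon i)) = 0" if y: "y \<in> chart n V" "conormal y w" for y
    proof -
      have yV: "y \<in> V" using y chV by blast
      have yn: "y \<in> nonzero_points" by (rule V_nonzero[OF yV])
      let ?\<tau> = "monomial_at y (inv_mon i)"
      \<comment> \<open>The relation \<open>G i\<close> along the orbit of \<open>y\<close>. It is
        known where the translate stays in the chart, hence holds identically in
        \<open>t\<close>.\<close>
      define H where "H t = G i (\<lambda>l. if l \<in> I then w l else if l \<in> J then y l * t l ^ nat N else ?\<tau>)" for t
      have H: "H \<in> pfun J" unfolding H_def[abs_def]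
      proof (rule pfun_subst[OF G(1)[OF i]])
        fix l show "(\<lambda>t. if l \<in> I then w l else if l \<in> J then y l * t l ^ nat N else ?\<tau>) \<in> pfun J"
          by (cases "l \<in> I"; cases "l \<in> J") (auto intro!: pfun.mult pfun_power pfun.const pfun.proj)
      qed
      define T where "T = tlead V ` alg_vars n V \<union> (\<lambda>j. euler j (tpoly V j)) ` alg_vars n V"
      have T: "finite T" "\<And>g. g \<in> T \<Longrightarrow> g \<in> laurent n" "\<And>z. z \<in> V \<Longrightarrow> (\<forall>g\<in>T. leval g z \<noteq> 0) \<longleftrightarrow> z \<in> chart n V"
        using tpoly_facts[OF V] by (auto simp: T_def chart_def intro: laurent_euler)
      have "\<exists>P. P \<in> pfun J \<and> (\<exists>K. \<forall>t. (\<forall>s\<in>J. t s \<noteq> 0) \<longrightarrow> P t = leval g (y * act t) * (\<Prod>s\<in>J. t s ^ K))" if "g \<in> T" for g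
        using pfun_act[OF T(2)[OF that], of y] by blast
      then obtain P where P: "\<And>g. g \<in> T \<Longrightarrow> P g \<in> pfun J"
        "\<And>g. g \<in> T \<Longrightarrow> \<exists>K. \<forall>t. (\<forall>s\<in>J. t s \<noteq> 0) \<longrightarrow> P g t = leval g (y * act t) * (\<Prod>s\<in>J. t s ^ K)" by metis
      define Z where "Z s = (case s of Inl g \<Rightarrow> P g | Inr j \<Rightarrow> (\<lambda>t. t j))" for s :: "laurent_poly + nat"
      have Hz: "H t = 0" for t
      proof (rule pfun_vanish_open[of "Inl ` T \<union> Inr ` J" H J Z])
        show "finite (Inl ` T \<union> Inr ` J)" using T by simp
        show "H \<in> pfun J" by (rule H)
        fix s assume s: "s \<in> Inl ` T \<union> Inr ` J"
        then show "Z s \<in> pfun J" using P(1) by (auto simp: Z_def intro: pfun.proj)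
        have a1: "y * act (\<lambda>_. 1) = y" by (auto simp: act_def fun_eq_iff)
        have "Z s (\<lambda>_. 1) \<noteq> 0"
        proof (cases s)
          case (Inl g)
          then have g: "g \<in> T" using s by auto
          obtain K where "\<And>t. (\<forall>s\<in>J. t s \<noteq> 0) \<Longrightarrow> P g t = leval g (y * act t) * (\<Prod>s\<in>J. t s ^ K)" using P(2)[OF g] by blast
          from this[of "\<lambda>_. 1"] have "P g (\<lambda>_. 1) = leval g y" by (simp add: a1)
          then show ?thesis using T(3)[OF yV] y(1) g by (auto simp: Z_def Inl)
        qed (simp add: Z_def)
        then show "\<exists>c. Z s c \<noteq> 0" by blast
      next
        fix t assume Zt: "\<And>s. s \<in> Inl ` T \<union> Inr ` J \<Longrightarrow> Z s t \<noteq> 0"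
        have t: "t s \<noteq> 0" if "s \<in> J" for s using Zt[of "Inr s"] that by (simp add: Z_def)
        have yt: "y * act t \<in> V" by (rule stable_act[OF stable_V yV t])
        have "leval g (y * act t) \<noteq> 0" if g: "g \<in> T" for g
          using Zt[of "Inl g"] P(2)[OF g] t g by (auto simp: Z_def)
        then have ch: "y * act t \<in> chart n V" using T(3)[OF yt] by blast
        have "conormal (y * act t) w" using y(2) log_tangent_act[OF yV t] by (simp add: conormal_def)
        from G(3)[OF i ch this] have "G i (\<lambda>l. if l \<in> I then w l else leval (f i l) (y * act t)) = 0" .
        also have "G i (\<lambda>l. if l \<in> I then w l else leval (f i l) (y * act t)) = H t"
          unfolding H_def
        proof (rule pfun_cong[OF G(1)[OF i]])
          fix l assume l: "l \<in> {..n}"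
          have "monomial_at (act t) (inv_mon i) = 1" using t by (simp add: monomial_at_act ipair_v_inv_mon)
          then have "leval (f i n) (y * act t) = ?\<tau>"
            using IJ(4) by (simp add: f_def leval_single monomial_at_mult)
          moreover have "leval (f i l) (y * act t) = y l * t l ^ nat N" if "l \<in> J"
            using that act_J by (simp add: f_def leval_lvar)
          moreover have "l = n" if "l \<notin> I" "l \<notin> J" using that l IJ(1)[of l] by force
          ultimately show "(if l \<in> I then w l else leval (f i l) (y * act t)) =
            (if l \<in> I then w l else if l \<in> J then y l * t l ^ nat N else ?\<tau>)" by auto
        qed
        finally show "H t = 0" .
      qed
      \<comment> \<open>Roots of order \<open>N\<close> move the coordinates in \<open>J\<close> to
        the values \<open>p i l\<close>. A zero value is allowed, since \<open>H\<close> vanishes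
        for all \<open>t\<close>.\<close>
      have "\<exists>t. t ^ nat N = p i l / y l" for l
        using exists_complex_root[of "nat N" "p i l / y l"] N_pos by (metis zero_less_nat_eq less_numeral_extra(3))
      then obtain t where t: "\<And>l. t l ^ nat N = p i l / y l" by metis
      have "F ?\<tau> = H t" unfolding F_def H_def
      proof (rule pfun_cong[OF G(1)[OF i]])
        fix l assume l: "l \<in> {..n}"
        have "l = n" if "l \<notin> I" "l \<notin> J" using that l IJ(1)[of l] by force
        then show "(if l \<in> I then w l else if l = n then ?\<tau> else p i l) =
          (if l \<in> I then w l else if l \<in> J then y l * t l ^ nat N else ?\<tau>)"
          using t nonzero_pointsD[OF yn] IJ(4) by auto
      qed
      then show ?thesis by (simp add: Hz)
    qed
    then have "{monomial_at y (inv_mon i) | y. y \<in> chart n V \<and> conormal y w} \<subseteq> {T. F T = 0}" by blast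
    then show ?thesis using fin finite_subset by blast
  qed
  moreover have "q w \<noteq> 0" using Qw[of None] by (simp add: Q_def)
  ultimately show ?thesis using x(1) cw conormal_perp[OF xV cw] by blast
qed

end

lemma stabilizer_basis_exists:
  assumes V: "variety n V"
  shows "\<exists>J N v. stabilizer_basis n V J N v"
proof -
  have "stab_lattice n V \<subseteq> coord_space n" by (auto simp: stab_lattice_def)
  from echelon_exists[OF this stab_lattice_lin] show ?thesis
    unfolding stabilizer_basis_def using V by blast
qed

section \<open>Degeneracy loci of generic forms\<close>

lemma closed_translate:
  assumes X: "zariski_closed n X" and y: "y \<in> torus n"
  shows "zariski_closed n {x \<in> torus n. x * y \<in> X}"
proof -
  have "{x \<in> torus n. x * y \<in> X} = zero_locus n (rescale y ` vanishing_ideal n X)"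
  proof (intro equalityI subsetI)
    fix x assume "x \<in> {x \<in> torus n. x * y \<in> X}"
    then show "x \<in> zero_locus n (rescale y ` vanishing_ideal n X)"
      by (auto simp: zero_locus_def leval_rescale dest: vanishing_idealD)
  next
    fix x assume x: "x \<in> zero_locus n (rescale y ` vanishing_ideal n X)"
    then have xt: "x \<in> torus n" by (simp add: zero_locus_def)
    have "x * y \<in> X"
    proof (rule zariski_closed_memI[OF X torus_mult[OF xt y]])
      fix f assume "f \<in> vanishing_ideal n X"
      then have "leval (rescale y f) x = 0" using x by (simp add: zero_locus_def)
      then show "leval f (x * y) = 0" by (simp add: leval_rescale)
    qed
    then show "x \<in> {x \<in> torus n. x * y \<in> X}" using xt by simp
  qed
  moreover have "rescale y ` vanishing_ideal n X \<subseteq> laurent n" using laurent_rescale vanishing_ideal_laurent by blast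
  ultimately show ?thesis by (simp add: zariski_closed_zero_locus)
qed

text \<open>A Laurent polynomial that vanishes on \<open>D\<close> vanishes on the closure, so
  irreducibility may be tested on \<open>D\<close>.\<close>

lemma closure_variety:
  assumes D: "D \<subseteq> torus n" "D \<noteq> {}"
    and prime: "\<And>f g. f \<in> laurent n \<Longrightarrow> g \<in> laurent n \<Longrightarrow> (\<And>x. x \<in> D \<Longrightarrow> leval f x * leval g x = 0) \<Longrightarrow>
      (\<forall>x\<in>D. leval f x = 0) \<or> (\<forall>x\<in>D. leval g x = 0)"
  shows "variety n (zariski_closure n D)"
proof (rule varietyI[OF closure_closed[OF D(1)]])
  show "zariski_closure n D \<noteq> {}" using D(2) closure_subset by blast
  fix f g assume f: "f \<in> laurent n" and g: "g \<in> laurent n"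
    and fg: "\<And>x. x \<in> zariski_closure n D \<Longrightarrow> leval f x * leval g x = 0"
  have "(\<forall>x\<in>D. leval f x = 0) \<or> (\<forall>x\<in>D. leval g x = 0)"
    by (rule prime[OF f g]) (use fg closure_subset in blast)
  then show "(\<forall>x\<in>zariski_closure n D. leval f x = 0) \<or> (\<forall>x\<in>zariski_closure n D. leval g x = 0)"
    using closure_vanish[OF f D(1)] closure_vanish[OF g D(1)] by blast
qed

lemma inv_form_conormal:
  assumes x: "x \<in> nonzero_points"
  shows "(\<forall>v\<in>tangent_space n V x. inv_form n c x v = 0) \<longleftrightarrow> (\<forall>\<eta>\<in>log_tangent n V x. (\<Sum>l<n. c l * \<eta> l) = 0)"
proof -
  have "inv_form n c x (x * \<eta>) = (\<Sum>l<n. c l * \<eta> l)" for \<eta>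
    unfolding inv_form_log using nonzero_pointsD[OF x] by simp
  then show ?thesis unfolding tangent_space_image[OF x] by simp
qed

lemma inv_form_sum: "(\<Sum>j\<le>k. a j * inv_form n (w j) x v) = inv_form n (\<lambda>l. \<Sum>j\<le>k. a j * w j l) x v"
  unfolding inv_form_def sum_distrib_left sum_distrib_right sum_divide_distrib
  by (subst sum.swap) (simp add: mult_ac)

context stabilizer_basis
begin

definition k :: nat where "k = card J"

definition zeros :: "(nat \<Rightarrow> complex) \<Rightarrow> (nat \<Rightarrow> complex) set" where
  "zeros w = {x \<in> smooth_part n V. conormal x w}"

lemma smooth_V: "x \<in> smooth_part n V \<Longrightarrow> x \<in> V" by (simp add: smooth_part_def)

lemma degeneracy_locus_conormal:
  "degeneracy_locus n V m w = {x \<in> smooth_part n V. \<exists>a. (\<exists>j\<le>m. a j \<noteq> 0) \<and> conormal x (\<lambda>l. \<Sum>j\<le>m. a j * w j l)}"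
proof -
  have "(\<forall>v\<in>tangent_space n V x. (\<Sum>j\<le>m. a j * inv_form n (w j) x v) = 0) \<longleftrightarrow> conormal x (\<lambda>l. \<Sum>j\<le>m. a j * w j l)"
    if "x \<in> smooth_part n V" for x a
    unfolding inv_form_sum conormal_def by (rule inv_form_conormal[OF V_nonzero[OF smooth_V[OF that]]])
  then show ?thesis unfolding degeneracy_locus_def by blast
qed

lemma conormal_scale: "conormal x w \<Longrightarrow> conormal x (\<lambda>l. b * w l)"
  by (simp add: conormal_def mult.assoc sum_distrib_left[symmetric])

text \<open>It feeds \<open>span_dependency\<close> whenever more than \<open>card J\<close> vectors
  supported on \<open>J\<close> occur.\<close>

lemma units_span:
  fixes u :: "nat \<Rightarrow> complex"
  assumes "\<And>s. s \<notin> J \<Longrightarrow> u s = 0"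
  shows "u \<in> fvec.span ((\<lambda>s s'. if s = s' then 1 else 0) ` J)"
proof -
  have "u = (\<Sum>s\<in>J. fscale (u s) (\<lambda>s'. if s = s' then 1 else 0))"
  proof
    fix s'
    have "(\<Sum>s\<in>J. fscale (u s) (\<lambda>s'. if s = s' then 1 else 0)) s' = (\<Sum>s\<in>J. if s = s' then u s else 0)"
      by (simp add: fscale_def if_distrib cong: if_cong)
    also have "\<dots> = u s'" using assms[of s'] by simp
    finally show "u s' = (\<Sum>s\<in>J. fscale (u s) (\<lambda>s'. if s = s' then 1 else 0)) s'" by simp
  qed
  also have "\<dots> \<in> fvec.span ((\<lambda>s s'. if s = s' then 1 else 0) ` J)"
    by (intro fvec.span_sum fvec.span_scale fvec.span_base) auto
  finally show ?thesis .
qed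

lemma units_card: "finite ((\<lambda>s s'. if s = s' then 1 else (0::complex)) ` J)" "card ((\<lambda>s s'. if s = s' then 1 else (0::complex)) ` J) \<le> card J"
  by (auto intro: card_image_le)

definition pr :: "(nat \<Rightarrow> complex) \<Rightarrow> nat \<Rightarrow> complex" where
  "pr w s = (\<Sum>l<n. w l * of_int (v s l))"

lemma pr_sum: "pr (\<lambda>l. \<Sum>j\<in>S. a j * w j l) s = (\<Sum>j\<in>S. a j * pr (w j) s)"
  unfolding pr_def sum_distrib_left sum_distrib_right by (subst sum.swap) (simp add: mult_ac)

text \<open>Generic forms \<open>c 0, \<dots>, c k\<close> have a unique combination annihilated by the stabilizer.  The
  uniqueness is enforced by making the pairing matrix of the last \<open>k\<close> forms diagonally dominant.\<close>

lemma good_forms: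
  assumes p: "p \<in> pfun ({..k} \<times> {..<n})" "p c0 \<noteq> 0"
  shows "\<exists>c w x. p c \<noteq> 0 \<and> degeneracy_locus n V k (\<lambda>j i. c (j, i)) = zeros w \<and> x \<in> chart n V \<and> conormal x w \<and>
    (\<forall>i\<in>I. finite {monomial_at y (inv_mon i) | y. y \<in> chart n V \<and> conormal y w})"
proof -
  obtain e where e: "bij_betw e {..<k} J"
    using ex_bij_betw_nat_finite[OF finite_J] unfolding atLeast0LessThan k_def by blast
  have eJ: "e j \<in> J" if "j < k" for j using e that by (auto simp: bij_betw_def)
  have eJn: "e j < n" if "j < k" for j using eJ[OF that] J by auto
  \<comment> \<open>Moving in this direction by \<open>t\<close> adds \<open>t\<close> to the pivot
    entry of each form 1, ..., k, hence t N to the diagonal of their pairing matrix with the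
    \<open>v s\<close>.\<close>
  define \<epsilon> where "\<epsilon> jl = (if fst jl = 0 then 0 else if snd jl = e (fst jl - 1) then 1 else (0::complex))" for jl
  define row where "row c j = (\<lambda>l. c (j, l))" for c :: "nat \<times> nat \<Rightarrow> complex" and j :: nat
  \<comment> \<open>The total size of the original pairings. The parameter \<open>t\<close> has to
    exceed it and to avoid the finitely many zeros of \<open>p\<close> on the line.\<close>
  define M where "M = (\<Sum>j\<in>{1..k}. \<Sum>s\<in>J. norm (pr (row c0 j) s))"
  have "finite {t. p (\<lambda>u. c0 u + t * \<epsilon> u) = 0}"
    by (rule pfun_line_finite_zeros[OF p(1), of c0 0 \<epsilon>]) (use p(2) in simp)
  then have "finite ((of_nat :: nat \<Rightarrow> complex) -` {t. p (\<lambda>u. c0 u + t * \<epsilon> u) = 0})"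
    by (rule finite_vimageI) simp
  then have "finite ((of_nat :: nat \<Rightarrow> complex) -` {t. p (\<lambda>u. c0 u + t * \<epsilon> u) = 0} \<union> {..nat \<lceil>M\<rceil>})" by simp
  then obtain t where t: "t \<notin> (of_nat :: nat \<Rightarrow> complex) -` {t. p (\<lambda>u. c0 u + t * \<epsilon> u) = 0} \<union> {..nat \<lceil>M\<rceil>}"
    using ex_new_if_finite infinite_UNIV_nat by blast
  define c1 where "c1 u = c0 u + of_nat t * \<epsilon> u" for u
  have pc1: "p c1 \<noteq> 0" using t by (simp add: c1_def[abs_def])
  have tM: "real t > M" using t by (simp add: not_le) linarith
  have pr1: "pr (row c1 (Suc j)) s = pr (row c0 (Suc j)) s + of_nat t * (if s = e j then of_int N else 0)"
    if j: "j < k" and s: "s \<in> J" for j s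
  proof -
    have "(\<Sum>l<n. \<epsilon> (Suc j, l) * of_int (v s l)) = (\<Sum>l<n. if l = e j then of_int (v s l) else 0)"
      by (intro sum.cong refl) (auto simp: \<epsilon>_def)
    also have "\<dots> = of_int (v s (e j))" using eJn[OF j] by simp
    also have "\<dots> = (if s = e j then of_int N else 0)" using v_at[OF s eJ[OF j]] by auto
    finally show ?thesis
      by (simp add: pr_def row_def c1_def distrib_right sum.distrib sum_distrib_left[symmetric] mult.assoc)
  qed
  \<comment> \<open>Diagonal dominance: at the index with the largest coefficient in absolute value,
    the term coming from t N exceeds everything that the original pairings contribute.\<close>
  have inj: "\<forall>j\<in>{1..k}. b j = 0" if b: "\<And>s. s \<in> J \<Longrightarrow> (\<Sum>j\<in>{1..k}. b j * pr (row c1 j) s) = 0" for b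
  proof (cases "k = 0")
    case False
    define m where "m = Max ((\<lambda>j. norm (b j)) ` {1..k})"
    have "m \<in> (\<lambda>j. norm (b j)) ` {1..k}" unfolding m_def by (rule Max_in) (use False in auto)
    then obtain j0 where j0: "j0 \<in> {1..k}" "m = norm (b j0)" by blast
    have bm: "norm (b j) \<le> m" if "j \<in> {1..k}" for j unfolding m_def using that by (intro Max_ge) auto
    define s where "s = e (j0 - 1)"
    have "j0 - 1 < k" using j0(1) by auto
    then have s: "s \<in> J" unfolding s_def by (rule eJ)
    have "pr (row c1 j) s = pr (row c0 j) s + of_nat t * (if j = j0 then of_int N else 0)" if j: "j \<in> {1..k}" for j
    proof -
      have j': "j = Suc (j - 1)" "j - 1 < k" "j0 - 1 < k" using j j0 by auto
      have "s = e (j - 1) \<longleftrightarrow> j = j0"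
        using e j'(2,3) j j0 unfolding s_def bij_betw_def inj_on_def by (metis Suc_pred' atLeastAtMost_iff lessThan_iff less_eq_Suc_le One_nat_def)
      then show ?thesis using pr1[OF j'(2) s] j'(1) by simp
    qed
    then have "(\<Sum>j\<in>{1..k}. b j * pr (row c1 j) s) =
      (\<Sum>j\<in>{1..k}. b j * pr (row c0 j) s) + (\<Sum>j\<in>{1..k}. if j = j0 then of_nat t * of_int N * b j0 else 0)"
      unfolding sum.distrib[symmetric] by (intro sum.cong refl) (auto simp: algebra_simps)
    then have eq: "of_nat t * of_int N * b j0 = - (\<Sum>j\<in>{1..k}. b j * pr (row c0 j) s)"
      using b[OF s] j0 by (simp add: eq_neg_iff_add_eq_0 add.commute)
    have "real t * real_of_int N * m = norm (of_nat t * of_int N * b j0)"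
      using N_pos by (simp add: norm_mult j0(2))
    also have "\<dots> \<le> (\<Sum>j\<in>{1..k}. norm (b j * pr (row c0 j) s))" unfolding eq norm_minus_cancel by (rule norm_sum)
    also have "\<dots> \<le> (\<Sum>j\<in>{1..k}. m * (\<Sum>s\<in>J. norm (pr (row c0 j) s)))"
    proof (rule sum_mono)
      fix j assume j: "j \<in> {1..k}"
      have "norm (pr (row c0 j) s) \<le> (\<Sum>s\<in>J. norm (pr (row c0 j) s))" using s by (intro member_le_sum) auto
      then show "norm (b j * pr (row c0 j) s) \<le> m * (\<Sum>s\<in>J. norm (pr (row c0 j) s))"
        unfolding norm_mult using bm[OF j] by (intro mult_mono) (auto intro: order_trans[OF norm_ge_zero])
    qed
    also have "\<dots> = m * M" by (simp add: M_def sum_distrib_left)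
    finally have le: "real t * real_of_int N * m \<le> m * M" .
    have "m = 0"
    proof (rule ccontr)
      assume "m \<noteq> 0"
      then have mp: "m > 0" using j0 by simp
      have "real t * 1 \<le> real t * real_of_int N" using N_pos by (intro mult_left_mono) auto
      then have "M < real t * real_of_int N" using tM by simp
      then have "m * M < m * (real t * real_of_int N)" using mp by (rule mult_strict_left_mono)
      then show False using le by (simp add: mult_ac)
    qed
    then show ?thesis using bm by (metis norm_le_zero_iff)
  qed simp
  have split0: "(\<Sum>j\<le>k. g j) = g 0 + (\<Sum>j\<in>{1..k}. g j)" for g :: "nat \<Rightarrow> complex"
  proof -
    have "{..k} = insert 0 {1..k}" by auto
    then show ?thesis by simp
  qed
  have "\<exists>\<gamma>. (\<exists>j\<in>{..k}. \<gamma> j \<noteq> 0) \<and> (\<forall>s. (\<Sum>j\<in>{..k}. \<gamma> j * (if s \<in> J then pr (row c1 j) s else 0)) = 0)"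
  proof (rule span_dependency[OF finite_atMost units_card(1)])
    show "card ((\<lambda>s s'. if s = s' then 1 else (0::complex)) ` J) < card {..k}" using units_card(2) by (simp add: k_def)
  qed (rule units_span, simp)
  then obtain \<gamma> where \<gamma>0: "\<exists>j\<in>{..k}. \<gamma> j \<noteq> 0"
    and \<gamma>1: "\<And>s. (\<Sum>j\<in>{..k}. \<gamma> j * (if s \<in> J then pr (row c1 j) s else 0)) = 0" by blast
  have \<gamma>: "(\<Sum>j\<le>k. \<gamma> j * pr (row c1 j) s) = 0" if "s \<in> J" for s
    using \<gamma>0 \<gamma>1[of s] that by auto
  have \<gamma>nz: "\<exists>j\<le>k. \<gamma> j \<noteq> 0" using \<gamma>0 by auto
  \<comment> \<open>By \<open>inj\<close> the forms 1, ..., k alone admit no nontrivial such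
    combination, so the form 0 occurs and its coefficient can be normalised to 1.\<close>
  have g0: "\<gamma> 0 \<noteq> 0"
  proof
    assume z: "\<gamma> 0 = 0"
    have "\<forall>j\<in>{1..k}. \<gamma> j = 0" by (rule inj) (use \<gamma> z in \<open>simp add: split0\<close>)
    then show False using \<gamma>nz z by (metis Suc_le_eq atLeastAtMost_iff gr0I One_nat_def)
  qed
  define a where "a j = \<gamma> j / \<gamma> 0" for j
  have a0: "a 0 = 1" using g0 by (simp add: a_def)
  define w0 where "w0 l = (\<Sum>j\<le>k. a j * row c1 j l)" for l
  have "pr w0 s = 0" if "s \<in> J" for s
  proof -
    have "pr w0 s = (\<Sum>j\<le>k. \<gamma> j * pr (row c1 j) s) / \<gamma> 0"
      unfolding w0_def[abs_def] pr_sum by (simp add: a_def sum_divide_distrib)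
    then show ?thesis using \<gamma>[OF that] by simp
  qed
  then have w0: "perp w0" by (simp add: perp_def pr_def)
  define rest where "rest l = (\<Sum>j\<in>{1..k}. a j * c1 (j, l))" for l
  \<comment> \<open>Form 0 becomes \<open>w\<close> minus the rest, so the normalised combination
    equals \<open>w\<close>. Thus \<open>w\<close> can be varied with the other forms and the
    coefficients \<open>a\<close> fixed, and the condition on \<open>p\<close> becomes the
    polynomial condition \<open>q\<close> on \<open>w\<close>.\<close>
  define fm where "fm w u = (if fst u = 0 then w (snd u) - rest (snd u) else c1 u)" for w and u :: "nat \<times> nat"
  define q where "q w = p (\<lambda>u. fm w u)" for w
  have q: "q \<in> pfun {..<n}" unfolding q_def[abs_def]
  proof (rule pfun_subst[OF p(1)])
    fix u :: "nat \<times> nat" assume "u \<in> {..k} \<times> {..<n}"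
    then have u: "snd u < n" by auto
    have "(\<lambda>w. w (snd u) + - rest (snd u)) \<in> pfun {..<n}" using u by (intro pfun.add pfun.proj pfun.const) auto
    then show "(\<lambda>w. fm w u) \<in> pfun {..<n}" by (cases "fst u = 0") (auto simp: fm_def intro: pfun.const)
  qed
  have "fm w0 = c1"
  proof
    fix u :: "nat \<times> nat"
    have "w0 l = c1 (0, l) + rest l" for l unfolding w0_def rest_def split0 by (simp add: a0 row_def)
    then show "fm w0 u = c1 u" by (cases u) (simp add: fm_def)
  qed
  then have "q w0 \<noteq> 0" using pc1 by (simp add: q_def)
  from good_conormal[OF q w0 this] obtain w x where wx: "x \<in> chart n V" "conormal x w" "perp w" "q w \<noteq> 0"
    "\<forall>i\<in>I. finite {monomial_at y (inv_mon i) | y. y \<in> chart n V \<and> conormal y w}" by blast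
  define c where "c = fm w"
  have comb: "(\<Sum>j\<le>k. b j * c (j, l)) = b 0 * w l + (\<Sum>j\<in>{1..k}. (b j - b 0 * a j) * c1 (j, l))" for b l
  proof -
    have "(\<Sum>j\<in>{1..k}. b j * c (j, l)) = (\<Sum>j\<in>{1..k}. b j * c1 (j, l))" by (intro sum.cong refl) (auto simp: c_def fm_def)
    then show ?thesis unfolding split0
      by (simp add: c_def fm_def rest_def right_diff_distrib left_diff_distrib sum_subtractf sum_distrib_left mult.assoc)
  qed
  have "degeneracy_locus n V k (\<lambda>j i. c (j, i)) = zeros w"
  proof (intro equalityI subsetI)
    fix y assume "y \<in> zeros w"
    then have y: "y \<in> smooth_part n V" "conormal y w" by (auto simp: zeros_def)
    have w: "(\<lambda>l. \<Sum>j\<le>k. a j * c (j, l)) = w" by (simp add: comb a0)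
    have "(\<exists>j\<le>k. a j \<noteq> 0) \<and> conormal y (\<lambda>l. \<Sum>j\<le>k. a j * c (j, l))"
      unfolding w using y(2) a0 by (metis le0 zero_neq_one)
    then show "y \<in> degeneracy_locus n V k (\<lambda>j i. c (j, i))"
      unfolding degeneracy_locus_conormal using y(1) by blast
  next
    fix y assume "y \<in> degeneracy_locus n V k (\<lambda>j i. c (j, i))"
    then obtain b where y: "y \<in> smooth_part n V" and b: "\<exists>j\<le>k. b j \<noteq> 0" "conormal y (\<lambda>l. \<Sum>j\<le>k. b j * c (j, l))"
      unfolding degeneracy_locus_conormal by blast
    have "perp (\<lambda>l. \<Sum>j\<le>k. b j * c (j, l))" by (rule conormal_perp[OF smooth_V[OF y] b(2)])
    \<comment> \<open>A conormal combination annihilates the stabilizer, and so does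
      \<open>w\<close>. What remains is a combination of the forms 1, ..., k that does so too, hence
      is trivial by \<open>inj\<close>.\<close>
    have "\<forall>j\<in>{1..k}. b j - b 0 * a j = 0"
    proof (rule inj)
      fix s assume s: "s \<in> J"
      have "0 = pr (\<lambda>l. \<Sum>j\<le>k. b j * c (j, l)) s" using \<open>perp (\<lambda>l. \<Sum>j\<le>k. b j * c (j, l))\<close> s by (simp add: perp_def pr_def)
      also have "\<dots> = b 0 * pr w s + pr (\<lambda>l. \<Sum>j\<in>{1..k}. (b j - b 0 * a j) * row c1 j l) s"
        unfolding comb by (simp add: pr_def row_def distrib_right sum.distrib sum_distrib_left mult.assoc)
      also have "pr w s = 0" using wx(3) s by (simp add: perp_def pr_def)
      finally show "(\<Sum>j\<in>{1..k}. (b j - b 0 * a j) * pr (row c1 j) s) = 0" by (simp add: pr_sum)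
    qed
    then have bj: "b j = b 0 * a j" if "j \<in> {1..k}" for j using that by simp
    have b0: "b 0 \<noteq> 0"
    proof
      assume z: "b 0 = 0"
      obtain j where "j \<le> k" "b j \<noteq> 0" using b(1) by blast
      then show False using z bj[of j] by (cases "j = 0") auto
    qed
    have "(\<lambda>l. \<Sum>j\<le>k. b j * c (j, l)) = (\<lambda>l. b 0 * w l)" unfolding comb using bj by (simp add: fun_eq_iff)
    then have "conormal y (\<lambda>l. inverse (b 0) * (b 0 * w l))" using conormal_scale[of y "\<lambda>l. b 0 * w l"] b(2) by simp
    then have "conormal y w" using b0 by (simp add: mult.assoc[symmetric])
    then show "y \<in> zeros w" using y by (simp add: zeros_def)
  qed
  moreover have "p c \<noteq> 0" using wx(4) by (simp add: q_def c_def)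
  ultimately show ?thesis using wx(1,2,5) by blast
qed

subsection \<open>Components of the degeneracy locus\<close>

lemma one_param_act: "s \<in> J \<Longrightarrow> one_param (v s) t = act (\<lambda>s'. if s' = s then t else 1)"
proof
  fix l assume s: "s \<in> J"
  have "act (\<lambda>s'. if s' = s then t else 1) l = (\<Prod>s'\<in>J. if s' = s then t powi v s l else 1)"
    unfolding act_def by (intro prod.cong refl) auto
  then show "one_param (v s) t l = act (\<lambda>s'. if s' = s then t else 1) l" using s by (simp add: one_param_def)
qed

lemma stableI:
  assumes "\<And>x t. x \<in> X \<Longrightarrow> (\<And>s. s \<in> J \<Longrightarrow> t s \<noteq> 0) \<Longrightarrow> x * act t \<in> X"
  shows "stable X"
  unfolding stable_def using assms by (auto simp: one_param_act)

lemma stable_zeros: "stable (zeros w)"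
proof (rule stableI)
  fix x and t :: "nat \<Rightarrow> complex" assume x: "x \<in> zeros w" and t: "\<And>s. s \<in> J \<Longrightarrow> t s \<noteq> 0"
  have xs: "x \<in> smooth_part n V" "x \<in> V" "conormal x w" using x smooth_V by (auto simp: zeros_def)
  have xt: "x * act t \<in> V" by (rule stable_act[OF stable_V xs(2) t])
  have d: "fvec.dim (tangent_space n V y) = fvec.dim (log_tangent n V y)" if "y \<in> V" for y
    unfolding tangent_space_image[OF V_nonzero[OF that]]
    using dim_mult_image[of y] nonzero_pointsD[OF V_nonzero[OF that]] by simp
  have lt: "log_tangent n V (x * act t) = log_tangent n V x" by (rule log_tangent_act[OF xs(2) t])
  have "x * act t \<in> smooth_part n V" using xs(1) xt d[OF xt] d[OF xs(2)] lt by (simp add: smooth_part_def)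
  then show "x * act t \<in> zeros w" using xs(3) lt by (simp add: zeros_def conormal_def)
qed

lemma stable_closure:
  assumes Z: "stable Z" "Z \<subseteq> torus n"
  shows "stable (zariski_closure n Z)"
proof (rule stableI)
  fix x and t :: "nat \<Rightarrow> complex" assume x: "x \<in> zariski_closure n Z" and t: "\<And>s. s \<in> J \<Longrightarrow> t s \<noteq> 0"
  have "zariski_closure n Z \<subseteq> {x \<in> torus n. x * act t \<in> zariski_closure n Z}"
  proof (rule closure_minimal[OF closed_translate[OF closure_closed[OF Z(2)] act_torus[OF t]]])
    show "Z \<subseteq> {x \<in> torus n. x * act t \<in> zariski_closure n Z}"
    proof
      fix y assume y: "y \<in> Z"
      have "y * act t \<in> Z" by (rule stable_act[OF Z(1) y t])
      then show "y \<in> {x \<in> torus n. x * act t \<in> zariski_closure n Z}" using y Z(2) closure_subset[of Z n] by blast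
    qed
  qed
  then show "x * act t \<in> zariski_closure n Z" using x by blast
qed

text \<open>The translates of \<open>C\<close> sweep out a set \<open>D\<close>, irreducible as an
  image of \<open>C\<close> times a torus. Its closure lies in \<open>X\<close> and contains
  \<open>C\<close>, so it equals \<open>C\<close> by maximality.\<close>

lemma stable_component:
  assumes X: "zariski_closed n X" "stable X" and C: "C \<in> components n X"
  shows "stable C"
proof -
  have vC: "variety n C" and CX: "C \<subseteq> X" and maxC: "\<And>C'. variety n C' \<Longrightarrow> C \<subseteq> C' \<Longrightarrow> C' \<subseteq> X \<Longrightarrow> C' = C"
    using C by (auto simp: components_def)
  define D where "D = {x * act t | x t. x \<in> C \<and> (\<forall>s\<in>J. t s \<noteq> 0)}"
  have DX: "D \<subseteq> X" unfolding D_def using CX stable_act[OF X(2)] by blast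
  have Dt: "D \<subseteq> torus n" using DX zariski_closed_torus[OF X(1)] by blast
  have a1: "x * act (\<lambda>_. 1) = x" for x by (auto simp: act_def fun_eq_iff)
  have CD: "C \<subseteq> D"
  proof
    fix x assume "x \<in> C"
    then have "x * act (\<lambda>_. 1) \<in> D"
      unfolding D_def by (intro CollectI exI[of _ x] exI[of _ "\<lambda>_. 1"]) simp
    then show "x \<in> D" by (simp only: a1)
  qed
  have "variety n (zariski_closure n D)"
  proof (rule closure_variety[OF Dt])
    show "D \<noteq> {}" using CD variety_nonempty[OF vC] by blast
    fix f g assume f: "f \<in> laurent n" and g: "g \<in> laurent n" and fg: "\<And>x. x \<in> D \<Longrightarrow> leval f x * leval g x = 0"
    show "(\<forall>x\<in>D. leval f x = 0) \<or> (\<forall>x\<in>D. leval g x = 0)"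
    proof (rule ccontr)
      assume "\<not> ?thesis"
      then obtain x1 t1 x2 t2 where 1: "x1 \<in> C" "\<forall>s\<in>J. t1 s \<noteq> 0" "leval f (x1 * act t1) \<noteq> 0"
        and 2: "x2 \<in> C" "\<forall>s\<in>J. t2 s \<noteq> 0" "leval g (x2 * act t2) \<noteq> 0" unfolding D_def by blast
      obtain P K where P: "P \<in> pfun J" "\<And>t. \<forall>s\<in>J. t s \<noteq> 0 \<Longrightarrow> P t = leval f (x1 * act t) * (\<Prod>s\<in>J. t s ^ K)"
        using pfun_act[OF f, of x1] by blast
      obtain Q L where Q: "Q \<in> pfun J" "\<And>t. \<forall>s\<in>J. t s \<noteq> 0 \<Longrightarrow> Q t = leval g (x2 * act t) * (\<Prod>s\<in>J. t s ^ L)"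
        using pfun_act[OF g, of x2] by blast
      have nz: "P t1 \<noteq> 0" "Q t2 \<noteq> 0" using P(2)[OF 1(2)] Q(2)[OF 2(2)] 1 2 by auto
      \<comment> \<open>One \<open>t\<close> for which neither translated function vanishes
        identically on \<open>C\<close>; irreducibility of \<open>C\<close> is then applied to these
        two.\<close>
      have "\<exists>t. (\<forall>s\<in>J. t s \<noteq> 0) \<and> P t \<noteq> 0 \<and> Q t \<noteq> 0"
      proof (rule ccontr)
        assume no: "\<not> ?thesis"
        have "P t1 = 0"
        proof (rule pfun_vanish_open[of "insert None (Some ` J)" P J "\<lambda>s. case s of None \<Rightarrow> Q | Some i \<Rightarrow> (\<lambda>t. t i)"])
          fix s assume "s \<in> insert None (Some ` J)"
          then show "(case s of None \<Rightarrow> Q | Some i \<Rightarrow> (\<lambda>t. t i)) \<in> pfun J"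
            "\<exists>c. (case s of None \<Rightarrow> Q | Some i \<Rightarrow> (\<lambda>t. t i)) c \<noteq> 0"
            using Q(1) nz(2) by (auto intro: pfun.proj exI[of _ "\<lambda>_. 1"])
        next
          fix t assume t: "\<And>s. s \<in> insert None (Some ` J) \<Longrightarrow> (case s of None \<Rightarrow> Q | Some i \<Rightarrow> (\<lambda>t. t i)) t \<noteq> 0"
          have "Q t \<noteq> 0" using t[of None] by simp
          moreover have "t s \<noteq> 0" if "s \<in> J" for s using t[of "Some s"] that by simp
          ultimately show "P t = 0" using no by blast
        qed (use P in auto)
        then show False using nz by simp
      qed
      then obtain t where t: "\<forall>s\<in>J. t s \<noteq> 0" "P t \<noteq> 0" "Q t \<noteq> 0" by blast
      have "leval (rescale (act t) f) x * leval (rescale (act t) g) x = 0" if "x \<in> C" for x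
        using fg[of "x * act t"] that t(1) unfolding D_def leval_rescale by blast
      then have "(\<forall>x\<in>C. leval (rescale (act t) f) x = 0) \<or> (\<forall>x\<in>C. leval (rescale (act t) g) x = 0)"
        by (intro variety_prime[OF vC]) (auto intro: laurent_rescale f g)
      then show False using P(2)[OF t(1)] Q(2)[OF t(1)] t 1(1) 2(1) by (auto simp: leval_rescale)
    qed
  qed
  moreover have "C \<subseteq> zariski_closure n D" using CD closure_subset by blast
  moreover have "zariski_closure n D \<subseteq> X" by (rule closure_minimal[OF X(1) DX])
  ultimately have "zariski_closure n D = C" by (rule maxC)
  then have DC: "D \<subseteq> C" using closure_subset by blast
  show ?thesis
  proof (rule stableI)
    fix x and t :: "nat \<Rightarrow> complex" assume "x \<in> C" "\<And>s. s \<in> J \<Longrightarrow> t s \<noteq> 0"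
    then have "x * act t \<in> D" unfolding D_def by blast
    then show "x * act t \<in> C" using DC by blast
  qed
qed

text \<open>On a single orbit the coordinates in \<open>J\<close> take arbitrary nonzero values, by
  extraction of roots of order \<open>N\<close>; so no relation between them can hold.\<close>

lemma orbit_indep:
  assumes X: "stable X" "X \<noteq> {}" "X \<subseteq> torus n" and e: "bij_betw e {..<k} J"
  shows "indep_on X k (\<lambda>i. if i < k then lvar (e i) 1 else 0)"
  unfolding indep_on_def
proof (intro ballI impI allI)
  fix G :: "(nat \<Rightarrow> complex) \<Rightarrow> complex" and y
  assume G: "G \<in> pfun {..<k}" and van: "\<forall>x\<in>X. G (\<lambda>i. leval (if i < k then lvar (e i) 1 else 0) x) = 0"
  obtain x where x: "x \<in> X" using X(2) by blast
  have xn: "x \<in> nonzero_points" using x X(3) torus_nonzero by blast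
  have eJ: "e j \<in> J" if "j < k" for j using e that by (auto simp: bij_betw_def)
  show "G y = 0"
  proof (rule pfun_vanish_open[of "{..<k}" G "{..<k}" "\<lambda>i c. c i"])
    fix c :: "nat \<Rightarrow> complex" assume c: "\<And>s. s \<in> {..<k} \<Longrightarrow> c s \<noteq> 0"
    have "\<exists>t. t ^ nat N = c i / x (e i)" for i
      using exists_complex_root[of "nat N" "c i / x (e i)"] N_pos by (metis zero_less_nat_eq less_numeral_extra(3))
    then obtain t0 where t0: "\<And>i. t0 i ^ nat N = c i / x (e i)" by metis
    define t where "t s = t0 (the_inv_into {..<k} e s)" for s
    have te: "t (e i) ^ nat N = c i / x (e i)" if "i < k" for i
      using e that t0 by (simp add: t_def bij_betw_def the_inv_into_f_f)
    have tz: "t s \<noteq> 0" if s: "s \<in> J" for s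
    proof -
      obtain i where i: "i < k" "s = e i" using e s by (auto simp: bij_betw_def)
      then have "t s ^ nat N \<noteq> 0" using te[OF i(1)] c[of i] nonzero_pointsD[OF xn] by simp
      then show ?thesis using N_pos by auto
    qed
    have "x * act t \<in> X" by (rule stable_act[OF X(1) x tz])
    then have "G (\<lambda>i. leval (if i < k then lvar (e i) 1 else 0) (x * act t)) = 0" using van by blast
    moreover have "G (\<lambda>i. leval (if i < k then lvar (e i) 1 else 0) (x * act t)) = G c"
      by (rule pfun_cong[OF G])
         (use nonzero_pointsD[OF xn] te eJ act_J in \<open>auto simp: leval_lvar\<close>)
    ultimately show "G c = 0" by simp
  qed (use G in \<open>auto intro: pfun.proj exI[of _ "\<lambda>_. 1"]\<close>)
qed

lemma e_exists: "\<exists>e. bij_betw e {..<k} J"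
  using ex_bij_betw_nat_finite[OF finite_J] unfolding atLeast0LessThan k_def by blast

lemma e_laurent: "bij_betw e {..<k} J \<Longrightarrow> (if i < k then lvar (e i) 1 else 0) \<in> laurent n"
  using J by (auto simp: bij_betw_def intro!: lvar_laurent)

lemma stable_krull:
  assumes "variety n C" "stable C"
  shows "k \<le> krull_dim n C"
proof -
  obtain e where e: "bij_betw e {..<k} J" using e_exists by blast
  show ?thesis unfolding krull_dim_free_vars[OF assms(1)]
    by (rule indep_on_bound[OF assms(1) orbit_indep[OF assms(2) variety_nonempty[OF assms(1)] variety_torus[OF assms(1)] e]])
       (rule e_laurent[OF e])
qed

text \<open>The level set of the character through \<open>x\<close> is stable, so the
  \<open>k\<close> coordinates in \<open>J\<close> are independent on it. If the character were not
  constant on \<open>C\<close>, it would extend them to \<open>k + 1\<close> independent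
  functions.\<close>

lemma stable_inv_mon_const:
  assumes C: "variety n C" "stable C" "krull_dim n C = k" and i: "i \<in> I" and x: "x \<in> C" "y \<in> C"
  shows "monomial_at x (inv_mon i) = monomial_at y (inv_mon i)"
proof (rule ccontr)
  assume ne: "\<not> ?thesis"
  obtain e where e: "bij_betw e {..<k} J" using e_exists by blast
  define f where "f = single (inv_mon i) 1 - single 0 (monomial_at x (inv_mon i))"
  have f: "f \<in> laurent n" unfolding f_def by (intro laurent_diff laurent_single keys_inv_mon i) simp
  have fx: "leval f z = monomial_at z (inv_mon i) - monomial_at x (inv_mon i)" for z
    by (simp add: f_def leval_diff leval_single)
  define C0 where "C0 = {z\<in>C. leval f z = 0}"
  have C0: "stable C0"
  proof (rule stableI)
    fix z and t :: "nat \<Rightarrow> complex" assume z: "z \<in> C0" and t: "\<And>s. s \<in> J \<Longrightarrow> t s \<noteq> 0"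
    have "monomial_at (act t) (inv_mon i) = 1" using t by (simp add: monomial_at_act ipair_v_inv_mon)
    then show "z * act t \<in> C0" using z stable_act[OF C(2) _ t] by (auto simp: C0_def fx monomial_at_mult)
  qed
  have "x \<in> C0" using x by (simp add: C0_def fx)
  then have ind: "indep_on C0 k (\<lambda>i. if i < k then lvar (e i) 1 else 0)"
    using orbit_indep[OF C0 _ _ e] variety_torus[OF C(1)] by (auto simp: C0_def)
  have "indep_on C (Suc k) ((\<lambda>i. if i < k then lvar (e i) 1 else 0)(k := f))"
    by (rule indep_on_extend[OF C(1) ind e_laurent[OF e] _ f])
       (use x(2) ne in \<open>auto simp: C0_def vanishes_def fx intro!: bexI[of _ y]\<close>)
  then have "Suc k \<le> card (free_vars n C)"
    by (rule indep_on_bound[OF C(1)]) (simp only: fun_upd_apply f e_laurent[OF e] split: if_split, simp)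
  then show False using C(3) by (simp add: krull_dim_free_vars[OF C(1)])
qed

text \<open>Constant characters force a tangent vector to be determined by its entries in
  \<open>J\<close>, so more than \<open>k\<close> independent tangent vectors would have a
  nontrivial combination equal to 0.\<close>

lemma inv_mon_const_krull:
  assumes C: "variety n C" and const: "\<And>i x y. i \<in> I \<Longrightarrow> x \<in> C \<Longrightarrow> y \<in> C \<Longrightarrow> monomial_at x (inv_mon i) = monomial_at y (inv_mon i)"
  shows "krull_dim n C \<le> k"
proof (rule ccontr)
  let ?A = "free_vars n C"
  assume "\<not> ?thesis"
  then have kA: "card ((\<lambda>s s'. if s = s' then 1 else (0::complex)) ` J) < card ?A"
    using units_card(2) by (simp add: krull_dim_free_vars[OF C] k_def)
  obtain x where x: "x \<in> chart n C" using chart_nonvanishing[OF C, of "{}"] by auto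
  have xC: "x \<in> C" using x chart_subset by blast
  have xn: "x \<in> nonzero_points" using xC variety_nonzero[OF C] by blast
  have "\<exists>\<eta>\<in>log_tangent n C x. \<forall>b\<in>?A. \<eta> b = (if a = b then 1 else 0)" if a: "a \<in> ?A" for a
  proof -
    have "(\<lambda>b. if a = b then 1 else 0) \<in> coord_space n" using free_vars_less[OF a] by (auto simp: coord_space_def)
    from chart_tangent_solve[OF C x this] show ?thesis .
  qed
  then obtain u where u: "\<And>a. a \<in> ?A \<Longrightarrow> u a \<in> log_tangent n C x"
    "\<And>a b. a \<in> ?A \<Longrightarrow> b \<in> ?A \<Longrightarrow> u a b = (if a = b then 1 else 0)" by metis
  have "\<exists>\<gamma>. (\<exists>a\<in>?A. \<gamma> a \<noteq> 0) \<and> (\<forall>s. (\<Sum>a\<in>?A. \<gamma> a * (if s \<in> J then u a s else 0)) = 0)"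
    by (rule span_dependency[OF finite_vars(1) units_card(1) kA]) (rule units_span, simp)
  then obtain \<gamma> a0 where \<gamma>0: "a0 \<in> ?A" "\<gamma> a0 \<noteq> 0"
    and \<gamma>1: "\<And>s. (\<Sum>a\<in>?A. \<gamma> a * (if s \<in> J then u a s else 0)) = 0" by blast
  have \<gamma>: "a0 \<in> ?A" "\<gamma> a0 \<noteq> 0" "\<And>s. s \<in> J \<Longrightarrow> (\<Sum>a\<in>?A. \<gamma> a * u a s) = 0"
  proof -
    fix s assume "s \<in> J"
    then show "(\<Sum>a\<in>?A. \<gamma> a * u a s) = 0" using \<gamma>1[of s] by simp
  qed (use \<gamma>0 in auto)
  define \<eta> where "\<eta> = (\<Sum>a\<in>?A. fscale (\<gamma> a) (u a))"
  have \<eta>: "\<eta> \<in> log_tangent n C x"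
    unfolding \<eta>_def by (intro fvec.subspace_sum[OF log_tangent_subspace] fvec.subspace_scale[OF log_tangent_subspace] u)
  have \<eta>J: "\<eta> s = 0" if "s \<in> J" for s using \<gamma>(3)[OF that] by (simp add: \<eta>_def fscale_def)
  have \<eta>I: "\<eta> i = 0" if i: "i \<in> I" for i
  proof -
    let ?f = "single (inv_mon i) 1 - single 0 (monomial_at x (inv_mon i))"
    have "?f \<in> vanishing_ideal n C"
      using const[OF i xC] keys_inv_mon[OF i]
      by (auto simp: vanishing_ideal_def leval_diff leval_single intro!: laurent_diff laurent_single)
    then have "log_deriv n x \<eta> (?f) = 0" using \<eta> by (simp add: log_tangent_def)
    moreover have "log_deriv n x \<eta> ?f + log_deriv n x \<eta> (single 0 (monomial_at x (inv_mon i))) = log_deriv n x \<eta> (single (inv_mon i) 1)"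
      unfolding log_deriv_add[symmetric] by simp
    ultimately have "ipair \<eta> (inv_mon i) * monomial_at x (inv_mon i) = 0"
      using log_deriv_single[OF keys_inv_mon[OF i], of x \<eta> 1] by simp
    then have "ipair \<eta> (inv_mon i) = 0" using monomial_at_nonzero[OF xn] by simp
    then show ?thesis using N_pos \<eta>J by (simp add: ipair_inv_mon)
  qed
  have "\<eta> l = 0" for l
  proof (cases "l < n")
    case True
    then show ?thesis using \<eta>I \<eta>J by (cases "l \<in> J") (auto simp: I_def)
  qed (use \<eta> in \<open>auto simp: log_tangent_def coord_space_def\<close>)
  moreover have "\<eta> a0 = (\<Sum>a\<in>?A. if a = a0 then \<gamma> a else 0)"
    unfolding \<eta>_def sum_fun_apply fscale_def by (intro sum.cong refl) (use u(2) \<gamma>(1) in auto)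
  ultimately show False using \<gamma> by simp
qed

lemma inv_mon_finite_const:
  assumes C: "variety n C" "C \<subseteq> X" and X: "zariski_closed n X" and i: "i \<in> I"
    and fin: "finite ((\<lambda>x. monomial_at x (inv_mon i)) ` X)" and x: "x \<in> C" "y \<in> C"
  shows "monomial_at x (inv_mon i) = monomial_at y (inv_mon i)"
proof -
  let ?f = "\<lambda>a. single (inv_mon i) 1 - single 0 a :: laurent_poly"
  have f: "?f a \<in> laurent n" for a using keys_inv_mon[OF i] by (auto intro!: laurent_diff laurent_single)
  have ev: "leval (?f a) z = monomial_at z (inv_mon i) - a" for a z by (simp add: leval_diff leval_single)
  have cl: "zariski_closed n {z\<in>C. leval (?f a) z = 0}" for a
    by (rule zariski_closed_zero_set[OF variety_closed[OF C(1)] f])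
  have "\<exists>a\<in>(\<lambda>x. monomial_at x (inv_mon i)) ` X. C \<subseteq> {z\<in>C. leval (?f a) z = 0}"
  proof (rule variety_subset_UNION[OF C(1) fin cl])
    show "C \<subseteq> (\<Union>a\<in>(\<lambda>x. monomial_at x (inv_mon i)) ` X. {z\<in>C. leval (?f a) z = 0})"
      using C(2) by (auto simp: ev)
  qed
  then obtain a where "C \<subseteq> {z\<in>C. leval (?f a) z = 0}" by blast
  then have "monomial_at z (inv_mon i) = a" if "z \<in> C" for z using that by (auto simp: ev subset_iff)
  then show ?thesis using x by simp
qed

text \<open>The product of the differences between the character and its values on \<open>Z\<close>
  is a Laurent polynomial that vanishes on \<open>Z\<close>, hence on the closure.\<close>

lemma closure_finite_values:
  assumes Z: "Z \<subseteq> torus n" and i: "i \<in> I" and fin: "finite ((\<lambda>x. monomial_at x (inv_mon i)) ` Z)"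
  shows "finite ((\<lambda>x. monomial_at x (inv_mon i)) ` zariski_closure n Z)"
proof -
  let ?A = "(\<lambda>x. monomial_at x (inv_mon i)) ` Z"
  define f where "f = (\<Prod>a\<in>?A. single (inv_mon i) 1 - single 0 a :: laurent_poly)"
  have f: "f \<in> laurent n" unfolding f_def using keys_inv_mon[OF i] by (auto intro!: laurent_prod laurent_diff laurent_single)
  have ev: "leval f z = (\<Prod>a\<in>?A. monomial_at z (inv_mon i) - a)" if "z \<in> torus n" for z
    by (simp add: f_def leval_prod[OF torus_nonzero[OF that]] leval_diff leval_single)
  have "leval f x = 0" if "x \<in> Z" for x
    unfolding ev[OF subsetD[OF Z that]] using that fin by (auto simp: prod_zero_iff)
  then have "leval f x = 0" if "x \<in> zariski_closure n Z" for x using closure_vanish[OF f Z _ that] by blast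
  moreover have "zariski_closure n Z \<subseteq> torus n" using closure_minimal[OF zariski_closed_torus_self Z] .
  ultimately have "(\<lambda>x. monomial_at x (inv_mon i)) ` zariski_closure n Z \<subseteq> ?A"
    using ev fin by (force simp: prod_zero_iff subset_iff)
  then show ?thesis using fin finite_subset by blast
qed

lemma zeros_torus: "zeros w \<subseteq> torus n"
  using smooth_V V_torus by (auto simp: zeros_def)

text \<open>The component through \<open>x\<close> does not lie outside the chart, hence lies in the
  closure of the zeros in the chart, where the characters \<open>inv_mon i\<close> take finitely
  many values. They are constant on it, so its dimension is at most \<open>k\<close>; stability
  gives equality. Thus there is at least one component of dimension \<open>k\<close>.\<close>

lemma pure_part_zeros:
  assumes x: "x \<in> chart n V" "conormal x w"
    and fin: "\<And>i. i \<in> I \<Longrightarrow> finite {monomial_at y (inv_mon i) | y. y \<in> chart n V \<and> conormal y w}"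
  defines "\<C> \<equiv> {C \<in> components n (zariski_closure n (zeros w)). krull_dim n C = k}"
  shows "finite \<C>" "\<C> \<noteq> {}" "\<And>C. C \<in> \<C> \<Longrightarrow> variety n C \<and> stable C"
    "\<And>C i y z. C \<in> \<C> \<Longrightarrow> i \<in> I \<Longrightarrow> y \<in> C \<Longrightarrow> z \<in> C \<Longrightarrow> monomial_at y (inv_mon i) = monomial_at z (inv_mon i)"
    "\<And>C D. C \<in> \<C> \<Longrightarrow> D \<in> \<C> \<Longrightarrow> C \<subseteq> D \<Longrightarrow> C = D"
proof -
  let ?X = "zariski_closure n (zeros w)"
  have X: "zariski_closed n ?X" by (rule closure_closed[OF zeros_torus])
  have Xs: "stable ?X" by (rule stable_closure[OF stable_zeros zeros_torus])
  show "finite \<C>" using finite_components(1)[OF X] by (simp add: \<C>_def)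
  show vs: "variety n C \<and> stable C" if "C \<in> \<C>" for C
    using that stable_component[OF X Xs] by (auto simp: \<C>_def components_def)
  show "monomial_at y (inv_mon i) = monomial_at z (inv_mon i)" if "C \<in> \<C>" "i \<in> I" "y \<in> C" "z \<in> C" for C i y z
    using stable_inv_mon_const[of C i y z] vs[OF that(1)] that by (auto simp: \<C>_def)
  show "C = D" if "C \<in> \<C>" "D \<in> \<C>" "C \<subseteq> D" for C D
    using that unfolding \<C>_def components_def by blast
  have xZ: "x \<in> zeros w" using x chart_smooth[OF V] by (simp add: zeros_def)
  then have "x \<in> ?X" using closure_subset by blast
  then obtain C where C: "C \<in> components n ?X" "x \<in> C" using finite_components(2)[OF X] by blast
  have vC: "variety n C" "C \<subseteq> ?X" using C(1) by (auto simp: components_def)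
  define T where "T = tlead V ` alg_vars n V \<union> (\<lambda>j. euler j (tpoly V j)) ` alg_vars n V"
  have T: "finite T" "\<And>g. g \<in> T \<Longrightarrow> g \<in> laurent n" "\<And>z. z \<in> V \<Longrightarrow> (\<forall>g\<in>T. leval g z \<noteq> 0) \<longleftrightarrow> z \<in> chart n V"
    using tpoly_facts[OF V] by (auto simp: T_def chart_def intro: laurent_euler)
  define B where "B = (\<Union>g\<in>T. {z\<in>V. leval g z = 0})"
  have B: "zariski_closed n B" unfolding B_def
    by (intro zariski_closed_UNION T zariski_closed_zero_set variety_closed V)
  let ?Z1 = "zeros w \<inter> chart n V"
  have Z1t: "?Z1 \<subseteq> torus n" using zeros_torus by blast
  have "zeros w \<subseteq> zariski_closure n ?Z1 \<union> B"
  proof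
    fix z assume z: "z \<in> zeros w"
    then have "z \<in> V" using smooth_V by (auto simp: zeros_def)
    then show "z \<in> zariski_closure n ?Z1 \<union> B" using z closure_subset[of ?Z1 n] T(3)[of z] by (auto simp: B_def)
  qed
  then have "?X \<subseteq> zariski_closure n ?Z1 \<union> B"
    by (rule closure_minimal[OF zariski_closed_Un[OF closure_closed[OF Z1t] B]])
  then have "C \<subseteq> zariski_closure n ?Z1 \<or> C \<subseteq> B"
    using variety_subset_Un[OF vC(1) closure_closed[OF Z1t] B] vC(2) by blast
  moreover have "x \<notin> B" using x(1) T(3)[of x] chart_subset by (auto simp: B_def)
  ultimately have C1: "C \<subseteq> zariski_closure n ?Z1" using C(2) by blast
  have const: "monomial_at y (inv_mon i) = monomial_at z (inv_mon i)" if "i \<in> I" "y \<in> C" "z \<in> C" for i y z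
  proof (rule inv_mon_finite_const[OF vC(1) C1 closure_closed[OF Z1t] that(1) _ that(2,3)])
    have "(\<lambda>x. monomial_at x (inv_mon i)) ` ?Z1 \<subseteq> {monomial_at y (inv_mon i) | y. y \<in> chart n V \<and> conormal y w}"
      by (auto simp: zeros_def)
    then show "finite ((\<lambda>x. monomial_at x (inv_mon i)) ` zariski_closure n ?Z1)"
      by (intro closure_finite_values[OF Z1t that(1)] finite_subset[OF _ fin[OF that(1)]])
  qed
  have "krull_dim n C \<le> k" using inv_mon_const_krull[OF vC(1) const] by blast
  moreover have "k \<le> krull_dim n C" using stable_krull[OF vC(1) stable_component[OF X Xs C(1)]] .
  ultimately have "C \<in> \<C>" using C(1) by (simp add: \<C>_def)
  then show "\<C> \<noteq> {}" by blast
qed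

end

section \<open>Initial ideals and multiplicities\<close>

lemma laurent_ring_simps [simp]:
  "carrier (laurent_ring n) = laurent n" "mult (laurent_ring n) = (*)" "one (laurent_ring n) = 1"
  "zero (laurent_ring n) = 0" "add (laurent_ring n) = (+)"
  by (simp_all add: laurent_ring_def)

lemma cring_laurent_ring: "cring (laurent_ring n)"
proof (rule cringI)
  show "abelian_group (laurent_ring n)"
  proof (rule abelian_groupI)
    fix x assume "x \<in> carrier (laurent_ring n)"
    then show "\<exists>y\<in>carrier (laurent_ring n). y \<oplus>\<^bsub>laurent_ring n\<^esub> x = \<zero>\<^bsub>laurent_ring n\<^esub>"
      by (intro bexI[of _ "- x"]) (auto intro: laurent_uminus)
  qed (auto simp: add_ac intro: laurent_add)
  show "comm_monoid (laurent_ring n)"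
    by (rule comm_monoidI) (auto simp: mult_ac intro: laurent_mult)
qed (simp add: distrib_right)

lemma ideal_laurent_ring_iff:
  "ideal J (laurent_ring n) \<longleftrightarrow> J \<subseteq> laurent n \<and> 0 \<in> J \<and> (\<forall>f\<in>J. \<forall>g\<in>J. f + g \<in> J) \<and> (\<forall>f\<in>J. \<forall>g\<in>laurent n. g * f \<in> J)"
proof
  assume "ideal J (laurent_ring n)"
  then interpret ideal J "laurent_ring n" .
  show "J \<subseteq> laurent n \<and> 0 \<in> J \<and> (\<forall>f\<in>J. \<forall>g\<in>J. f + g \<in> J) \<and> (\<forall>f\<in>J. \<forall>g\<in>laurent n. g * f \<in> J)"
    using a_subset I_l_closed additive_subgroup.zero_closed[OF ideal.axioms(1)[OF ideal_axioms]]
      additive_subgroup.a_closed[OF ideal.axioms(1)[OF ideal_axioms]] by simp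
next
  assume a: "J \<subseteq> laurent n \<and> 0 \<in> J \<and> (\<forall>f\<in>J. \<forall>g\<in>J. f + g \<in> J) \<and> (\<forall>f\<in>J. \<forall>g\<in>laurent n. g * f \<in> J)"
  interpret cring "laurent_ring n" by (rule cring_laurent_ring)
  show "ideal J (laurent_ring n)"
  proof (rule idealI[OF ring_axioms])
    show "subgroup J (add_monoid (laurent_ring n))"
    proof (rule add.subgroupI)
      fix f assume f: "f \<in> J"
      then have fl: "f \<in> laurent n" using a by blast
      have "\<ominus>\<^bsub>laurent_ring n\<^esub> f = - f"
        using minus_equality[of "- f" f] fl laurent_uminus[OF fl] by simp
      moreover have "(- 1) * f \<in> J" using a f laurent_uminus[OF laurent_one] by blast
      ultimately show "\<ominus>\<^bsub>laurent_ring n\<^esub> f \<in> J" by simp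
    qed (use a in auto)
  qed (use a in \<open>auto simp: mult.commute\<close>)
qed

lemma primeideal_laurent_ring_iff:
  "primeideal P (laurent_ring n) \<longleftrightarrow> ideal P (laurent_ring n) \<and> P \<noteq> laurent n \<and>
    (\<forall>f\<in>laurent n. \<forall>g\<in>laurent n. f * g \<in> P \<longrightarrow> f \<in> P \<or> g \<in> P)"
proof
  assume "primeideal P (laurent_ring n)"
  then interpret primeideal P "laurent_ring n" .
  show "ideal P (laurent_ring n) \<and> P \<noteq> laurent n \<and> (\<forall>f\<in>laurent n. \<forall>g\<in>laurent n. f * g \<in> P \<longrightarrow> f \<in> P \<or> g \<in> P)"
    using ideal_axioms I_notcarr I_prime by auto
next
  assume "ideal P (laurent_ring n) \<and> P \<noteq> laurent n \<and>
    (\<forall>f\<in>laurent n. \<forall>g\<in>laurent n. f * g \<in> P \<longrightarrow> f \<in> P \<or> g \<in> P)"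
  then show "primeideal P (laurent_ring n)"
    by (intro primeidealI cring_laurent_ring) auto
qed

lemma vanishing_ideal_ideal: "X \<subseteq> torus n \<Longrightarrow> ideal (vanishing_ideal n X) (laurent_ring n)"
  unfolding ideal_laurent_ring_iff
  by (intro conjI ballI vanishing_ideal_add vanishing_ideal_mult vanishing_ideal_zero) (auto simp: vanishing_ideal_def)

lemma one_notin_vanishing_ideal: "X \<noteq> {} \<Longrightarrow> 1 \<notin> vanishing_ideal n X"
  by (auto simp: vanishing_ideal_def leval_def)

lemma vanishing_ideal_prime:
  assumes C: "variety n C"
  shows "primeideal (vanishing_ideal n C) (laurent_ring n)"
  unfolding primeideal_laurent_ring_iff
proof (intro conjI ballI impI)
  show "ideal (vanishing_ideal n C) (laurent_ring n)" by (rule vanishing_ideal_ideal[OF variety_torus[OF C]])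
  show "vanishing_ideal n C \<noteq> laurent n"
    using one_notin_vanishing_ideal[OF variety_nonempty[OF C], of n] laurent_one by metis
  fix f g assume fg: "f \<in> laurent n" "g \<in> laurent n" "f * g \<in> vanishing_ideal n C"
  have "leval f x * leval g x = 0" if "x \<in> C" for x
    using vanishing_idealD[OF fg(3) that] leval_mult[of x f g] subsetD[OF variety_nonzero[OF C] that] by simp
  then have "(\<forall>x\<in>C. leval f x = 0) \<or> (\<forall>x\<in>C. leval g x = 0)" by (rule variety_prime[OF C fg(1,2)])
  then show "f \<in> vanishing_ideal n C \<or> g \<in> vanishing_ideal n C" using fg by (auto simp: vanishing_ideal_def)
qed

text \<open>Otherwise elements of the vanishing ideals of the members, all chosen outside
  \<open>P\<close>, have a product in the vanishing ideal of the union.\<close>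

lemma prime_contains_component:
  assumes P: "primeideal P (laurent_ring n)" and \<C>: "finite \<C>" "\<And>C. C \<in> \<C> \<Longrightarrow> C \<subseteq> torus n"
    and sub: "vanishing_ideal n (\<Union>\<C>) \<subseteq> P"
  shows "\<exists>C\<in>\<C>. vanishing_ideal n C \<subseteq> P"
  using \<C> sub
proof (induction \<C> rule: finite_induct)
  case empty
  then have "laurent n \<subseteq> P" by (auto simp: vanishing_ideal_def)
  then show ?case using P by (auto simp: primeideal_laurent_ring_iff ideal_laurent_ring_iff)
next
  case (insert C \<C>)
  show ?case
  proof (cases "vanishing_ideal n C \<subseteq> P")
    case False
    then obtain f where f: "f \<in> vanishing_ideal n C" "f \<notin> P" by blast
    have "vanishing_ideal n (\<Union>\<C>) \<subseteq> P"
    proof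
      fix g assume g: "g \<in> vanishing_ideal n (\<Union>\<C>)"
      have fg: "f \<in> laurent n" "g \<in> laurent n" using f g vanishing_ideal_laurent by auto
      have "leval (f * g) x = 0" if x: "x \<in> \<Union>(insert C \<C>)" for x
      proof -
        have "x \<in> nonzero_points" using x insert.prems(1) torus_nonzero by blast
        moreover have "leval f x = 0 \<or> leval g x = 0" using x f(1) g by (auto simp: vanishing_ideal_def)
        ultimately show ?thesis by (auto simp: leval_mult)
      qed
      then have "f * g \<in> vanishing_ideal n (\<Union>(insert C \<C>))"
        using laurent_mult[OF fg] by (simp add: vanishing_ideal_def)
      then have "f * g \<in> P" using insert.prems(2) by blast
      then show "g \<in> P" using P fg f(2) by (auto simp: primeideal_laurent_ring_iff)
    qed
    then show ?thesis using insert by blast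
  qed blast
qed

lemma vanishing_ideal_subset_iff:
  assumes "zariski_closed n D" "C \<subseteq> torus n"
  shows "vanishing_ideal n D \<subseteq> vanishing_ideal n C \<longleftrightarrow> C \<subseteq> D"
proof
  assume sub: "vanishing_ideal n D \<subseteq> vanishing_ideal n C"
  show "C \<subseteq> D"
  proof
    fix x assume x: "x \<in> C"
    show "x \<in> D" by (rule zariski_closed_memI[OF assms(1)]) (use x assms(2) sub vanishing_idealD in blast)+
  qed
qed (auto simp: vanishing_ideal_def)

context
  fixes n :: nat and \<C> :: "(nat \<Rightarrow> complex) set set"
  assumes fin: "finite \<C>" and var: "\<And>C. C \<in> \<C> \<Longrightarrow> variety n C"
    and incomparable: "\<And>C D. C \<in> \<C> \<Longrightarrow> D \<in> \<C> \<Longrightarrow> C \<subseteq> D \<Longrightarrow> C = D"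
begin

lemma Union_torus: "\<Union>\<C> \<subseteq> torus n" using var variety_torus by blast

lemma minimal_primes_components: "minimal_primes n (vanishing_ideal n (\<Union>\<C>)) = vanishing_ideal n ` \<C>"
proof -
  have comp: "\<exists>C\<in>\<C>. vanishing_ideal n C \<subseteq> P" if "primeideal P (laurent_ring n)" "vanishing_ideal n (\<Union>\<C>) \<subseteq> P" for P
    using prime_contains_component[OF that(1) fin _ that(2)] var variety_torus by blast
  have sub: "vanishing_ideal n (\<Union>\<C>) \<subseteq> vanishing_ideal n C" if "C \<in> \<C>" for C
    using that by (auto simp: vanishing_ideal_def)
  have prime: "primeideal (vanishing_ideal n C) (laurent_ring n)" if "C \<in> \<C>" for C
    using vanishing_ideal_prime var that by blast
  show ?thesis
  proof (intro equalityI subsetI)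
    fix P assume P: "P \<in> minimal_primes n (vanishing_ideal n (\<Union>\<C>))"
    then obtain C where C: "C \<in> \<C>" "vanishing_ideal n C \<subseteq> P" using comp[of P] by (auto simp: minimal_primes_def)
    then have "vanishing_ideal n C = P" using P sub[OF C(1)] prime[OF C(1)] unfolding minimal_primes_def by blast
    then show "P \<in> vanishing_ideal n ` \<C>" using C(1) by blast
  next
    fix P assume "P \<in> vanishing_ideal n ` \<C>"
    then obtain C where C: "C \<in> \<C>" "P = vanishing_ideal n C" by blast
    have "P' = P" if P': "primeideal P' (laurent_ring n)" "vanishing_ideal n (\<Union>\<C>) \<subseteq> P'" "P' \<subseteq> P" for P'
    proof -
      obtain D where D: "D \<in> \<C>" "vanishing_ideal n D \<subseteq> P'" using comp[OF P'(1,2)] by blast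
      then have "C \<subseteq> D"
        using P'(3) C vanishing_ideal_subset_iff[OF variety_closed[OF var] variety_torus[OF var], of D C] by blast
      then have "C = D" using incomparable C D by blast
      then show ?thesis using D P'(3) C by blast
    qed
    then show "P \<in> minimal_primes n (vanishing_ideal n (\<Union>\<C>))"
      using C prime sub by (auto simp: minimal_primes_def)
  qed
qed

text \<open>Choose \<open>h\<close> vanishing on the other members but not on \<open>C\<close>. For
  \<open>g\<close> vanishing on \<open>C\<close>, the product g h lies in \<open>J\<close>, and no
  power of \<open>h\<close> does; so \<open>g\<close> lies in \<open>J\<close>. A reduced union
  therefore has length 1 along each member.\<close>

lemma primary_ideals_component:
  assumes C: "C \<in> \<C>"
  shows "{J \<in> primary_ideals n (vanishing_ideal n C). vanishing_ideal n (\<Union>\<C>) \<subseteq> J} = {vanishing_ideal n C}"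
proof -
  let ?P = "vanishing_ideal n C"
  have prime: "primeideal ?P (laurent_ring n)" using vanishing_ideal_prime var C by blast
  have rad: "f \<in> ?P" if "f \<in> laurent n" "f ^ e \<in> ?P" for f e
  proof -
    have "leval f x = 0" if x: "x \<in> C" for x
      using vanishing_idealD[OF \<open>f ^ e \<in> ?P\<close> x] leval_power[of x f e] subsetD[OF variety_nonzero[OF var[OF C]] x] by simp
    then show ?thesis using that by (simp add: vanishing_ideal_def)
  qed
  have one: "f ^ 1 \<in> J" if "f \<in> J" for f :: laurent_poly and J using that by simp
  have "?P \<in> primary_ideals n ?P"
    unfolding primary_ideals_def using prime one rad vanishing_ideal_laurent[of _ n C]
    unfolding primeideal_laurent_ring_iff by blast
  moreover have "vanishing_ideal n (\<Union>\<C>) \<subseteq> ?P" using C by (auto simp: vanishing_ideal_def)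
  moreover have "J = ?P" if J: "J \<in> primary_ideals n ?P" "vanishing_ideal n (\<Union>\<C>) \<subseteq> J" for J
  proof
    have Ji: "ideal J (laurent_ring n)" and radJ: "{f \<in> laurent n. \<exists>e. f ^ e \<in> J} = ?P"
      and pr: "\<And>f g. f \<in> laurent n \<Longrightarrow> g \<in> laurent n \<Longrightarrow> f * g \<in> J \<Longrightarrow> f \<in> J \<or> (\<exists>e. g ^ e \<in> J)"
      using J(1) by (auto simp: primary_ideals_def)
    show "J \<subseteq> ?P" using radJ one Ji unfolding ideal_laurent_ring_iff by blast
    have "\<not> vanishing_ideal n (\<Union>(\<C> - {C})) \<subseteq> ?P"
    proof
      assume "vanishing_ideal n (\<Union>(\<C> - {C})) \<subseteq> ?P"
      then obtain D where D: "D \<in> \<C> - {C}" "vanishing_ideal n D \<subseteq> ?P"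
        using prime_contains_component[OF prime, of "\<C> - {C}"] fin var variety_torus by blast
      then have "C \<subseteq> D" using vanishing_ideal_subset_iff[OF variety_closed variety_torus] var C by blast
      then show False using incomparable D C by blast
    qed
    then obtain h where h: "h \<in> vanishing_ideal n (\<Union>(\<C> - {C}))" "h \<notin> ?P" by blast
    show "?P \<subseteq> J"
    proof
      fix g assume g: "g \<in> ?P"
      have gh: "g \<in> laurent n" "h \<in> laurent n" using g h vanishing_ideal_laurent by auto
      have "leval (g * h) x = 0" if x: "x \<in> \<Union>\<C>" for x
      proof -
        have "leval g x = 0 \<or> leval h x = 0" using x g h(1) by (auto simp: vanishing_ideal_def)
        then show ?thesis using leval_mult[of x g h] torus_nonzero[of x n] Union_torus x by auto
      qed
      then have "g * h \<in> vanishing_ideal n (\<Union>\<C>)" using laurent_mult[OF gh] unfolding vanishing_ideal_def by blast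
      then have "g * h \<in> J" using J(2) by blast
      then show "g \<in> J" using pr[OF gh] h(2) radJ gh(2) by blast
    qed
  qed
  ultimately show ?thesis by blast
qed

lemma length_at_component:
  assumes C: "C \<in> \<C>"
  shows "length_at n (vanishing_ideal n (\<Union>\<C>)) (vanishing_ideal n C) = 1"
proof -
  have chain: "subset.chain {P} B \<longleftrightarrow> B \<subseteq> {P}" for P :: "laurent_poly set" and B
    by (auto simp: subset.chain_def)
  \<comment> \<open>The empty chain counts as a chain of cardinality 0; the supremum is attained by
    the singleton.\<close>
  have "{card B | B. finite B \<and> B \<subseteq> {P}} = {0, 1}" for P :: "laurent_poly set"
    by (auto simp: subset_singleton_iff intro: exI[of _ "{}"] exI[of _ "{P}"])
  then show ?thesis unfolding length_at_def primary_ideals_component[OF C] chain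
    by (simp add: Sup_nat_def)
qed

text \<open>In direction 0 every polynomial is its own initial form, so the initial ideal is the
  vanishing ideal, and each of its minimal primes contributes length 1.\<close>

lemma init_mult_zero: "init_mult n (\<Union>\<C>) (\<lambda>_. 0) = card \<C>"
proof -
  interpret cring "laurent_ring n" by (rule cring_laurent_ring)
  let ?I = "vanishing_ideal n (\<Union>\<C>)"
  have id: "ideal ?I (laurent_ring n)" by (rule vanishing_ideal_ideal[OF Union_torus])
  have "init_form (\<lambda>_. 0) f = f" for f by (simp add: init_form_def pairing_def sum_single_lookup)
  then have "init_ideal n (\<lambda>_. 0) ?I = genideal (laurent_ring n) ?I" by (simp add: init_ideal_def)
  also have "\<dots> = ?I" using genideal_minimal[OF id order_refl] genideal_self[of ?I] vanishing_ideal_laurent by auto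
  finally have init: "init_ideal n (\<lambda>_. 0) ?I = ?I" .
  have "inj_on (vanishing_ideal n) \<C>"
  proof (rule inj_onI)
    fix C D assume "C \<in> \<C>" "D \<in> \<C>" "vanishing_ideal n C = vanishing_ideal n D"
    then show "C = D" using incomparable vanishing_ideal_subset_iff[OF variety_closed[OF var] variety_torus[OF var], of D C] by blast
  qed
  then show ?thesis
    by (simp add: init_mult_def init Let_def minimal_primes_components sum.reindex length_at_component)
qed

end

section \<open>Initial forms consisting of one monomial\<close>

lemma pairing_ipair: "pairing = ipair"
  by (intro ext) (simp add: pairing_def ipair_def)

lemma init_form_lfilter: "init_form u f = lfilter (\<lambda>m. \<forall>m'\<in>keys f. ipair u m \<le> ipair u m') f"
proof -
  let ?Q = "\<lambda>m. \<forall>m'\<in>keys f. ipair u m \<le> ipair u m'"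
  have "init_form u f = (\<Sum>m\<in>keys (lfilter ?Q f). single m (lookup (lfilter ?Q f) m))"
    unfolding init_form_def pairing_ipair keys_lfilter by (intro sum.cong refl) (simp add: lookup_lfilter)
  then show ?thesis by (simp add: sum_single_lookup)
qed

text \<open>One term is strictly smaller in direction \<open>u\<close> than all others. The initial
  form is then a monomial, that is, a unit; the condition is stated so as to be stable under
  products.\<close>

definition dominated :: "(nat \<Rightarrow> real) \<Rightarrow> laurent_poly \<Rightarrow> bool" where
  "dominated u f \<longleftrightarrow> (\<exists>m0 a g. a \<noteq> 0 \<and> f = single m0 a + g \<and> (\<forall>m\<in>keys g. ipair u m0 < ipair u m))"

lemma dominated_mult:
  assumes "dominated u f" "dominated u g"
  shows "dominated u (f * g)"
proof -
  obtain m a f' where f: "a \<noteq> 0" "f = single m a + f'" "\<And>p. p \<in> keys f' \<Longrightarrow> ipair u m < ipair u p"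
    using assms(1) unfolding dominated_def by blast
  obtain m' b g' where g: "b \<noteq> 0" "g = single m' b + g'" "\<And>p. p \<in> keys g' \<Longrightarrow> ipair u m' < ipair u p"
    using assms(2) unfolding dominated_def by blast
  have "f * g = single (m + m') (a * b) + (single m a * g' + f' * g)"
    by (simp add: f g algebra_simps mult_single)
  moreover have "ipair u (m + m') < ipair u p" if p: "p \<in> keys (single m a * g' + f' * g)" for p
  proof -
    have "p \<in> keys (single m a * g') \<or> p \<in> keys (f' * g)" using subsetD[OF keys_add p] by blast
    then show ?thesis
    proof
      assume "p \<in> keys (single m a * g')"
      then obtain q r where "p = q + r" "q \<in> keys (single m a)" "r \<in> keys g'"
        using subsetD[OF keys_mult, of p "single m a" g'] by blast
      then show ?thesis using g(3)[of r] f(1) by (simp add: ipair_add)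
    next
      assume "p \<in> keys (f' * g)"
      then obtain q r where p: "p = q + r" "q \<in> keys f'" "r \<in> keys g"
        using subsetD[OF keys_mult, of p f' g] by blast
      have "r \<in> keys (single m' b) \<or> r \<in> keys g'" using subsetD[OF keys_add, of r "single m' b" g'] p(3) unfolding g(2) by blast
      then have "ipair u m' \<le> ipair u r" using g(1,3) by (auto intro: less_imp_le)
      then show ?thesis using f(3)[OF p(2)] by (simp add: p(1) ipair_add)
    qed
  qed
  moreover have "a * b \<noteq> 0" using f(1) g(1) by simp
  ultimately show ?thesis unfolding dominated_def by blast
qed

lemma dominated_binomial:
  assumes "ipair u M \<noteq> 0" "a \<noteq> 0"
  shows "dominated u (single M 1 - single 0 a)"
proof (cases "ipair u M > 0")
  case True
  have "single M 1 - single 0 a = single 0 (- a) + single M 1" by (simp add: single_uminus)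
  moreover have "\<forall>m\<in>keys (single M (1::complex)). ipair u 0 < ipair u m" using True by simp
  ultimately show ?thesis unfolding dominated_def using assms(2) neg_equal_0_iff_equal by metis
next
  case False
  have "single M 1 - single 0 a = single M 1 + single 0 (- a)" by (simp add: single_uminus)
  moreover have "\<forall>m\<in>keys (single 0 (- a)). ipair u M < ipair u m" using False assms by auto
  ultimately show ?thesis unfolding dominated_def using zero_neq_one by metis
qed

lemma dominated_prod: "(\<And>s. s \<in> S \<Longrightarrow> dominated u (f s)) \<Longrightarrow> dominated u (prod f S)"
proof (induction S rule: infinite_finite_induct)
  case (insert s S)
  then show ?case by (simp add: dominated_mult)
next
  have 1: "dominated u 1" unfolding dominated_def
    by (intro exI[of _ 0] exI[of _ 1]) simp
  { case (infinite S) then show ?case using 1 by simp next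
    case empty then show ?case using 1 by simp }
qed

lemma init_form_dominated:
  assumes "dominated u f"
  shows "\<exists>m a. a \<noteq> 0 \<and> m \<in> keys f \<and> init_form u f = single m a"
proof -
  obtain m a g where f: "a \<noteq> 0" "f = single m a + g" "\<And>p. p \<in> keys g \<Longrightarrow> ipair u m < ipair u p"
    using assms unfolding dominated_def by blast
  have mg: "m \<notin> keys g" using f(3) by blast
  have fm: "lookup f m = a" using mg by (simp add: f(2) lookup_add in_keys_iff)
  then have mk: "m \<in> keys f" using f(1) by (simp add: in_keys_iff)
  have ge: "ipair u m \<le> ipair u p" if "p \<in> keys f" for p
  proof -
    have "p \<in> keys (single m a) \<or> p \<in> keys g" using subsetD[OF keys_add, of p "single m a" g] that unfolding f(2) by blast
    then show ?thesis using f(1,3) by (auto intro: less_imp_le)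
  qed
  have "init_form u f = single m a"
  proof (rule poly_mapping_eqI)
    fix p
    show "lookup (init_form u f) p = lookup (single m a) p"
    proof (cases "p = m")
      case True
      then show ?thesis using ge fm by (simp add: init_form_lfilter lookup_lfilter)
    next
      case False
      have "lookup f p = 0" if "\<forall>m'\<in>keys f. ipair u p \<le> ipair u m'"
      proof (rule ccontr)
        assume "lookup f p \<noteq> 0"
        then have "p \<in> keys g" using False by (simp add: f(2) lookup_add lookup_single in_keys_iff)
        then show False using f(3) that mk by force
      qed
      then show ?thesis using False by (simp add: init_form_lfilter lookup_lfilter lookup_single)
    qed
  qed
  then show ?thesis using f(1) mk by blast
qed

lemma init_ideal_dominated:
  assumes f: "f \<in> Q" "dominated u f" and Q: "Q \<subseteq> laurent n"
  shows "init_ideal n u Q = laurent n"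
proof -
  interpret cring "laurent_ring n" by (rule cring_laurent_ring)
  have "init_form u ` Q \<subseteq> laurent n" unfolding init_form_lfilter using Q laurent_lfilter by blast
  then have id: "ideal (init_ideal n u Q) (laurent_ring n)" "init_form u ` Q \<subseteq> init_ideal n u Q"
    unfolding init_ideal_def using genideal_ideal genideal_self by auto
  obtain m a where ma: "a \<noteq> 0" "m \<in> keys f" "init_form u f = single m a" using init_form_dominated[OF f(2)] by blast
  have "keys (- m) \<subseteq> {..<n}" using laurent_keys[of f n m] f(1) Q ma(2) by auto
  then have "g * single (- m) (inverse a) \<in> laurent n" if "g \<in> laurent n" for g
    using that by (intro laurent_mult laurent_single)
  moreover have "single m a \<in> init_ideal n u Q" using id(2) f(1) ma(3) by (metis image_subset_iff)
  ultimately have "g * single (- m) (inverse a) * single m a \<in> init_ideal n u Q" if "g \<in> laurent n" for g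
    using id(1) that unfolding ideal_laurent_ring_iff by blast
  moreover have "g * single (- m) (inverse a) * single m a = g" for g
    using ma(1) by (simp add: mult.assoc mult_single)
  ultimately have "laurent n \<subseteq> init_ideal n u Q" by auto
  then show ?thesis using id(1) by (auto simp: ideal_laurent_ring_iff)
qed

text \<open>The initial ideal is then contained in the vanishing ideal, which is proper.\<close>

lemma trop_set_stable:
  assumes f: "\<And>f. f \<in> vanishing_ideal n X \<Longrightarrow> init_form u f \<in> vanishing_ideal n X"
    and X: "X \<subseteq> torus n" "X \<noteq> {}" and u: "u \<in> coord_space n"
  shows "u \<in> trop_set n X"
proof -
  interpret cring "laurent_ring n" by (rule cring_laurent_ring)
  have "init_ideal n u (vanishing_ideal n X) \<subseteq> vanishing_ideal n X" unfolding init_ideal_def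
    by (rule genideal_minimal[OF vanishing_ideal_ideal[OF X(1)]]) (use f in blast)
  then have "1 \<notin> init_ideal n u (vanishing_ideal n X)" using one_notin_vanishing_ideal[OF X(2)] by blast
  then show ?thesis using u laurent_one[of n] by (auto simp: trop_set_def)
qed

section \<open>The tropical fan of a finite union of orbits of the stabilizer\<close>

context stabilizer_basis
begin

text \<open>The real span of the stabilizer lattice, described by the equations that the characters
  \<open>inv_mon i\<close> impose; \<open>trop_span_expand\<close> recovers the spanning
  vectors.\<close>

definition trop_span :: "(nat \<Rightarrow> real) set" where
  "trop_span = {u \<in> coord_space n. \<forall>i\<in>I. ipair u (inv_mon i) = 0}"

lemma subspace_trop_span: "fvec.subspace trop_span"
proof -
  have "ipair (\<lambda>i. c * u i) m = c * ipair u m" "ipair (u + w) m = ipair u m + ipair w m" for c :: real and u w m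
    using ipair_scale_left ipair_add_left[of u w] by (auto simp: plus_fun_def)
  then show ?thesis
    by (auto simp: fvec.subspace_def trop_span_def coord_space_def fscale_def zero_fun_def)
qed

lemma trop_span_expand:
  assumes u: "u \<in> trop_span"
  shows "u l * of_int N = (\<Sum>s\<in>J. u s * of_int (v s l))"
proof (cases "l < n")
  case True
  show ?thesis
  proof (cases "l \<in> J")
    case lJ: True
    have "(\<Sum>s\<in>J. u s * of_int (v s l)) = (\<Sum>s\<in>J. if s = l then u l * of_int N else 0)"
      by (intro sum.cong refl) (use v_at lJ in auto)
    then show ?thesis using lJ by simp
  next
    case False
    then have "l \<in> I" using True by (simp add: I_def)
    then show ?thesis using u by (simp add: trop_span_def ipair_inv_mon)
  qed
next
  case False
  have "v s l = 0" if "s \<in> J" for s using v_coord[OF that] False by (simp add: coord_space_def)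
  then show ?thesis using u False by (simp add: trop_span_def coord_space_def)
qed

lemma dim_trop_span: "fvec.dim trop_span = k"
  unfolding k_def
proof (rule dim_coordinates[OF subspace_trop_span finite_J])
  fix s assume s: "s \<in> J"
  have "ipair (\<lambda>l. inverse (real_of_int N) * of_int (v s l)) (inv_mon i) = 0" for i
    unfolding ipair_scale_left ipair_of_int using ipair_v_inv_mon[OF s] by simp
  then show "(\<lambda>l. inverse (real_of_int N) * of_int (v s l)) \<in> trop_span"
    using v_coord[OF s] by (simp add: trop_span_def coord_space_def)
next
  fix s s' assume "s \<in> J" "s' \<in> J"
  then show "inverse (real_of_int N) * of_int (v s s') = (if s = s' then 1 else 0)" using v_at N_pos by simp
next
  fix u assume u: "u \<in> trop_span" "\<And>s. s \<in> J \<Longrightarrow> u s = 0"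
  have "u l = 0" for l using trop_span_expand[OF u(1), of l] u(2) N_pos by simp
  then show "u = 0" by (simp add: fun_eq_iff)
qed

text \<open>For \<open>u\<close> in the span, the pairing with \<open>u\<close> depends only on the
  stabilizer weights, so initial forms stay in the vanishing ideal by \<open>stable_filter\<close>.
  For other \<open>u\<close>, some character has nonzero pairing; the product of its differences
  with its values on the members vanishes on the union and has a monomial as initial form.\<close>

lemma trop_set_components:
  assumes \<C>: "finite \<C>" "\<C> \<noteq> {}" "\<And>C. C \<in> \<C> \<Longrightarrow> variety n C \<and> stable C"
    and const: "\<And>C i y z. C \<in> \<C> \<Longrightarrow> i \<in> I \<Longrightarrow> y \<in> C \<Longrightarrow> z \<in> C \<Longrightarrow> monomial_at y (inv_mon i) = monomial_at z (inv_mon i)"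
  shows "trop_set n (\<Union>\<C>) = trop_span"
proof (intro equalityI subsetI)
  have ne: "C \<noteq> {}" "C \<subseteq> torus n" "stable C" if "C \<in> \<C>" for C
    using \<C>(3)[OF that] variety_torus[of n C] variety_nonempty[of n C] by auto
  have X: "\<Union>\<C> \<subseteq> torus n" "\<Union>\<C> \<noteq> {}" using ne \<C>(2) by auto
  have Xs: "stable (\<Union>\<C>)" using ne(3) unfolding stable_def by (meson UnionE UnionI)
  fix u assume u: "u \<in> trop_span"
  have "init_form u f \<in> vanishing_ideal n (\<Union>\<C>)" if f: "f \<in> vanishing_ideal n (\<Union>\<C>)" for f
    unfolding init_form_lfilter
  proof (rule stable_filter[OF Xs f])
    fix m m' assume eq: "\<And>s. s \<in> J \<Longrightarrow> ipair (v s) m = ipair (v s) m'"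
    have "ipair u p * of_int N = (\<Sum>s\<in>J. u s * of_int (ipair (v s) p))" for p
    proof -
      have "ipair u p * of_int N = ipair (\<lambda>l. \<Sum>s\<in>J. u s * of_int (v s l)) p"
        unfolding trop_span_expand[OF u, symmetric] mult.commute[of _ "of_int N"] ipair_scale_left ..
      then show ?thesis by (simp add: ipair_sum_left ipair_scale_left ipair_of_int)
    qed
    then have "ipair u m * of_int N = ipair u m' * of_int N" using eq by simp
    then have "ipair u m = ipair u m'" using N_pos by simp
    then show "(\<forall>p\<in>keys f. ipair u m \<le> ipair u p) = (\<forall>p\<in>keys f. ipair u m' \<le> ipair u p)" by simp
  qed
  moreover have "u \<in> coord_space n" using u unfolding trop_span_def by blast
  ultimately show "u \<in> trop_set n (\<Union>\<C>)" by (rule trop_set_stable[OF _ X])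
next
  fix u assume u: "u \<in> trop_set n (\<Union>\<C>)"
  show "u \<in> trop_span"
  proof (rule ccontr)
    assume "u \<notin> trop_span"
    then obtain i where i: "i \<in> I" "ipair u (inv_mon i) \<noteq> 0" using u by (auto simp: trop_span_def trop_set_def)
    define p where "p C = (SOME x. x \<in> C)" for C :: "(nat \<Rightarrow> complex) set"
    have p: "p C \<in> C" if "C \<in> \<C>" for C unfolding p_def using \<C>(3)[OF that] variety_nonempty some_in_eq by metis
    have nz: "x \<in> nonzero_points" if "x \<in> C" "C \<in> \<C>" for x C using \<C>(3) that variety_nonzero by blast
    define f where "f = (\<Prod>C\<in>\<C>. single (inv_mon i) 1 - single 0 (monomial_at (p C) (inv_mon i)) :: laurent_poly)"
    have f: "f \<in> laurent n" unfolding f_def using keys_inv_mon[OF i(1)]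
      by (intro laurent_prod laurent_diff laurent_single laurent_const)
    have "leval f x = 0" if x: "x \<in> C" "C \<in> \<C>" for x C
      unfolding f_def leval_prod[OF nz[OF x]] using \<C>(1) x const[OF x(2) i(1) x(1) p[OF x(2)]]
      by (auto simp: prod_zero_iff leval_diff leval_single intro!: bexI[of _ C])
    then have "f \<in> vanishing_ideal n (\<Union>\<C>)" using f by (auto simp: vanishing_ideal_def)
    moreover have "dominated u f" unfolding f_def
      by (intro dominated_prod dominated_binomial i) (use nz p monomial_at_nonzero in blast)
    ultimately have "init_ideal n u (vanishing_ideal n (\<Union>\<C>)) = laurent n"
      by (rule init_ideal_dominated) (use vanishing_ideal_laurent in blast)
    then show False using u by (simp add: trop_set_def)
  qed
qed

text \<open>The tropical set is a linear space of dimension \<open>k\<close>, so the origin is a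
  regular point; its weight is the number of components, which is positive.\<close>

lemma trop_fan_nonzero:
  assumes x: "x \<in> chart n V" "conormal x w"
    and fin: "\<And>i. i \<in> I \<Longrightarrow> finite {monomial_at y (inv_mon i) | y. y \<in> chart n V \<and> conormal y w}"
  shows "trop_fan n k (zeros w) \<noteq> 0"
proof -
  define \<C> where "\<C> = {C \<in> components n (zariski_closure n (zeros w)). krull_dim n C = k}"
  note \<C> = pure_part_zeros[OF x fin, folded \<C>_def]
  have pure: "pure_part n k (zeros w) = \<Union>\<C>" by (simp add: pure_part_def \<C>_def)
  have trop: "trop_set n (\<Union>\<C>) = trop_span" by (rule trop_set_components[OF \<C>(1-4)])
  have "(\<lambda>_. 0) \<in> trop_span" using fvec.subspace_0[OF subspace_trop_span] by (simp add: zero_fun_def)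
  then have "(\<lambda>_. 0) \<in> regular_points n k (trop_set n (\<Union>\<C>))"
    unfolding regular_points_def trop
    using subspace_trop_span dim_trop_span
    by (intro CollectI conjI exI[of _ UNIV] exI[of _ trop_span]) (auto simp: trop_span_def plus_fun_def)
  moreover have "init_mult n (\<Union>\<C>) (\<lambda>_. 0) = card \<C>"
    by (rule init_mult_zero[OF \<C>(1) _ \<C>(5)]) (use \<C>(3) in blast)+
  ultimately have "trop_fan n k (zeros w) (\<lambda>_. 0) = card \<C>" by (simp add: trop_fan_def pure)
  moreover have "card \<C> \<noteq> 0" using \<C>(1,2) by simp
  ultimately show ?thesis by auto
qed

end

section \<open>Preimages under homomorphisms\<close>

text \<open>Induction on the coordinates in \<open>A\<close>: one element whose entry at
  \<open>i\<close> divides all entries at \<open>i\<close>, together with generators of the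
  sublattice where that entry is 0. The generators may be redundant, which leaves their number fixed
  at \<open>card A\<close>.\<close>

lemma lattice_generators:
  fixes S :: "(nat \<Rightarrow> int) set"
  assumes A: "finite A" and S: "(\<lambda>_. 0) \<in> S" "\<And>u w q. u \<in> S \<Longrightarrow> w \<in> S \<Longrightarrow> (\<lambda>l. u l - q * w l) \<in> S"
    and det: "\<And>u. u \<in> S \<Longrightarrow> (\<And>i. i \<in> A \<Longrightarrow> u i = 0) \<Longrightarrow> u = (\<lambda>_. 0)"
  shows "\<exists>B. (\<forall>j<card A. B j \<in> S) \<and> (\<forall>u\<in>S. \<exists>c. \<forall>l. u l = (\<Sum>j<card A. c j * B j l))"
  using assms
proof (induction A arbitrary: S rule: finite_induct)
  case empty
  then show ?case by (auto simp: fun_eq_iff)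
next
  case (insert i A)
  define S0 where "S0 = {u \<in> S. u i = 0}"
  have "\<exists>B. (\<forall>j<card A. B j \<in> S0) \<and> (\<forall>u\<in>S0. \<exists>c. \<forall>l. u l = (\<Sum>j<card A. c j * B j l))"
  proof (rule insert.IH)
    show "(\<lambda>_. 0) \<in> S0" using insert.prems(1) by (simp add: S0_def)
    show "(\<lambda>l. u l - q * w l) \<in> S0" if "u \<in> S0" "w \<in> S0" for u w q
      using insert.prems(2)[of u w q] that by (simp add: S0_def)
    show "u = (\<lambda>_. 0)" if "u \<in> S0" "\<And>i. i \<in> A \<Longrightarrow> u i = 0" for u
      by (rule insert.prems(3)) (use that in \<open>auto simp: S0_def\<close>)
  qed
  then obtain B where B: "\<And>j. j < card A \<Longrightarrow> B j \<in> S0"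
    "\<And>u. u \<in> S0 \<Longrightarrow> \<exists>c. \<forall>l. u l = (\<Sum>j<card A. c j * B j l)" by blast
  have "\<exists>w\<in>S. \<forall>u\<in>S. \<exists>q. u i = q * w i"
  proof (cases "\<exists>u\<in>S. u i \<noteq> 0")
    case True
    then obtain u0 where u0: "u0 \<in> S" "u0 i \<noteq> 0" by blast
    have "(\<lambda>l. - u0 l) \<in> S" using insert.prems(2)[OF insert.prems(1) u0(1), of 1] by simp
    then obtain w0 where "w0 \<in> S \<and> w0 i > 0" using u0 by (cases "u0 i > 0") force+
    \<comment> \<open>An element with the least positive entry at \<open>i\<close> divides all such
      entries: a nonzero remainder would be smaller.\<close>
    then obtain w where w: "w \<in> S" "w i > 0" "\<And>w'. w' \<in> S \<Longrightarrow> w' i > 0 \<Longrightarrow> nat (w i) \<le> nat (w' i)"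
      using ex_has_least_nat[of "\<lambda>w. w \<in> S \<and> w i > 0" w0 "\<lambda>w. nat (w i)"] by blast
    have "u i = (u i div w i) * w i" if u: "u \<in> S" for u
    proof (rule ccontr)
      assume "u i \<noteq> (u i div w i) * w i"
      then have m: "u i - (u i div w i) * w i \<noteq> 0" by simp
      have e: "u i - (u i div w i) * w i = u i mod w i" by (simp add: minus_div_mult_eq_mod)
      have "u i mod w i > 0" using m w(2) pos_mod_sign[of "w i" "u i"] unfolding e by linarith
      then have "nat (w i) \<le> nat (u i mod w i)"
        using w(3)[OF insert.prems(2)[OF u w(1), of "u i div w i"]] unfolding e by blast
      then show False using pos_mod_bound[OF w(2), of "u i"] w(2) by linarith
    qed
    then show ?thesis using w(1) by blast
  qed (auto intro!: bexI[OF _ insert.prems(1)])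
  then obtain w where w: "w \<in> S" "\<And>u. u \<in> S \<Longrightarrow> \<exists>q. u i = q * w i" by blast
  have card: "card (insert i A) = Suc (card A)" using insert.hyps by simp
  have "\<exists>c. \<forall>l. u l = (\<Sum>j<Suc (card A). c j * (B(card A := w)) j l)" if u: "u \<in> S" for u
  proof -
    obtain q where q: "u i = q * w i" using w(2)[OF u] by blast
    have "(\<lambda>l. u l - q * w l) \<in> S0" using insert.prems(2)[OF u w(1)] q by (simp add: S0_def)
    then obtain c where c: "\<And>l. u l - q * w l = (\<Sum>j<card A. c j * B j l)" using B(2)[of "\<lambda>l. u l - q * w l"] by auto
    have "(\<Sum>j<card A. (c(card A := q)) j * (B(card A := w)) j l) = (\<Sum>j<card A. c j * B j l)" for l
      by (intro sum.cong refl) auto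
    then have "u l = (\<Sum>j<Suc (card A). (c(card A := q)) j * (B(card A := w)) j l)" for l
      using c[of l] by simp
    then show ?thesis by blast
  qed
  moreover have "(B(card A := w)) j \<in> S" if "j < Suc (card A)" for j
    using that B(1)[of j] w(1) by (auto simp: S0_def less_Suc_eq)
  ultimately show ?case unfolding card by (intro exI[of _ "B(card A := w)"]) blast
qed

definition expo :: "nat \<Rightarrow> (nat \<Rightarrow> int) \<Rightarrow> (nat \<Rightarrow>\<^sub>0 int)" where
  "expo d u = (\<Sum>i<d. single i (u i))"

lemma lookup_expo: "lookup (expo d u) i = (if i < d then u i else 0)"
  by (simp add: expo_def lookup_sum lookup_single when_def)

lemma keys_expo: "keys (expo d u) \<subseteq> {..<d}"
  by (auto simp: in_keys_iff lookup_expo split: if_splits)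

lemma monomial_at_expo: "monomial_at x (expo d u) = (\<Prod>i<d. x i powi u i)"
  unfolding monomial_at_superset[OF finite_lessThan keys_expo] by (intro prod.cong) (auto simp: lookup_expo)

lemma powi_sum:
  fixes x :: complex
  shows "x \<noteq> 0 \<Longrightarrow> x powi (\<Sum>s\<in>S. a s) = (\<Prod>s\<in>S. x powi a s)"
  by (induction S rule: infinite_finite_induct) (auto simp: power_int_add)

lemma prod_powi:
  fixes f :: "'a \<Rightarrow> complex"
  shows "(\<Prod>s\<in>S. f s) powi k = (\<Prod>s\<in>S. f s powi k)"
  by (induction S rule: infinite_finite_induct) (auto simp: power_int_mult_distrib)

lemma monomial_at_combination:
  assumes x: "x \<in> nonzero_points" and m: "\<And>l. l < n \<Longrightarrow> lookup m l = (\<Sum>j<d. c j * B j l)" "keys m \<subseteq> {..<n}"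
  shows "monomial_at x m = (\<Prod>j<d. monomial_at x (expo n (B j)) powi c j)"
proof -
  have "monomial_at x m = (\<Prod>l<n. \<Prod>j<d. (x l powi B j l) powi c j)"
    unfolding monomial_at_superset[OF finite_lessThan m(2)]
    by (intro prod.cong refl) (simp add: m(1) powi_sum nonzero_pointsD[OF x] power_int_mult[symmetric] mult.commute)
  also have "\<dots> = (\<Prod>j<d. monomial_at x (expo n (B j)) powi c j)"
    unfolding monomial_at_expo prod_powi by (rule prod.swap)
  finally show ?thesis .
qed

definition monomial_map :: "nat \<Rightarrow> nat \<Rightarrow> (nat \<Rightarrow> nat \<Rightarrow> int) \<Rightarrow> (nat \<Rightarrow> complex) \<Rightarrow> nat \<Rightarrow> complex" where
  "monomial_map n d B x = (\<lambda>j. if j < d then monomial_at x (expo n (B j)) else 1)"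

text \<open>Coordinates from \<open>d\<close> on are constantly 1, so the target may be a larger
  torus; this covers values of \<open>r\<close> below the rank of the stabilizer.\<close>

lemma torus_hom_monomial_map:
  assumes "d \<le> m"
  shows "torus_hom n m (monomial_map n d B)"
  unfolding torus_hom_def
proof (intro conjI ballI allI impI)
  show "monomial_map n d B ` torus n \<subseteq> torus m"
    using assms monomial_at_nonzero[OF torus_nonzero] by (auto simp: monomial_map_def torus_def[of m] split: if_splits)
  show "monomial_map n d B (x * y) = monomial_map n d B x * monomial_map n d B y" for x y
    by (auto simp: monomial_map_def monomial_at_mult)
  fix j
  show "\<exists>f\<in>laurent n. \<forall>x\<in>torus n. monomial_map n d B x j = leval f x"
  proof (cases "j < d")
    case True
    then show ?thesis
      by (intro bexI[of _ "single (expo n (B j)) 1"] laurent_single keys_expo) (simp add: monomial_map_def leval_single)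
  next
    case False
    then show ?thesis by (intro bexI[of _ 1]) (auto simp: monomial_map_def)
  qed
qed

lemma monomial_map_pullback:
  assumes F: "F \<in> laurent m"
  shows "\<exists>f\<in>laurent n. \<forall>x\<in>nonzero_points. leval f x = leval F (monomial_map n d B x)"
proof -
  define p where "p q = expo n (\<lambda>l. \<Sum>j<d. lookup q j * B j l)" for q :: "nat \<Rightarrow>\<^sub>0 int"
  have p: "monomial_at x (p q) = monomial_at (monomial_map n d B x) q" if x: "x \<in> nonzero_points" for x q
  proof -
    have "monomial_at x (p q) = (\<Prod>j<d. monomial_at x (expo n (B j)) powi lookup q j)"
      by (rule monomial_at_combination[OF x]) (simp_all add: p_def lookup_expo keys_expo)
    also have "\<dots> = (\<Prod>j\<in>{..<d} \<union> keys q. monomial_map n d B x j powi lookup q j)"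
      by (rule prod.mono_neutral_cong_left) (auto simp: monomial_map_def)
    also have "\<dots> = monomial_at (monomial_map n d B x) q"
      by (rule monomial_at_superset[symmetric]) auto
    finally show ?thesis .
  qed
  show ?thesis
  proof (intro bexI ballI)
    show "leval (\<Sum>q\<in>keys F. single (p q) (lookup F q)) x = leval F (monomial_map n d B x)" if "x \<in> nonzero_points" for x
      unfolding leval_sum leval_single leval_eq[of F] using p[OF that] by simp
  qed (intro laurent_sum laurent_single, simp add: p_def keys_expo)
qed

context stabilizer_basis
begin

text \<open>All characters trivial on the stabilizer torus. The exponents \<open>inv_mon i\<close>
  span a subgroup of finite index only, and points that agree on it may lie in different
  orbits.\<close>

definition dual_lattice :: "(nat \<Rightarrow> int) set" where
  "dual_lattice = {u \<in> coord_space n. \<forall>s\<in>J. (\<Sum>l<n. v s l * u l) = 0}"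

lemma dual_lattice_determined:
  assumes u: "u \<in> dual_lattice" "\<And>i. i \<in> I \<Longrightarrow> u i = 0"
  shows "u = (\<lambda>_. 0)"
proof
  fix l
  show "u l = 0"
  proof (cases "l \<in> J")
    case True
    have "(\<Sum>l'<n. v l l' * u l') = (\<Sum>l'<n. if l' = l then N * u l else 0)"
    proof (intro sum.cong refl)
      fix l' assume l': "l' \<in> {..<n}"
      show "v l l' * u l' = (if l' = l then N * u l else 0)"
        using v_at[OF True, of l'] u(2)[of l'] l' True by (cases "l' \<in> J") (auto simp: I_def)
    qed
    then show ?thesis using u(1) True J N_pos by (auto simp: dual_lattice_def)
  next
    case False
    then show ?thesis using u by (cases "l < n") (auto simp: I_def dual_lattice_def coord_space_def)
  qed
qed

lemma dual_lattice_generators: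
  "\<exists>B. \<forall>u\<in>dual_lattice. \<exists>c. \<forall>l. u l = (\<Sum>j<card I. c j * B j l)"
proof -
  have "\<exists>B. (\<forall>j<card I. B j \<in> dual_lattice) \<and> (\<forall>u\<in>dual_lattice. \<exists>c. \<forall>l. u l = (\<Sum>j<card I. c j * B j l))"
  proof (rule lattice_generators)
    show "finite I" by (simp add: I_def)
    show "(\<lambda>_. 0) \<in> dual_lattice" by (simp add: dual_lattice_def coord_space_def)
    show "(\<lambda>l. u l - q * w l) \<in> dual_lattice" if "u \<in> dual_lattice" "w \<in> dual_lattice" for u w q
    proof -
      have "(\<Sum>l<n. v s l * (u l - q * w l)) = (\<Sum>l<n. v s l * u l) - q * (\<Sum>l<n. v s l * w l)" for s
        by (simp add: sum_subtractf sum_distrib_left algebra_simps)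
      then show ?thesis using that by (simp add: dual_lattice_def coord_space_def)
    qed
    show "u = (\<lambda>_. 0)" if "u \<in> dual_lattice" "\<And>i. i \<in> I \<Longrightarrow> u i = 0" for u
      using dual_lattice_determined that by blast
  qed
  then show ?thesis by blast
qed

text \<open>Two exponents of equal stabilizer weight differ by an element of
  \<open>dual_lattice\<close>, hence by a monomial in the coordinates of the quotient map.\<close>

lemma monomial_class:
  assumes B: "\<And>u. u \<in> dual_lattice \<Longrightarrow> \<exists>c. \<forall>l. u l = (\<Sum>j<card I. c j * B j l)"
    and m: "keys m \<subseteq> {..<n}" "keys m0 \<subseteq> {..<n}" "\<And>s. s \<in> J \<Longrightarrow> ipair (v s) m = ipair (v s) m0"
  shows "\<exists>c. \<forall>x\<in>nonzero_points. monomial_at x m = monomial_at x m0 * monomial_at (monomial_map n (card I) B x) (expo (card I) c)"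
proof -
  have k: "keys (m - m0) \<subseteq> {..<n}" using m(1,2) keys_diff[of m m0] by blast
  have "(\<Sum>l<n. v s l * lookup (m - m0) l) = 0" if "s \<in> J" for s
    using m(3)[OF that] ipair_superset[OF finite_lessThan k, of "v s"] by (simp add: ipair_diff)
  then have "lookup (m - m0) \<in> dual_lattice"
    using k by (auto simp: dual_lattice_def coord_space_def in_keys_iff subset_iff)
  then obtain c where c: "\<And>l. lookup (m - m0) l = (\<Sum>j<card I. c j * B j l)" using B by blast
  have "monomial_at x m = monomial_at x m0 * monomial_at (monomial_map n (card I) B x) (expo (card I) c)"
    if x: "x \<in> nonzero_points" for x
  proof -
    have "monomial_at x m = monomial_at x m0 * monomial_at x (m - m0)" using monomial_at_add[OF x, of m0 "m - m0"] by simp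
    also have "monomial_at x (m - m0) = (\<Prod>j<card I. monomial_at x (expo n (B j)) powi c j)"
      by (rule monomial_at_combination[OF x c k])
    also have "\<dots> = monomial_at (monomial_map n (card I) B x) (expo (card I) c)"
      unfolding monomial_at_expo[of _ "card I"] by (intro prod.cong refl) (simp add: monomial_map_def)
    finally show ?thesis .
  qed
  then show ?thesis by blast
qed

text \<open>A function vanishing on \<open>V\<close> is a sum of pieces, homogeneous under the stabilizer, which vanish
  on \<open>V\<close> too; each piece is a monomial times a function of the quotient torus.\<close>

lemma pulled_back_stabilizer:
  assumes r: "card I \<le> d"
  shows "pulled_back n d V"
proof -
  obtain B where B: "\<And>u. u \<in> dual_lattice \<Longrightarrow> \<exists>c. \<forall>l. u l = (\<Sum>j<card I. c j * B j l)"
    using dual_lattice_generators by blast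
  define h where "h = monomial_map n (card I) B"
  have h: "torus_hom n d h" unfolding h_def by (rule torus_hom_monomial_map[OF r])
  have hV: "h ` V \<subseteq> torus d" using h V_torus unfolding torus_hom_def by blast
  \<comment> \<open>The closure of the image is the only candidate. That no further points of the
    torus map into it follows from the homogeneous pieces of the equations of
    \<open>V\<close>.\<close>
  define W where "W = zariski_closure d (h ` V)"
  have "variety d W" unfolding W_def
  proof (rule closure_variety[OF hV])
    show "h ` V \<noteq> {}" using variety_nonempty[OF V] by simp
    fix F G assume FG: "F \<in> laurent d" "G \<in> laurent d" and z: "\<And>y. y \<in> h ` V \<Longrightarrow> leval F y * leval G y = 0"
    obtain f where f: "f \<in> laurent n" "\<And>x. x \<in> nonzero_points \<Longrightarrow> leval f x = leval F (h x)"
      using monomial_map_pullback[OF FG(1), of n "card I" B] unfolding h_def by blast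
    obtain g where g: "g \<in> laurent n" "\<And>x. x \<in> nonzero_points \<Longrightarrow> leval g x = leval G (h x)"
      using monomial_map_pullback[OF FG(2), of n "card I" B] unfolding h_def by blast
    have "leval f x * leval g x = 0" if "x \<in> V" for x using z that f(2) g(2) V_nonzero by simp
    then have "(\<forall>x\<in>V. leval f x = 0) \<or> (\<forall>x\<in>V. leval g x = 0)" by (rule variety_prime[OF V f(1) g(1)])
    then show "(\<forall>y\<in>h ` V. leval F y = 0) \<or> (\<forall>y\<in>h ` V. leval G y = 0)" using f(2) g(2) V_nonzero by auto
  qed
  moreover have "V = {x \<in> torus n. h x \<in> W}"
  proof (intro equalityI subsetI)
    fix x assume "x \<in> V"
    then show "x \<in> {x \<in> torus n. h x \<in> W}" using V_torus closure_subset unfolding W_def by blast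
  next
    fix x assume "x \<in> {x \<in> torus n. h x \<in> W}"
    then have x: "x \<in> torus n" "h x \<in> W" by auto
    have xn: "x \<in> nonzero_points" by (rule torus_nonzero[OF x(1)])
    show "x \<in> V"
    proof (rule zariski_closed_memI[OF variety_closed[OF V] x(1)])
      fix f assume f: "f \<in> vanishing_ideal n V"
      have fl: "f \<in> laurent n" by (rule vanishing_ideal_laurent[OF f])
      let ?k = "\<lambda>m s. if s \<in> J then ipair (v s) m else 0"
      have "(\<Sum>m\<in>{m\<in>keys f. ?k m = ?k m0}. lookup f m * monomial_at x m) = 0" if m0: "m0 \<in> keys f" for m0
      proof -
        let ?K = "{m\<in>keys f. \<forall>s\<in>J. ipair (v s) m = ipair (v s) m0}"
        define R where "R m c \<longleftrightarrow> (\<forall>x\<in>nonzero_points. monomial_at x m =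
          monomial_at x m0 * monomial_at (h x) (expo (card I) c))" for m c
        have "\<exists>c. R m c" if m: "m \<in> ?K" for m unfolding R_def h_def
        proof (rule monomial_class[OF B])
          show "keys m \<subseteq> {..<n}" "keys m0 \<subseteq> {..<n}" using laurent_keys[OF fl] m m0 by blast+
          show "ipair (v s) m = ipair (v s) m0" if "s \<in> J" for s using m that by blast
        qed
        then have "\<forall>m\<in>?K. \<exists>c. R m c" by blast
        from bchoice[OF this] obtain c where "\<And>m. m \<in> ?K \<Longrightarrow> R m (c m)" by blast
        then have c: "\<And>m x. m \<in> ?K \<Longrightarrow> x \<in> nonzero_points \<Longrightarrow>
          monomial_at x m = monomial_at x m0 * monomial_at (h x) (expo (card I) (c m))" unfolding R_def by blast
        \<comment> \<open>Divided by the monomial \<open>m0\<close>, the piece becomes a function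
          \<open>F\<close> of \<open>h x\<close>. It vanishes on the image of \<open>V\<close> and
          therefore on \<open>W\<close>.\<close>
        define F where "F = (\<Sum>m\<in>?K. single (expo (card I) (c m)) (lookup f m))"
        have Fl: "F \<in> laurent d" unfolding F_def
          using keys_expo[of "card I"] r by (intro laurent_sum laurent_single) force
        have ev: "(\<Sum>m\<in>?K. lookup f m * monomial_at y m) = monomial_at y m0 * leval F (h y)" if "y \<in> nonzero_points" for y
          unfolding F_def leval_sum leval_single sum_distrib_left
          by (intro sum.cong refl) (simp add: c that mult_ac)
        have "leval F z = 0" if z: "z \<in> h ` V" for z
        proof -
          obtain y where y: "y \<in> V" "z = h y" using z by blast
          have "leval (lfilter (\<lambda>m. \<forall>s\<in>J. ipair (v s) m = ipair (v s) m0) f) y = 0"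
            by (rule vanishing_idealD[OF stable_class[OF stable_V f finite_J order_refl] y(1)])
          then have "monomial_at y m0 * leval F (h y) = 0" using ev[OF V_nonzero[OF y(1)]] by (simp add: leval_lfilter)
          then show ?thesis using y monomial_at_nonzero[OF V_nonzero[OF y(1)]] by simp
        qed
        then have "leval F (h x) = 0" using closure_vanish[OF Fl hV] x(2) unfolding W_def by blast
        moreover have "?k m = ?k m0 \<longleftrightarrow> (\<forall>s\<in>J. ipair (v s) m = ipair (v s) m0)" for m unfolding fun_eq_iff by auto
        ultimately show ?thesis using ev[OF xn] by simp
      qed
      then have "(\<Sum>\<kappa>\<in>?k ` keys f. \<Sum>m\<in>{m\<in>keys f. ?k m = \<kappa>}. lookup f m * monomial_at x m) = 0"
        by (intro sum.neutral) blast
      then show "leval f x = 0" unfolding leval_eq by (subst sum.image_gen[of _ _ ?k]) simp_all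
    qed
  qed
  ultimately show ?thesis unfolding pulled_back_def using h by blast
qed

lemma card_I: "card I = n - k" "k \<le> n"
proof -
  show "card I = n - k" unfolding I_def k_def using J by (simp add: card_Diff_subset)
  show "k \<le> n" unfolding k_def using card_mono[OF finite_lessThan J] by simp
qed

lemma pulled_back_le: "r \<le> k \<Longrightarrow> r \<le> n \<and> pulled_back n (n - r) V"
  using card_I pulled_back_stabilizer by simp

text \<open>Whatever nonzero polynomial \<open>p\<close> witnesses genericity,
  \<open>good_forms\<close> finds a tuple with \<open>p\<close> nonzero whose degeneracy locus has a
  nonzero fan.\<close>

lemma trop_sm_nonzero: "\<not> has_trop_sm n V k 0"
proof
  assume "has_trop_sm n V k 0"
  \<comment> \<open>\<open>V\<close> itself is stable, so \<open>stable_krull\<close> bounds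
    \<open>k\<close> by its dimension and selects the generic branch of
    \<open>has_trop_sm\<close>.\<close>
  then have "generic ({..k} \<times> {..<n}) (\<lambda>c. trop_fan n k (degeneracy_locus n V k (\<lambda>j i. c (j, i))) = 0)"
    using stable_krull[OF V stable_V] by (simp add: has_trop_sm_def)
  then obtain p :: "((nat \<times> nat) \<Rightarrow>\<^sub>0 nat) \<Rightarrow>\<^sub>0 complex" where p: "p \<noteq> 0"
    "\<And>m. m \<in> keys p \<Longrightarrow> keys m \<subseteq> {..k} \<times> {..<n}"
    "\<And>c. peval p c \<noteq> 0 \<Longrightarrow> trop_fan n k (degeneracy_locus n V k (\<lambda>j i. c (j, i))) = 0"
    unfolding generic_def by blast
  obtain c0 where "peval p c0 \<noteq> 0" using peval_nonzero[OF p(1)] by blast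
  from good_forms[OF peval_pfun[OF p(2)] this] obtain c w x where c: "peval p c \<noteq> 0"
    "degeneracy_locus n V k (\<lambda>j i. c (j, i)) = zeros w" "x \<in> chart n V" "conormal x w"
    "\<forall>i\<in>I. finite {monomial_at y (inv_mon i) | y. y \<in> chart n V \<and> conormal y w}" by blast
  have "trop_fan n k (zeros w) \<noteq> 0" by (rule trop_fan_nonzero[OF c(3,4)]) (use c(5) in blast)
  then show False using p(3)[OF c(1)] c(2) by simp
qed

text \<open>In rank 0 every form annihilates the stabilizer, so \<open>good_conormal\<close> finds,
  off any given hypersurface, a form with a zero on the smooth part.\<close>

lemma generic_form_zero:
  assumes "generic {..<n} (\<lambda>c. \<forall>x\<in>smooth_part n V. \<exists>v\<in>tangent_space n V x. inv_form n c x v \<noteq> 0)"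
  shows "1 \<le> k"
proof (rule ccontr)
  assume "\<not> 1 \<le> k"
  then have "J = {}" by (simp add: k_def not_le)
  then have perp: "perp w" for w unfolding perp_def by blast
  obtain p :: "(nat \<Rightarrow>\<^sub>0 nat) \<Rightarrow>\<^sub>0 complex" where p: "p \<noteq> 0" "\<And>m. m \<in> keys p \<Longrightarrow> keys m \<subseteq> {..<n}"
    "\<And>c. peval p c \<noteq> 0 \<Longrightarrow> \<forall>x\<in>smooth_part n V. \<exists>v\<in>tangent_space n V x. inv_form n c x v \<noteq> 0"
    using assms unfolding generic_def by blast
  obtain w0 where "peval p w0 \<noteq> 0" using peval_nonzero[OF p(1)] by blast
  from good_conormal[OF peval_pfun[OF p(2)] perp this] obtain w x
    where w: "x \<in> chart n V" "conormal x w" "peval p w \<noteq> 0" by blast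
  have xs: "x \<in> smooth_part n V" by (rule chart_smooth[OF V w(1)])
  have "\<forall>v\<in>tangent_space n V x. inv_form n w x v = 0"
    using w(2) inv_form_conormal[OF V_nonzero[OF smooth_V[OF xs]], of n V w] unfolding conormal_def by blast
  then show False using p(3)[OF w(3)] xs by blast
qed

end

theorem theorem1p11:
  fixes n :: nat and V :: "(nat \<Rightarrow> complex) set"
  assumes "variety n V"
  shows "(generic {..<n} (\<lambda>c. \<forall>x \<in> smooth_part n V. \<exists>v \<in> tangent_space n V x. inv_form n c x v \<noteq> 0)
            \<longrightarrow> 1 \<le> n \<and> pulled_back n (n - 1) V) \<and>
         (\<forall>r. (\<forall>k<r. has_trop_sm n V k 0) \<longrightarrow> r \<le> n \<and> pulled_back n (n - r) V)"
proof -
  obtain J N v where "stabilizer_basis n V J N v" using stabilizer_basis_exists[OF assms] by blast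
  then interpret stabilizer_basis n V J N v .
  \<comment> \<open>Outside the quantifier \<open>k\<close> is the rank of the stabilizer: if it
    were below \<open>r\<close>, the hypothesis at this index would contradict
    \<open>trop_sm_nonzero\<close>.\<close>
  have "r \<le> k" if "\<forall>k<r. has_trop_sm n V k 0" for r
    using that trop_sm_nonzero by (meson not_le)
  then show ?thesis using generic_form_zero pulled_back_le by blast
qed

end
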